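(* (1) The ergodic central measures on the Fibonacci graph $\Phi$ are naturally parametrized by the points of the interval $[0,1]$. Denote by $\mu_x$ the measure corresponding to $x$. (2) The measure $\mu_x$ is continuous if and only if $x\ne\{N\lambda\}$ for any $N\in\mathbb Z$ (or, equivalently, if $x$ has infinite canonical expansion). (3) The action of the adic transformation $T_\Phi$ is not transitive, and its trajectories are described as follows. Let $x$ be as in (2), i.e. $x\ne\{N\lambda\}$ for any $N\in\mathbb Z$, and let $\phi_x$ denote the space of paths in $\Phi$ such that $\phi_x=\operatorname{supp}\mu_x$. The set $\phi_x$ is invariant under $T_\Phi$, and we have the following alternatives. (a) If the generalized canonical expansion of $x$ contains infinitely many pieces $1(00)^l1$ with $l\ge1$ (call such a piece even), then $T_\Phi|_{\phi_x}$ is strictly ergodic and metrically isomorphic to the shift by $1$ on the group of certain $\mathbf a$-adic integers, with $\mathbf a=(a_1,a_2,\dots)$ a sequence of positive integers, generally speaking nonstationary. Thus $T_\Phi|_{\phi_x}$ has a purely discrete rational spectrum. (b) If the generalized canonical expansion of $x$ does not contain even pieces at all, then $T_\Phi|_{\phi_x}$ is also strictly ergodic and metrically isomorphic to a certain irrational rotation of the circle. (c) Finally, if the generalized canonical expansion of $x$ contains a finite number of even pieces, then $T_\Phi|_{\phi_x}$ is metrically isomorphic to some special automorphism over a rotation of the circle, i.e. to a shift on the space $S^1\ltimes\mathbb Z/k$ for some $k\in\mathbb N$.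
   Context: $\lambda=\frac{1+\sqrt5}2$, $\{\cdot\}$ is the fractional part. The canonical expansion of $x$ is the greedy one, $x=\sum_{k\ge1}\varepsilon_k\lambda^{-k}$ with $\varepsilon_k=[\lambda T^{k-1}x]$, $Tx=\{\lambda x\}$; it is infinite if $\varepsilon_k=1$ for infinitely many $k$. The Fibonacci graph $\Phi$ is the graded graph whose vertices of level $n$ are the distinct values $\sum_{k=1}^n\varepsilon_k\lambda^{-k-1}$, $\varepsilon_k\in\{0,1\}$, with an edge labelled $\varepsilon_n\in\{0,1\}$ from the vertex $v$ of level $n-1$ to the vertex $v+\varepsilon_n\lambda^{-n-1}$ of level $n$. Its space of infinite paths is $Y(\Phi)=\{0,1\}^{\mathbb N}$, and $\pi:Y(\Phi)\to[0,1]$ is $\pi(\varepsilon)=\sum_{k\ge1}\varepsilon_k\lambda^{-k-1}$. The measure corresponding to $x$ in the parametrization lives on the paths projecting to $x$ under $\pi$. Tail partition: two paths belong to the same element if they have the same $\pi$-image and agree from some index on. A measure on $\Phi$ is Markov if the sequence of the vertices of levels $1,2,\dots$ of a random path is a (nonhomogeneous) Markov chain. A Markov measure is central if it satisfies any of the following equivalent conditions: for any vertex the conditional measure on the set of all paths descending to this vertex is uniform; the measure is $T_\Phi$-invariant; the measure is invariant with respect to the tail partition. A central measure is ergodic if $T_\Phi$ is ergodic with respect to it (equivalently, the tail partition is trivial, i.e. contains only sets of measure 0 or 1). The (lexicographic) order on each element of the tail partition is the transitive order generated by: $\varepsilon\prec\varepsilon'$ if for some $k\ge2$, $(\varepsilon_{k-1},\varepsilon_k,\varepsilon_{k+1})=(0,1,1)$,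 $(\varepsilon'_{k-1},\varepsilon'_k,\varepsilon'_{k+1})=(1,0,0)$ and $\varepsilon_j=\varepsilon'_j$ for $j-k\ge2$. The adic transformation $T_\Phi$ assigns to a path its immediate successor in its element of the tail partition, if it exists; it is defined on the paths containing at least one triple $011$. The generalized canonical expansion of $x\in(0,1)$ is the sequence $(\varepsilon_k)\in\{0,1\}^{\mathbb N}$ with $x=\sum_k\varepsilon_k\lambda^{-k-1}$, constructed by a modification of the greedy algorithm, such that either $\varepsilon_k\varepsilon_{k+1}=0$ for all $k$, or $\varepsilon_1=\dots=\varepsilon_m=1$ for some $m\in\mathbb N$ and the remaining tail has no two adjacent 1's. Continuous means without atoms; strictly ergodic means having a unique invariant Borel probability measure; the metric isomorphisms are with respect to $\mu_x$.
   Formalization: The criterion x ≠ {Nλ} in (2) and all of (3) are stated for 0 ≤ x < 1: at x = 1, which is literally not of the form {Nλ}, μ_1 is a point mass and the canonical expansion is finite; the criterion by infinite canonical expansion is proved on all of [0,1]. *)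

theory Defs
  imports "HOL-Probability.Probability"
begin

definition golden :: real where
  "golden = (1 + sqrt 5) / 2"

text \<open>
  Paths are indexed from 0: the entry \<open>\<epsilon> k\<close> is the digit usually written \<open>\<epsilon>\<close> with index
  \<open>k + 1\<close> (\<open>True\<close> is the digit 1), so that its weight is \<open>golden\<close> to the power \<open>-(k + 2)\<close>.
  The two endpoints of an edge determine its label, hence a path is the same thing as its
  sequence of labels, and every 0-1 sequence occurs.
\<close>

type_synonym path = "nat \<Rightarrow> bool"

definition weight :: "nat \<Rightarrow> real" where
  "weight k = (1 / golden) ^ (k + 2)"

definition vertex :: "nat \<Rightarrow> path \<Rightarrow> real" where
  "vertex n \<epsilon> = (\<Sum>k<n. of_bool (\<epsilon> k) * weight k)"

definition proj :: "path \<Rightarrow> real" where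
  "proj \<epsilon> = (\<Sum>k. of_bool (\<epsilon> k) * weight k)"

definition cylinder :: "nat \<Rightarrow> path \<Rightarrow> path set" where
  "cylinder n \<epsilon> = {\<delta>. \<forall>k<n. \<delta> k = \<epsilon> k}"

definition tail_equiv :: "path \<Rightarrow> path \<Rightarrow> bool" where
  "tail_equiv \<epsilon> \<delta> \<longleftrightarrow> proj \<epsilon> = proj \<delta> \<and> (\<exists>N. \<forall>k\<ge>N. \<epsilon> k = \<delta> k)"

text \<open>
  Only the digits to the right of the replaced triple have to agree; those to its left are
  constrained by \<open>tail_equiv\<close> alone.  The order therefore compares paths at the last index
  where they differ, and it is total on each class.
\<close>

definition order_gen :: "path \<Rightarrow> path \<Rightarrow> bool" where
  "order_gen \<epsilon> \<delta> \<longleftrightarrow> tail_equiv \<epsilon> \<delta> \<and>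
     (\<exists>i. \<not> \<epsilon> i \<and> \<epsilon> (i + 1) \<and> \<epsilon> (i + 2) \<and>
          \<delta> i \<and> \<not> \<delta> (i + 1) \<and> \<not> \<delta> (i + 2) \<and>
          (\<forall>j\<ge>i + 3. \<epsilon> j = \<delta> j))"

definition path_less :: "path \<Rightarrow> path \<Rightarrow> bool" where
  "path_less = tranclp order_gen"

definition immediate_succ :: "path \<Rightarrow> path \<Rightarrow> bool" where
  "immediate_succ \<epsilon> \<delta> \<longleftrightarrow> path_less \<epsilon> \<delta> \<and> \<not> (\<exists>\<eta>. path_less \<epsilon> \<eta> \<and> path_less \<eta> \<delta>)"

text \<open>
  The adic transformation is a partial map.  Its domain consists of the paths containing a
  triple 011; outside of it, the value of \<open>adic\<close> is meaningless.
\<close>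

definition adic_dom :: "path set" where
  "adic_dom = {\<epsilon>. \<exists>\<delta>. immediate_succ \<epsilon> \<delta>}"

definition adic :: "path \<Rightarrow> path" where
  "adic \<epsilon> = (THE \<delta>. immediate_succ \<epsilon> \<delta>)"

definition adic_orbit :: "path \<Rightarrow> path set" where
  "adic_orbit \<epsilon> = {\<delta>. equivclp (\<lambda>\<eta> \<eta>'. \<eta> \<in> adic_dom \<and> \<eta>' = adic \<eta>) \<epsilon> \<delta>}"

definition adic_invariant_set :: "path set \<Rightarrow> bool" where
  "adic_invariant_set A \<longleftrightarrow> (\<forall>\<epsilon>\<in>adic_dom. adic \<epsilon> \<in> A \<longleftrightarrow> \<epsilon> \<in> A)"

text \<open>
  Invariance under a partial injective map can only be tested on subsets of its range: the
  point mass at the path 111... (which has neither a successor nor a predecessor) is central.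
\<close>

definition adic_invariant_measure :: "path measure \<Rightarrow> bool" where
  "adic_invariant_measure M \<longleftrightarrow>
     (\<forall>A\<in>sets borel. A \<subseteq> adic ` adic_dom \<longrightarrow>
        emeasure M (adic -` A \<inter> adic_dom) = emeasure M A)"

definition path_prob :: "path measure \<Rightarrow> bool" where
  "path_prob M \<longleftrightarrow> prob_space M \<and> sets M = sets borel"

definition markov :: "path measure \<Rightarrow> bool" where
  "markov M \<longleftrightarrow> (\<forall>n\<ge>1. \<forall>v :: nat \<Rightarrow> real.
     measure M {\<epsilon>. \<forall>k\<in>{1..n + 1}. vertex k \<epsilon> = v k} * measure M {\<epsilon>. vertex n \<epsilon> = v n} =
     measure M {\<epsilon>. \<forall>k\<in>{1..n}. vertex k \<epsilon> = v k} *
     measure M {\<epsilon>. vertex n \<epsilon> = v n \<and> vertex (n + 1) \<epsilon> = v (n + 1)})"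

text \<open>
  Uniformity of the conditional measures: all finite paths descending to the same vertex of
  level \<open>n\<close> have the same probability.
\<close>

definition central :: "path measure \<Rightarrow> bool" where
  "central M \<longleftrightarrow> path_prob M \<and> markov M \<and>
     (\<forall>n \<epsilon> \<delta>. vertex n \<epsilon> = vertex n \<delta> \<longrightarrow>
        measure M (cylinder n \<epsilon>) = measure M (cylinder n \<delta>))"

definition adic_ergodic :: "path measure \<Rightarrow> bool" where
  "adic_ergodic M \<longleftrightarrow>
     (\<forall>A\<in>sets borel. adic_invariant_set A \<longrightarrow> measure M A = 0 \<or> measure M A = 1)"

definition ergodic_central :: "path measure \<Rightarrow> bool" where
  "ergodic_central M \<longleftrightarrow> central M \<and> adic_ergodic M"

definition lives_over :: "path measure \<Rightarrow> real \<Rightarrow> bool" where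
  "lives_over M x \<longleftrightarrow> (AE \<epsilon> in M. proj \<epsilon> = x)"

definition mu :: "real \<Rightarrow> path measure" where
  "mu x = (THE M. ergodic_central M \<and> lives_over M x)"

definition atomless :: "path measure \<Rightarrow> bool" where
  "atomless M \<longleftrightarrow> (\<forall>\<epsilon>. emeasure M {\<epsilon>} = 0)"

definition supp :: "path measure \<Rightarrow> path set" where
  "supp M = {\<epsilon>. \<forall>U. open U \<and> \<epsilon> \<in> U \<longrightarrow> emeasure M U > 0}"

definition phi :: "real \<Rightarrow> path set" where
  "phi x = supp (mu x)"

definition strictly_ergodic_on :: "path set \<Rightarrow> bool" where
  "strictly_ergodic_on S \<longleftrightarrow>
     (\<exists>!M. path_prob M \<and> emeasure M S = 1 \<and> adic_invariant_measure M)"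

definition canonical_digit :: "real \<Rightarrow> nat \<Rightarrow> int" where
  "canonical_digit x k = \<lfloor>golden * ((\<lambda>y. frac (golden * y)) ^^ k) x\<rfloor>"

definition infinite_canonical :: "real \<Rightarrow> bool" where
  "infinite_canonical x \<longleftrightarrow> infinite {k. canonical_digit x k = 1}"

text \<open>
  The generalized canonical expansion is the greedy expansion of \<open>x\<close> with respect to the
  weights, with digits restricted to 0 and 1; \<open>gen_canonical_proj\<close> and \<open>gen_canonical_shape\<close>
  below are its characteristic properties.
\<close>

fun gen_remainder :: "real \<Rightarrow> nat \<Rightarrow> real" where
  "gen_remainder x 0 = x"
| "gen_remainder x (Suc k) =
     (if weight k \<le> gen_remainder x k then gen_remainder x k - weight k else gen_remainder x k)"

definition gen_canonical :: "real \<Rightarrow> path" where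
  "gen_canonical x k \<longleftrightarrow> weight k \<le> gen_remainder x k"

definition even_pieces :: "path \<Rightarrow> nat set" where
  "even_pieces \<epsilon> = {i. \<exists>l\<ge>1. \<epsilon> i \<and> (\<forall>j\<in>{1..2 * l}. \<not> \<epsilon> (i + j)) \<and> \<epsilon> (i + 2 * l + 1)}"

lemma golden_inv: "(1 / golden) ^ 2 = 1 - 1 / golden" and golden_gt_1: "golden > 1"
proof -
  have "sqrt 5 > 1" by simp
  then show g: "golden > 1" by (simp add: golden_def)
  have "golden\<^sup>2 = golden + 1"
    by (simp add: golden_def power2_eq_square field_simps)
  then show "(1 / golden) ^ 2 = 1 - 1 / golden"
    using g by (simp add: field_simps power2_eq_square)
qed

lemma weight_rec: "(1 / golden) ^ n - weight n = (1 / golden) ^ (n + 1)"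
proof -
  have "weight n = (1 / golden) ^ n * (1 / golden) ^ 2"
    unfolding weight_def by (rule power_add)
  then show ?thesis unfolding golden_inv by (simp add: right_diff_distrib)
qed

lemma gen_remainder_bounds:
  assumes "x \<in> {0..1}"
  shows "0 \<le> gen_remainder x n \<and> gen_remainder x n \<le> (1 / golden) ^ n"
proof (induction n)
  case 0
  then show ?case using assms by simp
next
  case (Suc n)
  have "weight n \<le> (1 / golden) ^ (n + 1)"
    unfolding weight_def using golden_gt_1 by (intro power_decreasing) auto
  then show ?case using Suc weight_rec[of n] by auto
qed

lemma gen_remainder_vertex: "gen_remainder x n = x - vertex n (gen_canonical x)"
  by (induction n) (auto simp: vertex_def gen_canonical_def)

lemma gen_canonical_proj:
  assumes "x \<in> {0..1}"
  shows "proj (gen_canonical x) = x"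
proof -
  have "(\<lambda>n. (1 / golden) ^ n) \<longlonglongrightarrow> 0"
    using golden_gt_1 by (intro LIMSEQ_power_zero) simp
  then have "(\<lambda>n. gen_remainder x n) \<longlonglongrightarrow> 0"
    by (rule real_tendsto_sandwich[OF _ _ tendsto_const, rotated 2])
      (simp_all add: gen_remainder_bounds[OF assms])
  then have "(\<lambda>n. x - gen_remainder x n) \<longlonglongrightarrow> x - 0"
    by (intro tendsto_intros)
  moreover have "(\<lambda>n. x - gen_remainder x n) = (\<lambda>n. vertex n (gen_canonical x))"
    by (simp add: gen_remainder_vertex)
  ultimately have "(\<lambda>k. of_bool (gen_canonical x k) * weight k) sums x"
    by (simp add: sums_def vertex_def)
  then show ?thesis by (simp add: proj_def sums_iff)
qed

lemma gen_canonical_shape: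
  assumes "x \<in> {0<..<1}"
  shows "\<exists>m. (\<forall>k<m. gen_canonical x k) \<and>
             (\<forall>k\<ge>m. \<not> (gen_canonical x k \<and> gen_canonical x (k + 1)))"
proof -
  let ?e = "gen_canonical x" and ?r = "gen_remainder x"
  have ex: "\<exists>n. \<not> ?e n"
  proof (rule ccontr)
    assume "\<not> (\<exists>n. \<not> ?e n)"
    then have all: "?e n" for n by blast
    have r: "?r n = x - 1 + (1 / golden) ^ n" for n
    proof (induction n)
      case (Suc n)
      then show ?case using all[of n] weight_rec[of n] by (simp add: gen_canonical_def)
    qed simp
    obtain n where "(1 / golden) ^ n < 1 - x"
      using real_arch_pow_inv[of "1 - x" "1 / golden"] assms golden_gt_1 by auto
    with r[of n] gen_remainder_bounds[of x n] assms show False by auto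
  qed
  define m where "m = (LEAST n. \<not> ?e n)"
  have m: "\<not> ?e m" and lt: "\<And>k. k < m \<Longrightarrow> ?e k"
    unfolding m_def using LeastI_ex[OF ex] not_less_Least by blast+
  have w: "weight k < (1 / golden) ^ (k + 1)" "weight (Suc k) < weight k" for k
    unfolding weight_def using golden_gt_1 by (intro power_strict_decreasing; simp)+
  have w2: "(1 / golden) ^ (k + 1) - weight k = weight (Suc k)" for k
    using weight_rec[of "Suc k"] by (simp add: weight_def)
  have P: "?r k < (1 / golden) ^ (k + 1)" if "k \<ge> m" for k
    using that
  proof (induction k rule: dec_induct)
    case base
    then show ?case using m w(1)[of m] by (simp add: gen_canonical_def)
  next
    case (step k)
    have "(1 / golden) ^ (Suc k + 1) = weight k" by (simp add: weight_def)
    then show ?case using step w2[of k] w(2)[of k] by auto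
  qed
  have "\<not> (?e k \<and> ?e (k + 1))" if "k \<ge> m" for k
    using P[OF that] w2[of k] by (auto simp: gen_canonical_def)
  with lt show ?thesis by blast
qed

text \<open>
  Isomorphism modulo null sets between a map \<open>T\<close> defined on the set \<open>D\<close> only and an everywhere
  defined map \<open>S\<close>.
\<close>

definition metrically_isomorphic ::
    "'a measure \<Rightarrow> 'a set \<Rightarrow> ('a \<Rightarrow> 'a) \<Rightarrow> 'b measure \<Rightarrow> ('b \<Rightarrow> 'b) \<Rightarrow> bool" where
  "metrically_isomorphic M D T N S \<longleftrightarrow>
     (\<exists>f g. f \<in> M \<rightarrow>\<^sub>M N \<and> g \<in> N \<rightarrow>\<^sub>M M \<and> distr M N f = N \<and> distr N M g = M \<and>
        (AE x in M. g (f x) = x) \<and> (AE y in N. f (g y) = y) \<and>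
        (AE x in M. x \<in> D \<and> f (T x) = S (f x)))"

definition eigenfunction ::
    "'a measure \<Rightarrow> 'a set \<Rightarrow> ('a \<Rightarrow> 'a) \<Rightarrow> complex \<Rightarrow> ('a \<Rightarrow> complex) \<Rightarrow> bool" where
  "eigenfunction M D T c f \<longleftrightarrow>
     f \<in> borel_measurable M \<and> integrable M (\<lambda>x. (cmod (f x))\<^sup>2) \<and>
     \<not> (AE x in M. f x = 0) \<and> (AE x in M. x \<in> D \<and> f (T x) = c * f x)"

definition purely_discrete_spectrum :: "'a measure \<Rightarrow> 'a set \<Rightarrow> ('a \<Rightarrow> 'a) \<Rightarrow> bool" where
  "purely_discrete_spectrum M D T \<longleftrightarrow>
     (\<forall>f. f \<in> borel_measurable M \<and> integrable M (\<lambda>x. (cmod (f x))\<^sup>2) \<longrightarrow>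
        (\<forall>e>0. \<exists>(n::nat) c g b. (\<forall>i<n. eigenfunction M D T (c i) (g i)) \<and>
           (LINT x|M. (cmod (f x - (\<Sum>i<n. b i * g i x)))\<^sup>2) < e))"

definition rational_spectrum :: "'a measure \<Rightarrow> 'a set \<Rightarrow> ('a \<Rightarrow> 'a) \<Rightarrow> bool" where
  "rational_spectrum M D T \<longleftrightarrow>
     (\<forall>c f. eigenfunction M D T c f \<longrightarrow> (\<exists>r\<in>\<rat>. c = cis (2 * pi * r)))"

text \<open>
  The \<open>a\<close>-adic integers are the digit sequences \<open>z\<close> with \<open>z i < a i\<close>, added with carry; Haar
  measure is the product of the uniform measures.
\<close>

fun aint_carry :: "(nat \<Rightarrow> nat) \<Rightarrow> (nat \<Rightarrow> nat) \<Rightarrow> (nat \<Rightarrow> nat) \<Rightarrow> nat \<Rightarrow> nat" where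
  "aint_carry a z w 0 = 0"
| "aint_carry a z w (Suc i) = (z i + w i + aint_carry a z w i) div a i"

definition aint_add :: "(nat \<Rightarrow> nat) \<Rightarrow> (nat \<Rightarrow> nat) \<Rightarrow> (nat \<Rightarrow> nat) \<Rightarrow> nat \<Rightarrow> nat" where
  "aint_add a z w i = (z i + w i + aint_carry a z w i) mod a i"

definition aint_of_nat :: "(nat \<Rightarrow> nat) \<Rightarrow> nat \<Rightarrow> nat \<Rightarrow> nat" where
  "aint_of_nat a n i = (n div (\<Prod>j<i. a j)) mod a i"

definition aint_shift :: "(nat \<Rightarrow> nat) \<Rightarrow> (nat \<Rightarrow> nat) \<Rightarrow> nat \<Rightarrow> nat" where
  "aint_shift a z = aint_add a z (aint_of_nat a 1)"

definition aint_haar :: "(nat \<Rightarrow> nat) \<Rightarrow> (nat \<Rightarrow> nat) measure" where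
  "aint_haar a = (\<Pi>\<^sub>M i\<in>UNIV. uniform_count_measure {..<a i})"

text \<open>The circle is represented by the interval \<open>[0,1)\<close> with addition modulo 1.\<close>

definition circle :: "real measure" where
  "circle = restrict_space lborel {0..<1}"

definition rotation :: "real \<Rightarrow> real \<Rightarrow> real" where
  "rotation \<alpha> s = frac (s + \<alpha>)"

text \<open>
  The shift on the skew product of the circle and \<open>\<int>/k\<close>: adding 1 in \<open>\<int>/k\<close>, with a carry that
  rotates the circle by \<open>\<alpha>\<close>.  This is the special automorphism over the rotation under the
  constant roof function \<open>k\<close>.
\<close>

definition skew_shift :: "real \<Rightarrow> nat \<Rightarrow> real \<times> nat \<Rightarrow> real \<times> nat" where
  "skew_shift \<alpha> k = (\<lambda>(s, i). if i + 1 < k then (s, i + 1) else (rotation \<alpha> s, 0))"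

definition skew_space :: "nat \<Rightarrow> (real \<times> nat) measure" where
  "skew_space k = circle \<Otimes>\<^sub>M uniform_count_measure {..<k}"

definition fibre_measure :: "real \<Rightarrow> path measure" where
  "fibre_measure x = restrict_space (mu x) (phi x)"

definition adic_isomorphic :: "real \<Rightarrow> 'b measure \<Rightarrow> ('b \<Rightarrow> 'b) \<Rightarrow> bool" where
  "adic_isomorphic x N S \<longleftrightarrow>
     metrically_isomorphic (fibre_measure x) (phi x \<inter> adic_dom) adic N S"

end

theory Submission
  imports Defs
begin

text \<open>
  Fix \<open>x\<close>. At every level at most two vertices still have a continuation projecting to \<open>x\<close>: any two
  such vertices of level \<open>n\<close> differ by \<open>tau^(n+1)\<close> or \<open>tau^(n+2)\<close>. The paths over \<open>x\<close> thus form
  a graph of width at most two, whose path counts grow by nonnegative integer matrices of determinant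
  one, except where both vertices merge. This leaves room for only one system of conditional weights,
  so exactly one central measure lives over \<open>x\<close>; uniqueness makes it ergodic, and ergodic central
  measures live over points because the projection is constant on the elements of the tail partition.

  The levels with a single vertex that follow a level with two vertices correspond to the even pieces
  of the expansion. If there are infinitely many of them, the rank of a path among the paths with the
  same end, read off at these levels, is an adic integer and the adic transformation adds 1.
  After the last such level the two vertices are the two towers of a cutting and
  stacking construction, which is a rotation when the counts at that level are 1 and a skew product
  over a rotation otherwise.
\<close>

text \<open>The paths below a vertex v of level n project onto [v, v + tau^n], and tau^2 = 1 - tau
  turns comparisons of such intervals into linear inequalities between two consecutive powers of
  tau. This is why only two distances between vertices occur. The obstacle is a point x that is an
  end of such an interval: from that vertex it is reached only by a path that is constant from there
  on. Rewriting its last 100 as 011 over and over (or the mirror image) gives infinitely many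
  equivalent paths of equal mass, so for 0 < x < 1 such a path is null and all inequalities may be
  taken strict. The order does not involve x, yet it is analysed by ranks inside a fibre: every
  vertex belongs to the fibre of the midpoint of its interval. Whether x is some {N lambda} is a
  question about Z[tau]. Galois conjugation answers it: the remainders stay in the unit interval
  while their conjugates are contracted, which leaves two possible values in the end. The rotation
  comes from laying out the masses on [0, 1) so that cutting and stacking becomes Rauzy induction of
  a two-interval exchange.\<close>

definition tau :: real where
  "tau = 1 / golden"

lemma tau_pos: "tau > 0" and tau_lt_1: "tau < 1"
  using golden_gt_1 by (simp_all add: tau_def)

lemma tau_sq: "tau ^ 2 = 1 - tau"
  using golden_inv by (simp add: tau_def)

lemma golden_eq_tau: "golden = 1 + tau"
  using tau_sq golden_gt_1 by (simp add: tau_def field_simps power2_eq_square)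

section \<open>Powers of the inverse golden ratio\<close>

definition tp :: "nat \<Rightarrow> real" where
  "tp n = tau ^ n"

lemma tp_0 [simp]: "tp 0 = 1" and tp_1 [simp]: "tp (Suc 0) = tau"
  by (simp_all add: tp_def)

lemma tp_Suc: "tp (Suc n) = tau * tp n"
  by (simp add: tp_def)

text \<open>As a simp rule this reduces all powers to linear combinations of \<open>tp n\<close> and
  \<open>tp (Suc n)\<close>, so that linear arithmetic decides the comparisons below.\<close>

lemma tp_Suc_Suc [simp]: "tp (Suc (Suc n)) = tp n - tp (Suc n)"
proof -
  have "tp (Suc (Suc n)) = tp n * tau ^ 2"
    by (simp add: tp_def power2_eq_square)
  then show ?thesis
    unfolding tau_sq by (simp add: tp_def algebra_simps)
qed

lemma tp_pos: "tp n > 0"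
  using tau_pos by (simp add: tp_def)

lemma tp_nonneg: "0 \<le> tp n"
  using tp_pos[of n] by simp

lemma tp_less: "tp (Suc n) < tp n"
  using tp_pos[of "Suc (Suc n)"] unfolding tp_Suc_Suc by linarith

text \<open>Positivity of \<open>tp (n + 3)\<close>, \<open>tp (n + 4)\<close> and
  \<open>tp (n + 5)\<close>, expanded by the recursion. The constants give the convergents 1/2, 2/3
  and 3/5 of tau.\<close>

lemma tp_bounds: "2 * tp (Suc n) > tp n" "3 * tp (Suc n) < 2 * tp n" "5 * tp (Suc n) > 3 * tp n"
  using tp_pos[of "Suc (Suc (Suc n))"] tp_pos[of "Suc (Suc (Suc (Suc n)))"]
    tp_pos[of "Suc (Suc (Suc (Suc (Suc n))))"] by simp_all

lemma tp_tendsto: "tp \<longlonglongrightarrow> 0"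
  unfolding tp_def using tau_pos tau_lt_1 by (intro LIMSEQ_power_zero) simp

lemma tp_small: "e > 0 \<Longrightarrow> \<exists>n. \<forall>m\<ge>n. tp m < e"
  using order_tendstoD(2)[OF tp_tendsto, of e] by (auto simp: eventually_sequentially)

text \<open>The weight is the amount by which the interval below a vertex shrinks in one step: digit
  0 cuts it off at the right end, digit 1 at the left end.\<close>

lemma weight_tp: "weight n = tp n - tp (Suc n)"
  using tp_Suc_Suc[of n] by (simp add: weight_def tau_def tp_def)

section \<open>Vertices and the nested intervals below them\<close>

lemma vertex_0 [simp]: "vertex 0 \<epsilon> = 0"
  by (simp add: vertex_def)

lemma vertex_Suc: "vertex (Suc n) \<epsilon> = vertex n \<epsilon> + (if \<epsilon> n then tp n - tp (Suc n) else 0)"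
  by (simp add: vertex_def weight_tp)

lemma vertex_cong: "(\<And>k. k < n \<Longrightarrow> \<epsilon> k = \<delta> k) \<Longrightarrow> vertex n \<epsilon> = vertex n \<delta>"
  unfolding vertex_def by (intro sum.cong) auto

lemma vertex_upd [simp]: "n \<le> m \<Longrightarrow> vertex n (\<epsilon>(m := b)) = vertex n \<epsilon>"
  by (intro vertex_cong) auto

lemma vertex_agree:
  assumes "vertex m \<epsilon> = vertex m \<delta>" "m \<le> n" "\<And>k. m \<le> k \<Longrightarrow> k < n \<Longrightarrow> \<epsilon> k = \<delta> k"
  shows "vertex n \<epsilon> = vertex n \<delta>"
  using assms(2,3,1) by (induction n rule: dec_induct) (auto simp: vertex_Suc)

lemma vertex_ge_0: "vertex n \<epsilon> \<ge> 0"
  unfolding vertex_def by (intro sum_nonneg) (auto simp: weight_tp less_imp_le[OF tp_less])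

lemma vertex_diff_bounds:
  assumes "m \<le> n"
  shows "vertex m \<epsilon> \<le> vertex n \<epsilon>" "vertex n \<epsilon> + tp n \<le> vertex m \<epsilon> + tp m"
proof -
  have "vertex m \<epsilon> \<le> vertex n \<epsilon> \<and> vertex n \<epsilon> + tp n \<le> vertex m \<epsilon> + tp m"
    using assms
  proof (induction n rule: dec_induct)
    case (step n)
    then show ?case using tp_less[of n] by (auto simp: vertex_Suc)
  qed auto
  then show "vertex m \<epsilon> \<le> vertex n \<epsilon>" "vertex n \<epsilon> + tp n \<le> vertex m \<epsilon> + tp m"
    by auto
qed

text \<open>Exchanging the digits reflects the unit interval. This transfers statements on paths
  ending in zeros to paths ending in ones.\<close>

lemma vertex_compl: "vertex n (\<lambda>k. \<not> \<epsilon> k) = 1 - tp n - vertex n \<epsilon>"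
  by (induction n) (auto simp: vertex_Suc)

lemma vertex_sums: "(\<lambda>n. vertex n \<epsilon>) \<longlonglongrightarrow> proj \<epsilon>"
proof -
  have "summable (\<lambda>k. of_bool (\<epsilon> k) * weight k)"
  proof (rule summable_comparison_test)
    show "\<exists>N. \<forall>n\<ge>N. norm (of_bool (\<epsilon> n) * weight n) \<le> tp n"
    proof (intro exI allI impI)
      fix n
      show "norm (of_bool (\<epsilon> n) * weight n) \<le> tp n"
        using tp_less[of n] tp_nonneg[of "Suc n"] by (auto simp: weight_tp)
    qed
    show "summable tp"
      unfolding tp_def using tau_pos tau_lt_1 by (intro summable_geometric) auto
  qed
  then show ?thesis
    unfolding proj_def vertex_def[abs_def] by (rule summable_LIMSEQ)
qed

lemma vertex_le_proj: "vertex n \<epsilon> \<le> proj \<epsilon>"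
  by (rule LIMSEQ_le_const[OF vertex_sums]) (use vertex_diff_bounds(1) in auto)

lemma proj_le_vertex: "proj \<epsilon> \<le> vertex n \<epsilon> + tp n"
proof (rule LIMSEQ_le_const2[OF vertex_sums], intro exI allI impI)
  fix m assume "n \<le> m"
  then show "vertex m \<epsilon> \<le> vertex n \<epsilon> + tp n"
    using vertex_diff_bounds(2)[of n m \<epsilon>] tp_pos[of m] by linarith
qed

lemma proj_eqI:
  assumes "\<And>n. \<bar>x - vertex n \<epsilon>\<bar> \<le> tp n"
  shows "proj \<epsilon> = x"
proof -
  have "(\<lambda>n. vertex n \<epsilon>) \<longlonglongrightarrow> x"
  proof (rule LIMSEQ_I)
    fix e :: real assume "e > 0"
    then obtain N where N: "\<forall>m\<ge>N. tp m < e" using tp_small by blast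
    show "\<exists>N. \<forall>n\<ge>N. norm (vertex n \<epsilon> - x) < e"
    proof (intro exI allI impI)
      fix n assume "N \<le> n"
      then show "norm (vertex n \<epsilon> - x) < e"
        using N[rule_format, of n] assms[of n] by (simp add: abs_minus_commute)
    qed
  qed
  then show ?thesis
    using vertex_sums LIMSEQ_unique by blast
qed

lemma proj_eq_iff: "proj \<epsilon> = x \<longleftrightarrow> (\<forall>n. vertex n \<epsilon> \<le> x \<and> x \<le> vertex n \<epsilon> + tp n)"
proof
  assume *: "\<forall>n. vertex n \<epsilon> \<le> x \<and> x \<le> vertex n \<epsilon> + tp n"
  have "\<bar>x - vertex n \<epsilon>\<bar> \<le> tp n" for n
    using *[rule_format, of n] by linarith
  then show "proj \<epsilon> = x" by (rule proj_eqI)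
qed (use vertex_le_proj proj_le_vertex in auto)

lemma proj_bounds: "proj \<epsilon> \<in> {0..1}"
  using vertex_le_proj[of 0 \<epsilon>] proj_le_vertex[of \<epsilon> 0] by simp

lemma proj_0: "proj \<epsilon> = 0 \<longleftrightarrow> \<epsilon> = (\<lambda>_. False)"
proof
  assume *: "proj \<epsilon> = 0"
  have "\<not> \<epsilon> n" for n
    using vertex_le_proj[of "Suc n" \<epsilon>] vertex_ge_0[of n \<epsilon>] tp_less[of n] *
    by (auto simp: vertex_Suc)
  then show "\<epsilon> = (\<lambda>_. False)" by auto
qed (auto intro!: proj_eqI simp: vertex_def tp_nonneg)

lemma vertex_eq_1: "vertex n \<epsilon> + tp n = 1 \<longleftrightarrow> (\<forall>k<n. \<epsilon> k)"
proof (induction n)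
  case (Suc n)
  show ?case
    using vertex_diff_bounds(2)[of 0 n \<epsilon>] tp_less[of n] Suc[symmetric]
    by (auto simp: vertex_Suc less_Suc_eq)
qed simp

lemma proj_1: "proj \<epsilon> = 1 \<longleftrightarrow> \<epsilon> = (\<lambda>_. True)"
proof
  assume *: "proj \<epsilon> = 1"
  have "\<epsilon> n" for n
    using proj_le_vertex[of \<epsilon> "Suc n"] vertex_diff_bounds(2)[of 0 "Suc n" \<epsilon>] *
      vertex_eq_1[of "Suc n" \<epsilon>] by auto
  then show "\<epsilon> = (\<lambda>_. True)" by auto
next
  assume *: "\<epsilon> = (\<lambda>_. True)"
  show "proj \<epsilon> = 1"
  proof (rule proj_eqI)
    fix n
    show "\<bar>1 - vertex n \<epsilon>\<bar> \<le> tp n"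
      using vertex_eq_1[of n \<epsilon>] tp_pos[of n] * by auto
  qed
qed

subsection \<open>Cylinders\<close>

text \<open>Representatives of the cylinders of level n, filled up with zeros.\<close>

definition words :: "nat \<Rightarrow> path set" where
  "words n = {\<epsilon>. \<forall>k\<ge>n. \<not> \<epsilon> k}"

definition trunc :: "nat \<Rightarrow> path \<Rightarrow> path" where
  "trunc n \<epsilon> = (\<lambda>k. k < n \<and> \<epsilon> k)"

lemma finite_words: "finite (words n)"
proof -
  have "words n \<subseteq> (\<lambda>A k. k \<in> A) ` Pow {..<n}"
  proof
    fix \<epsilon> assume "\<epsilon> \<in> words n"
    then have "{k. \<epsilon> k} \<in> Pow {..<n}" and "\<epsilon> = (\<lambda>k. k \<in> {k. \<epsilon> k})"
      by (auto simp: words_def not_less[symmetric])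
    then show "\<epsilon> \<in> (\<lambda>A k. k \<in> A) ` Pow {..<n}" by blast
  qed
  then show ?thesis by (rule finite_subset) auto
qed

lemma trunc_words [simp]: "trunc n \<epsilon> \<in> words n"
  by (auto simp: trunc_def words_def)

lemma trunc_word: "\<epsilon> \<in> words n \<Longrightarrow> trunc n \<epsilon> = \<epsilon>"
  by (auto simp: trunc_def words_def fun_eq_iff not_less[symmetric])

lemma in_cylinder_trunc: "\<delta> \<in> cylinder n \<epsilon> \<longleftrightarrow> trunc n \<delta> = trunc n \<epsilon>"
  by (auto simp: cylinder_def trunc_def fun_eq_iff)

lemma cylinder_self [simp]: "\<epsilon> \<in> cylinder n \<epsilon>"
  by (simp add: cylinder_def)

lemma cylinder_eqI: "(\<And>k. k < n \<Longrightarrow> \<epsilon> k = \<delta> k) \<Longrightarrow> cylinder n \<epsilon> = cylinder n \<delta>"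
  by (auto simp: cylinder_def)

lemma cylinder_0 [simp]: "cylinder 0 \<epsilon> = UNIV"
  by (auto simp: cylinder_def)

lemma vertex_cylinder: "\<delta> \<in> cylinder n \<epsilon> \<Longrightarrow> m \<le> n \<Longrightarrow> vertex m \<delta> = vertex m \<epsilon>"
  by (intro vertex_cong) (auto simp: cylinder_def)

lemma open_cylinder: "open (cylinder n \<epsilon>)"
proof -
  have "cylinder n \<epsilon> = (\<Inter>k\<in>{..<n}. (\<lambda>\<delta>. \<delta> k) -` {\<epsilon> k})"
    by (auto simp: cylinder_def)
  also have "open \<dots>"
  proof (intro open_INT ballI)
    fix k
    show "open ((\<lambda>\<delta> :: path. \<delta> k) -` {\<epsilon> k})"
      using open_vimage[OF Topological_Spaces.open_discrete[of "{\<epsilon> k}"] continuous_on_product_coordinates[of k]] by simp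
  qed simp
  finally show ?thesis .
qed

lemma open_contains_cylinder:
  assumes "open U" "\<epsilon> \<in> U"
  shows "\<exists>n. cylinder n \<epsilon> \<subseteq> U"
proof -
  obtain X where X: "\<epsilon> \<in> Pi\<^sub>E UNIV X" "finite {i. X i \<noteq> topspace euclidean}" "Pi\<^sub>E UNIV X \<subseteq> U"
    using product_topology_open_contains_basis[of "\<lambda>_. euclidean :: bool topology" UNIV U \<epsilon>] assms
    by (auto simp: open_fun_def)
  obtain n where n: "\<And>i. X i \<noteq> UNIV \<Longrightarrow> i < n"
    using finite_nat_bounded[OF X(2)] by auto
  have "cylinder n \<epsilon> \<subseteq> Pi\<^sub>E UNIV X"
  proof
    fix \<delta> assume d: "\<delta> \<in> cylinder n \<epsilon>"
    show "\<delta> \<in> Pi\<^sub>E UNIV X"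
      unfolding PiE_iff
    proof (intro conjI ballI)
      fix i
      show "\<delta> i \<in> X i"
        using X(1) n[of i] d by (cases "X i = UNIV") (auto simp: cylinder_def PiE_iff)
    qed simp
  qed
  then show ?thesis using X(3) by blast
qed

text \<open>The sets determined by the first n digits. They are open and closed, hence Borel, and
  finite unions of cylinders.\<close>

definition fin_dep :: "nat \<Rightarrow> path set \<Rightarrow> bool" where
  "fin_dep n A \<longleftrightarrow> (\<forall>\<epsilon>\<in>A. cylinder n \<epsilon> \<subseteq> A)"

lemma fin_depI: "(\<And>\<epsilon> \<delta>. \<epsilon> \<in> A \<Longrightarrow> (\<And>k. k < n \<Longrightarrow> \<delta> k = \<epsilon> k) \<Longrightarrow> \<delta> \<in> A) \<Longrightarrow> fin_dep n A"
  by (auto simp: fin_dep_def cylinder_def)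

lemma fin_dep_open: "fin_dep n A \<Longrightarrow> open A"
proof -
  assume "fin_dep n A"
  then have "A = (\<Union>\<epsilon>\<in>A. cylinder n \<epsilon>)" by (auto simp: fin_dep_def)
  then show "open A" using open_cylinder by (metis open_UN)
qed

lemma fin_dep_Compl: "fin_dep n A \<Longrightarrow> fin_dep n (- A)"
  unfolding fin_dep_def
proof (intro ballI subsetI ComplI)
  fix \<epsilon> \<delta> assume *: "\<forall>\<epsilon>\<in>A. cylinder n \<epsilon> \<subseteq> A" "\<epsilon> \<in> - A" "\<delta> \<in> cylinder n \<epsilon>" "\<delta> \<in> A"
  then have "\<epsilon> \<in> cylinder n \<delta>" by (simp add: cylinder_def)
  then show False using * by blast
qed

lemma fin_dep_closed: "fin_dep n A \<Longrightarrow> closed A"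
  using fin_dep_open[OF fin_dep_Compl] by (simp add: closed_def)

lemma fin_dep_borel [intro]: "fin_dep n A \<Longrightarrow> A \<in> sets borel"
  using fin_dep_open by auto

lemma fin_dep_words: "fin_dep n A \<Longrightarrow> A = (\<Union>p\<in>words n \<inter> A. cylinder n p)"
proof (intro set_eqI iffI)
  fix \<epsilon> assume A: "fin_dep n A" "\<epsilon> \<in> A"
  have "trunc n \<epsilon> \<in> cylinder n \<epsilon>" by (simp add: cylinder_def trunc_def)
  then have "trunc n \<epsilon> \<in> words n \<inter> A" "\<epsilon> \<in> cylinder n (trunc n \<epsilon>)"
    using A by (auto simp: fin_dep_def) (auto simp: cylinder_def trunc_def)
  then show "\<epsilon> \<in> (\<Union>p\<in>words n \<inter> A. cylinder n p)" by blast
qed (auto simp: fin_dep_def)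

lemma disjoint_cylinders: "disjoint_family_on (cylinder n) (words n)"
  by (auto simp: disjoint_family_on_def in_cylinder_trunc trunc_word)

lemma cylinder_borel [measurable]: "cylinder n \<epsilon> \<in> sets borel"
  using open_cylinder by auto

lemma fin_dep_vertex: "m \<le> n \<Longrightarrow> fin_dep n {\<epsilon>. P (vertex m \<epsilon>)}"
  unfolding fin_dep_def using vertex_cylinder by auto

lemma closed_proj: "closed {\<epsilon>. proj \<epsilon> = x}"
proof -
  have "{\<epsilon>. proj \<epsilon> = x} = (\<Inter>n. {\<epsilon>. vertex n \<epsilon> \<le> x \<and> x \<le> vertex n \<epsilon> + tp n})"
    by (auto simp: proj_eq_iff)
  moreover have "closed {\<epsilon>. vertex n \<epsilon> \<le> x \<and> x \<le> vertex n \<epsilon> + tp n}" for n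
    using fin_dep_closed[OF fin_dep_vertex[of n n "\<lambda>v. v \<le> x \<and> x \<le> v + tp n"]] by simp
  ultimately show ?thesis by (metis (no_types, lifting) closed_INT)
qed

lemma proj_measurable [measurable]: "proj \<in> borel_measurable borel"
proof (rule borel_measurable_LIMSEQ_real[OF vertex_sums])
  fix n
  show "vertex n \<in> borel_measurable borel"
  proof (rule borel_measurableI_le)
    fix y
    have "fin_dep n {\<epsilon>. vertex n \<epsilon> \<le> y}"
      using fin_dep_vertex[of n n "\<lambda>v. v \<le> y"] by simp
    then show "{\<epsilon> \<in> space borel. vertex n \<epsilon> \<le> y} \<in> sets borel" by auto
  qed
qed

text \<open>The lower bound \<open>s\<close> on the levels is kept free because some measures are
  computed only on cylinders of level at least \<open>s\<close>.\<close>

lemma sets_borel_cylinders: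
  "sets (borel :: path measure) = sigma_sets UNIV (insert {} {cylinder n \<epsilon> | n \<epsilon>. s \<le> n})" (is "_ = sigma_sets UNIV ?G")
proof (intro equalityI)
  show "sigma_sets UNIV ?G \<subseteq> sets borel"
    by (rule sigma_algebra.sigma_sets_subset[OF sets.sigma_algebra_axioms[of borel, simplified]]) auto
  have "U \<in> sigma_sets UNIV ?G" if op: "open U" for U :: "path set"
  proof -
    define I where "I = {(n, p). s \<le> n \<and> p \<in> words n \<and> cylinder n p \<subseteq> U}"
    have "I \<subseteq> Sigma UNIV words" by (auto simp: I_def)
    then have "countable I"
      by (rule countable_subset) (intro countable_SIGMA, simp, rule countable_finite, rule finite_words)
    moreover have "U = (\<Union>(n, p)\<in>I. cylinder n p)"
    proof (intro set_eqI iffI)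
      fix \<epsilon> assume e: "\<epsilon> \<in> U"
      obtain n where n: "cylinder n \<epsilon> \<subseteq> U" using open_contains_cylinder[OF op e] by blast
      let ?m = "max n s"
      have "cylinder ?m (trunc ?m \<epsilon>) \<subseteq> cylinder n \<epsilon>"
        by (auto simp: cylinder_def trunc_def)
      then have "(?m, trunc ?m \<epsilon>) \<in> I" using n by (auto simp: I_def)
      moreover have "\<epsilon> \<in> cylinder ?m (trunc ?m \<epsilon>)" by (auto simp: cylinder_def trunc_def)
      ultimately show "\<epsilon> \<in> (\<Union>(n, p)\<in>I. cylinder n p)" by blast
    qed (auto simp: I_def)
    moreover have "(\<Union>(n, p)\<in>I. cylinder n p) \<in> sigma_sets UNIV ?G"
    proof (rule sigma_sets_UNION)
      show "countable ((\<lambda>(n, p). cylinder n p) ` I)" using \<open>countable I\<close> by auto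
    qed (auto simp: I_def)
    ultimately show ?thesis by simp
  qed
  then have "sigma_sets UNIV {U :: path set. open U} \<subseteq> sigma_sets UNIV ?G"
    by (intro sigma_algebra.sigma_sets_subset[OF sigma_algebra_sigma_sets]) auto
  then show "sets borel \<subseteq> sigma_sets UNIV ?G"
    by (simp add: borel_def)
qed

lemma Int_stable_cylinders: "Int_stable (insert {} {cylinder n \<epsilon> | n \<epsilon>. s \<le> n})"
proof (rule Int_stableI)
  fix A B :: "path set"
  assume A: "A \<in> insert {} {cylinder n \<epsilon> | n \<epsilon>. s \<le> n}" and B: "B \<in> insert {} {cylinder n \<epsilon> | n \<epsilon>. s \<le> n}"
  show "A \<inter> B \<in> insert {} {cylinder n \<epsilon> | n \<epsilon>. s \<le> n}"
  proof (cases "A \<inter> B = {}")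
    case False
    then obtain \<delta> where d: "\<delta> \<in> A" "\<delta> \<in> B" by auto
    obtain n \<epsilon> where n: "A = cylinder n \<epsilon>" "s \<le> n" using A d by auto
    obtain m \<eta> where m: "B = cylinder m \<eta>" "s \<le> m" using B d by auto
    have "A \<inter> B = cylinder (max n m) \<delta>"
      using d unfolding n m cylinder_def by (auto simp: less_max_iff_disj)
    then show ?thesis using n m by auto
  qed simp
qed

lemma measure_eqI_cylinders:
  fixes M N :: "path measure"
  assumes "finite_measure M" "finite_measure N" "sets M = sets borel" "sets N = sets borel"
    and eq: "\<And>n \<epsilon>. s \<le> n \<Longrightarrow> emeasure M (cylinder n \<epsilon>) = emeasure N (cylinder n \<epsilon>)"
  shows "M = N"
proof (rule measure_eqI_generator_eq_countable[where E = "insert {} {cylinder n \<epsilon> | n \<epsilon>. s \<le> n}" and \<Omega> = UNIV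
      and A = "cylinder s ` words s"])
  interpret M: finite_measure M by fact
  interpret N: finite_measure N by fact
  show "Int_stable (insert {} {cylinder n \<epsilon> | n \<epsilon>. s \<le> n})" by (rule Int_stable_cylinders)
  show "emeasure M X = emeasure N X" if "X \<in> insert {} {cylinder n \<epsilon> | n \<epsilon>. s \<le> n}" for X
    using that eq by auto
  show "emeasure M a \<noteq> \<infinity>" for a by simp
  show "\<Union> (cylinder s ` words s) = UNIV"
    using fin_dep_words[of s UNIV] by (simp add: fin_dep_def)
  show "sets M = sigma_sets UNIV (insert {} {cylinder n \<epsilon> | n \<epsilon>. s \<le> n})"
    "sets N = sigma_sets UNIV (insert {} {cylinder n \<epsilon> | n \<epsilon>. s \<le> n})"
    using assms(3,4) sets_borel_cylinders[of s] by simp_all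
  show "countable (cylinder s ` words s)"
    using finite_words[of s] by (simp add: countable_finite)
qed auto

subsection \<open>Vertices that can still reach a point\<close>

lemma last_difference:
  fixes \<epsilon> \<delta> :: path
  assumes "k < n" "\<epsilon> k \<noteq> \<delta> k"
  obtains m where "m < n" "\<epsilon> m \<noteq> \<delta> m" "\<forall>k. m < k \<and> k < n \<longrightarrow> \<epsilon> k = \<delta> k"
proof -
  define m where "m = Max {k. k < n \<and> \<epsilon> k \<noteq> \<delta> k}"
  have "m \<in> {k. k < n \<and> \<epsilon> k \<noteq> \<delta> k}" unfolding m_def using assms by (intro Max_in) auto
  moreover have "k \<le> m" if "k < n" "\<epsilon> k \<noteq> \<delta> k" for k
    unfolding m_def using that by (intro Max_ge) auto
  ultimately show thesis using that[of m] by fastforce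
qed

text \<open>One vertex, or two at distance tau^(n+1) (\<open>Far\<close>) or tau^(n+2)
  (\<open>Near\<close>). The latter is the weight of the next edge, so two edges can meet
  there.\<close>

datatype shape = Single | Far | Near

locale fibre =
  fixes x :: real
  assumes x_pos: "0 < x" and x_less_1: "x < 1"
begin

text \<open>Distance from the higher of the remaining vertices to x. It is the remainder of a greedy
  algorithm with strict comparison, so it never becomes 0.\<close>

primrec urem :: "nat \<Rightarrow> real" where
  "urem 0 = x"
| "urem (Suc n) = (if weight n < urem n then urem n - weight n else urem n)"

text \<open>The weight of the next edge is less than the remainder, so the edge 1 out of the upper
  vertex still reaches x. These are the greedy digits.\<close>

definition split_up :: "nat \<Rightarrow> bool" where
  "split_up n \<longleftrightarrow> tp (Suc (Suc n)) < urem n"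

text \<open>At shape \<open>Near\<close> this says \<open>urem n + tp (n + 2) < tp (n + 1)\<close>:
  the edge 0 out of the lower vertex still reaches x.\<close>

definition split_low :: "nat \<Rightarrow> bool" where
  "split_low n \<longleftrightarrow> urem n < tp (Suc (Suc (Suc n)))"

text \<open>From \<open>Far\<close> only the edge 0 above and the edge 1 below survive, which brings
  the vertices to distance tau^(n+3), that is \<open>Near\<close> one level on. From
  \<open>Near\<close> the edge 0 above and the edge 1 below meet, and it remains to see whether a
  second vertex branches off.\<close>

primrec shape :: "nat \<Rightarrow> shape" where
  "shape 0 = Single"
| "shape (Suc n) = (case shape n of
     Single \<Rightarrow> if split_up n \<and> urem n < tp (Suc n) then Far else Single
   | Far \<Rightarrow> Near
   | Near \<Rightarrow> if split_up n \<or> split_low n then Far else Single)"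

definition gap :: "nat \<Rightarrow> real" where
  "gap n = (case shape n of Single \<Rightarrow> 0 | Far \<Rightarrow> tp (Suc n) | Near \<Rightarrow> tp (Suc (Suc n)))"

text \<open>Strict inequalities: x is an interior point of the interval below the vertex. Paths over
  x through any other vertex are eventually constant and null for central measures.\<close>

definition alive :: "nat \<Rightarrow> path \<Rightarrow> bool" where
  "alive n \<epsilon> \<longleftrightarrow> vertex n \<epsilon> < x \<and> x < vertex n \<epsilon> + tp n"

definition upper :: "nat \<Rightarrow> path \<Rightarrow> bool" where
  "upper n \<epsilon> \<longleftrightarrow> x - vertex n \<epsilon> = urem n"

definition lower :: "nat \<Rightarrow> path \<Rightarrow> bool" where
  "lower n \<epsilon> \<longleftrightarrow> shape n \<noteq> Single \<and> x - vertex n \<epsilon> = urem n + gap n"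

lemma urem_Suc: "urem (Suc n) = (if split_up n then urem n - (tp n - tp (Suc n)) else urem n)"
  by (simp add: split_up_def weight_tp)

declare urem.simps(2) [simp del]

text \<open>The remainders at both vertices are strictly between 0 and the length
  \<open>tp n\<close> of the interval, so both vertices are alive.\<close>

lemma shape_bounds: "0 < urem n \<and> urem n + gap n < tp n"
proof (induction n)
  case 0
  then show ?case using x_pos x_less_1 by (simp add: gap_def)
next
  case (Suc n)
  then show ?case
    using tp_bounds[of n] tp_pos[of n] tp_pos[of "Suc n"]
    by (cases "shape n")
      (auto simp: gap_def urem_Suc split_up_def split_low_def)
qed

lemma alive_Suc: "alive (Suc n) \<epsilon> \<Longrightarrow> alive n \<epsilon>"
  using tp_less[of n] by (auto simp: alive_def vertex_Suc split: if_splits)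

lemma alive_le: "alive n \<epsilon> \<Longrightarrow> m \<le> n \<Longrightarrow> alive m \<epsilon>"
  by (rotate_tac, induction n rule: dec_induct) (auto dest: alive_Suc)

lemma gap_pos: "shape n \<noteq> Single \<Longrightarrow> gap n > 0"
  using tp_pos[of "Suc n"] tp_less[of n] by (cases "shape n") (auto simp: gap_def)

lemma upper_lower_excl: "upper n \<epsilon> \<Longrightarrow> \<not> lower n \<epsilon>"
  using gap_pos[of n] by (auto simp: upper_def lower_def)

text \<open>An alive vertex has an alive predecessor, so only the ends of edges out of the upper and
  the lower vertex are candidates. The bounds on the powers of tau leave at most two of them and
  identify those that coincide.\<close>

lemma alive_iff: "alive n \<epsilon> \<longleftrightarrow> upper n \<epsilon> \<or> lower n \<epsilon>"
proof
  assume "upper n \<epsilon> \<or> lower n \<epsilon>"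
  then show "alive n \<epsilon>"
    using shape_bounds[of n] gap_pos[of n]
    by (cases "shape n") (auto simp: upper_def lower_def alive_def gap_def)
next
  show "alive n \<epsilon> \<Longrightarrow> upper n \<epsilon> \<or> lower n \<epsilon>"
  proof (induction n)
    case 0
    then show ?case by (simp add: upper_def)
  next
    case (Suc n)
    then show ?case
      using tp_bounds[of n] tp_pos[of n] tp_pos[of "Suc n"] shape_bounds[of n] alive_Suc[OF Suc.prems]
      by (cases "shape n"; cases "\<epsilon> n")
        (auto simp: upper_def lower_def alive_def gap_def urem_Suc vertex_Suc split_up_def split_low_def)
  qed
qed

lemma upper_Suc:
  "upper (Suc n) \<epsilon> \<longleftrightarrow> (case shape n of
      Single \<Rightarrow> upper n \<epsilon> \<and> \<epsilon> n = split_up n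
    | Far \<Rightarrow> upper n \<epsilon> \<and> \<not> \<epsilon> n
    | Near \<Rightarrow> if split_up n then upper n \<epsilon> \<and> \<epsilon> n
              else upper n \<epsilon> \<and> \<not> \<epsilon> n \<or> lower n \<epsilon> \<and> \<epsilon> n)" (is "?L \<longleftrightarrow> ?R")
proof
  assume L: ?L
  then have "upper n \<epsilon> \<or> lower n \<epsilon>"
    using alive_iff alive_Suc by blast
  then show ?R
    using L tp_bounds[of n] tp_pos[of n] tp_pos[of "Suc n"] shape_bounds[of n]
    by (cases "shape n"; cases "\<epsilon> n")
      (auto simp: upper_def lower_def gap_def urem_Suc vertex_Suc split_up_def split: if_splits)
next
  assume ?R
  then show ?L
    using tp_bounds[of n] tp_pos[of n] tp_pos[of "Suc n"] shape_bounds[of n]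
    by (cases "shape n"; cases "\<epsilon> n")
      (auto simp: upper_def lower_def gap_def urem_Suc vertex_Suc split_up_def split: if_splits)
qed

lemma lower_Suc:
  "lower (Suc n) \<epsilon> \<longleftrightarrow> (case shape n of
      Single \<Rightarrow> shape (Suc n) = Far \<and> upper n \<epsilon> \<and> \<not> \<epsilon> n
    | Far \<Rightarrow> lower n \<epsilon> \<and> \<epsilon> n
    | Near \<Rightarrow> if split_up n then upper n \<epsilon> \<and> \<not> \<epsilon> n \<or> lower n \<epsilon> \<and> \<epsilon> n
              else split_low n \<and> lower n \<epsilon> \<and> \<not> \<epsilon> n)" (is "?L \<longleftrightarrow> ?R")
proof
  assume L: ?L
  then have "upper n \<epsilon> \<or> lower n \<epsilon>"
    using alive_iff alive_Suc by blast
  then show ?R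
    using L tp_bounds[of n] tp_pos[of n] tp_pos[of "Suc n"] shape_bounds[of n]
    by (cases "shape n"; cases "\<epsilon> n")
      (auto simp: upper_def lower_def gap_def urem_Suc vertex_Suc split_up_def split_low_def split: if_splits)
next
  assume ?R
  then show ?L
    using tp_bounds[of n] tp_pos[of n] tp_pos[of "Suc n"] shape_bounds[of n]
    by (cases "shape n"; cases "\<epsilon> n")
      (auto simp: upper_def lower_def gap_def urem_Suc vertex_Suc split_up_def split_low_def split: if_splits)
qed

lemma upper_cong: "vertex n \<epsilon> = vertex n \<delta> \<Longrightarrow> upper n \<epsilon> = upper n \<delta>"
  and lower_cong: "vertex n \<epsilon> = vertex n \<delta> \<Longrightarrow> lower n \<epsilon> = lower n \<delta>"
  and alive_cong: "vertex n \<epsilon> = vertex n \<delta> \<Longrightarrow> alive n \<epsilon> = alive n \<delta>"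
  by (simp_all add: upper_def lower_def alive_def)

lemma upper_vertex: "upper n \<epsilon> \<Longrightarrow> upper n \<delta> \<Longrightarrow> vertex n \<epsilon> = vertex n \<delta>"
  and lower_vertex: "lower n \<epsilon> \<Longrightarrow> lower n \<delta> \<Longrightarrow> vertex n \<epsilon> = vertex n \<delta>"
  by (simp_all add: upper_def lower_def)

lemma upper_upd [simp]: "upper n (\<epsilon>(n := b)) = upper n \<epsilon>"
  and lower_upd [simp]: "lower n (\<epsilon>(n := b)) = lower n \<epsilon>"
  by (simp_all add: upper_def lower_def)

lemma split_excl: "split_up n \<Longrightarrow> \<not> split_low n"
  using tp_pos[of "Suc n"] tp_bounds[of n] by (auto simp: split_up_def split_low_def)

lemma Near_prev:
  assumes "shape n = Near"
  obtains m where "n = Suc m" "shape m = Far"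
  using assms by (cases n) (auto split: shape.splits if_splits)

lemma Far_prev:
  assumes "shape n = Far"
  obtains m where "n = Suc m" "shape m = Single" "split_up m" "urem m < tp (Suc m)"
    | m where "n = Suc m" "shape m = Near" "split_up m \<or> split_low m"
  using assms by (cases n) (auto split: shape.splits if_splits)

lemma Far_not_split_up: "shape n = Far \<Longrightarrow> \<not> split_up n"
  using shape_bounds[of n] by (auto simp: split_up_def gap_def)

lemma ex_upper: "\<exists>\<epsilon>. upper n \<epsilon>"
proof (induction n)
  case (Suc n)
  then obtain \<epsilon> where "upper n \<epsilon>" by blast
  then have "upper (Suc n) (\<epsilon>(n := split_up n))"
    using Far_not_split_up[of n] by (auto simp: upper_Suc split: shape.splits)
  then show ?case by blast
qed (simp add: upper_def)

lemma ex_lower: "shape n \<noteq> Single \<Longrightarrow> \<exists>\<epsilon>. lower n \<epsilon>"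
proof (induction n)
  case (Suc n)
  show ?case
  proof (cases "shape n")
    case Single
    then obtain \<epsilon> where "upper n \<epsilon>" using ex_upper by blast
    then have "lower (Suc n) (\<epsilon>(n := False))"
      using Suc.prems Single by (auto simp: lower_Suc split: if_splits)
    then show ?thesis by blast
  next
    case Far
    then obtain \<epsilon> where "lower n \<epsilon>" using Suc.IH by auto
    then have "lower (Suc n) (\<epsilon>(n := True))" using Far by (auto simp: lower_Suc)
    then show ?thesis by blast
  next
    case Near
    then obtain \<epsilon> where "lower n \<epsilon>" using Suc.IH by auto
    then have "lower (Suc n) (\<epsilon>(n := split_up n))"
      using Near Suc.prems by (auto simp: lower_Suc split: if_splits)
    then show ?thesis by blast
  qed
qed simp

subsection \<open>Numbers of paths and ranks\<close>

text \<open>Numbers of paths to the lower and to the upper vertex, in this order. At a single vertex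
  both components hold its number of paths, so a later splitting starts with the right
  counts.\<close>

primrec dims :: "nat \<Rightarrow> nat \<times> nat" where
  "dims 0 = (1, 1)"
| "dims (Suc n) =
     (fst (dims n) + (if shape n = Near \<and> \<not> split_low n then snd (dims n) else 0),
      snd (dims n) + (if shape n = Near \<and> \<not> split_up n then fst (dims n) else 0))"

definition dlo :: "nat \<Rightarrow> nat" where "dlo n = fst (dims n)"
definition dhi :: "nat \<Rightarrow> nat" where "dhi n = snd (dims n)"

lemma dlo_0 [simp]: "dlo 0 = 1" and dhi_0 [simp]: "dhi 0 = 1"
  by (simp_all add: dlo_def dhi_def)

lemma dlo_Suc: "dlo (Suc n) = dlo n + (if shape n = Near \<and> \<not> split_low n then dhi n else 0)"
  and dhi_Suc: "dhi (Suc n) = dhi n + (if shape n = Near \<and> \<not> split_up n then dlo n else 0)"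
  by (simp_all add: dlo_def dhi_def)

lemma dims_pos: "dlo n > 0" "dhi n > 0"
proof -
  have "dlo n > 0 \<and> dhi n > 0" by (induction n) (auto simp: dlo_Suc dhi_Suc)
  then show "dlo n > 0" "dhi n > 0" by auto
qed

lemma Single_dims: "shape n = Single \<Longrightarrow> dlo n = dhi n"
  by (induction n) (auto simp: dlo_Suc dhi_Suc split: shape.splits if_splits)

definition dim :: "nat \<Rightarrow> path \<Rightarrow> nat" where
  "dim n \<epsilon> = (if upper n \<epsilon> then dhi n else dlo n)"

definition merge :: "nat \<Rightarrow> path \<Rightarrow> bool" where
  "merge n \<epsilon> \<longleftrightarrow> shape n = Near \<and> (upper n \<epsilon> \<and> \<not> \<epsilon> n \<or> lower n \<epsilon> \<and> \<epsilon> n)"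

text \<open>Number of paths to the same vertex that precede the given one. Where two edges meet, the
  paths through the lower vertex, with last digit 1, come before those through the upper one, just
  as 011 precedes 100.\<close>

primrec rk :: "nat \<Rightarrow> path \<Rightarrow> nat" where
  "rk 0 \<epsilon> = 0"
| "rk (Suc n) \<epsilon> = rk n \<epsilon> + (if shape n = Near \<and> upper n \<epsilon> \<and> \<not> \<epsilon> n then dlo n else 0)"

lemma dim_cong: "vertex n \<epsilon> = vertex n \<delta> \<Longrightarrow> dim n \<epsilon> = dim n \<delta>"
  by (simp add: dim_def upper_def)

lemma rk_cong: "(\<And>k. k < n \<Longrightarrow> \<epsilon> k = \<delta> k) \<Longrightarrow> rk n \<epsilon> = rk n \<delta>"
proof (induction n)
  case (Suc n)
  have "upper n \<epsilon> = upper n \<delta>" using Suc.prems by (intro upper_cong vertex_cong) simp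
  then show ?case using Suc by simp
qed simp

lemma rk_upd [simp]: "n \<le> m \<Longrightarrow> rk n (\<epsilon>(m := b)) = rk n \<epsilon>"
  by (rule rk_cong) auto

lemma dim_Suc:
  assumes "alive (Suc n) \<epsilon>"
  shows "dim (Suc n) \<epsilon> = (if merge n \<epsilon> then dlo n + dhi n else dim n \<epsilon>)"
proof -
  have "upper n \<epsilon> \<or> lower n \<epsilon>" "upper (Suc n) \<epsilon> \<or> lower (Suc n) \<epsilon>"
    using assms alive_Suc alive_iff by blast+
  then show ?thesis
    using upper_lower_excl[of n \<epsilon>] upper_lower_excl[of "Suc n" \<epsilon>] split_excl[of n] Single_dims[of n]
    unfolding dim_def merge_def
    by (cases "shape n") (auto simp: dlo_Suc dhi_Suc upper_Suc lower_Suc split: if_splits)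
qed

lemma rk_less_dim: "alive n \<epsilon> \<Longrightarrow> rk n \<epsilon> < dim n \<epsilon>"
proof (induction n)
  case 0
  then show ?case by (auto simp: dim_def)
next
  case (Suc n)
  have "rk n \<epsilon> < dim n \<epsilon>" using Suc alive_Suc by blast
  then show ?case
    using dim_Suc[OF Suc.prems] upper_lower_excl[of n \<epsilon>] by (auto simp: merge_def dim_def split: if_splits)
qed

text \<open>The transition rules contain no other pair of distinct edges with a common end.\<close>

lemma merge_twins:
  assumes "alive (Suc n) \<epsilon>" "vertex (Suc n) \<epsilon> = vertex (Suc n) \<delta>" "\<epsilon> n" "\<not> \<delta> n"
  shows "shape n = Near" "lower n \<epsilon>" "upper n \<delta>"
proof -
  have *: "upper (Suc n) \<epsilon> \<and> upper (Suc n) \<delta> \<or> lower (Suc n) \<epsilon> \<and> lower (Suc n) \<delta>"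
    using assms(1) upper_cong[OF assms(2)] lower_cong[OF assms(2)] by (auto simp: alive_iff)
  then have "shape n = Near \<and> lower n \<epsilon> \<and> upper n \<delta>"
    using assms(3,4) upper_lower_excl[of n \<epsilon>] upper_lower_excl[of n \<delta>] by (cases "shape n") (auto simp: upper_Suc lower_Suc split: if_splits)
  then show "shape n = Near" "lower n \<epsilon>" "upper n \<delta>" by auto
qed

lemma merge_vertex:
  assumes "shape n = Near" "lower n \<epsilon>" "\<epsilon> n" "upper n \<delta>" "\<not> \<delta> n"
  shows "vertex (Suc n) \<epsilon> = vertex (Suc n) \<delta>"
  using assms by (simp add: lower_def upper_def gap_def vertex_Suc)

lemma vertex_agree_rev:
  assumes "vertex n \<epsilon> = vertex n \<delta>" "m \<le> n" "\<And>k. m \<le> k \<Longrightarrow> k < n \<Longrightarrow> \<epsilon> k = \<delta> k"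
  shows "vertex m \<epsilon> = vertex m \<delta>"
  using assms(2,3,1) by (induction n rule: dec_induct) (auto simp: vertex_Suc)

text \<open>At the last difference the paths come from the two vertices that meet there: one has
  rank below \<open>dlo m\<close>, the other gets \<open>dlo m\<close> added. Afterwards both ranks
  grow by the same amounts.\<close>

lemma rk_mono:
  assumes "alive n \<epsilon>" "vertex n \<epsilon> = vertex n \<delta>" "m < n" "\<epsilon> m" "\<not> \<delta> m"
    and agree: "\<And>k. m < k \<Longrightarrow> k < n \<Longrightarrow> \<epsilon> k = \<delta> k"
  shows "rk n \<epsilon> < rk n \<delta>"
proof -
  have v: "vertex k \<epsilon> = vertex k \<delta>" if "Suc m \<le> k" "k \<le> n" for k
    by (rule vertex_agree_rev[of n]) (use assms(2) that agree in auto)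
  have a: "alive (Suc m) \<epsilon>" using alive_le[OF assms(1), of "Suc m"] assms(3) by simp
  have sm: "Suc m \<le> n" using assms by simp
  note tw = merge_twins[OF a v[OF order_refl sm] assms(4,5)]
  have "rk m \<epsilon> < dlo m"
    using rk_less_dim[of m \<epsilon>] alive_Suc[OF a] tw upper_lower_excl[of m \<epsilon>] by (auto simp: dim_def split: if_splits)
  then have *: "rk (Suc m) \<epsilon> < rk (Suc m) \<delta>"
    using tw assms(4,5) by simp
  have "k \<le> n \<longrightarrow> rk k \<epsilon> < rk k \<delta>" if "Suc m \<le> k" for k
    using that
  proof (induction k rule: dec_induct)
    case (step k)
    show ?case
    proof
      assume k: "Suc k \<le> n"
      then have "vertex k \<epsilon> = vertex k \<delta>" "\<epsilon> k = \<delta> k" using v[of k] agree[of k] step by auto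
      moreover from this have "upper k \<epsilon> = upper k \<delta>" by (intro upper_cong)
      ultimately show "rk (Suc k) \<epsilon> < rk (Suc k) \<delta>" using k step by simp
    qed
  qed (use * in auto)
  then show ?thesis using sm by blast
qed

lemma rk_inj:
  assumes "alive n \<epsilon>" "vertex n \<epsilon> = vertex n \<delta>" "rk n \<epsilon> = rk n \<delta>" "k < n"
  shows "\<epsilon> k = \<delta> k"
proof (rule ccontr)
  assume ne: "\<epsilon> k \<noteq> \<delta> k"
  obtain m where m: "m < n" "\<epsilon> m \<noteq> \<delta> m" "\<forall>k. m < k \<and> k < n \<longrightarrow> \<epsilon> k = \<delta> k"
    by (rule last_difference[of k n \<epsilon> \<delta>, OF assms(4) ne])
  have "alive n \<delta>" using assms(1) alive_cong[OF assms(2)] by blast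
  then show False
  proof (cases "\<epsilon> m")
    case True
    then have "rk n \<epsilon> < rk n \<delta>" using m by (intro rk_mono[OF assms(1,2)]) auto
    then show False using assms(3) by simp
  next
    case False
    then have "rk n \<delta> < rk n \<epsilon>" using m \<open>alive n \<delta>\<close> assms(2) by (intro rk_mono) auto
    then show False using assms(3) by simp
  qed
qed

text \<open>Induction downwards along the path. At a meeting of two edges a rank below
  \<open>dlo n\<close> is realised through the lower vertex and a larger one through the upper
  vertex; elsewhere the last digit is kept.\<close>

lemma rk_surj:
  assumes "alive n \<epsilon>" "j < dim n \<epsilon>"
  shows "\<exists>\<delta>. vertex n \<delta> = vertex n \<epsilon> \<and> rk n \<delta> = j \<and> (\<forall>k\<ge>n. \<delta> k = \<epsilon> k)"
  using assms
proof (induction n arbitrary: \<epsilon> j)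
  case 0
  then show ?case by (auto simp: dim_def split: if_splits)
next
  case (Suc n)
  have al: "alive n \<epsilon>" using Suc.prems alive_Suc by blast
  \<comment> \<open>The common step: an initial segment of level n with the rank required there, a
    chosen digit \<open>b\<close> at n, and the tail of \<epsilon> after it.\<close>
  have *: "\<exists>\<delta>. vertex (Suc n) \<delta> = vertex (Suc n) \<epsilon> \<and> rk (Suc n) \<delta> = j \<and> (\<forall>k\<ge>Suc n. \<delta> k = \<epsilon> k)"
    if \<theta>: "alive n \<theta>" "i < dim n \<theta>" "vertex (Suc n) (\<theta>(n := b)) = vertex (Suc n) \<epsilon>"
      "j = i + (if shape n = Near \<and> upper n \<theta> \<and> \<not> b then dlo n else 0)" for \<theta> i b
  proof -
    obtain \<delta> where \<delta>: "vertex n \<delta> = vertex n \<theta>" "rk n \<delta> = i" using Suc.IH[OF \<theta>(1,2)] by blast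
    define \<eta> where "\<eta> = (\<lambda>k. if k < n then \<delta> k else if k = n then b else \<epsilon> k)"
    have v: "vertex n \<eta> = vertex n \<theta>" "rk n \<eta> = i"
      using \<delta> vertex_cong[of n \<eta> \<delta>] rk_cong[of n \<eta> \<delta>] by (auto simp: \<eta>_def)
    then have "upper n \<eta> = upper n \<theta>" by (simp add: upper_def)
    then have "rk (Suc n) \<eta> = j" "vertex (Suc n) \<eta> = vertex (Suc n) \<epsilon>" "\<forall>k\<ge>Suc n. \<eta> k = \<epsilon> k"
      using \<theta> v by (auto simp: vertex_Suc \<eta>_def)
    then show ?thesis by blast
  qed
  show ?case
  proof (cases "merge n \<epsilon>")
    case False
    have "j < dim n \<epsilon>" using Suc.prems(2) dim_Suc[OF Suc.prems(1)] False by simp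
    then show ?thesis
      using False by (intro *[of \<epsilon> j "\<epsilon> n", OF al]) (auto simp: merge_def)
  next
    case True
    then have near: "shape n = Near" by (simp add: merge_def)
    obtain \<theta> \<eta> where \<theta>: "lower n \<theta>" "upper n \<eta>" using ex_lower[of n] ex_upper[of n] near by auto
    have v: "vertex (Suc n) (\<theta>(n := True)) = vertex (Suc n) (\<eta>(n := False))"
      using \<theta> near by (intro merge_vertex) auto
    have ve: "vertex (Suc n) (\<theta>(n := True)) = vertex (Suc n) \<epsilon>"
      using True \<theta> v upper_vertex[of n \<eta> \<epsilon>] lower_vertex[of n \<theta> \<epsilon>]
      by (auto simp: merge_def vertex_Suc)
    show ?thesis
    proof (cases "j < dlo n")
      case True
      then show ?thesis
        using \<theta> ve upper_lower_excl[of n \<theta>] by (intro *[of \<theta> j True]) (auto simp: dim_def alive_iff)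
    next
      case False
      moreover have "j < dlo n + dhi n"
        using Suc.prems(2) dim_Suc[OF Suc.prems(1)] \<open>merge n \<epsilon>\<close> by simp
      ultimately show ?thesis
        using \<theta> v ve near by (intro *[of \<eta> "j - dlo n" False]) (auto simp: dim_def alive_iff)
    qed
  qed
qed

end

text \<open>Facts about the order do not mention x. To use ranks for them, x is placed in the middle
  of the interval below the given vertex.\<close>

lemma ex_fibre:
  obtains x where "fibre x" "fibre.alive x n \<epsilon>"
proof
  let ?x = "vertex n \<epsilon> + tp n / 2"
  show *: "fibre ?x"
    using tp_pos[of n] vertex_ge_0[of n \<epsilon>] vertex_diff_bounds(2)[of 0 n \<epsilon>] by unfold_locales auto
  show "fibre.alive ?x n \<epsilon>"
    using tp_pos[of n] by (simp add: fibre.alive_def[OF *])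
qed

subsection \<open>The order and the adic transformation\<close>

text \<open>Explicit form of the generated order: comparison at the last difference, where the digit
  1 comes first.\<close>

definition prec :: "path \<Rightarrow> path \<Rightarrow> bool" where
  "prec \<epsilon> \<delta> \<longleftrightarrow> (\<exists>m. vertex (Suc m) \<epsilon> = vertex (Suc m) \<delta> \<and> \<epsilon> m \<and> \<not> \<delta> m \<and> (\<forall>k>m. \<epsilon> k = \<delta> k))"

lemma tail_equivI:
  assumes "vertex n \<epsilon> = vertex n \<delta>" "\<And>k. n \<le> k \<Longrightarrow> \<epsilon> k = \<delta> k"
  shows "tail_equiv \<epsilon> \<delta>"
proof -
  have "vertex m \<epsilon> = vertex m \<delta>" if "m \<ge> n" for m
    by (rule vertex_agree[of n]) (use assms that in auto)
  then have "(\<lambda>m. vertex m \<delta>) \<longlonglongrightarrow> proj \<epsilon>"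
    by (intro Lim_transform_eventually[OF vertex_sums]) (auto simp: eventually_sequentially)
  then show ?thesis
    using LIMSEQ_unique[OF vertex_sums] assms(2) by (auto simp: tail_equiv_def)
qed

text \<open>From n on the difference of the partial sums is constant, hence equal to the difference
  of the projections, which is 0.\<close>

lemma tail_equiv_vertex:
  assumes "tail_equiv \<epsilon> \<delta>" "\<And>k. n \<le> k \<Longrightarrow> \<epsilon> k = \<delta> k"
  shows "vertex n \<epsilon> = vertex n \<delta>"
proof -
  have "vertex m \<epsilon> - vertex m \<delta> = vertex n \<epsilon> - vertex n \<delta>" if "m \<ge> n" for m
    using that assms(2) by (induction m rule: dec_induct) (auto simp: vertex_Suc)
  then have 1: "(\<lambda>m. vertex m \<epsilon> - vertex m \<delta>) \<longlonglongrightarrow> vertex n \<epsilon> - vertex n \<delta>"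
    by (intro tendsto_eventually eventually_sequentiallyI[of n]) 
  have 2: "(\<lambda>m. vertex m \<epsilon> - vertex m \<delta>) \<longlonglongrightarrow> proj \<epsilon> - proj \<delta>"
    by (rule tendsto_diff[OF vertex_sums vertex_sums])
  show ?thesis
    using LIMSEQ_unique[OF 1 2] assms(1) by (simp add: tail_equiv_def)
qed

lemma prec_tail_equiv: "prec \<epsilon> \<delta> \<Longrightarrow> tail_equiv \<epsilon> \<delta>"
  unfolding prec_def by (elim exE conjE, rule tail_equivI) auto

lemma prec_trans:
  assumes "prec \<epsilon> \<delta>" "prec \<delta> \<eta>"
  shows "prec \<epsilon> \<eta>"
proof -
  obtain m where m: "vertex (Suc m) \<epsilon> = vertex (Suc m) \<delta>" "\<epsilon> m" "\<not> \<delta> m" "\<forall>k>m. \<epsilon> k = \<delta> k"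
    using assms(1) by (auto simp: prec_def)
  obtain n where n: "vertex (Suc n) \<delta> = vertex (Suc n) \<eta>" "\<delta> n" "\<not> \<eta> n" "\<forall>k>n. \<delta> k = \<eta> k"
    using assms(2) by (auto simp: prec_def)
  consider "m < n" | "n < m" using m n by (cases m n rule: linorder_cases) auto
  then show ?thesis
  proof cases
    case 1
    have "vertex (Suc n) \<epsilon> = vertex (Suc n) \<delta>"
      by (rule vertex_agree[of "Suc m"]) (use m 1 in auto)
    then show ?thesis unfolding prec_def using m n 1 by (intro exI[of _ n]) auto
  next
    case 2
    have "vertex (Suc m) \<delta> = vertex (Suc m) \<eta>"
      by (rule vertex_agree[of "Suc n"]) (use n 2 in auto)
    then show ?thesis unfolding prec_def using m n 2 by (intro exI[of _ m]) auto
  qed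
qed

lemma order_gen_prec: "order_gen \<epsilon> \<delta> \<Longrightarrow> prec \<epsilon> \<delta>"
proof -
  assume "order_gen \<epsilon> \<delta>"
  then obtain i where i: "tail_equiv \<epsilon> \<delta>" "\<epsilon> (i + 2)" "\<not> \<delta> (i + 2)" "\<forall>j\<ge>i + 3. \<epsilon> j = \<delta> j"
    by (auto simp: order_gen_def)
  have "vertex (Suc (i + 2)) \<epsilon> = vertex (Suc (i + 2)) \<delta>"
    by (rule tail_equiv_vertex) (use i in auto)
  then show ?thesis unfolding prec_def using i by (intro exI[of _ "i + 2"]) auto
qed

lemma order_genI:
  assumes "vertex i \<epsilon> = vertex i \<delta>" "\<not> \<epsilon> i" "\<epsilon> (Suc i)" "\<epsilon> (Suc (Suc i))"
    "\<delta> i" "\<not> \<delta> (Suc i)" "\<not> \<delta> (Suc (Suc i))" "\<And>k. k > Suc (Suc i) \<Longrightarrow> \<epsilon> k = \<delta> k"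
  shows "order_gen \<epsilon> \<delta>"
proof -
  have "vertex (Suc (Suc (Suc i))) \<epsilon> = vertex (Suc (Suc (Suc i))) \<delta>"
    using assms by (simp add: vertex_Suc)
  then have "tail_equiv \<epsilon> \<delta>" using assms(8) by (intro tail_equivI) auto
  then show ?thesis unfolding order_gen_def using assms by (auto intro!: exI[of _ i])
qed

text \<open>
  Two paths through the same vertex that differ in their last edge end in 011 or 111 and in 100
  or 000, respectively; changing the digit before that reduces to an earlier difference.
\<close>

lemma prec_path_less: "prec \<epsilon> \<delta> \<Longrightarrow> path_less \<epsilon> \<delta>"
proof -
  have "path_less \<epsilon> \<delta>" if "vertex (Suc m) \<epsilon> = vertex (Suc m) \<delta>" "\<epsilon> m" "\<not> \<delta> m" "\<forall>k>m. \<epsilon> k = \<delta> k" for m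
    using that
  proof (induction m arbitrary: \<epsilon> \<delta> rule: less_induct)
    case (less m)
    obtain x where "fibre x" and al: "fibre.alive x (Suc m) \<epsilon>" by (rule ex_fibre)
    interpret fibre x by fact
    note tw = merge_twins[OF al less.prems(1-3)]
    obtain k where k: "m = Suc k" "shape k = Far" using tw(1) by (rule Near_prev)
    then obtain i where i: "k = Suc i" by (metis Far_prev)
    have lo: "\<epsilon> k" "lower k \<epsilon>" and up: "\<not> \<delta> k" "upper k \<delta>"
      using tw k by (auto simp: lower_Suc upper_Suc)
    have direct: ?case if "vertex i \<epsilon> = vertex i \<delta>" "\<not> \<epsilon> i" "\<delta> i"
      unfolding path_less_def using that less.prems lo up k i by (intro tranclp.r_into_trancl order_genI[of i]) auto
    from k(2)[unfolded i] show ?case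
    proof (cases rule: Far_prev)
      case (1 j)
      then show ?thesis
        using direct lo(2) up(2) upper_vertex[of i \<epsilon> \<delta>] by (auto simp: i lower_Suc upper_Suc)
    next
      case (2 j)
      then have near: "shape i = Near" by simp
      show ?thesis
      proof (cases "split_up i")
        case True
        then have d: "upper i \<delta>" "\<delta> i" using up(2) near by (auto simp: i upper_Suc)
        consider "lower i \<epsilon>" "\<epsilon> i" | "upper i \<epsilon>" "\<not> \<epsilon> i"
          using lo(2) near True by (auto simp: i lower_Suc)
        then show ?thesis
        proof cases
          case 1
          \<comment> \<open>An intermediate path: it meets \<epsilon> at level \<open>Suc i\<close>,
            and it differs from \<delta> by one generating replacement.\<close>
          define \<eta> where "\<eta> = (\<lambda>k. if k < i then \<delta> k else if k = i then False else \<epsilon> k)"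
          have v: "vertex i \<eta> = vertex i \<delta>" by (rule vertex_cong) (simp add: \<eta>_def)
          have "vertex (Suc i) \<epsilon> = vertex (Suc i) \<eta>"
            using near 1 d v upper_cong[OF v] by (intro merge_vertex) (auto simp: \<eta>_def)
          then have "path_less \<epsilon> \<eta>"
            using 1 by (intro less.IH[of i]) (auto simp: k i \<eta>_def)
          moreover have "order_gen \<eta> \<delta>"
            using v d lo up less.prems k i by (intro order_genI[of i]) (auto simp: \<eta>_def)
          ultimately show ?thesis by (simp add: path_less_def)
        qed (use direct d upper_vertex[of i \<epsilon> \<delta>] in auto)
      next
        case False
        then have e: "lower i \<epsilon>" "\<not> \<epsilon> i" using lo(2) near by (auto simp: i lower_Suc)
        consider "upper i \<delta>" "\<not> \<delta> i" | "lower i \<delta>" "\<delta> i"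
          using up(2) near False by (auto simp: i upper_Suc)
        then show ?thesis
        proof cases
          case 1
          define \<eta> where "\<eta> = (\<lambda>k. if k < i then \<epsilon> k else if k = i then True else \<delta> k)"
          have v: "vertex i \<eta> = vertex i \<epsilon>" by (rule vertex_cong) (simp add: \<eta>_def)
          have "vertex (Suc i) \<eta> = vertex (Suc i) \<delta>"
            using near 1 e v lower_cong[OF v] by (intro merge_vertex) (auto simp: \<eta>_def)
          then have "path_less \<eta> \<delta>"
            using 1 by (intro less.IH[of i]) (auto simp: k i \<eta>_def)
          moreover have "order_gen \<epsilon> \<eta>"
            using v e lo up less.prems k i by (intro order_genI[of i]) (auto simp: \<eta>_def)
          ultimately show ?thesis by (simp add: path_less_def tranclp_into_tranclp2)
        qed (use direct e lower_vertex[of i \<epsilon> \<delta>] in auto)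
      qed
    qed
  qed
  then show "prec \<epsilon> \<delta> \<Longrightarrow> path_less \<epsilon> \<delta>" by (auto simp: prec_def)
qed

lemma path_less_iff_prec: "path_less \<epsilon> \<delta> \<longleftrightarrow> prec \<epsilon> \<delta>"
proof
  assume "path_less \<epsilon> \<delta>"
  then have "tranclp order_gen \<epsilon> \<delta>" by (simp add: path_less_def)
  then show "prec \<epsilon> \<delta>"
    by induction (auto intro: order_gen_prec prec_trans)
qed (rule prec_path_less)

lemma immediate_succ_tail_equiv: "immediate_succ \<epsilon> \<delta> \<Longrightarrow> tail_equiv \<epsilon> \<delta>"
  by (simp add: immediate_succ_def path_less_iff_prec prec_tail_equiv)

lemma prec_total:
  assumes "tail_equiv \<epsilon> \<delta>" "\<epsilon> \<noteq> \<delta>"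
  shows "prec \<epsilon> \<delta> \<or> prec \<delta> \<epsilon>"
proof -
  obtain N where N: "\<forall>k\<ge>N. \<epsilon> k = \<delta> k" using assms by (auto simp: tail_equiv_def)
  have "\<exists>k. \<epsilon> k \<noteq> \<delta> k" using assms(2) by auto
  then obtain k where ne: "\<epsilon> k \<noteq> \<delta> k" by blast
  then have k: "k < N" using N by (cases "k < N") auto
  obtain m where m: "m < N" "\<epsilon> m \<noteq> \<delta> m" "\<forall>k. m < k \<and> k < N \<longrightarrow> \<epsilon> k = \<delta> k"
    by (rule last_difference[of k N \<epsilon> \<delta>, OF k ne])
  then have *: "\<epsilon> k = \<delta> k" if "m < k" for k using N that by (cases "k < N") auto
  then have "vertex (Suc m) \<epsilon> = vertex (Suc m) \<delta>"
    by (rule tail_equiv_vertex[OF assms(1)]) (use * in auto)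
  then show ?thesis using m(2) * by (cases "\<epsilon> m") (auto simp: prec_def intro!: exI[of _ m])
qed

section \<open>Paths with a common vertex and a common tail; the adic transformation on
  ranks\<close>

definition same :: "nat \<Rightarrow> path \<Rightarrow> path \<Rightarrow> bool" where
  "same n \<epsilon> \<delta> \<longleftrightarrow> vertex n \<epsilon> = vertex n \<delta> \<and> (\<forall>k\<ge>n. \<epsilon> k = \<delta> k)"

lemma same_sym: "same n \<epsilon> \<delta> \<Longrightarrow> same n \<delta> \<epsilon>"
  by (auto simp: same_def)

lemma same_trans: "same n \<epsilon> \<delta> \<Longrightarrow> same n \<delta> \<eta> \<Longrightarrow> same n \<epsilon> \<eta>"
  by (auto simp: same_def)

lemma same_vertex:
  assumes "same n \<epsilon> \<delta>" "n \<le> m"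
  shows "vertex m \<epsilon> = vertex m \<delta>"
  by (rule vertex_agree[of n]) (use assms in \<open>auto simp: same_def\<close>)

lemma same_mono: "same n \<epsilon> \<delta> \<Longrightarrow> n \<le> m \<Longrightarrow> same m \<epsilon> \<delta>"
  using same_vertex[of n \<epsilon> \<delta> m] by (auto simp: same_def)

lemma prec_same: "prec \<epsilon> \<delta> \<Longrightarrow> \<exists>n. same n \<epsilon> \<delta>"
  unfolding prec_def same_def by (elim exE conjE, rule_tac x = "Suc m" in exI) auto

text \<open>If \<epsilon> and \<eta> differed last at some m not below n, where \<epsilon> and
  \<delta> agree, then m would also be the last difference of \<eta> and \<delta>, and the digits
  there have the wrong order.\<close>

lemma prec_same_between:
  assumes "same n \<epsilon> \<delta>" "prec \<epsilon> \<eta>" "prec \<eta> \<delta>"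
  shows "same n \<epsilon> \<eta>"
proof -
  obtain m where m: "vertex (Suc m) \<epsilon> = vertex (Suc m) \<eta>" "\<epsilon> m" "\<not> \<eta> m" "\<forall>k>m. \<epsilon> k = \<eta> k"
    using assms(2) by (auto simp: prec_def)
  obtain l where l: "\<eta> l" "\<not> \<delta> l" "\<forall>k>l. \<eta> k = \<delta> k"
    using assms(3) by (auto simp: prec_def)
  have "m < n"
  proof (rule ccontr)
    assume "\<not> m < n"
    then have "\<delta> k = \<epsilon> k" if "k \<ge> m" for k using assms(1) that by (auto simp: same_def)
    then show False using m l by (cases l m rule: linorder_cases) auto
  qed
  then show ?thesis
    using m same_mono[of "Suc m" \<epsilon> \<eta> n] by (auto simp: same_def)
qed

context fibre
begin

lemma same_alive: "same n \<epsilon> \<delta> \<Longrightarrow> alive n \<epsilon> = alive n \<delta>"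
  and same_upper: "same n \<epsilon> \<delta> \<Longrightarrow> upper n \<epsilon> = upper n \<delta>"
  and same_lower: "same n \<epsilon> \<delta> \<Longrightarrow> lower n \<epsilon> = lower n \<delta>"
  and same_dim: "same n \<epsilon> \<delta> \<Longrightarrow> dim n \<epsilon> = dim n \<delta>"
  by (simp_all add: same_def alive_def upper_def lower_def dim_def)

text \<open>Monotonicity of the rank gives one direction, totality of the order turns it into the
  other.\<close>

lemma prec_iff_rk:
  assumes al: "alive n \<epsilon>" and s: "same n \<epsilon> \<delta>"
  shows "prec \<epsilon> \<delta> \<longleftrightarrow> rk n \<epsilon> < rk n \<delta>"
proof -
  have imp: "rk n \<epsilon> < rk n \<delta>" if al: "alive n \<epsilon>" and s: "same n \<epsilon> \<delta>" and p: "prec \<epsilon> \<delta>" for \<epsilon> \<delta>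
  proof -
    obtain m where m: "\<epsilon> m" "\<not> \<delta> m" "\<forall>k>m. \<epsilon> k = \<delta> k" using p by (auto simp: prec_def)
    then have "m < n" using s by (cases "m < n") (auto simp: same_def)
    then show ?thesis
      using m al s by (intro rk_mono[of n \<epsilon> \<delta> m]) (auto simp: same_def)
  qed
  show ?thesis
  proof
    assume "rk n \<epsilon> < rk n \<delta>"
    then have "\<epsilon> \<noteq> \<delta>" by auto
    moreover have "tail_equiv \<epsilon> \<delta>" using s tail_equivI[of n] by (auto simp: same_def)
    ultimately have "prec \<epsilon> \<delta> \<or> prec \<delta> \<epsilon>" by (intro prec_total)
    moreover have "\<not> prec \<delta> \<epsilon>"
      using imp[of \<delta> \<epsilon>] al same_sym[OF s] same_alive[OF s] \<open>rk n \<epsilon> < rk n \<delta>\<close> by auto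
    ultimately show "prec \<epsilon> \<delta>" by simp
  qed (use imp[OF al s] in simp)
qed

lemma same_rk_eq:
  assumes "alive n \<epsilon>" "same n \<epsilon> \<delta>" "rk n \<epsilon> = rk n \<delta>"
  shows "\<epsilon> = \<delta>"
proof
  fix k
  show "\<epsilon> k = \<delta> k"
    using rk_inj[of n \<epsilon> \<delta> k] assms by (cases "k < n") (auto simp: same_def)
qed

lemma rk_surj_same:
  assumes "alive n \<epsilon>" "j < dim n \<epsilon>"
  obtains \<delta> where "same n \<epsilon> \<delta>" "rk n \<delta> = j"
proof -
  obtain \<delta> where "vertex n \<delta> = vertex n \<epsilon>" "rk n \<delta> = j" "\<forall>k\<ge>n. \<delta> k = \<epsilon> k"
    using rk_surj[OF assms] by blast
  then show thesis using that[of \<delta>] by (simp add: same_def)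
qed

lemma immediate_succ_rk:
  assumes al: "alive n \<epsilon>" and s: "same n \<epsilon> \<delta>" and r: "rk n \<delta> = Suc (rk n \<epsilon>)"
  shows "immediate_succ \<epsilon> \<delta>"
  unfolding immediate_succ_def path_less_iff_prec
proof (intro conjI notI)
  show "prec \<epsilon> \<delta>" using prec_iff_rk[OF al s] r by simp
  assume "\<exists>\<eta>. prec \<epsilon> \<eta> \<and> prec \<eta> \<delta>"
  then obtain \<eta> where \<eta>: "prec \<epsilon> \<eta>" "prec \<eta> \<delta>" by blast
  then have se: "same n \<epsilon> \<eta>" using prec_same_between[OF s] by blast
  then have "same n \<eta> \<delta>" using s same_sym same_trans by blast
  then have "rk n \<epsilon> < rk n \<eta>" "rk n \<eta> < rk n \<delta>"
    using prec_iff_rk[OF al se] prec_iff_rk[of n \<eta> \<delta>] same_alive[OF se] al \<eta> by auto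
  then show False using r by simp
qed

end

lemma immediate_succ_unique:
  assumes "immediate_succ \<epsilon> \<delta>" "immediate_succ \<epsilon> \<delta>'"
  shows "\<delta> = \<delta>'"
proof (rule ccontr)
  assume ne: "\<delta> \<noteq> \<delta>'"
  have "tail_equiv \<epsilon> \<delta>" "tail_equiv \<epsilon> \<delta>'" using assms immediate_succ_tail_equiv by auto
  then obtain N N' where N: "proj \<delta> = proj \<delta>'" "\<forall>k\<ge>N. \<epsilon> k = \<delta> k" "\<forall>k\<ge>N'. \<epsilon> k = \<delta>' k"
    by (auto simp: tail_equiv_def)
  then have "tail_equiv \<delta> \<delta>'" by (auto simp: tail_equiv_def intro!: exI[of _ "max N N'"])
  then show False using prec_total[OF _ ne] assms by (auto simp: immediate_succ_def path_less_iff_prec)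
qed

lemma immediate_succ_inj:
  assumes "immediate_succ \<delta> \<epsilon>" "immediate_succ \<delta>' \<epsilon>"
  shows "\<delta> = \<delta>'"
proof (rule ccontr)
  assume ne: "\<delta> \<noteq> \<delta>'"
  have "tail_equiv \<delta> \<epsilon>" "tail_equiv \<delta>' \<epsilon>" using assms immediate_succ_tail_equiv by auto
  then obtain N N' where N: "proj \<delta> = proj \<delta>'" "\<forall>k\<ge>N. \<delta> k = \<epsilon> k" "\<forall>k\<ge>N'. \<delta>' k = \<epsilon> k"
    by (auto simp: tail_equiv_def)
  then have "tail_equiv \<delta> \<delta>'" by (auto simp: tail_equiv_def intro!: exI[of _ "max N N'"])
  then show False using prec_total[OF _ ne] assms by (auto simp: immediate_succ_def path_less_iff_prec)
qed

lemma adic_eq: "immediate_succ \<epsilon> \<delta> \<Longrightarrow> adic \<epsilon> = \<delta>"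
  unfolding adic_def using immediate_succ_unique by (intro the_equality) auto

lemma adic_domD: "\<epsilon> \<in> adic_dom \<Longrightarrow> immediate_succ \<epsilon> (adic \<epsilon>)"
  using adic_eq by (auto simp: adic_dom_def)

lemma adic_domI: "immediate_succ \<epsilon> \<delta> \<Longrightarrow> \<epsilon> \<in> adic_dom"
  by (auto simp: adic_dom_def)

lemma adic_prec: "\<epsilon> \<in> adic_dom \<Longrightarrow> prec \<epsilon> (adic \<epsilon>)"
  using adic_domD by (auto simp: immediate_succ_def path_less_iff_prec)

lemma adic_proj: "\<epsilon> \<in> adic_dom \<Longrightarrow> proj (adic \<epsilon>) = proj \<epsilon>"
  using immediate_succ_tail_equiv[OF adic_domD] by (simp add: tail_equiv_def)

lemma adic_inj: "inj_on adic adic_dom"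
  using immediate_succ_inj adic_domD by (metis inj_onI)

context fibre
begin

text \<open>Every rank below \<open>dim n \<epsilon>\<close> occurs among the paths with this vertex
  and tail, and nothing of the order lies between consecutive ranks.\<close>

lemma adic_rk:
  assumes "alive n \<epsilon>" "Suc (rk n \<epsilon>) < dim n \<epsilon>"
  shows "\<epsilon> \<in> adic_dom" "same n \<epsilon> (adic \<epsilon>)" "rk n (adic \<epsilon>) = Suc (rk n \<epsilon>)"
proof -
  obtain \<delta> where d: "same n \<epsilon> \<delta>" "rk n \<delta> = Suc (rk n \<epsilon>)" using rk_surj_same[OF assms] by blast
  then have "immediate_succ \<epsilon> \<delta>" using immediate_succ_rk assms(1) by blast
  then show "\<epsilon> \<in> adic_dom" "same n \<epsilon> (adic \<epsilon>)" "rk n (adic \<epsilon>) = Suc (rk n \<epsilon>)"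
    using adic_eq adic_domI d by auto
qed

lemma adic_pred:
  assumes "alive n \<delta>" "rk n \<delta> > 0"
  obtains \<epsilon> where "\<epsilon> \<in> adic_dom" "adic \<epsilon> = \<delta>" "same n \<epsilon> \<delta>" "rk n \<delta> = Suc (rk n \<epsilon>)"
proof -
  have "rk n \<delta> - 1 < dim n \<delta>" using rk_less_dim[OF assms(1)] by simp
  then obtain \<epsilon> where e: "same n \<delta> \<epsilon>" "rk n \<epsilon> = rk n \<delta> - 1" using rk_surj_same[OF assms(1)] by blast
  then have al: "alive n \<epsilon>" and dm: "Suc (rk n \<epsilon>) < dim n \<epsilon>"
    using same_alive[OF e(1)] same_dim[OF e(1)] assms rk_less_dim[OF assms(1)] by auto
  note a = adic_rk[OF al dm]
  have "same n (adic \<epsilon>) \<delta>" using a(2) e(1) same_sym same_trans by blast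
  then have "adic \<epsilon> = \<delta>"
    using a(3) e(2) assms same_alive[OF a(2)] al by (intro same_rk_eq[of n]) auto
  then show thesis using that[of \<epsilon>] a e assms same_sym by auto
qed

text \<open>The successor found at level n also has a larger rank at level m, so the rank at m is
  not the largest one.\<close>

lemma Suc_rk_dim_mono:
  assumes "alive m \<epsilon>" "n \<le> m" "Suc (rk n \<epsilon>) < dim n \<epsilon>"
  shows "Suc (rk m \<epsilon>) < dim m \<epsilon>"
proof -
  have "alive n \<epsilon>" using alive_le assms by blast
  note a = adic_rk[OF this assms(3)]
  have s: "same m \<epsilon> (adic \<epsilon>)" using same_mono[OF a(2) assms(2)] .
  have "rk m \<epsilon> < rk m (adic \<epsilon>)" using prec_iff_rk[OF assms(1) s] adic_prec[OF a(1)] by simp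
  then show ?thesis using rk_less_dim[of m "adic \<epsilon>"] same_alive[OF s] same_dim[OF s] assms(1) by auto
qed

lemma adic_invariant_rk:
  assumes "adic_invariant_set A" "alive n \<epsilon>" "same n \<epsilon> \<delta>" "rk n \<epsilon> \<le> rk n \<delta>"
  shows "\<epsilon> \<in> A \<longleftrightarrow> \<delta> \<in> A"
  using assms(2-)
proof (induction "rk n \<delta> - rk n \<epsilon>" arbitrary: \<epsilon>)
  case 0
  then show ?case using same_rk_eq[of n \<epsilon> \<delta>] by auto
next
  case (Suc j)
  have "Suc (rk n \<epsilon>) < dim n \<epsilon>"
    using Suc.hyps(2) Suc.prems rk_less_dim[of n \<delta>] same_alive[of n \<epsilon> \<delta>] same_dim[of n \<epsilon> \<delta>] by auto
  note a = adic_rk[OF Suc.prems(1) this]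
  have "adic \<epsilon> \<in> A \<longleftrightarrow> \<delta> \<in> A"
    using Suc a same_alive[OF a(2)] by (intro Suc.hyps(1)) (auto intro: same_trans same_sym)
  then show ?case using assms(1) a(1) by (auto simp: adic_invariant_set_def)
qed

end

text \<open>One of the two paths is reached from the other by finitely many applications of the adic
  transformation, running through the ranks in between.\<close>

lemma adic_invariant_same:
  assumes "adic_invariant_set A" "same n \<epsilon> \<delta>"
  shows "\<epsilon> \<in> A \<longleftrightarrow> \<delta> \<in> A"
proof -
  obtain x where "fibre x" and al: "fibre.alive x n \<epsilon>" by (rule ex_fibre)
  interpret fibre x by fact
  show ?thesis
    using adic_invariant_rk[OF assms(1), of n \<epsilon> \<delta>] adic_invariant_rk[OF assms(1), of n \<delta> \<epsilon>]
      al same_alive[OF assms(2)] assms(2) same_sym[OF assms(2)] by (cases "rk n \<epsilon> \<le> rk n \<delta>") auto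
qed

lemma adic_invariant_proj: "adic_invariant_set {\<epsilon>. P (proj \<epsilon>)}"
  by (simp add: adic_invariant_set_def adic_proj)

text \<open>An orbit stays in one fibre of the projection. The fibre is closed and misses at least
  one of the paths 000... and 111..., whose projections differ.\<close>

lemma adic_orbit_not_dense: "closure (adic_orbit \<epsilon>) \<noteq> UNIV"
proof -
  have "proj \<delta> = proj \<epsilon>" if "\<delta> \<in> adic_orbit \<epsilon>" for \<delta>
  proof -
    have "equivclp (\<lambda>\<eta> \<eta>'. \<eta> \<in> adic_dom \<and> \<eta>' = adic \<eta>) \<epsilon> \<delta>" using that by (simp add: adic_orbit_def)
    then show ?thesis by (induction rule: equivclp_induct) (auto simp: adic_proj)
  qed
  then have "closure (adic_orbit \<epsilon>) \<subseteq> {\<delta>. proj \<delta> = proj \<epsilon>}"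
    by (intro closure_minimal closed_proj) auto
  moreover have "proj (\<lambda>_. True) \<noteq> proj (\<lambda>_. False)"
    using proj_0[of "\<lambda>_. False"] proj_1[of "\<lambda>_. True"] by simp
  moreover have "proj (\<lambda>_. True) = proj \<epsilon> \<and> proj (\<lambda>_. False) = proj \<epsilon>"
    if "UNIV \<subseteq> {\<delta>. proj \<delta> = proj \<epsilon>}" using that by blast
  ultimately show ?thesis by auto
qed

subsection \<open>Central measures\<close>

definition exch :: "path measure \<Rightarrow> bool" where
  "exch M \<longleftrightarrow> (\<forall>n \<epsilon> \<delta>. vertex n \<epsilon> = vertex n \<delta> \<longrightarrow>
     measure M (cylinder n \<epsilon>) = measure M (cylinder n \<delta>))"

lemma path_prob_space: "path_prob M \<Longrightarrow> space M = UNIV"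
  using sets_eq_imp_space_eq[of M borel] by (simp add: path_prob_def)

lemma measure_fin_dep:
  assumes "path_prob M" "fin_dep n A"
  shows "measure M A = (\<Sum>p\<in>words n \<inter> A. measure M (cylinder n p))"
proof -
  interpret prob_space M using assms by (simp add: path_prob_def)
  have "measure M (\<Union>p\<in>words n \<inter> A. cylinder n p) = (\<Sum>p\<in>words n \<inter> A. measure M (cylinder n p))"
    using assms disjoint_cylinders[of n] finite_words[of n]
    by (intro finite_measure_finite_Union) (auto simp: path_prob_def disjoint_family_on_def)
  then show ?thesis using fin_dep_words[OF assms(2)] by simp
qed

lemma vertices_determine_path:
  assumes "\<forall>k\<in>{1..n}. vertex k \<epsilon> = vertex k \<delta>" "k < n"
  shows "\<epsilon> k = \<delta> k"
proof -
  have "vertex k \<epsilon> = vertex k \<delta>" using assms by (cases "k = 0") auto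
  moreover have "vertex (Suc k) \<epsilon> = vertex (Suc k) \<delta>" using assms by auto
  ultimately show ?thesis using tp_less[of k] by (auto simp: vertex_Suc split: if_splits)
qed

lemma vertices_cylinder: "{\<delta>. \<forall>k\<in>{1..n}. vertex k \<delta> = vertex k \<epsilon>} = cylinder n \<epsilon>"
proof (intro set_eqI iffI)
  fix \<delta> assume "\<delta> \<in> {\<delta>. \<forall>k\<in>{1..n}. vertex k \<delta> = vertex k \<epsilon>}"
  then show "\<delta> \<in> cylinder n \<epsilon>"
    using vertices_determine_path[of n \<delta> \<epsilon>] by (auto simp: cylinder_def)
qed (use vertex_cylinder in auto)

text \<open>All paths to a given vertex are equally likely, and so are their prolongations by a
  given edge, so the past carries no information on the next vertex.\<close>

lemma exch_markov:
  assumes "path_prob M" "exch M"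
  shows "markov M"
  unfolding markov_def
proof (intro allI impI)
  fix n :: nat and v :: "nat \<Rightarrow> real" assume "1 \<le> n"
  let ?P = "\<lambda>n. {\<epsilon>. \<forall>k\<in>{1..n}. vertex k \<epsilon> = v k}"
  let ?Q = "{\<epsilon>. vertex n \<epsilon> = v n \<and> vertex (n + 1) \<epsilon> = v (n + 1)}"
  have exch: "measure M (cylinder n \<epsilon>) = measure M (cylinder n \<delta>)"
    if "vertex n \<epsilon> = vertex n \<delta>" for n \<epsilon> \<delta>
    using assms(2) that unfolding exch_def by blast
  have v_cyl: "?P n = cylinder n \<epsilon>" if "\<epsilon> \<in> ?P n" for n \<epsilon>
  proof -
    have "?P n = {\<delta>. \<forall>k\<in>{1..n}. vertex k \<delta> = vertex k \<epsilon>}" using that by auto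
    then show ?thesis using vertices_cylinder by simp
  qed
  show "measure M (?P (n + 1)) * measure M {\<epsilon>. vertex n \<epsilon> = v n} = measure M (?P n) * measure M ?Q"
  proof (cases "?P n = {} \<or> ?Q = {}")
    case True
    moreover have "?P (n + 1) \<subseteq> ?P n" "?P (n + 1) \<subseteq> ?Q" using \<open>1 \<le> n\<close> by auto
    ultimately have "?P (n + 1) = {}" by blast
    then have 0: "measure M (?P (n + 1)) = 0" by (simp only: measure_empty)
    from True have "measure M (?P n) = 0 \<or> measure M ?Q = 0"
      by (elim disjE) (simp_all only: measure_empty simp_thms)
    with 0 show ?thesis by (elim disjE) (simp_all only: mult_zero_left mult_zero_right)
  next
    case False
    then obtain \<epsilon> \<delta> where e: "\<epsilon> \<in> ?P n" and d: "\<delta> \<in> ?Q" by blast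
    \<comment> \<open>A path through all prescribed vertices: the initial segment of \<epsilon>
      followed by the edge of \<delta>.\<close>
    define \<eta> where "\<eta> = \<epsilon>(n := \<delta> n)"
    have vn: "vertex n \<epsilon> = v n" "vertex n \<delta> = v n" "vertex (n + 1) \<delta> = v (n + 1)"
      using e d \<open>1 \<le> n\<close> by auto
    then have v1: "vertex (Suc n) \<eta> = v (n + 1)" by (simp add: \<eta>_def vertex_Suc)
    have "vertex k \<eta> = v k" if "k \<in> {1..n+1}" for k
      using e v1 that by (cases "k = Suc n") (auto simp: \<eta>_def)
    then have eta: "\<eta> \<in> ?P (n + 1)" by blast
    let ?W = "words n \<inter> {\<epsilon>. vertex n \<epsilon> = v n}"
    have "measure M {\<epsilon>. vertex n \<epsilon> = v n} = (\<Sum>p\<in>?W. measure M (cylinder n p))"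
      using fin_dep_vertex[of n n "\<lambda>u. u = v n"] assms(1) by (intro measure_fin_dep) auto
    also have "\<dots> = (\<Sum>p\<in>?W. measure M (cylinder n \<epsilon>))"
      using vn by (intro sum.cong exch) auto
    also have "\<dots> = card ?W * measure M (cylinder n \<epsilon>)"
      by (rule sum_constant)
    finally have 1: "measure M {\<epsilon>. vertex n \<epsilon> = v n} = card ?W * measure M (cylinder n \<epsilon>)" .
    have "fin_dep (Suc n) ?Q"
      unfolding fin_dep_def by (auto simp: vertex_cylinder[of _ "Suc n"])
    then have "measure M ?Q = (\<Sum>p\<in>words (Suc n) \<inter> ?Q. measure M (cylinder (Suc n) p))"
      using assms(1) by (intro measure_fin_dep)
    also have "\<dots> = (\<Sum>p\<in>words (Suc n) \<inter> ?Q. measure M (cylinder (Suc n) \<eta>))"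
      using v1 by (intro sum.cong exch) auto
    also have "\<dots> = card (words (Suc n) \<inter> ?Q) * measure M (cylinder (Suc n) \<eta>)"
      by (rule sum_constant)
    \<comment> \<open>The edge between the two prescribed vertices is unique, so appending it is a
      bijection.\<close>
    also have "card (words (Suc n) \<inter> ?Q) = card ?W"
    proof (rule bij_betw_same_card[symmetric])
      have dig: "p n = \<delta> n" if "p \<in> ?Q" for p
        using that vn tp_less[of n] by (auto simp: vertex_Suc split: if_splits)
      show "bij_betw (\<lambda>p. p(n := \<delta> n)) ?W (words (Suc n) \<inter> ?Q)"
      proof (rule bij_betw_byWitness[where f' = "\<lambda>p. p(n := False)"])
        show "\<forall>a\<in>?W. (a(n := \<delta> n))(n := False) = a" by (auto simp: words_def fun_eq_iff)
        show "\<forall>a'\<in>words (Suc n) \<inter> ?Q. (a'(n := False))(n := \<delta> n) = a'"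
        proof
          fix p assume "p \<in> words (Suc n) \<inter> ?Q"
          then show "(p(n := False))(n := \<delta> n) = p" using dig[of p] by (auto simp: fun_eq_iff)
        qed
        show "(\<lambda>p. p(n := \<delta> n)) ` ?W \<subseteq> words (Suc n) \<inter> ?Q"
          using vn by (auto simp: words_def vertex_Suc)
        show "(\<lambda>p. p(n := False)) ` (words (Suc n) \<inter> ?Q) \<subseteq> ?W"
        proof (rule image_subsetI)
          fix p assume p: "p \<in> words (Suc n) \<inter> ?Q"
          have "\<not> (p(n := False)) k" if "n \<le> k" for k
            using p that by (cases "k = n") (auto simp: words_def)
          then show "p(n := False) \<in> ?W" using p by (simp add: words_def)
        qed
      qed
    qed
    finally have 2: "measure M ?Q = card ?W * measure M (cylinder (Suc n) \<eta>)" .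
    show ?thesis
      using 1 2 v_cyl[OF e] v_cyl[OF eta] by simp
  qed
qed

lemma central_iff_exch: "central M \<longleftrightarrow> path_prob M \<and> exch M"
  using exch_markov by (auto simp: central_def exch_def)

definition splice :: "nat \<Rightarrow> path \<Rightarrow> path \<Rightarrow> path" where
  "splice n p \<epsilon> = (\<lambda>k. if k < n then p k else \<epsilon> k)"

lemma splice_measurable [measurable]: "splice n p \<in> borel \<rightarrow>\<^sub>M borel"
proof (intro borel_measurable_continuous_onI continuous_on_coordinatewise_then_product)
  fix i
  show "continuous_on UNIV (\<lambda>\<epsilon>. splice n p \<epsilon> i)"
    by (cases "i < n") (simp_all add: splice_def)
qed

lemma vertex_splice [simp]: "vertex n (splice n p \<epsilon>) = vertex n p"
  by (rule vertex_cong) (simp add: splice_def)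

lemma same_splice: "\<epsilon> \<in> cylinder n p \<Longrightarrow> vertex n p = vertex n q \<Longrightarrow> same n \<epsilon> (splice n q \<epsilon>)"
  using vertex_cylinder[of \<epsilon> n p n] vertex_splice[of n q \<epsilon>] unfolding same_def
  by (auto simp: splice_def)

text \<open>Both sides are finite measures in \<open>B\<close>. On cylinders of level at least n the
  splice replaces an initial segment by one with the same end vertex, which keeps the mass, so the
  two measures agree.\<close>

lemma exch_splice:
  assumes "path_prob M" "exch M" "vertex n p = vertex n q" and B: "B \<in> sets borel"
  shows "emeasure M (cylinder n p \<inter> {\<epsilon>. splice n q \<epsilon> \<in> B}) = emeasure M (cylinder n q \<inter> B)"
proof -
  interpret prob_space M using assms by (simp add: path_prob_def)
  have sM [measurable_cong, simp]: "sets M = sets borel" using assms by (simp add: path_prob_def)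
  have spM [simp]: "space M = UNIV" using path_prob_space assms by blast
  define M1 where "M1 = distr (density M (indicator (cylinder n p))) borel (splice n q)"
  define M2 where "M2 = density M (indicator (cylinder n q))"
  have e1: "emeasure M1 B = emeasure M (cylinder n p \<inter> {\<epsilon>. splice n q \<epsilon> \<in> B})" if [measurable]: "B \<in> sets borel" for B
  proof -
    have m: "splice n q -` B \<in> sets borel"
      using measurable_sets[OF splice_measurable, of B n q] by simp
    have "emeasure M1 B = emeasure (density M (indicator (cylinder n p))) (splice n q -` B)"
      unfolding M1_def by (subst emeasure_distr) auto
    also have "\<dots> = (\<integral>\<^sup>+ \<epsilon>. indicator (cylinder n p) \<epsilon> * indicator (splice n q -` B) \<epsilon> \<partial>M)"
      using m by (subst emeasure_density) auto
    also have "\<dots> = (\<integral>\<^sup>+ \<epsilon>. indicator (cylinder n p \<inter> splice n q -` B) \<epsilon> \<partial>M)"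
      by (intro nn_integral_cong) (auto split: split_indicator)
    finally show ?thesis using m by (simp add: vimage_def)
  qed
  have e2: "emeasure M2 B = emeasure M (cylinder n q \<inter> B)" if [measurable]: "B \<in> sets borel" for B
  proof -
    have "emeasure M2 B = (\<integral>\<^sup>+ \<epsilon>. indicator (cylinder n q) \<epsilon> * indicator B \<epsilon> \<partial>M)"
      unfolding M2_def by (subst emeasure_density) auto
    also have "\<dots> = (\<integral>\<^sup>+ \<epsilon>. indicator (cylinder n q \<inter> B) \<epsilon> \<partial>M)"
      by (intro nn_integral_cong) (auto split: split_indicator)
    finally show ?thesis by simp
  qed
  have "M1 = M2"
  proof (rule measure_eqI_cylinders[where s = n])
    show "sets M1 = sets borel" "sets M2 = sets borel" by (simp_all add: M1_def M2_def)
    then have "space M1 = UNIV" "space M2 = UNIV"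
      using sets_eq_imp_space_eq[of M1 borel] sets_eq_imp_space_eq[of M2 borel] by auto
    then show "finite_measure M1" "finite_measure M2"
      using e1[of UNIV] e2[of UNIV] by (auto intro!: finite_measureI)
    fix m \<eta> assume m: "n \<le> m"
    show "emeasure M1 (cylinder m \<eta>) = emeasure M2 (cylinder m \<eta>)"
    proof (cases "\<eta> \<in> cylinder n q")
      case False
      then have "{\<epsilon>. splice n q \<epsilon> \<in> cylinder m \<eta>} = {}" "cylinder n q \<inter> cylinder m \<eta> = {}"
        using m by (auto simp: cylinder_def splice_def)
      then show ?thesis by (simp add: e1 e2)
    next
      case True
      have "cylinder n q \<inter> cylinder m \<eta> = cylinder m \<eta>"
        using True m by (auto simp: cylinder_def)
      moreover have "cylinder n p \<inter> {\<epsilon>. splice n q \<epsilon> \<in> cylinder m \<eta>} = cylinder m (splice n p \<eta>)"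
        using True m by (auto simp: cylinder_def splice_def)
      moreover have "measure M (cylinder m (splice n p \<eta>)) = measure M (cylinder m \<eta>)"
      proof -
        have "same n \<eta> (splice n p \<eta>)" using True assms(3) by (intro same_splice) auto
        then have "vertex m (splice n p \<eta>) = vertex m \<eta>" using same_vertex m by metis
        with assms(2) show ?thesis unfolding exch_def by blast
      qed
      ultimately show ?thesis by (simp add: e1 e2 emeasure_eq_measure)
    qed
  qed
  then show ?thesis using e1[OF B] e2[OF B] by simp
qed

text \<open>Splicing initial segments with a common end preserves an invariant set \<open>A\<close>,
  so M conditioned on \<open>A\<close> is again a central measure over x. By uniqueness it is M
  itself, and \<open>A\<close> has measure 1.\<close>

lemma unique_central_ergodic:
  assumes "central M" "lives_over M x"
    and uniq: "\<And>N. central N \<Longrightarrow> lives_over N x \<Longrightarrow> N = M"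
  shows "adic_ergodic M"
  unfolding adic_ergodic_def
proof (intro ballI impI)
  fix A :: "path set" assume A: "A \<in> sets borel" "adic_invariant_set A"
  have M: "path_prob M" "exch M" using assms(1) by (auto simp: central_iff_exch)
  interpret prob_space M using M by (simp add: path_prob_def)
  have sM [simp]: "sets M = sets borel" using M by (simp add: path_prob_def)
  show "measure M A = 0 \<or> measure M A = 1"
  proof (cases "measure M A = 0")
    case False
    then have pos: "emeasure M A \<noteq> 0" "emeasure M A \<noteq> \<infinity>" by (auto simp: emeasure_eq_measure)
    define N where "N = uniform_measure M A"
    have meas: "measure N B = measure M (A \<inter> B) / measure M A" if "B \<in> sets borel" for B
      using A that pos unfolding N_def by (intro measure_uniform_measure) auto
    have "path_prob N"
      unfolding path_prob_def N_def using pos by (simp add: prob_space_uniform_measure)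
    moreover have "exch N"
      unfolding exch_def
    proof (intro allI impI)
      fix n p q assume v: "vertex n p = vertex n q"
      have "cylinder n p \<inter> {\<epsilon>. splice n q \<epsilon> \<in> A} = cylinder n p \<inter> A"
        using adic_invariant_same[OF A(2) same_splice[OF _ v]] by auto
      then have "emeasure M (cylinder n p \<inter> A) = emeasure M (cylinder n q \<inter> A)"
        using exch_splice[OF M v A(1)] by simp
      then show "measure N (cylinder n p) = measure N (cylinder n q)"
        using meas by (simp add: measure_def Int_commute)
    qed
    moreover have "lives_over N x"
      using assms(2) A pos unfolding lives_over_def N_def
      by (intro AE_uniform_measureI) auto
    ultimately have "N = M" by (intro uniq) (auto simp: central_iff_exch)
    then have "measure M A = measure M A / measure M A" using meas[OF A(1)] by simp
    then show ?thesis using False by simp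
  qed simp
qed

text \<open>The sublevel sets of the projection are invariant, so its distribution function takes
  the values 0 and 1 only. It jumps at the infimum of the set \<open>T\<close> where it is
  1.\<close>

lemma ergodic_lives_over:
  assumes "ergodic_central M"
  shows "\<exists>x\<in>{0..1}. lives_over M x"
proof -
  have M: "path_prob M" "adic_ergodic M" using assms by (auto simp: ergodic_central_def central_def)
  interpret prob_space M using M by (simp add: path_prob_def)
  have sM [simp, measurable_cong]: "sets M = sets borel" using M by (simp add: path_prob_def)
  have spM [simp]: "space M = UNIV" using path_prob_space M by blast
  have S: "{\<epsilon>. proj \<epsilon> \<le> t} \<in> sets borel" for t
    using borel_measurable_le[OF proj_measurable borel_measurable_const[of t]] by simp
  have dich: "measure M {\<epsilon>. proj \<epsilon> \<le> t} = 0 \<or> measure M {\<epsilon>. proj \<epsilon> \<le> t} = 1" for t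
    using M(2) adic_invariant_proj[of "\<lambda>y. y \<le> t"] S[of t] by (auto simp: adic_ergodic_def)
  define T where "T = {t. measure M {\<epsilon>. proj \<epsilon> \<le> t} = 1}"
  have "{\<epsilon>. proj \<epsilon> \<le> 1} = UNIV" using proj_bounds by auto
  then have T1: "1 \<in> T" using prob_space by (simp add: T_def)
  have T0: "t \<ge> 0" if "t \<in> T" for t
  proof (rule ccontr)
    assume "\<not> t \<ge> 0"
    moreover have "0 \<le> proj \<epsilon>" for \<epsilon> using proj_bounds[of \<epsilon>] by simp
    ultimately have "{\<epsilon>. proj \<epsilon> \<le> t} = {}" by (metis (mono_tags) empty_Collect_eq order_trans)
    then show False using that by (simp add: T_def)
  qed
  have bdd: "bdd_below T" using T0 by (auto simp: bdd_below_def)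
  define x where "x = Inf T"
  have x: "x \<in> {0..1}" using T1 T0 bdd unfolding x_def by (auto intro!: cInf_greatest cInf_lower)
  have up: "AE \<epsilon> in M. proj \<epsilon> \<le> x + 1 / real (Suc n)" for n
  proof -
    obtain t where t: "t \<in> T" "t < x + 1 / real (Suc n)"
      using cInf_less_iff[of T "x + 1 / real (Suc n)"] T1 bdd unfolding x_def by auto
    then have "AE \<epsilon> in M. \<epsilon> \<in> {\<epsilon>. proj \<epsilon> \<le> t}" using S by (intro AE_prob_1) (auto simp: T_def)
    then show ?thesis using t by (auto elim!: eventually_mono)
  qed
  have low: "AE \<epsilon> in M. x - 1 / real (Suc n) < proj \<epsilon>" for n
  proof -
    let ?t = "x - 1 / real (Suc n)"
    have "?t \<notin> T" using cInf_lower[OF _ bdd, of ?t] unfolding x_def by auto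
    then have "measure M {\<epsilon>. proj \<epsilon> \<le> ?t} = 0" using dich[of ?t] by (simp add: T_def)
    then have "{\<epsilon>. proj \<epsilon> \<le> ?t} \<in> null_sets M" using S[of ?t] by (auto simp: null_sets_def emeasure_eq_measure)
    then show ?thesis by (rule AE_I') auto
  qed
  have "AE \<epsilon> in M. \<forall>n. proj \<epsilon> \<le> x + 1 / real (Suc n) \<and> x - 1 / real (Suc n) < proj \<epsilon>"
    using up low by (auto simp: AE_all_countable)
  then have "AE \<epsilon> in M. proj \<epsilon> = x"
  proof (rule eventually_mono)
    fix \<epsilon> assume *: "\<forall>n. proj \<epsilon> \<le> x + 1 / real (Suc n) \<and> x - 1 / real (Suc n) < proj \<epsilon>"
    have l: "(\<lambda>n. 1 / real (Suc n)) \<longlonglongrightarrow> 0"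
      using LIMSEQ_inverse_real_of_nat by (simp add: divide_inverse)
    have "proj \<epsilon> \<le> x + 0"
      by (rule LIMSEQ_le_const[OF tendsto_add[OF tendsto_const l]]) (use * in auto)
    moreover have "x - 0 \<le> proj \<epsilon>"
      by (rule LIMSEQ_le_const2[OF tendsto_diff[OF tendsto_const l]]) (use * less_imp_le in blast)
    ultimately show "proj \<epsilon> = x" by simp
  qed
  then show ?thesis using x by (auto simp: lives_over_def)
qed

subsection \<open>Weights of the vertices\<close>

context fibre
begin

text \<open>\<open>z n\<close> holds the mass of one path to the upper and of one path to the lower
  vertex, in this order (opposite to \<open>dims\<close>). The equations split it among the alive
  prolongations.\<close>

definition wrec :: "(nat \<Rightarrow> real \<times> real) \<Rightarrow> nat \<Rightarrow> bool" where
  "wrec z n \<longleftrightarrow>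
     fst (z n) = fst (z (Suc n)) + (if shape n = Single \<or> shape n = Near \<and> split_up n then snd (z (Suc n)) else 0) \<and>
     snd (z n) = (case shape n of Single \<Rightarrow> 0 | Far \<Rightarrow> snd (z (Suc n))
       | Near \<Rightarrow> snd (z (Suc n)) + (if split_up n then 0 else fst (z (Suc n))))"

lemma wrec_cong: "z n = z' n \<Longrightarrow> z (Suc n) = z' (Suc n) \<Longrightarrow> wrec z n = wrec z' n"
  by (simp only: wrec_def)

definition wsys :: "(nat \<Rightarrow> real \<times> real) \<Rightarrow> bool" where
  "wsys z \<longleftrightarrow> fst (z 0) = 1 \<and> (\<forall>n. 0 \<le> fst (z n) \<and> 0 \<le> snd (z n) \<and> wrec z n)"

text \<open>Total mass of all paths to the vertices of level n.\<close>

definition wnorm :: "nat \<Rightarrow> real \<times> real \<Rightarrow> real" where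
  "wnorm n p = real (dlo n) * snd p + real (dhi n) * fst p"

text \<open>The recursion for masses is dual to the one for numbers of paths, so their pairing is
  constant. At a single vertex the lower mass has to be 0, since \<open>dlo\<close> repeats
  \<open>dhi\<close> there.\<close>

lemma wnorm_step:
  assumes "wrec z n" "shape (Suc n) = Single \<longrightarrow> snd (z (Suc n)) = 0"
  shows "wnorm n (z n) = wnorm (Suc n) (z (Suc n))"
  using assms Single_dims[of n] split_excl[of n]
  by (cases "shape n"; cases "split_up n"; cases "split_low n")
    (simp_all add: wnorm_def wrec_def dlo_Suc dhi_Suc algebra_simps)

lemma wrec_Single: "wrec z n \<Longrightarrow> shape n = Single \<Longrightarrow> snd (z n) = 0"
  by (simp add: wrec_def)

lemma wsys_norm:
  assumes "wsys z"
  shows "wnorm n (z n) = 1"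
proof (induction n)
  case 0
  then show ?case using assms wrec_Single[of z 0] by (simp add: wsys_def wnorm_def)
next
  case (Suc n)
  then show ?case using assms wnorm_step[of z n] wrec_Single[of z "Suc n"] by (simp add: wsys_def)
qed

lemma wnorm_bounds:
  assumes "wnorm n p = 1" "0 \<le> fst p" "0 \<le> snd p"
  shows "fst p \<le> 1 / dhi n" "snd p \<le> 1 / dlo n"
proof -
  have "0 \<le> real (dhi n) * fst p" "0 \<le> real (dlo n) * snd p" using assms by simp_all
  then have "real (dhi n) * fst p \<le> 1" "real (dlo n) * snd p \<le> 1"
    using assms(1) unfolding wnorm_def by linarith+
  then show "fst p \<le> 1 / dhi n" "snd p \<le> 1 / dlo n"
    using dims_pos[of n] by (simp_all add: field_simps)
qed

lemma wsys_le:
  assumes "wsys z"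
  shows "fst (z n) \<le> 1 / dhi n" "snd (z n) \<le> 1 / dlo n"
  using assms by (auto intro!: wnorm_bounds wsys_norm simp: wsys_def)

lemma wsys_eq_below:
  assumes "wsys z" "wsys z'" "z m = z' m" "n \<le> m"
  shows "z n = z' n"
  using assms(4)
proof (induction n rule: inc_induct)
  case (step n)
  have "wrec z n" "wrec z' n" using assms by (auto simp: wsys_def)
  then show ?case using step by (cases "shape n") (auto simp: wrec_def prod_eq_iff)
qed (use assms in simp)

lemma wsys_Single:
  assumes "wsys z" "shape n = Single"
  shows "snd (z n) = 0" "fst (z n) = 1 / dhi n"
proof -
  show 0: "snd (z n) = 0" using assms wrec_Single by (auto simp: wsys_def)
  then show "fst (z n) = 1 / dhi n"
    using wsys_norm[OF assms(1), of n] dims_pos[of n] by (simp add: wnorm_def field_simps)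
qed

lemma dims_mono: "m \<le> n \<Longrightarrow> dlo m \<le> dlo n" "m \<le> n \<Longrightarrow> dhi m \<le> dhi n"
  by (auto intro: lift_Suc_mono_le simp: dlo_Suc dhi_Suc)

text \<open>Without single vertices every second level is \<open>Near\<close>, and each such level
  adds one count to the other.\<close>

lemma dims_unbounded_sum:
  assumes "\<And>m. m \<ge> n \<Longrightarrow> shape m \<noteq> Single"
  shows "\<exists>m\<ge>n. k \<le> dlo m + dhi m"
proof (induction k)
  case (Suc k)
  then obtain m where m: "m \<ge> n" "k \<le> dlo m + dhi m" by blast
  obtain j where j: "j \<ge> m" "shape j = Near"
  proof (cases "shape m")
    case Far
    then show ?thesis using that[of "Suc m"] by simp
  qed (use assms m that in auto)
  have "k \<le> dlo j + dhi j" using m(2) dims_mono[OF j(1)] by linarith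
  then have "Suc k \<le> dlo (Suc j) + dhi (Suc j)"
    using j(2) split_excl[of j] dims_pos[of j] by (auto simp: dlo_Suc dhi_Suc)
  then show ?case using j m by (intro exI[of _ "Suc j"]) auto
qed auto

text \<open>
  Two solutions differ by \<open>(dhi n * t, - dlo n * t)\<close> with the same \<open>t\<close> at all levels (the
  recursion has determinant 1), and \<open>t\<close> is at most \<open>1 / (dlo n * dhi n)\<close>.
\<close>

lemma wsys_unique:
  assumes z: "wsys z" and z': "wsys z'"
  shows "z = z'"
proof
  fix n
  show "z n = z' n"
  proof (cases "\<exists>m\<ge>n. shape m = Single")
    case True
    then obtain m where m: "m \<ge> n" "shape m = Single" by blast
    then have "z m = z' m" using wsys_Single[OF z] wsys_Single[OF z'] by (simp add: prod_eq_iff)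
    then show ?thesis using wsys_eq_below[OF z z'] m by blast
  next
    case False
    define e where "e m = snd (z m) - snd (z' m)" for m
    define d where "d m = fst (z m) - fst (z' m)" for m
    define t where "t = e n / dhi n"
    have nrm: "real (dlo m) * e m + real (dhi m) * d m = 0" for m
      using wsys_norm[OF z, of m] wsys_norm[OF z', of m] by (simp add: wnorm_def e_def d_def algebra_simps)
    have e: "e m = dhi m * t" if "m \<ge> n" for m
      using that
    proof (induction m rule: dec_induct)
      case base
      then show ?case using dims_pos[of n] by (simp add: t_def)
    next
      case (step m)
      have w: "wrec z m" "wrec z' m" using z z' by (auto simp: wsys_def)
      have ns: "shape m \<noteq> Single" "shape (Suc m) \<noteq> Single" using False step.hyps by (auto simp del: shape.simps)
      show ?case
      proof (cases "shape m = Near \<and> \<not> split_up m")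
        case True
        then have "e m = e (Suc m) + d m" using w by (simp add: wrec_def e_def d_def)
        moreover have "dhi (Suc m) = dhi m + dlo m" using True by (simp add: dhi_Suc)
        moreover have "d m = - (dlo m * t)"
        proof -
          have "dhi m * (dlo m * t + d m) = 0" using nrm[of m] step.IH by (simp add: algebra_simps)
          then show ?thesis using dims_pos[of m] by simp
        qed
        ultimately show ?thesis using step.IH by (simp add: algebra_simps)
      next
        case False
        then have "e (Suc m) = e m" using w ns by (cases "shape m") (auto simp: wrec_def e_def)
        moreover have "dhi (Suc m) = dhi m" using False by (auto simp: dhi_Suc)
        ultimately show ?thesis using step.IH by simp
      qed
    qed
    have "t = 0"
    proof (rule ccontr)
      assume "t \<noteq> 0"
      then obtain k :: nat where k: "1 / \<bar>t\<bar> < k" using reals_Archimedean2 by blast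
      obtain m where m: "m \<ge> n" "Suc k \<le> dlo m + dhi m"
        using dims_unbounded_sum[of n "Suc k"] False by blast
      have "\<bar>e m\<bar> \<le> 1 / dlo m"
        using wsys_le(2)[OF z, of m] wsys_le(2)[OF z', of m] z z'
        unfolding e_def wsys_def by (smt (verit))
      then have "dlo m * (dhi m * \<bar>t\<bar>) \<le> 1"
        using e[OF m(1)] dims_pos[of m] by (simp add: abs_mult field_simps)
      \<comment> \<open>(a + 1)(b + 1) is at least a + b + 1.\<close>
      moreover have "k \<le> dlo m * dhi m"
      proof -
        obtain a b where "dlo m = Suc a" "dhi m = Suc b" using dims_pos[of m] by (metis gr0_implies_Suc)
        then show ?thesis using m(2) by simp
      qed
      then have "k * \<bar>t\<bar> \<le> (dlo m * dhi m) * \<bar>t\<bar>" by (intro mult_right_mono) (simp_all flip: of_nat_mult)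
      ultimately have "k * \<bar>t\<bar> \<le> 1" by (simp add: mult.assoc)
      then show False using k \<open>t \<noteq> 0\<close> by (simp add: field_simps)
    qed
    then have "e n = 0" "d n = 0" using e[of n] nrm[of n] dims_pos[of n] by auto
    then show ?thesis by (simp add: e_def d_def prod_eq_iff)
  qed
qed

text \<open>Each level is computed from the next one with nonnegative coefficients, so an admissible
  pair at the top level \<open>N\<close> determines the levels below.\<close>

lemma wrec_extend_back:
  assumes "0 \<le> fst p" "0 \<le> snd p" "wnorm N p = 1" "shape N = Single \<longrightarrow> snd p = 0"
  shows "\<exists>z. z N = p \<and> (\<forall>n\<le>N. 0 \<le> fst (z n) \<and> 0 \<le> snd (z n) \<and> wnorm n (z n) = 1) \<and> (\<forall>n<N. wrec z n)"
  using assms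
proof (induction N arbitrary: p)
  case 0
  then show ?case by (intro exI[of _ "\<lambda>_. p"]) auto
next
  case (Suc N)
  define q where "q = (fst p + (if shape N = Single \<or> shape N = Near \<and> split_up N then snd p else 0),
     case shape N of Single \<Rightarrow> 0 | Far \<Rightarrow> snd p | Near \<Rightarrow> snd p + (if split_up N then 0 else fst p))"
  define y where "y n = (if n = N then q else p)" for n
  have y: "y N = q" "y (Suc N) = p" by (simp_all add: y_def)
  have yr: "wrec y N" unfolding wrec_def y by (cases "shape N") (simp_all add: q_def)
  have "wnorm N q = 1" using wnorm_step[of y N] yr y Suc.prems by simp
  moreover have "0 \<le> fst q" "0 \<le> snd q" using Suc.prems by (auto simp: q_def split: shape.splits)
  moreover have "shape N = Single \<longrightarrow> snd q = 0" by (simp add: q_def)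
  ultimately obtain z where z: "z N = q" "\<forall>n\<le>N. 0 \<le> fst (z n) \<and> 0 \<le> snd (z n) \<and> wnorm n (z n) = 1"
    "\<forall>n<N. wrec z n"
    using Suc.IH[of q] by blast
  let ?z = "z(Suc N := p)"
  have "wrec ?z n" if "n < Suc N" for n
  proof (cases "n = N")
    case True
    then show ?thesis using z(1) y yr by (cases "shape N") (simp_all add: wrec_def)
  next
    case False
    then have "wrec z n" using z(3) that by simp
    then show ?thesis using False that wrec_cong[of z n ?z] by simp
  qed
  moreover have "0 \<le> fst (?z n) \<and> 0 \<le> snd (?z n) \<and> wnorm n (?z n) = 1" if "n \<le> Suc N" for n
    using z(2) Suc.prems that by (cases "n = Suc N") auto
  moreover have "?z (Suc N) = p" by simp
  ultimately show ?case by blast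
qed

text \<open>Compactness. Finitely many of the equations can be solved backwards from a high level
  with values in the unit square, and each equation defines a closed set.\<close>

lemma wsys_ex: "\<exists>z. wsys z"
proof -
  define K :: "(nat \<Rightarrow> real \<times> real) set" where "K = Pi\<^sub>E UNIV (\<lambda>_. {0..1} \<times> {0..1})"
  define F where "F n = {z. fst (z 0) = 1 \<and> wrec z n}" for n
  have "compactin (product_topology (\<lambda>_. euclidean) UNIV) K"
    unfolding K_def by (subst compactin_PiE) (auto intro!: compact_Times)
  then have comp: "compact K" by (simp add: euclidean_product_topology)
  have clos: "closed (F n)" for n
  proof -
    have c: "continuous_on UNIV (\<lambda>z :: nat \<Rightarrow> real \<times> real. fst (z n))"
      "continuous_on UNIV (\<lambda>z :: nat \<Rightarrow> real \<times> real. snd (z n))" for n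
      by (intro continuous_on_fst continuous_on_snd continuous_on_product_coordinates)+
    show ?thesis
      unfolding F_def wrec_def
      by (cases "shape n"; cases "split_up n"; simp; intro closed_Collect_conj closed_Collect_eq;
          intro c continuous_on_const continuous_on_add)
  qed
  have ne: "K \<inter> \<Inter> (F ` I) \<noteq> {}" if fin: "finite I" for I
  proof -
    obtain N where N: "\<And>n. n \<in> I \<Longrightarrow> n < N" using finite_nat_bounded[OF fin] by auto
    \<comment> \<open>At the top level all mass is put on the upper vertex.\<close>
    have "\<exists>z. z N = (1 / dhi N, 0) \<and> (\<forall>n\<le>N. 0 \<le> fst (z n) \<and> 0 \<le> snd (z n) \<and> wnorm n (z n) = 1) \<and> (\<forall>n<N. wrec z n)"
      using dims_pos[of N] by (intro wrec_extend_back) (auto simp: wnorm_def)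
    then obtain z where z: "\<forall>n\<le>N. 0 \<le> fst (z n) \<and> 0 \<le> snd (z n) \<and> wnorm n (z n) = 1" "\<forall>n<N. wrec z n"
      "z N = (1 / dhi N, 0)" by blast
    define y where "y n = (if n \<le> N then z n else (0, 0))" for n
    have y: "0 \<le> fst (y n) \<and> fst (y n) \<le> 1 \<and> 0 \<le> snd (y n) \<and> snd (y n) \<le> 1" for n
    proof (cases "n \<le> N")
      case True
      then have "fst (z n) \<le> 1 / dhi n" "snd (z n) \<le> 1 / dlo n" using wnorm_bounds[of n "z n"] z by auto
      moreover have "1 / real (dhi n) \<le> 1" "1 / real (dlo n) \<le> 1" using dims_pos[of n] by simp_all
      ultimately have "fst (z n) \<le> 1" "snd (z n) \<le> 1" by linarith+
      then show ?thesis using z True by (simp add: y_def)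
    qed (simp add: y_def)
    have "y \<in> K" unfolding K_def PiE_iff using y by (auto simp: mem_Times_iff)
    moreover have "y \<in> F n" if "n \<in> I" for n
    proof -
      have "snd (z 0) = 0"
        using z wrec_Single[of z 0] N[OF that] by auto
      then have "fst (z 0) = 1" using z(1)[rule_format, of 0] by (simp add: wnorm_def)
      moreover have "wrec y n" using z(2) N[OF that] wrec_cong[of z n y] by (simp add: y_def)
      ultimately show ?thesis by (simp add: F_def y_def)
    qed
    ultimately show ?thesis by blast
  qed
  have "K \<inter> \<Inter> (range F) \<noteq> {}"
  proof (rule compact_imp_fip[OF comp])
    fix G assume "finite G" "G \<subseteq> range F"
    then obtain I where "finite I" "G = F ` I" using finite_subset_image by metis
    then show "K \<inter> \<Inter> G \<noteq> {}" using ne by simp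
  qed (use clos in auto)
  then obtain z where z: "z \<in> K" "\<And>n. z \<in> F n" by blast
  then have "wsys z"
    unfolding wsys_def by (auto simp: F_def K_def PiE_iff mem_Times_iff)
  then show ?thesis by blast
qed

section \<open>The masses of cylinders\<close>

definition wt :: "nat \<Rightarrow> real \<times> real" where
  "wt = (THE z. wsys z)"

lemma wsys_wt: "wsys wt"
  unfolding wt_def using wsys_ex wsys_unique by (metis theI')

text \<open>The measure that a cylinder of level n is to receive; cylinders that are not alive
  receive 0.\<close>

definition mass :: "(nat \<Rightarrow> real \<times> real) \<Rightarrow> nat \<Rightarrow> path \<Rightarrow> real" where
  "mass z n \<epsilon> = (if upper n \<epsilon> then fst (z n) else if lower n \<epsilon> then snd (z n) else 0)"

lemma mass_cong: "vertex n \<epsilon> = vertex n \<delta> \<Longrightarrow> mass z n \<epsilon> = mass z n \<delta>"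
  by (simp add: mass_def upper_def lower_def)

lemma mass_upper: "upper n \<epsilon> \<Longrightarrow> mass z n \<epsilon> = fst (z n)"
  and mass_lower: "lower n \<epsilon> \<Longrightarrow> mass z n \<epsilon> = snd (z n)"
  using upper_lower_excl[of n \<epsilon>] by (auto simp: mass_def)

lemma mass_not_alive: "\<not> alive n \<epsilon> \<Longrightarrow> mass z n \<epsilon> = 0"
  by (simp add: mass_def alive_iff)

lemma mass_children_upper:
  assumes "upper n \<epsilon>" "\<forall>m. shape m = Single \<longrightarrow> snd (z m) = 0"
  shows "mass z (Suc n) (\<epsilon>(n := True)) + mass z (Suc n) (\<epsilon>(n := False)) =
    fst (z (Suc n)) + (if shape n = Single \<or> shape n = Near \<and> split_up n then snd (z (Suc n)) else 0)"
proof -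
  have "snd (z (Suc n)) = 0" if "shape (Suc n) = Single" using assms that by blast
  then show ?thesis
    using assms upper_lower_excl[of n \<epsilon>]
    by (cases "shape n") (auto simp: mass_def upper_Suc lower_Suc split: if_splits)
qed

lemma mass_children_lower:
  assumes "lower n \<epsilon>" "\<forall>m. shape m = Single \<longrightarrow> snd (z m) = 0"
  shows "mass z (Suc n) (\<epsilon>(n := True)) + mass z (Suc n) (\<epsilon>(n := False)) =
    (case shape n of Single \<Rightarrow> 0 | Far \<Rightarrow> snd (z (Suc n))
       | Near \<Rightarrow> snd (z (Suc n)) + (if split_up n then 0 else fst (z (Suc n))))"
proof -
  have "snd (z (Suc n)) = 0" if "shape (Suc n) = Single" using assms that by blast
  then show ?thesis
    using assms upper_lower_excl[of n \<epsilon>]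
    by (cases "shape n") (auto simp: mass_def upper_Suc lower_Suc lower_def[of n \<epsilon>] split: if_splits)
qed

lemma mass_add:
  assumes "wsys z"
  shows "mass z n \<epsilon> = mass z (Suc n) (\<epsilon>(n := True)) + mass z (Suc n) (\<epsilon>(n := False))"
proof -
  have w: "wrec z n" "\<forall>m. shape m = Single \<longrightarrow> snd (z m) = 0"
    using assms wrec_Single by (auto simp: wsys_def)
  consider "upper n \<epsilon>" | "lower n \<epsilon>" | "\<not> alive n \<epsilon>" using alive_iff by blast
  then show ?thesis
  proof cases
    case 1
    show ?thesis unfolding mass_children_upper[of n \<epsilon> z, OF 1 w(2)] mass_upper[OF 1] using w(1) by (simp add: wrec_def)
  next
    case 2
    show ?thesis unfolding mass_children_lower[of n \<epsilon> z, OF 2 w(2)] mass_lower[OF 2] using w(1) by (simp add: wrec_def)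
  next
    case 3
    have "\<not> alive (Suc n) (\<epsilon>(n := b))" for b
    proof
      assume "alive (Suc n) (\<epsilon>(n := b))"
      then have "alive n (\<epsilon>(n := b))" by (rule alive_Suc)
      then show False using 3 by (simp add: alive_def)
    qed
    then show ?thesis using 3 by (simp add: mass_not_alive)
  qed
qed

end

subsection \<open>A central measure charges only paths that are not eventually constant\<close>

lemma singleton_borel [simp, measurable]: "{\<epsilon>} \<in> sets (borel :: path measure)"
proof -
  have "{\<epsilon>} = (\<Inter>n. cylinder n \<epsilon>)"
    by (auto simp: cylinder_def fun_eq_iff)
  moreover have "(\<Inter>n. cylinder n \<epsilon>) \<in> sets borel" by measurable
  ultimately show ?thesis by simp
qed

lemma exch_singleton:
  assumes "path_prob M" "exch M" "same n \<epsilon> \<delta>"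
  shows "measure M {\<epsilon>} = measure M {\<delta>}"
proof -
  have "cylinder n \<epsilon> \<inter> {\<eta>. splice n \<delta> \<eta> \<in> {\<delta>}} = {\<epsilon>}"
  proof (intro set_eqI iffI)
    fix \<eta> assume *: "\<eta> \<in> cylinder n \<epsilon> \<inter> {\<eta>. splice n \<delta> \<eta> \<in> {\<delta>}}"
    have "\<eta> k = \<epsilon> k" for k
    proof (cases "k < n")
      case False
      have "\<eta> k = splice n \<delta> \<eta> k" using False by (simp add: splice_def)
      also have "\<dots> = \<epsilon> k" using * assms(3) False by (simp add: same_def)
      finally show ?thesis .
    qed (use * in \<open>simp add: cylinder_def\<close>)
    then show "\<eta> \<in> {\<epsilon>}" by auto
  qed (use assms(3) in \<open>auto simp: same_def splice_def cylinder_def fun_eq_iff\<close>)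
  moreover have "cylinder n \<delta> \<inter> {\<delta>} = {\<delta>}" by auto
  moreover have "vertex n \<epsilon> = vertex n \<delta>" using assms(3) by (simp add: same_def)
  ultimately have "emeasure M {\<epsilon>} = emeasure M {\<delta>}"
    using exch_splice[OF assms(1,2), of n \<epsilon> \<delta> "{\<delta>}"] by simp
  then show ?thesis by (simp add: measure_def)
qed

text \<open>If the last digit 1 of \<open>p\<close> is at i, this is \<open>p\<close> after j
  rewritings of the last 100 into 011: from i on it reads 0101...011, and its last 1 is at
  \<open>i + 2 * j\<close>.\<close>

definition unfold_last :: "path \<Rightarrow> nat \<Rightarrow> nat \<Rightarrow> path" where
  "unfold_last p i j k \<longleftrightarrow> k < i \<and> p k \<or> i < k \<and> k < i + 2 * j \<and> odd (k - i) \<or> k = i + 2 * j"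

lemma unfold_last_0: "p i \<Longrightarrow> (\<And>k. k > i \<Longrightarrow> \<not> p k) \<Longrightarrow> unfold_last p i 0 = p"
proof
  fix k assume "p i" "\<And>k. k > i \<Longrightarrow> \<not> p k"
  then show "unfold_last p i 0 k = p k"
    by (cases k i rule: linorder_cases) (simp_all add: unfold_last_def)
qed

lemma unfold_last_same: "\<exists>n. same n (unfold_last p i 0) (unfold_last p i j)"
proof (induction j)
  case (Suc j)
  let ?m = "i + 2 * j"
  let ?e = "unfold_last p i j" and ?d = "unfold_last p i (Suc j)"
  have "vertex ?m ?e = vertex ?m ?d" by (rule vertex_cong) (auto simp: unfold_last_def)
  moreover have "?e ?m" "\<not> ?e (Suc ?m)" "\<not> ?e (Suc (Suc ?m))" "\<not> ?d ?m" "?d (Suc ?m)" "?d (Suc (Suc ?m))"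
    by (auto simp: unfold_last_def)
  ultimately have "vertex (Suc (Suc (Suc ?m))) ?e = vertex (Suc (Suc (Suc ?m))) ?d"
    by (simp add: vertex_Suc)
  moreover have "?e k = ?d k" if "k \<ge> Suc (Suc (Suc ?m))" for k
    using that by (auto simp: unfold_last_def)
  ultimately have "same (Suc (Suc (Suc ?m))) ?e ?d" by (simp add: same_def)
  then show ?case using Suc same_mono same_trans by (meson nat_le_linear)
qed (auto simp: same_def)

lemma unfold_last_inj: "inj (unfold_last p i)"
proof (rule injI)
  fix j l assume *: "unfold_last p i j = unfold_last p i l"
  have top: "unfold_last p i j (i + 2 * j)" "k > i + 2 * j \<Longrightarrow> \<not> unfold_last p i j k" for j k
    by (auto simp: unfold_last_def)
  show "j = l"
    using top(1)[of j] top(1)[of l] top(2)[of j "i + 2 * l"] top(2)[of l "i + 2 * j"] *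
    by (cases j l rule: linorder_cases) auto
qed

lemma same_compl: "same n \<epsilon> \<delta> \<Longrightarrow> same n (\<lambda>k. \<not> \<epsilon> k) (\<lambda>k. \<not> \<delta> k)"
  by (auto simp: same_def vertex_compl)

text \<open>All the points \<open>e j\<close> have the mass of \<epsilon>, and their total mass is
  at most 1.\<close>

lemma measure_zero_if_infinite_class:
  assumes "path_prob M" "exch M" "inj e" "\<And>j :: nat. \<exists>n. same n \<epsilon> (e j)"
  shows "measure M {\<epsilon>} = 0"
proof (rule ccontr)
  interpret prob_space M using assms by (simp add: path_prob_def)
  have [simp]: "sets M = sets borel" using assms by (simp add: path_prob_def)
  assume "measure M {\<epsilon>} \<noteq> 0"
  then have pos: "measure M {\<epsilon>} > 0" using measure_nonneg[of M "{\<epsilon>}"] by linarith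
  obtain J :: nat where J: "1 / measure M {\<epsilon>} < J" using reals_Archimedean2 by blast
  have "real J * measure M {\<epsilon>} = (\<Sum>j<J. measure M {e j})"
  proof -
    have "measure M {e j} = measure M {\<epsilon>}" for j
      using assms(4)[of j] exch_singleton[OF assms(1,2)] by fastforce
    then show ?thesis by simp
  qed
  also have "\<dots> = measure M (\<Union>j\<in>{..<J}. {e j})"
    using assms(3) by (intro finite_measure_finite_Union[symmetric]) (auto simp: disjoint_family_on_def inj_def)
  also have "\<dots> \<le> 1" by simp
  finally show False using J pos by (simp add: field_simps)
qed

lemma last_one:
  assumes "p \<in> words n" "p k"
  obtains i where "p i" "\<And>k. k > i \<Longrightarrow> \<not> p k"
proof -
  have "finite {k. p k}"
    by (rule finite_subset[of _ "{..<n}"]) (use assms in \<open>auto simp: words_def not_le[symmetric]\<close>)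
  then show thesis
    using that[of "Max {k. p k}"] Max_in[of "{k. p k}"] Max_ge[of "{k. p k}"] assms(2)
    by (metis empty_iff leD mem_Collect_eq)
qed

text \<open>The rewritings of the last 1 give infinitely many equivalent paths. Exchanging the
  digits preserves this, which yields the second claim.\<close>

lemma exch_word_null:
  assumes "path_prob M" "exch M" "p \<in> words n" "p k"
  shows "measure M {p} = 0" "measure M {\<lambda>k. \<not> p k} = 0"
proof -
  obtain i where i: "p i" "\<And>k. k > i \<Longrightarrow> \<not> p k" using last_one[OF assms(3,4)] by blast
  have s: "\<exists>n. same n p (unfold_last p i j)" for j
    using unfold_last_same[of p i j] unfold_last_0[of p i, OF i] by simp
  show "measure M {p} = 0"
    by (rule measure_zero_if_infinite_class[OF assms(1,2) unfold_last_inj[of p i] s])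
  show "measure M {\<lambda>k. \<not> p k} = 0"
  proof (rule measure_zero_if_infinite_class[OF assms(1,2)])
    show "inj (\<lambda>j k. \<not> unfold_last p i j k)"
      using unfold_last_inj[of p i] by (auto simp: inj_def fun_eq_iff)
    show "\<exists>n. same n (\<lambda>k. \<not> p k) (\<lambda>k. \<not> unfold_last p i j k)" for j
      using s[of j] same_compl by blast
  qed
qed

context fibre
begin

lemma proj_eq_left_end:
  assumes "proj \<epsilon> = x" "vertex n \<epsilon> = x" "k \<ge> n"
  shows "\<not> \<epsilon> k"
proof
  assume "\<epsilon> k"
  have "vertex n \<epsilon> \<le> vertex k \<epsilon>" "vertex (Suc k) \<epsilon> \<le> proj \<epsilon>"
    using vertex_diff_bounds(1)[OF assms(3)] vertex_le_proj by auto
  then show False using assms \<open>\<epsilon> k\<close> tp_less[of k] by (simp add: vertex_Suc)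
qed

lemma proj_eq_right_end:
  assumes "proj \<epsilon> = x" "vertex n \<epsilon> + tp n = x" "k \<ge> n"
  shows "\<epsilon> k"
proof (rule ccontr)
  assume "\<not> \<epsilon> k"
  have "vertex k \<epsilon> + tp k \<le> vertex n \<epsilon> + tp n" "proj \<epsilon> \<le> vertex (Suc k) \<epsilon> + tp (Suc k)"
    using vertex_diff_bounds(2)[OF assms(3)] proj_le_vertex by auto
  then show False using assms \<open>\<not> \<epsilon> k\<close> tp_less[of k] by (simp add: vertex_Suc)
qed

text \<open>If x is outside the interval below the vertex, no path over x passes there. If x is an
  end of it, the only such path is constant from n on; as 0 < x < 1 it is not constant altogether,
  and hence it is null.\<close>

lemma not_alive_null:
  assumes M: "path_prob M" "exch M" "lives_over M x" and na: "\<not> alive n \<epsilon>"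
  shows "measure M (cylinder n \<epsilon>) = 0"
proof -
  interpret prob_space M using M by (simp add: path_prob_def)
  have [simp]: "sets M = sets borel" using M by (simp add: path_prob_def)
  have null: "measure M (cylinder n \<epsilon>) = 0"
    if "\<And>\<delta>. \<delta> \<in> cylinder n \<epsilon> \<Longrightarrow> proj \<delta> = x \<Longrightarrow> \<delta> = \<eta>" "measure M {\<eta>} = 0" for \<eta>
  proof -
    have "AE \<delta> in M. \<delta> \<noteq> \<eta>"
      using that(2) by (intro AE_I'[of "{\<eta>}"]) (auto simp: null_sets_def emeasure_eq_measure)
    moreover have "AE \<delta> in M. proj \<delta> = x" using M by (simp add: lives_over_def)
    ultimately have "AE \<delta> in M. \<not> \<delta> \<in> cylinder n \<epsilon>"
      by eventually_elim (use that(1) in auto)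
    then show ?thesis
      using prob_eq_0[of "cylinder n \<epsilon>"] by simp
  qed
  consider "x < vertex n \<epsilon> \<or> x > vertex n \<epsilon> + tp n" | "x = vertex n \<epsilon>" | "x = vertex n \<epsilon> + tp n"
    using na unfolding alive_def by linarith
  then show ?thesis
  proof cases
    case 1
    \<comment> \<open>No path of the cylinder lies over x, so any null path may serve as the
      exceptional one, here 1000...\<close>
    have w: "(\<lambda>k. k = 0) \<in> words 1" by (auto simp: words_def)
    have no: "proj \<delta> \<noteq> x" if "\<delta> \<in> cylinder n \<epsilon>" for \<delta>
      using vertex_le_proj[of n \<delta>] proj_le_vertex[of \<delta> n] vertex_cylinder[OF that, of n] 1 by auto
    show ?thesis
      by (rule null[of "\<lambda>k. k = 0"]) (use no exch_word_null(1)[OF M(1,2) w, of 0] in auto)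
  next
    case 2
    have e: "\<exists>k. trunc n \<epsilon> k"
    proof (rule ccontr)
      assume "\<not> (\<exists>k. trunc n \<epsilon> k)"
      then have "vertex n \<epsilon> = 0" by (simp add: vertex_def trunc_def)
      then show False using 2 x_pos by simp
    qed
    then show ?thesis
    proof (elim exE, intro null[of "trunc n \<epsilon>"] exch_word_null(1)[OF M(1,2) trunc_words])
      fix \<delta> assume d: "\<delta> \<in> cylinder n \<epsilon>" "proj \<delta> = x"
      then have "\<not> \<delta> k" if "k \<ge> n" for k
        using proj_eq_left_end[of \<delta> n k] vertex_cylinder[OF d(1), of n] 2 that by auto
      then show "\<delta> = trunc n \<epsilon>" using d(1) by (auto simp: fun_eq_iff trunc_def cylinder_def not_less[symmetric])
    qed auto
  next
    case 3
    define p where "p = trunc n (\<lambda>k. \<not> \<epsilon> k)"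
    have e: "\<exists>k. p k"
    proof (rule ccontr)
      assume "\<not> (\<exists>k. p k)"
      then have "\<forall>k<n. \<epsilon> k" by (auto simp: p_def trunc_def)
      then have "vertex n \<epsilon> + tp n = 1" using vertex_eq_1 by blast
      then show False using 3 x_less_1 by simp
    qed
    then show ?thesis
    proof (elim exE, intro null[of "\<lambda>k. \<not> p k"] exch_word_null(2)[OF M(1,2), of p n])
      fix \<delta> assume d: "\<delta> \<in> cylinder n \<epsilon>" "proj \<delta> = x"
      then have "\<delta> k" if "k \<ge> n" for k
        using proj_eq_right_end[of \<delta> n k] vertex_cylinder[OF d(1), of n] 3 that by auto
      then show "\<delta> = (\<lambda>k. \<not> p k)" using d(1) by (auto simp: fun_eq_iff p_def trunc_def cylinder_def not_less[symmetric])
    qed (auto simp: p_def)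
  qed
qed

lemma measure_cylinder_add:
  assumes "path_prob M"
  shows "measure M (cylinder n \<epsilon>) =
    measure M (cylinder (Suc n) (\<epsilon>(n := True))) + measure M (cylinder (Suc n) (\<epsilon>(n := False)))"
proof -
  interpret prob_space M using assms by (simp add: path_prob_def)
  have [simp]: "sets M = sets borel" using assms by (simp add: path_prob_def)
  have "cylinder n \<epsilon> = cylinder (Suc n) (\<epsilon>(n := True)) \<union> cylinder (Suc n) (\<epsilon>(n := False))"
    by (auto simp: cylinder_def less_Suc_eq)
  moreover have "cylinder (Suc n) (\<epsilon>(n := True)) \<inter> cylinder (Suc n) (\<epsilon>(n := False)) = {}"
    by (auto simp: cylinder_def)
  ultimately show ?thesis by (simp add: finite_measure_Union)
qed

text \<open>The masses of one path to the upper and to the lower vertex satisfy the recursion, whose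
  solution is unique.\<close>

lemma central_mass:
  assumes M: "path_prob M" "exch M" "lives_over M x"
  shows "measure M (cylinder n \<epsilon>) = mass wt n \<epsilon>"
proof -
  interpret prob_space M using M by (simp add: path_prob_def)
  \<comment> \<open>The lower component is set to 0 at a single vertex, as the recursion
    demands.\<close>
  define z where "z n = (measure M (cylinder n (SOME \<epsilon>. upper n \<epsilon>)),
    if shape n = Single then 0 else measure M (cylinder n (SOME \<epsilon>. lower n \<epsilon>)))" for n
  have up: "upper n (SOME \<epsilon>. upper n \<epsilon>)" for n using ex_upper[of n] by (rule someI_ex)
  have lo: "lower n (SOME \<epsilon>. lower n \<epsilon>)" if "shape n \<noteq> Single" for n
    using ex_lower[OF that] by (rule someI_ex)
  have mu: "measure M (cylinder n \<epsilon>) = fst (z n)" if "upper n \<epsilon>" for n \<epsilon>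
  proof -
    have "measure M (cylinder n \<epsilon>) = measure M (cylinder n (SOME \<epsilon>. upper n \<epsilon>))"
      using M(2) upper_vertex[OF that up] unfolding exch_def by blast
    then show ?thesis by (simp add: z_def)
  qed
  have ml: "measure M (cylinder n \<epsilon>) = snd (z n)" if "lower n \<epsilon>" for n \<epsilon>
  proof -
    have ns: "shape n \<noteq> Single" using that by (simp add: lower_def)
    then have "measure M (cylinder n \<epsilon>) = measure M (cylinder n (SOME \<epsilon>. lower n \<epsilon>))"
      using M(2) lower_vertex[OF that lo] unfolding exch_def by blast
    then show ?thesis using ns by (simp add: z_def)
  qed
  have eq: "measure M (cylinder n \<epsilon>) = mass z n \<epsilon>" for n \<epsilon>
    using mu[of n \<epsilon>] ml[of n \<epsilon>] not_alive_null[OF M, of n \<epsilon>] alive_iff[of n \<epsilon>] unfolding mass_def by argo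
  have sz: "\<forall>m. shape m = Single \<longrightarrow> snd (z m) = 0" by (simp add: z_def)
  have "wrec z n" for n
    unfolding wrec_def
  proof
    show "fst (z n) = fst (z (Suc n)) + (if shape n = Single \<or> shape n = Near \<and> split_up n then snd (z (Suc n)) else 0)"
    proof -
      obtain \<epsilon> where \<epsilon>: "upper n \<epsilon>" using ex_upper by blast
      have "fst (z n) = mass z (Suc n) (\<epsilon>(n := True)) + mass z (Suc n) (\<epsilon>(n := False))"
        using measure_cylinder_add[OF M(1), of n \<epsilon>] mu[OF \<epsilon>] eq[of "Suc n"] by simp
      then show ?thesis unfolding mass_children_upper[of n \<epsilon> z, OF \<epsilon> sz] .
    qed
    show "snd (z n) = (case shape n of Single \<Rightarrow> 0 | Far \<Rightarrow> snd (z (Suc n))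
       | Near \<Rightarrow> snd (z (Suc n)) + (if split_up n then 0 else fst (z (Suc n))))"
    proof (cases "shape n = Single")
      case False
      obtain \<epsilon> where \<epsilon>: "lower n \<epsilon>" using ex_lower[OF False] by blast
      have "snd (z n) = mass z (Suc n) (\<epsilon>(n := True)) + mass z (Suc n) (\<epsilon>(n := False))"
        using measure_cylinder_add[OF M(1), of n \<epsilon>] ml[OF \<epsilon>] eq[of "Suc n"] by simp
      then show ?thesis unfolding mass_children_lower[of n \<epsilon> z, OF \<epsilon> sz] .
    qed (simp add: z_def)
  qed
  moreover have "fst (z 0) = 1" using prob_space path_prob_space[OF M(1)] by (simp add: z_def)
  moreover have "0 \<le> fst (z n) \<and> 0 \<le> snd (z n)" for n by (simp add: z_def)
  ultimately have "wsys z" by (simp add: wsys_def)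
  then show ?thesis using eq wsys_unique[OF _ wsys_wt] by metis
qed

end

subsection \<open>Measures with prescribed values on cylinders\<close>

lemma space_circle [simp]: "space circle = {0..<1}"
  by (simp add: circle_def space_restrict_space)

lemma sets_circle: "A \<in> sets circle \<longleftrightarrow> A \<subseteq> {0..<1} \<and> A \<in> sets borel"
  by (auto simp: circle_def sets_restrict_space_iff)

lemma emeasure_circle: "A \<in> sets circle \<Longrightarrow> emeasure circle A = emeasure lborel A"
  unfolding sets_circle by (simp add: circle_def emeasure_restrict_space)

lemma prob_space_circle: "prob_space circle"
proof
  have "{0..<1::real} \<in> sets circle" by (simp add: sets_circle)
  then show "emeasure circle (space circle) = 1" by (simp add: emeasure_circle)
qed

lemma fin_dep_fun:
  assumes "\<And>\<epsilon> \<delta>. (\<And>k. k < n \<Longrightarrow> \<epsilon> k = \<delta> k) \<Longrightarrow> f \<epsilon> = f \<delta>"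
  shows "fin_dep n {\<epsilon>. P (f \<epsilon>)}"
proof (rule fin_depI)
  fix \<epsilon> \<delta> assume *: "\<epsilon> \<in> {\<epsilon>. P (f \<epsilon>)}" "\<And>k. k < n \<Longrightarrow> \<delta> k = \<epsilon> k"
  have "f \<delta> = f \<epsilon>" by (rule assms) (rule *(2))
  then show "\<delta> \<in> {\<epsilon>. P (f \<epsilon>)}" using *(1) by simp
qed

text \<open>A measure with given cylinder masses is obtained as an image of Lebesgue measure on [0,
  1). The position in [0, 1) is needed again as the angle of the rotation, so the order
  \<open>ld\<close> of the subintervals is left open.\<close>

locale cylinder_mass =
  fixes C :: "nat \<Rightarrow> path \<Rightarrow> real" and ld :: "nat \<Rightarrow> bool"
  assumes C_cong: "\<And>n \<epsilon> \<delta>. (\<And>k. k < n \<Longrightarrow> \<epsilon> k = \<delta> k) \<Longrightarrow> C n \<epsilon> = C n \<delta>"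
    and C_nonneg: "0 \<le> C n \<epsilon>"
    and C_add: "C n \<epsilon> = C (Suc n) (\<epsilon>(n := True)) + C (Suc n) (\<epsilon>(n := False))"
    and C_0: "C 0 \<epsilon> = 1"
begin

text \<open>
  Nested intervals of length \<open>C n \<epsilon>\<close>; of the two subintervals of an interval of level \<open>n\<close>, the
  left one belongs to the digit \<open>ld n\<close>.
\<close>

primrec lft :: "nat \<Rightarrow> path \<Rightarrow> real" where
  "lft 0 \<epsilon> = 0"
| "lft (Suc n) \<epsilon> = lft n \<epsilon> + (if \<epsilon> n = ld n then 0 else C (Suc n) (\<epsilon>(n := ld n)))"

lemma lft_cong: "(\<And>k. k < n \<Longrightarrow> \<epsilon> k = \<delta> k) \<Longrightarrow> lft n \<epsilon> = lft n \<delta>"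
proof (induction n)
  case (Suc n)
  have "C (Suc n) (\<epsilon>(n := ld n)) = C (Suc n) (\<delta>(n := ld n))"
    using Suc.prems by (intro C_cong) auto
  then show ?case using Suc by simp
qed simp

lemma C_split: "C n \<epsilon> = C (Suc n) (\<epsilon>(n := ld n)) + C (Suc n) (\<epsilon>(n := \<not> ld n))"
  using C_add[of n \<epsilon>] by (cases "ld n") auto

lemma lft_nested:
  "lft n \<epsilon> \<le> lft (Suc n) \<epsilon>" "lft (Suc n) \<epsilon> + C (Suc n) \<epsilon> \<le> lft n \<epsilon> + C n \<epsilon>"
proof -
  show "lft n \<epsilon> \<le> lft (Suc n) \<epsilon>" using C_nonneg by simp
  show "lft (Suc n) \<epsilon> + C (Suc n) \<epsilon> \<le> lft n \<epsilon> + C n \<epsilon>"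
  proof (cases "\<epsilon> n = ld n")
    case True
    then have "\<epsilon>(n := ld n) = \<epsilon>" by (simp add: fun_eq_iff)
    then show ?thesis using C_split[of n \<epsilon>] C_nonneg[of "Suc n" "\<epsilon>(n := \<not> ld n)"] True by simp
  next
    case False
    then have "\<epsilon>(n := \<not> ld n) = \<epsilon>" by (simp add: fun_eq_iff)
    then show ?thesis using C_split[of n \<epsilon>] False by simp
  qed
qed

lemma lft_mono: "m \<le> n \<Longrightarrow> lft m \<epsilon> \<le> lft n \<epsilon>"
  by (rule lift_Suc_mono_le[of "\<lambda>n. lft n \<epsilon>", OF lft_nested(1)])

lemma rgt_mono: "m \<le> n \<Longrightarrow> lft n \<epsilon> + C n \<epsilon> \<le> lft m \<epsilon> + C m \<epsilon>"
  by (rule lift_Suc_antimono_le[of "\<lambda>n. lft n \<epsilon> + C n \<epsilon>", OF lft_nested(2)])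

primrec gword :: "real \<Rightarrow> nat \<Rightarrow> path" where
  "gword y 0 = (\<lambda>_. False)"
| "gword y (Suc n) = (gword y n)(n :=
     (if y < lft n (gword y n) + C (Suc n) ((gword y n)(n := ld n)) then ld n else \<not> ld n))"

definition gpath :: "real \<Rightarrow> path" where
  "gpath y n = gword y (Suc n) n"

lemma gword_gpath: "k < n \<Longrightarrow> gword y n k = gpath y k"
proof (induction n)
  case (Suc n)
  then show ?case by (cases "k = n") (auto simp: gpath_def)
qed simp

lemma gpath_digit:
  "gpath y n = (if y < lft n (gpath y) + C (Suc n) ((gpath y)(n := ld n)) then ld n else \<not> ld n)"
proof -
  have "lft n (gword y n) = lft n (gpath y)" by (rule lft_cong) (rule gword_gpath)
  moreover have "C (Suc n) ((gword y n)(n := ld n)) = C (Suc n) ((gpath y)(n := ld n))"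
    by (rule C_cong) (auto simp: gword_gpath)
  ultimately show ?thesis by (simp add: gpath_def)
qed

text \<open>The intervals are closed on the left and open on the right, so the choice of the digit
  never enters an interval of length 0.\<close>

lemma gpath_interval:
  assumes "0 \<le> y" "y < 1"
  shows "lft n (gpath y) \<le> y \<and> y < lft n (gpath y) + C n (gpath y)"
proof (induction n)
  case 0
  then show ?case using assms by (simp add: C_0)
next
  case (Suc n)
  let ?e = "gpath y"
  show ?case
  proof (cases "?e n = ld n")
    case True
    then have "?e(n := ld n) = ?e" by (simp add: fun_eq_iff)
    moreover have "y < lft n ?e + C (Suc n) (?e(n := ld n))"
      using gpath_digit[of y n] True by (auto split: if_splits)
    ultimately show ?thesis using Suc True by simp
  next
    case False
    then have "?e(n := \<not> ld n) = ?e" by (simp add: fun_eq_iff)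
    moreover have "lft n ?e + C (Suc n) (?e(n := ld n)) \<le> y"
      using gpath_digit[of y n] False by (auto split: if_splits)
    ultimately show ?thesis using Suc False C_split[of n ?e] by simp
  qed
qed

lemma gpath_unique:
  assumes "lft n \<epsilon> \<le> y" "y < lft n \<epsilon> + C n \<epsilon>" "k < n"
  shows "gpath y k = \<epsilon> k"
  using assms
proof (induction n arbitrary: k)
  case (Suc n)
  have I: "lft n \<epsilon> \<le> y" "y < lft n \<epsilon> + C n \<epsilon>"
    using Suc.prems lft_nested[of n \<epsilon>] by linarith+
  have pre: "\<And>k. k < n \<Longrightarrow> gpath y k = \<epsilon> k" using Suc.IH[OF I] .
  then have 1: "lft n (gpath y) = lft n \<epsilon>" by (intro lft_cong)
  have 2: "C (Suc n) ((gpath y)(n := ld n)) = C (Suc n) (\<epsilon>(n := ld n))"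
    using pre by (intro C_cong) auto
  have "gpath y n = \<epsilon> n"
  proof (cases "\<epsilon> n = ld n")
    case True
    then have "\<epsilon>(n := ld n) = \<epsilon>" by (simp add: fun_eq_iff)
    then show ?thesis using gpath_digit[of y n] Suc.prems True unfolding 1 2 by simp
  next
    case False
    then show ?thesis using gpath_digit[of y n] Suc.prems unfolding 1 2 by simp
  qed
  then show ?case using pre Suc.prems(3) by (cases "k = n") auto
qed simp

lemma gpath_cylinder:
  "gpath -` cylinder n \<epsilon> \<inter> {0..<1} = {lft n \<epsilon> ..< lft n \<epsilon> + C n \<epsilon>}"
proof (intro set_eqI iffI)
  fix y assume y: "y \<in> gpath -` cylinder n \<epsilon> \<inter> {0..<1}"
  then have pre: "\<And>k. k < n \<Longrightarrow> gpath y k = \<epsilon> k" by (auto simp: cylinder_def)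
  then have "lft n (gpath y) = lft n \<epsilon>" "C n (gpath y) = C n \<epsilon>" by (auto intro: lft_cong C_cong)
  then show "y \<in> {lft n \<epsilon> ..< lft n \<epsilon> + C n \<epsilon>}" using gpath_interval[of y n] y by auto
next
  fix y assume y: "y \<in> {lft n \<epsilon> ..< lft n \<epsilon> + C n \<epsilon>}"
  then have "0 \<le> y" "y < 1" using lft_mono[of 0 n \<epsilon>] rgt_mono[of 0 n \<epsilon>] by (auto simp: C_0)
  then show "y \<in> gpath -` cylinder n \<epsilon> \<inter> {0..<1}"
    using gpath_unique[of n \<epsilon> y] y by (auto simp: cylinder_def)
qed

lemma gpath_measurable: "gpath \<in> circle \<rightarrow>\<^sub>M borel"
proof (rule measurable_sigma_sets[OF sets_borel_cylinders[of 0]])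
  show "gpath -` A \<inter> space circle \<in> sets circle" if A: "A \<in> insert {} {cylinder n \<epsilon> |n \<epsilon>. 0 \<le> n}" for A
  proof -
    consider "A = {}" | n \<epsilon> where "A = cylinder n \<epsilon>" using A by blast
    then show ?thesis
    proof cases
      case (2 n \<epsilon>)
      have "gpath -` cylinder n \<epsilon> \<inter> {0..<1} \<in> sets borel"
        unfolding gpath_cylinder by simp
      then show ?thesis using 2 by (simp add: sets_circle)
    qed simp
  qed
qed auto

definition cmeas :: "path measure" where
  "cmeas = distr circle borel gpath"

lemma cmeas_prob: "path_prob cmeas"
  unfolding path_prob_def cmeas_def
  using prob_space.prob_space_distr[OF prob_space_circle gpath_measurable] by simp

lemma cmeas_cylinder: "measure cmeas (cylinder n \<epsilon>) = C n \<epsilon>"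
proof -
  have "gpath -` cylinder n \<epsilon> \<inter> {0..<1} \<in> sets circle"
    using measurable_sets[OF gpath_measurable, of "cylinder n \<epsilon>"] by simp
  then have "emeasure cmeas (cylinder n \<epsilon>) = emeasure lborel (gpath -` cylinder n \<epsilon> \<inter> {0..<1})"
    unfolding cmeas_def by (simp add: emeasure_distr[OF gpath_measurable] emeasure_circle)
  also have "\<dots> = ennreal (C n \<epsilon>)"
    unfolding gpath_cylinder using C_nonneg by simp
  finally show ?thesis using C_nonneg by (simp add: measure_def)
qed

text \<open>The left ends increase to this position. It inverts \<open>gpath\<close> where the
  lengths of the intervals tend to 0.\<close>

definition fpos :: "path \<Rightarrow> real" where
  "fpos \<epsilon> = lim (\<lambda>n. lft n \<epsilon>)"

lemma lft_tendsto: "(\<lambda>n. lft n \<epsilon>) \<longlonglongrightarrow> fpos \<epsilon>"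
proof -
  have "lft n \<epsilon> \<le> 1" for n
    using rgt_mono[of 0 n \<epsilon>] C_nonneg[of n \<epsilon>] by (simp add: C_0)
  moreover have "0 \<le> lft n \<epsilon>" for n
    using lft_mono[of 0 n \<epsilon>] by simp
  ultimately have "Bseq (\<lambda>n. lft n \<epsilon>)"
    by (intro BseqI'[of _ 1]) simp
  then have "convergent (\<lambda>n. lft n \<epsilon>)"
    using lft_mono by (intro Bseq_mono_convergent) auto
  then show ?thesis unfolding fpos_def by (simp add: convergent_LIMSEQ_iff)
qed

lemma lft_measurable [measurable]: "lft n \<in> borel_measurable borel"
proof (rule borel_measurableI_le)
  fix y
  have "fin_dep n {\<epsilon>. lft n \<epsilon> \<le> y}"
    by (rule fin_dep_fun) (rule lft_cong)
  then show "{\<epsilon> \<in> space borel. lft n \<epsilon> \<le> y} \<in> sets borel" by auto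
qed

lemma fpos_measurable: "fpos \<in> borel_measurable borel"
  by (rule borel_measurable_LIMSEQ_real[OF lft_tendsto lft_measurable])

lemma fpos_gpath:
  assumes "0 \<le> y" "y < 1" "(\<lambda>n. C n (gpath y)) \<longlonglongrightarrow> 0"
  shows "fpos (gpath y) = y"
proof -
  have "(\<lambda>n. lft n (gpath y) + C n (gpath y)) \<longlonglongrightarrow> fpos (gpath y) + 0"
    by (rule tendsto_add[OF lft_tendsto assms(3)])
  then have "y \<le> fpos (gpath y) + 0"
    by (rule LIMSEQ_le_const) (use gpath_interval[OF assms(1,2)] less_imp_le in blast)
  moreover have "fpos (gpath y) \<le> y"
    by (rule LIMSEQ_le_const2[OF lft_tendsto]) (use gpath_interval[OF assms(1,2)] in blast)
  ultimately show ?thesis by simp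
qed

end

section \<open>The central measure over an interior point\<close>

context fibre
begin

text \<open>At a \<open>Near\<close> level the vertex that splits has on the left the edge that
  meets the edge of the other vertex. With this choice the piece cut off a tower in the rotation
  part is always its left part.\<close>

definition ld :: "nat \<Rightarrow> bool" where
  "ld n \<longleftrightarrow> \<not> (shape n = Near \<and> split_up n)"

lemma mass_nonneg: "0 \<le> mass wt n \<epsilon>"
  using wsys_wt by (simp add: mass_def wsys_def)

sublocale cylinder_mass "mass wt" ld
proof
  show "mass wt n \<epsilon> = mass wt n \<delta>" if "\<And>k. k < n \<Longrightarrow> \<epsilon> k = \<delta> k" for n \<epsilon> \<delta>
    by (rule mass_cong, rule vertex_cong) (rule that)
  show "mass wt 0 \<epsilon> = 1" for \<epsilon> using wsys_wt by (simp add: mass_def upper_def wsys_def)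
  show "0 \<le> mass wt n \<epsilon>" for n \<epsilon> by (rule mass_nonneg)
  show "mass wt n \<epsilon> = mass wt (Suc n) (\<epsilon>(n := True)) + mass wt (Suc n) (\<epsilon>(n := False))" for n \<epsilon>
    by (rule mass_add[OF wsys_wt])
qed

lemma exch_cmeas: "exch cmeas"
  unfolding exch_def cmeas_cylinder using mass_cong by blast

lemma fin_dep_alive: "fin_dep n {\<epsilon>. alive n \<epsilon>}"
  unfolding alive_def by (rule fin_dep_vertex) simp

lemma AE_alive:
  assumes M: "path_prob M" "\<And>n \<epsilon>. \<not> alive n \<epsilon> \<Longrightarrow> measure M (cylinder n \<epsilon>) = 0"
  shows "AE \<epsilon> in M. \<forall>n. alive n \<epsilon>"
proof -
  interpret prob_space M using M by (simp add: path_prob_def)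
  have [simp]: "sets M = sets borel" using M by (simp add: path_prob_def)
  have "AE \<epsilon> in M. alive n \<epsilon>" for n
  proof -
    have fd: "fin_dep n (- {\<epsilon>. alive n \<epsilon>})" by (rule fin_dep_Compl[OF fin_dep_alive])
    then have "measure M (- {\<epsilon>. alive n \<epsilon>}) = 0"
      using M(2) unfolding measure_fin_dep[OF M(1) fd] by (intro sum.neutral) auto
    then have "- {\<epsilon>. alive n \<epsilon>} \<in> null_sets M"
      using fin_dep_borel[OF fd] by (simp add: null_sets_def emeasure_eq_measure)
    then show ?thesis by (rule AE_I') auto
  qed
  then show ?thesis by (simp add: AE_all_countable)
qed

lemma alive_proj: "(\<And>n. alive n \<epsilon>) \<Longrightarrow> proj \<epsilon> = x"
  unfolding proj_eq_iff alive_def by (simp add: less_imp_le)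

lemma cmeas_central: "central cmeas" "lives_over cmeas x"
proof -
  show "central cmeas" using central_iff_exch cmeas_prob exch_cmeas by blast
  have "AE \<epsilon> in cmeas. \<forall>n. alive n \<epsilon>"
    by (rule AE_alive[OF cmeas_prob]) (simp add: cmeas_cylinder mass_not_alive)
  then show "lives_over cmeas x"
    unfolding lives_over_def by (rule eventually_mono) (rule alive_proj, blast)
qed

lemma central_eqI:
  assumes "path_prob M" "path_prob N" "\<And>n \<epsilon>. s \<le> n \<Longrightarrow> measure M (cylinder n \<epsilon>) = measure N (cylinder n \<epsilon>)"
  shows "M = N"
proof -
  interpret M: prob_space M using assms by (simp add: path_prob_def)
  interpret N: prob_space N using assms by (simp add: path_prob_def)
  show ?thesis
    using assms by (intro measure_eqI_cylinders[where s = s])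
      (auto simp: path_prob_def M.emeasure_eq_measure N.emeasure_eq_measure M.finite_measure_axioms N.finite_measure_axioms)
qed

lemma central_unique:
  assumes "central M" "lives_over M x"
  shows "M = cmeas"
proof (rule central_eqI[where s = 0])
  show "path_prob M" "path_prob cmeas" using assms cmeas_prob by (auto simp: central_def)
  then show "measure M (cylinder n \<epsilon>) = measure cmeas (cylinder n \<epsilon>)" for n \<epsilon>
    using central_mass[of M n \<epsilon>] assms unfolding cmeas_cylinder by (auto simp: central_iff_exch)
qed

end

section \<open>The two end points, and the parametrization of the ergodic central measures\<close>

lemma point_fibre_central:
  assumes x: "\<And>\<epsilon>. proj \<epsilon> = x \<longleftrightarrow> \<epsilon> = \<eta>" and v: "\<forall>n \<epsilon>. vertex n \<epsilon> = vertex n \<eta> \<longrightarrow> \<epsilon> \<in> cylinder n \<eta>"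
  shows "central (return borel \<eta>)" "lives_over (return borel \<eta>) x"
    "central M \<Longrightarrow> lives_over M x \<Longrightarrow> M = return borel \<eta>"
proof -
  have pp: "path_prob (return borel \<eta>)"
    by (simp add: path_prob_def prob_space_return)
  have m: "measure (return borel \<eta>) (cylinder n \<epsilon>) = of_bool (vertex n \<epsilon> = vertex n \<eta>)" for n \<epsilon>
  proof -
    have "\<eta> \<in> cylinder n \<epsilon> \<longleftrightarrow> vertex n \<epsilon> = vertex n \<eta>"
      using v[rule_format, of n \<epsilon>] vertex_cylinder[of \<eta> n \<epsilon> n] by (auto simp: cylinder_def)
    then show ?thesis by (simp add: measure_return indicator_def)
  qed
  then show "central (return borel \<eta>)"
    using pp by (simp add: central_iff_exch exch_def)
  show "lives_over (return borel \<eta>) x"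
    unfolding lives_over_def using x by (subst AE_return) (auto intro: borel_closed closed_proj)
  assume M: "central M" "lives_over M x"
  then have pM: "path_prob M" by (simp add: central_def)
  interpret prob_space M using pM by (simp add: path_prob_def)
  have [simp]: "sets M = sets borel" using pM by (simp add: path_prob_def)
  have ae: "AE \<epsilon> in M. \<epsilon> = \<eta>" using M(2) x by (simp add: lives_over_def)
  show "M = return borel \<eta>"
  proof (rule fibre.central_eqI[where x = "1/2" and s = 0, OF _ pM pp])
    \<comment> \<open>The point 1/2 is an arbitrary choice that gives access to the comparison of
      measures on cylinders.\<close>
    show "fibre (1/2)" by unfold_locales auto
    fix n \<epsilon>
    have "prob (cylinder n \<epsilon>) = of_bool (\<eta> \<in> cylinder n \<epsilon>)"
    proof (cases "\<eta> \<in> cylinder n \<epsilon>")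
      case True
      from ae have "AE \<delta> in M. \<delta> \<in> cylinder n \<epsilon>" by (rule eventually_mono) (use True in simp)
      then show ?thesis using True prob_eq_1[of "cylinder n \<epsilon>"] by simp
    next
      case False
      from ae have "AE \<delta> in M. \<delta> \<notin> cylinder n \<epsilon>" by (rule eventually_mono) (use False in simp)
      then show ?thesis using False prob_eq_0[of "cylinder n \<epsilon>"] by simp
    qed
    moreover have "\<eta> \<in> cylinder n \<epsilon> \<longleftrightarrow> vertex n \<epsilon> = vertex n \<eta>"
      using v[rule_format, of n \<epsilon>] vertex_cylinder[of \<eta> n \<epsilon> n] by (auto simp: cylinder_def)
    ultimately show "prob (cylinder n \<epsilon>) = measure (return borel \<eta>) (cylinder n \<epsilon>)" using m by simp
  qed
qed

lemma vertex_eq_0: "vertex n \<epsilon> = 0 \<longleftrightarrow> (\<forall>k<n. \<not> \<epsilon> k)"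
proof (induction n)
  case (Suc n)
  then show ?case using vertex_ge_0[of n \<epsilon>] tp_less[of n] by (auto simp: vertex_Suc less_Suc_eq)
qed simp

lemma central_0:
  shows "central (return borel (\<lambda>_. False))" "lives_over (return borel (\<lambda>_. False)) 0"
    "central M \<Longrightarrow> lives_over M 0 \<Longrightarrow> M = return borel (\<lambda>_. False)"
proof -
  have v: "\<forall>n \<epsilon>. vertex n \<epsilon> = vertex n (\<lambda>_. False) \<longrightarrow> \<epsilon> \<in> cylinder n (\<lambda>_. False)"
  proof (intro allI impI)
    fix n \<epsilon> assume "vertex n \<epsilon> = vertex n (\<lambda>_. False)"
    then show "\<epsilon> \<in> cylinder n (\<lambda>_. False)"
      using vertex_eq_0[of n \<epsilon>] vertex_eq_0[of n "\<lambda>_. False"] by (simp add: cylinder_def)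
  qed
  note * = point_fibre_central[OF proj_0 v]
  show "central (return borel (\<lambda>_. False))" "lives_over (return borel (\<lambda>_. False)) 0"
    using *(1,2) .
  show "central M \<Longrightarrow> lives_over M 0 \<Longrightarrow> M = return borel (\<lambda>_. False)"
    by (rule *(3))
qed

lemma central_1:
  shows "central (return borel (\<lambda>_. True))" "lives_over (return borel (\<lambda>_. True)) 1"
    "central M \<Longrightarrow> lives_over M 1 \<Longrightarrow> M = return borel (\<lambda>_. True)"
proof -
  have v: "\<forall>n \<epsilon>. vertex n \<epsilon> = vertex n (\<lambda>_. True) \<longrightarrow> \<epsilon> \<in> cylinder n (\<lambda>_. True)"
  proof (intro allI impI)
    fix n \<epsilon> assume "vertex n \<epsilon> = vertex n (\<lambda>_. True)"
    then show "\<epsilon> \<in> cylinder n (\<lambda>_. True)"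
      using vertex_eq_1[of n \<epsilon>] vertex_eq_1[of n "\<lambda>_. True"] by (simp add: cylinder_def)
  qed
  note * = point_fibre_central[OF proj_1 v]
  show "central (return borel (\<lambda>_. True))" "lives_over (return borel (\<lambda>_. True)) 1"
    using *(1,2) .
  show "central M \<Longrightarrow> lives_over M 1 \<Longrightarrow> M = return borel (\<lambda>_. True)"
    by (rule *(3))
qed

lemma unique_central:
  assumes "x \<in> {0..1}"
  obtains M where "central M" "lives_over M x" "\<And>N. central N \<Longrightarrow> lives_over N x \<Longrightarrow> N = M"
proof -
  consider "x = 0" | "x = 1" | "fibre x" using assms by (force simp: fibre_def)
  then show thesis
  proof cases
    case 3
    then show thesis using that fibre.cmeas_central fibre.central_unique by blast
  qed (use that central_0 central_1 in blast)+
qed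

lemma mu_properties:
  assumes "x \<in> {0..1}"
  shows "ergodic_central (mu x)" "lives_over (mu x) x"
    and "\<And>N. central N \<Longrightarrow> lives_over N x \<Longrightarrow> N = mu x"
proof -
  obtain M where M: "central M" "lives_over M x" "\<And>N. central N \<Longrightarrow> lives_over N x \<Longrightarrow> N = M"
    using unique_central[OF assms] by metis
  have "adic_ergodic M" by (rule unique_central_ergodic[OF M])
  then have "mu x = M"
    unfolding mu_def using M(1,2) by (intro the_equality M(3)) (auto simp: ergodic_central_def)
  then show "ergodic_central (mu x)" "lives_over (mu x) x"
    using M(1,2) \<open>adic_ergodic M\<close> by (auto simp: ergodic_central_def)
  show "N = mu x" if "central N" "lives_over N x" for N
    using M(3)[OF that] \<open>mu x = M\<close> by simp
qed

lemma lives_over_unique: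
  assumes "path_prob M" "lives_over M x" "lives_over M y"
  shows "x = y"
proof -
  interpret prob_space M using assms by (simp add: path_prob_def)
  have "AE \<epsilon> in M. x = y" using assms(2,3) unfolding lives_over_def by eventually_elim simp
  then show ?thesis by simp
qed

text \<open>A measure lives over at most one point, which gives injectivity. An ergodic central
  measure lives over some point and is the only central measure there, which gives
  surjectivity.\<close>

lemma bij_betw_mu: "bij_betw mu {0..1} {M. ergodic_central M}"
  unfolding bij_betw_def
proof
  show "inj_on mu {0..1}"
  proof (rule inj_onI)
    fix x y :: real assume xy: "x \<in> {0..1}" "y \<in> {0..1}" "mu x = mu y"
    show "x = y"
      using lives_over_unique[of "mu x" x y] mu_properties(1,2)[OF xy(1)] mu_properties(2)[OF xy(2)] xy(3)
      by (simp add: ergodic_central_def central_def)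
  qed
  show "mu ` {0..1} = {M. ergodic_central M}"
  proof (intro equalityI subsetI)
    fix M assume "M \<in> {M. ergodic_central M}"
    then have M: "ergodic_central M" by simp
    then obtain x where x: "x \<in> {0..1}" "lives_over M x" using ergodic_lives_over by blast
    then have "M = mu x" using mu_properties(3)[OF x(1) _ x(2)] M by (auto simp: ergodic_central_def)
    then show "M \<in> mu ` {0..1}" using x by blast
  qed (use mu_properties(1) in auto)
qed

subsection \<open>The ring generated by the golden ratio\<close>

text \<open>The ring Z[tau]. A point of [0, 1) lies in it exactly if it is the fractional part of an
  integer multiple of \<open>golden\<close>.\<close>

definition Ztau :: "real set" where
  "Ztau = {of_int a + of_int b * tau | a b. True}"

lemma ZtauI: "y = of_int a + of_int b * tau \<Longrightarrow> y \<in> Ztau"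
  by (auto simp: Ztau_def)

lemma Ztau_add: "y \<in> Ztau \<Longrightarrow> z \<in> Ztau \<Longrightarrow> y + z \<in> Ztau"
  and Ztau_diff: "y \<in> Ztau \<Longrightarrow> z \<in> Ztau \<Longrightarrow> y - z \<in> Ztau"
proof -
  assume "y \<in> Ztau" "z \<in> Ztau"
  then obtain a b c d :: int where *: "y = of_int a + of_int b * tau" "z = of_int c + of_int d * tau"
    by (auto simp: Ztau_def)
  show "y + z \<in> Ztau" "y - z \<in> Ztau"
    by (rule ZtauI[of _ "a + c" "b + d"], simp add: * algebra_simps)
      (rule ZtauI[of _ "a - c" "b - d"], simp add: * algebra_simps)
qed

lemma Ztau_int: "of_int a \<in> Ztau"
  by (rule ZtauI[of _ a 0]) simp

lemma tau_tau: "tau * tau = 1 - tau" "tau * (tau * z) = z - tau * z"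
proof -
  show 1: "tau * tau = 1 - tau" using tau_sq by (simp add: power2_eq_square)
  show "tau * (tau * z) = z - tau * z" unfolding mult.assoc[symmetric] 1 by (simp add: algebra_simps)
qed

lemma golden_tau: "golden * tau = 1" "golden * (tau * z) = z" "tau * (golden * z) = z"
  using golden_gt_1 by (simp_all add: tau_def)

lemma Ztau_mult_tau: "y \<in> Ztau \<Longrightarrow> tau * y \<in> Ztau"
proof -
  assume "y \<in> Ztau"
  then obtain a b :: int where "y = of_int a + of_int b * tau" by (auto simp: Ztau_def)
  then have "tau * y = of_int b + of_int (a - b) * tau" by (simp add: algebra_simps tau_tau)
  then show "tau * y \<in> Ztau" by (rule ZtauI)
qed

lemma Ztau_tp: "tp n \<in> Ztau"
  using Ztau_int[of 1] by (induction n) (auto simp: tp_Suc Ztau_mult_tau)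

lemma Ztau_frac:
  assumes "x \<in> {0..<1}"
  shows "x \<in> Ztau \<longleftrightarrow> (\<exists>N::int. x = frac (of_int N * golden))"
proof
  assume "x \<in> Ztau"
  then obtain a b :: int where ab: "x = of_int a + of_int b * tau" by (auto simp: Ztau_def)
  have "of_int b * golden - x = of_int (b - a)" by (simp add: ab golden_eq_tau algebra_simps)
  then have "of_int b * golden - x \<in> \<int>" by (metis Ints_of_int)
  then have "frac (of_int b * golden) = x" using assms by (simp add: frac_unique_iff)
  then show "\<exists>N::int. x = frac (of_int N * golden)" by metis
next
  assume "\<exists>N::int. x = frac (of_int N * golden)"
  then obtain N :: int where "x = frac (of_int N * golden)" by blast
  then have "x = of_int (N - \<lfloor>of_int N * golden\<rfloor>) + of_int N * tau"
    by (simp add: frac_def golden_eq_tau algebra_simps)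
  then show "x \<in> Ztau" by (rule ZtauI)
qed

lemma golden_mult_Ztau: "golden * y \<in> Ztau \<Longrightarrow> y \<in> Ztau"
  using Ztau_mult_tau[of "golden * y"] golden_tau(3)[of y] by simp

text \<open>
  The conjugate of \<open>\<rho> n\<close> is contracted by the factor \<open>-tau\<close> up to the digits, so it ends up
  between \<open>-golden\<close> and \<open>golden^2\<close>; there only two elements of the ring lie in the unit interval.
\<close>

lemma conjugate_trap:
  fixes \<rho> d :: "nat \<Rightarrow> real"
  assumes "\<rho> 0 \<in> Ztau" and bounds: "\<And>n. 0 < \<rho> n" "\<And>n. \<rho> n < 1"
    and step: "\<And>n. \<rho> (Suc n) = golden * \<rho> n - d n * tau" and d: "\<And>n. d n = 0 \<or> d n = 1"
  shows "\<exists>n. \<forall>m\<ge>n. \<rho> m = tau \<or> \<rho> m = 1 - tau"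
proof -
  obtain a0 b0 :: int where ab0: "\<rho> 0 = of_int a0 + of_int b0 * tau" using assms(1) by (auto simp: Ztau_def)
  \<comment> \<open>The conjugate of a + b tau is a - b golden. Its size at the start is
    \<open>e\<close>, and the influence of \<open>e\<close> decays like \<open>tp n\<close>.\<close>
  define e where "e = \<bar>of_int a0 - of_int b0 * golden\<bar>"
  have ex: "\<exists>a b :: int. \<rho> n = of_int a + of_int b * tau \<and> - golden - e * tp n \<le> of_int a - of_int b * golden \<and>
      of_int a - of_int b * golden \<le> golden + 1 + e * tp n" for n
  proof (induction n)
    case 0
    show ?case
      by (rule exI[of _ a0], rule exI[of _ b0]) (use ab0 golden_gt_1 in \<open>auto simp: e_def\<close>)
  next
    case (Suc n)
    then obtain a b :: int where ab: "\<rho> n = of_int a + of_int b * tau"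
      and c: "- golden - e * tp n \<le> of_int a - of_int b * golden" "of_int a - of_int b * golden \<le> golden + 1 + e * tp n"
      by blast
    obtain k :: int where k: "d n = of_int k" "k = 0 \<or> k = 1" using d[of n] by (metis of_int_0 of_int_1)
    let ?c = "of_int a - of_int b * golden :: real"
    have "\<rho> (Suc n) = of_int (a + b) + of_int (a - k) * tau"
      unfolding step ab golden_eq_tau using k by (simp add: algebra_simps tau_tau)
    moreover have c': "of_int (a + b) - of_int (a - k) * golden = - tau * ?c + of_int k * golden"
      by (simp add: algebra_simps tau_tau golden_eq_tau)
    moreover have "tau * ?c \<le> tau * (golden + 1 + e * tp n)" "tau * (- golden - e * tp n) \<le> tau * ?c"
      using c tau_pos by (auto intro: mult_left_mono)
    then have "tau * ?c \<le> golden + e * tp (Suc n)" "- 1 - e * tp (Suc n) \<le> tau * ?c"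
      by (auto simp: tp_Suc algebra_simps tau_tau golden_eq_tau)
    moreover have "0 \<le> of_int k * golden \<and> of_int k * golden \<le> golden" using k(2) golden_gt_1 by auto
    ultimately show ?case
      by (intro exI[of _ "a + b"] exI[of _ "a - k"]) (unfold c', auto)
  qed
  have tb: "2 * tau > 1" "3 * tau < 2" using tp_bounds[of 0] by simp_all
  \<comment> \<open>From here on the initial conjugate contributes less than 1/2.\<close>
  obtain n where n: "\<forall>m\<ge>n. tp m < 1 / (2 * (e + 1))"
  proof -
    have "0 < 1 / (2 * (e + 1))" by (simp add: e_def add_nonneg_pos)
    then show thesis using tp_small that by blast
  qed
  have "\<rho> m = tau \<or> \<rho> m = 1 - tau" if "m \<ge> n" for m
  proof -
    obtain a b :: int where ab: "\<rho> m = of_int a + of_int b * tau"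
      and c: "- golden - e * tp m \<le> of_int a - of_int b * golden" "of_int a - of_int b * golden \<le> golden + 1 + e * tp m"
      using ex[of m] by blast
    have p: "0 < 2 * (e + 1)" by (simp add: e_def add_nonneg_pos)
    have "tp m * (2 * (e + 1)) < 1" using n that pos_less_divide_eq[OF p] by blast
    then have small: "e * tp m < 1 / 2" using tp_pos[of m] by (simp add: algebra_simps)
    \<comment> \<open>A number minus its conjugate is b times 1 + 2 tau, the square root of 5. With
      both numbers bounded this leaves three values of b.\<close>
    have diff: "\<rho> m - (of_int a - of_int b * golden) = of_int b * (1 + 2 * tau)"
      by (simp add: ab golden_eq_tau algebra_simps)
    have "of_int b * (1 + 2 * tau) < 2 * (1 + 2 * tau)" "(-2) * (1 + 2 * tau) < of_int b * (1 + 2 * tau)"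
      unfolding diff[symmetric] using c small bounds[of m] golden_eq_tau tb by auto
    then have "real_of_int b < 2" "-2 < real_of_int b" using tau_pos by (simp_all only: mult_less_cancel_right)
    then have "b = -1 \<or> b = 0 \<or> b = 1" by linarith
    then show ?thesis
    proof (elim disjE)
      assume "b = 0"
      then have "0 < real_of_int a" "real_of_int a < 1" using ab bounds[of m] by auto
      then show ?thesis by simp
    next
      assume b: "b = 1"
      then have "-1 < real_of_int a" "real_of_int a < 1" using ab bounds[of m] tau_pos tau_lt_1 by auto
      then have "a = 0" by linarith
      then show ?thesis using ab b by simp
    next
      assume b: "b = -1"
      then have "0 < real_of_int a" "real_of_int a < 2" using ab bounds[of m] tau_pos tau_lt_1 by auto
      then have "a = 1" by linarith
      then show ?thesis using ab b by simp
    qed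
  qed
  then show ?thesis by blast
qed

context fibre
begin

lemma urem_Ztau: "x - urem n \<in> Ztau"
proof (induction n)
  case 0
  then show ?case using Ztau_int[of 0] by simp
next
  case (Suc n)
  show ?case
  proof (cases "split_up n")
    case True
    then have "x - urem (Suc n) = (x - urem n) + (tp n - tp (Suc n))" by (simp add: urem_Suc)
    then show ?thesis using Ztau_add[OF Suc Ztau_diff[OF Ztau_tp[of n] Ztau_tp[of "Suc n"]]] by (simp only:)
  qed (use Suc in \<open>simp add: urem_Suc\<close>)
qed

text \<open>Outside the ring no comparison of a remainder with a power of tau is an
  equality.\<close>

lemma urem_ne_tp: "x \<notin> Ztau \<Longrightarrow> urem n \<noteq> tp k"
  using Ztau_add[OF urem_Ztau[of n] Ztau_tp[of k]] by auto

text \<open>The remainders rescaled by tau^(-n) satisfy the recursion of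
  \<open>conjugate_trap\<close>, so they end up at tau or tau^2. Neither value is compatible with
  \<open>Far\<close>, where the upper remainder is below tau^(n+2), and without \<open>Far\<close>
  no second vertex can persist.\<close>

lemma eventually_Single:
  assumes "x \<in> Ztau"
  shows "\<exists>n. \<forall>m\<ge>n. shape m = Single"
proof -
  define \<rho> where "\<rho> n = urem n / tp n" for n
  have b: "0 < \<rho> n" "\<rho> n < 1" for n
    using shape_bounds[of n] gap_pos[of n] tp_pos[of n] unfolding \<rho>_def
    by (cases "shape n"; simp add: gap_def field_simps; fail)+
  have step: "\<rho> (Suc n) = golden * \<rho> n - of_bool (split_up n) * tau" for n
  proof -
    have "tp n \<noteq> 0" "tau \<noteq> 0" using tp_pos[of n] tau_pos by auto
    moreover have "z / tau = golden * z" for z by (simp add: tau_def)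
    ultimately show ?thesis
      by (simp add: \<rho>_def urem_Suc tp_Suc divide_simps golden_tau tau_tau algebra_simps)
  qed
  have "\<exists>n. \<forall>m\<ge>n. \<rho> m = tau \<or> \<rho> m = 1 - tau"
    using assms b step by (intro conjugate_trap[of \<rho> "\<lambda>n. of_bool (split_up n)"]) (auto simp: \<rho>_def)
  then obtain n where n: "\<forall>m\<ge>n. \<rho> m = tau \<or> \<rho> m = 1 - tau" by blast
  have u: "urem m = tp (Suc m) \<or> urem m = tp (Suc (Suc m))" if "m \<ge> n" for m
  proof -
    have "urem m = \<rho> m * tp m" using tp_pos[of m] by (simp add: \<rho>_def)
    then show ?thesis using n[rule_format, OF that] by (elim disjE) (simp_all add: tp_Suc algebra_simps tau_tau)
  qed
  have nF: "shape m \<noteq> Far" if "m \<ge> n" for m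
    using shape_bounds[of m] u[OF that] tp_less[of m] tp_bounds(1)[of m] by (auto simp: gap_def)
  have S: "shape (Suc m) = Single" if "m \<ge> n" for m
    using nF[OF that] nF[of "Suc m"] u[OF that] that by (cases "shape m") (auto simp: split_up_def split_low_def split: if_splits)
  have "shape m = Single" if "m \<ge> Suc n" for m
    using S[of "m - 1"] that by (cases m) auto
  then show ?thesis by blast
qed

text \<open>The greedy path follows the upper vertices. For x in the ring it serves as an
  atom.\<close>

lemma upper_split_up: "upper n split_up"
  by (induction n) (auto simp: upper_Suc upper_def[of 0] Far_not_split_up split: shape.splits)

text \<open>Used for quantities that would stay constant along the levels although they are bounded
  by shrinking powers of tau.\<close>

lemma not_constant_positive:
  assumes "\<And>i. c \<le> tp (f i)" "\<And>i. i \<le> f i"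
  shows "c \<le> 0"
proof (rule ccontr)
  assume "\<not> c \<le> 0"
  then obtain n where "\<forall>m\<ge>n. tp m < c" using tp_small[of c] by auto
  then show False using assms(1)[of n] assms(2)[of n] by force
qed

section \<open>Points outside the ring: growth of the counts and positivity of the masses\<close>

context
  assumes irr: "x \<notin> Ztau"
begin

text \<open>A single vertex that never splits makes the greedy digits eventually all 0 or all 1.
  Then \<open>urem\<close> or \<open>tp - urem\<close> stays constant, although it is positive and
  bounded by shrinking powers of tau.\<close>

lemma not_eventually_Single: "\<exists>m\<ge>n. shape m \<noteq> Single"
proof (rule ccontr)
  assume "\<not> (\<exists>m\<ge>n. shape m \<noteq> Single)"
  then have S: "shape m = Single" if "m \<ge> n" for m using that by blast
  have no: "\<not> split_up m \<or> tp (Suc m) \<le> urem m" if "m \<ge> n" for m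
    using S[of m] S[of "Suc m"] that by (auto split: if_splits)
  show False
  proof (cases "\<exists>m\<ge>n. \<not> split_up m")
    case True
    then obtain m where m: "m \<ge> n" "\<not> split_up m" by blast
    have *: "\<not> split_up (m + i) \<and> urem (m + i) = urem m" for i
    proof (induction i)
      case (Suc i)
      then have "urem (Suc (m + i)) = urem (m + i)" by (simp add: urem_Suc)
      moreover have "urem (m + i) < tp (Suc (Suc (m + i)))"
        using Suc urem_ne_tp[OF irr, of "m + i" "Suc (Suc (m + i))"] unfolding split_up_def by linarith
      ultimately show ?case using Suc no[of "Suc (m + i)"] m by auto
    qed (use m in simp)
    have "urem m \<le> tp (Suc (Suc (m + i)))" for i using *[of i] unfolding split_up_def by linarith
    then have "urem m \<le> 0" by (rule not_constant_positive[where f = "\<lambda>i. Suc (Suc (m + i))"]) simp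
    then show False using shape_bounds[of m] by simp
  next
    case False
    have *: "tp (n + i) - urem (n + i) = tp n - urem n" for i
      using False by (induction i) (auto simp: urem_Suc)
    have "tp n - urem n \<le> tp (n + i)" for i using *[of i] shape_bounds[of "n + i"] by linarith
    then have "tp n - urem n \<le> 0" by (rule not_constant_positive[where f = "\<lambda>i. n + i"]) simp
    then show False using shape_bounds[of n] S[of n] by (simp add: gap_def)
  qed
qed

lemma ex_Near: "\<exists>m\<ge>n. shape m = Near"
proof -
  obtain m where m: "m \<ge> n" "shape m \<noteq> Single" using not_eventually_Single by blast
  show ?thesis
  proof (cases "shape m")
    case Far
    then show ?thesis using m by (intro exI[of _ "Suc m"]) auto
  qed (use m in auto)
qed

text \<open>Otherwise \<open>Near\<close> and \<open>Far\<close> alternate with an upper splitting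
  each time, and \<open>tp (Suc k) - urem k\<close> would be a positive constant on the
  \<open>Near\<close> levels k.\<close>

lemma ex_not_split_up: "\<exists>m\<ge>n. shape m = Near \<and> \<not> split_up m"
proof (rule ccontr)
  assume "\<not> (\<exists>m\<ge>n. shape m = Near \<and> \<not> split_up m)"
  then have up: "split_up m" if "m \<ge> n" "shape m = Near" for m using that by blast
  obtain j where j: "j \<ge> n" "shape j = Near" using ex_Near by blast
  have *: "shape (j + 2 * i) = Near \<and> tp (Suc (j + 2 * i)) - urem (j + 2 * i) = tp (Suc j) - urem j" for i
  proof (induction i)
    case (Suc i)
    let ?k = "j + 2 * i"
    have "split_up ?k" using up Suc j by auto
    then have "shape (Suc ?k) = Far" "urem (Suc ?k) = urem ?k - (tp ?k - tp (Suc ?k))" using Suc by (auto simp: urem_Suc)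
    moreover from this have "shape (Suc (Suc ?k)) = Near" "urem (Suc (Suc ?k)) = urem (Suc ?k)"
      using Far_not_split_up[of "Suc ?k"] by (auto simp: urem_Suc)
    ultimately show ?case using Suc by simp
  qed (use j in simp)
  have "tp (Suc j) - urem j \<le> tp (Suc (j + 2 * i))" for i
    using *[of i] shape_bounds[of "j + 2 * i"] by linarith
  then have "tp (Suc j) - urem j \<le> 0" by (rule not_constant_positive[where f = "\<lambda>i. Suc (j + 2 * i)"]) simp
  then show False using shape_bounds[of j] j(2) by (simp add: gap_def)
qed

text \<open>Otherwise the upper vertex would take the digit 0 for ever, and \<open>urem\<close>
  itself would be constant.\<close>

lemma ex_not_split_low: "\<exists>m\<ge>n. shape m = Near \<and> \<not> split_low m"
proof (rule ccontr)
  assume "\<not> (\<exists>m\<ge>n. shape m = Near \<and> \<not> split_low m)"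
  then have low: "split_low m" if "m \<ge> n" "shape m = Near" for m using that by blast
  obtain j where j: "j \<ge> n" "shape j = Near" using ex_Near by blast
  have *: "shape (j + 2 * i) = Near \<and> urem (j + 2 * i) = urem j" for i
  proof (induction i)
    case (Suc i)
    let ?k = "j + 2 * i"
    have "split_low ?k" using low Suc j by auto
    then have "shape (Suc ?k) = Far" "urem (Suc ?k) = urem ?k" using Suc split_excl[of ?k] by (auto simp: urem_Suc)
    moreover from this have "shape (Suc (Suc ?k)) = Near" "urem (Suc (Suc ?k)) = urem (Suc ?k)"
      using Far_not_split_up[of "Suc ?k"] by (auto simp: urem_Suc)
    ultimately show ?case using Suc by simp
  qed (use j in simp)
  have "urem j \<le> tp (Suc (Suc (Suc (j + 2 * i))))" for i
    using *[of i] low[of "j + 2 * i"] j(1) unfolding split_low_def by auto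
  then have "urem j \<le> 0" by (rule not_constant_positive[where f = "\<lambda>i. Suc (Suc (Suc (j + 2 * i)))"]) simp
  then show False using shape_bounds[of j] by simp
qed

lemma dhi_unbounded: "\<exists>n. k \<le> dhi n"
proof (induction k)
  case (Suc k)
  then obtain n where n: "k \<le> dhi n" by blast
  obtain m where m: "m \<ge> n" "shape m = Near" "\<not> split_up m" using ex_not_split_up by blast
  then have "Suc k \<le> dhi (Suc m)" using n dims_mono(2)[OF m(1)] dims_pos[of m] by (simp add: dhi_Suc)
  then show ?case by blast
qed simp

lemma dlo_unbounded: "\<exists>n. k \<le> dlo n"
proof (induction k)
  case (Suc k)
  then obtain n where n: "k \<le> dlo n" by blast
  obtain m where m: "m \<ge> n" "shape m = Near" "\<not> split_low m" using ex_not_split_low by blast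
  then have "Suc k \<le> dlo (Suc m)" using n dims_mono(1)[OF m(1)] dims_pos[of m] by (simp add: dlo_Suc)
  then show ?case by blast
qed simp

lemma inverse_dims_tendsto: "(\<lambda>n. 1 / real (dhi n)) \<longlonglongrightarrow> 0" "(\<lambda>n. 1 / real (dlo n)) \<longlonglongrightarrow> 0"
proof -
  have *: "(\<lambda>n. 1 / real (f n)) \<longlonglongrightarrow> 0" if f: "\<And>m n. m \<le> n \<Longrightarrow> f m \<le> f n" "\<And>k. \<exists>n. k \<le> f n" for f :: "nat \<Rightarrow> nat"
  proof -
    have "filterlim f at_top sequentially"
      unfolding filterlim_at_top eventually_sequentially
    proof
      fix k
      obtain n where "k \<le> f n" using f(2) by blast
      then show "\<exists>N. \<forall>n\<ge>N. k \<le> f n" using f(1) le_trans by blast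
    qed
    then have "filterlim (\<lambda>n. real (f n)) at_top sequentially"
      by (rule filterlim_compose[OF filterlim_real_sequentially])
    then show ?thesis
      using tendsto_divide_0[OF tendsto_const] filterlim_at_top_imp_at_infinity by blast
  qed
  show "(\<lambda>n. 1 / real (dhi n)) \<longlonglongrightarrow> 0" "(\<lambda>n. 1 / real (dlo n)) \<longlonglongrightarrow> 0"
    using *[of dhi] *[of dlo] dims_mono dhi_unbounded dlo_unbounded by blast+
qed

lemma wt_tendsto: "(\<lambda>n. fst (wt n) + snd (wt n)) \<longlonglongrightarrow> 0"
proof (rule real_tendsto_sandwich[OF _ _ tendsto_const])
  show "(\<lambda>n. 1 / real (dhi n) + 1 / real (dlo n)) \<longlonglongrightarrow> 0"
    using tendsto_add[OF inverse_dims_tendsto] by simp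
  have "fst (wt n) + snd (wt n) \<le> 1 / real (dhi n) + 1 / real (dlo n)" "0 \<le> fst (wt n) + snd (wt n)" for n
    using wsys_le[OF wsys_wt, of n] wsys_wt by (auto simp: wsys_def intro: add_mono)
  then show "\<forall>\<^sub>F n in sequentially. fst (wt n) + snd (wt n) \<le> 1 / real (dhi n) + 1 / real (dlo n)"
    "\<forall>\<^sub>F n in sequentially. 0 \<le> fst (wt n) + snd (wt n)" by simp_all
qed

lemma mass_le_wt: "mass wt n \<epsilon> \<le> fst (wt n) + snd (wt n)"
  using wsys_wt by (simp add: mass_def wsys_def)

lemma mass_tendsto: "(\<lambda>n. mass wt n \<epsilon>) \<longlonglongrightarrow> 0"
  by (rule real_tendsto_sandwich[OF _ _ tendsto_const wt_tendsto]) (simp_all add: mass_nonneg mass_le_wt)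

text \<open>A vanishing upper mass vanishes at all later levels. At a \<open>Near\<close> level
  without lower splitting this leaves no mass at all: either the next vertex is single, or the upper
  mass is the sum of both masses of the next level.\<close>

lemma wt_fst_pos: "fst (wt n) > 0"
proof (rule ccontr)
  have nn: "0 \<le> fst (wt m)" "0 \<le> snd (wt m)" "wrec wt m" for m using wsys_wt by (auto simp: wsys_def)
  assume "\<not> fst (wt n) > 0"
  then have 0: "fst (wt n) = 0" using nn[of n] by simp
  have z: "fst (wt m) = 0" if "m \<ge> n" for m
    using that
  proof (induction m rule: dec_induct)
    case (step m)
    have "fst (wt (Suc m)) \<le> fst (wt m)"
      using nn(3)[of m] nn(2)[of "Suc m"] unfolding wrec_def by (elim conjE) (simp split: if_splits)
    then show ?case using step.IH nn(1)[of "Suc m"] by linarith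
  qed (use 0 in simp)
  obtain m where m: "m \<ge> n" "shape m = Near" "\<not> split_low m" using ex_not_split_low by blast
  have "shape (Suc m) \<noteq> Single"
  proof
    assume "shape (Suc m) = Single"
    from wsys_Single(2)[OF wsys_wt this] show False using z[of "Suc m"] m(1) dims_pos[of "Suc m"] by simp
  qed
  moreover have "shape (Suc m) = Single" if "\<not> split_up m" using m that by simp
  ultimately have "split_up m" by blast
  then have "snd (wt (Suc m)) = 0" "fst (wt (Suc m)) = 0"
    using z[of m] z[of "Suc m"] nn(3)[of m, unfolded wrec_def, THEN conjunct1] m by simp_all
  then show False using wsys_norm[OF wsys_wt, of "Suc m"] by (simp add: wnorm_def)
qed

text \<open>A vanishing lower mass persists as long as the upper vertex splits at each
  \<open>Near\<close> level. At the next \<open>Near\<close> level where it does not, the lower mass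
  contains the positive upper mass of the following level.\<close>

lemma wt_snd_pos:
  assumes "shape n \<noteq> Single"
  shows "snd (wt n) > 0"
proof (rule ccontr)
  have nn: "0 \<le> fst (wt m)" "0 \<le> snd (wt m)" "wrec wt m" for m using wsys_wt by (auto simp: wsys_def)
  assume "\<not> snd (wt n) > 0"
  then have 0: "snd (wt n) = 0" using nn[of n] by simp
  have z: "snd (wt m) = 0 \<and> shape m \<noteq> Single" if "m \<ge> n" for m
    using that
  proof (induction m rule: dec_induct)
    case (step m)
    have w: "snd (wt m) = (case shape m of Single \<Rightarrow> 0 | Far \<Rightarrow> snd (wt (Suc m))
       | Near \<Rightarrow> snd (wt (Suc m)) + (if split_up m then 0 else fst (wt (Suc m))))"
      using nn(3)[of m] unfolding wrec_def by blast
    have up: "shape m \<noteq> Near \<or> split_up m"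
    proof (rule ccontr)
      assume "\<not> (shape m \<noteq> Near \<or> split_up m)"
      then have "snd (wt m) = snd (wt (Suc m)) + fst (wt (Suc m))" using w by simp
      then show False using step.IH nn(2)[of "Suc m"] wt_fst_pos[of "Suc m"] by linarith
    qed
    show ?case
    proof (cases "shape m")
      case Far
      then have "snd (wt m) = snd (wt (Suc m))" using w by simp
      then show ?thesis using step.IH Far by simp
    next
      case Near
      then have "snd (wt m) = snd (wt (Suc m))" using w up by simp
      then show ?thesis using step.IH Near up by simp
    qed (use step.IH in simp)
  qed (use 0 assms in simp)
  obtain m where m: "m \<ge> n" "shape m = Near" "\<not> split_up m" using ex_not_split_up by blast
  then have "fst (wt (Suc m)) = 0"
    using z[of m] z[of "Suc m"] nn(3)[of m, unfolded wrec_def, THEN conjunct2] by simp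
  then show False using wt_fst_pos[of "Suc m"] by simp
qed

lemma mass_pos: "alive n \<epsilon> \<Longrightarrow> mass wt n \<epsilon> > 0"
  unfolding alive_iff using wt_fst_pos[of n] wt_snd_pos[of n] by (auto simp: mass_def lower_def)

text \<open>The vertices and the right ends of their intervals lie in the ring, so x is never one of
  them.\<close>

lemma proj_iff_alive: "proj \<epsilon> = x \<longleftrightarrow> (\<forall>n. alive n \<epsilon>)"
proof
  assume *: "proj \<epsilon> = x"
  have vz: "vertex n \<epsilon> \<in> Ztau" for n
    by (induction n) (use Ztau_int[of 0] in \<open>auto simp: vertex_Suc intro!: Ztau_add Ztau_diff Ztau_tp\<close>)
  show "\<forall>n. alive n \<epsilon>"
  proof
    fix n
    have "x \<noteq> vertex n \<epsilon>" "x \<noteq> vertex n \<epsilon> + tp n" using vz[of n] irr Ztau_add[OF vz Ztau_tp] by auto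
    then show "alive n \<epsilon>" using *[unfolded proj_eq_iff, rule_format, of n] unfolding alive_def by simp
  qed
qed (use alive_proj in auto)

end

lemma mu_eq_cmeas: "mu x = cmeas"
  using mu_properties(3)[of x cmeas] cmeas_central x_pos x_less_1 by simp

text \<open>Every cylinder around a path over x is alive and so has positive mass; conversely the
  fibre is closed and carries the measure.\<close>

lemma phi_eq:
  assumes "x \<notin> Ztau"
  shows "phi x = {\<epsilon>. proj \<epsilon> = x}"
proof (intro set_eqI iffI)
  interpret cm: prob_space cmeas using cmeas_prob by (simp add: path_prob_def)
  have [simp]: "sets cmeas = sets borel" using cmeas_prob by (simp add: path_prob_def)
  fix \<epsilon> assume "\<epsilon> \<in> {\<epsilon>. proj \<epsilon> = x}"
  then have al: "alive n \<epsilon>" for n using proj_iff_alive[OF assms] by auto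
  show "\<epsilon> \<in> phi x"
    unfolding phi_def supp_def mu_eq_cmeas
  proof (intro CollectI allI impI)
    fix U :: "path set" assume U: "open U \<and> \<epsilon> \<in> U"
    then obtain n where n: "cylinder n \<epsilon> \<subseteq> U" using open_contains_cylinder[of U \<epsilon>] by blast
    have "0 < emeasure cmeas (cylinder n \<epsilon>)"
      using mass_pos[OF assms al] by (simp add: cm.emeasure_eq_measure cmeas_cylinder)
    also have "\<dots> \<le> emeasure cmeas U" using n U by (intro emeasure_mono) auto
    finally show "0 < emeasure cmeas U" .
  qed
next
  interpret cm: prob_space cmeas using cmeas_prob by (simp add: path_prob_def)
  fix \<epsilon> assume e: "\<epsilon> \<in> phi x"
  show "\<epsilon> \<in> {\<epsilon>. proj \<epsilon> = x}"
  proof (rule ccontr)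
    assume "\<epsilon> \<notin> {\<epsilon>. proj \<epsilon> = x}"
    moreover have "open (- {\<epsilon>. proj \<epsilon> = x})" using closed_proj by (simp add: open_Compl)
    ultimately have "0 < emeasure cmeas (- {\<epsilon>. proj \<epsilon> = x})" using e unfolding phi_def supp_def mu_eq_cmeas by blast
    moreover have "AE \<delta> in cmeas. \<delta> \<notin> - {\<epsilon>. proj \<epsilon> = x}" using cmeas_central(2) by (simp add: lives_over_def)
    then have "emeasure cmeas (- {\<epsilon>. proj \<epsilon> = x}) = 0"
      using AE_iff_measurable[of "- {\<epsilon>. proj \<epsilon> = x}" cmeas "\<lambda>\<delta>. \<delta> \<notin> - {\<epsilon>. proj \<epsilon> = x}"] borel_open[OF \<open>open (- {\<epsilon>. proj \<epsilon> = x})\<close>]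
        cmeas_prob path_prob_space[OF cmeas_prob] by (auto simp: path_prob_def)
    ultimately show False by simp
  qed
qed

text \<open>In the ring the levels are finally single with a constant number of paths, so the
  cylinders of the greedy path keep a fixed positive mass. Outside the ring the masses of cylinders
  tend to 0.\<close>

lemma atomless_cmeas: "atomless cmeas \<longleftrightarrow> x \<notin> Ztau"
proof
  interpret cm: prob_space cmeas using cmeas_prob by (simp add: path_prob_def)
  have [simp]: "sets cmeas = sets borel" using cmeas_prob by (simp add: path_prob_def)
  show "x \<notin> Ztau" if "atomless cmeas"
  proof
    assume "x \<in> Ztau"
    then obtain n where n: "\<forall>m\<ge>n. shape m = Single" using eventually_Single by blast
    have dc: "dhi m = dhi n" if "m \<ge> n" for m
      using that by (induction m rule: dec_induct) (use n in \<open>auto simp: dhi_Suc\<close>)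
    have dec: "decseq (\<lambda>m. cylinder m split_up)" by (auto simp: decseq_def cylinder_def)
    have "(\<lambda>m. measure cmeas (cylinder m split_up)) \<longlonglongrightarrow> measure cmeas (\<Inter>m. cylinder m split_up)"
      using dec by (intro cm.finite_Lim_measure_decseq) auto
    moreover have "(\<Inter>m. cylinder m split_up) = {split_up}" by (auto simp: cylinder_def fun_eq_iff)
    moreover have "1 / dhi n \<le> measure cmeas (cylinder m split_up)" if "m \<ge> n" for m
      using wsys_Single(2)[OF wsys_wt, of m] n that dc[OF that]
      by (simp add: cmeas_cylinder mass_upper[OF upper_split_up])
    ultimately have "1 / dhi n \<le> measure cmeas {split_up}"
      by (intro LIMSEQ_le_const[of "\<lambda>m. measure cmeas (cylinder m split_up)"]) auto
    moreover have "emeasure cmeas {split_up} = 0" using that by (simp add: atomless_def)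
    ultimately show False using dims_pos[of n] by (simp add: measure_def)
  qed
  show "atomless cmeas" if "x \<notin> Ztau"
    unfolding atomless_def
  proof
    fix \<epsilon>
    have "measure cmeas {\<epsilon>} \<le> mass wt n \<epsilon>" for n
    proof -
      have "measure cmeas {\<epsilon>} \<le> measure cmeas (cylinder n \<epsilon>)" by (intro cm.finite_measure_mono) auto
      then show ?thesis by (simp add: cmeas_cylinder)
    qed
    then have "measure cmeas {\<epsilon>} \<le> 0"
      by (intro LIMSEQ_le_const[OF mass_tendsto[OF that]]) auto
    then have "measure cmeas {\<epsilon>} = 0" using measure_nonneg[of cmeas "{\<epsilon>}"] by linarith
    then show "emeasure cmeas {\<epsilon>} = 0" by (simp add: cm.emeasure_eq_measure)
  qed
qed

end

lemma not_atomless_return: "\<not> atomless (return borel (\<eta> :: path))"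
  unfolding atomless_def by (auto intro!: exI[of _ \<eta>])

lemma atomless_mu:
  assumes "x \<in> {0..1}"
  shows "atomless (mu x) \<longleftrightarrow> x \<notin> Ztau"
proof -
  consider "x = 0" | "x = 1" | "fibre x" using assms by (force simp: fibre_def)
  then show ?thesis
  proof cases
    case 1
    then have "mu x = return borel (\<lambda>_. False)" using mu_properties(3)[OF assms] central_0(1,2) by simp
    then show ?thesis using not_atomless_return 1 Ztau_int[of 0] by simp
  next
    case 2
    then have "mu x = return borel (\<lambda>_. True)" using mu_properties(3)[OF assms] central_1(1,2) by simp
    then show ?thesis using not_atomless_return 2 Ztau_int[of 1] by simp
  next
    case 3
    then show ?thesis using fibre.mu_eq_cmeas[OF 3] fibre.atomless_cmeas[OF 3] by simp
  qed
qed

subsection \<open>Canonical expansions\<close>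

definition beta :: "real \<Rightarrow> real" where
  "beta y = frac (golden * y)"

lemma canonical_digit_beta: "canonical_digit x k = \<lfloor>golden * (beta ^^ k) x\<rfloor>"
  unfolding canonical_digit_def beta_def ..

lemma beta_bounds: "0 \<le> beta y" "beta y < 1"
  by (simp_all add: beta_def frac_lt_1)

lemma beta_iter_bounds: "x \<in> {0..<1} \<Longrightarrow> (beta ^^ k) x \<in> {0..<1}"
  by (cases k) (auto simp: beta_bounds)

lemma floor_golden:
  assumes "y \<in> {0..<1}"
  shows "\<lfloor>golden * y\<rfloor> = 0 \<or> \<lfloor>golden * y\<rfloor> = 1"
proof -
  have "golden < 2" using golden_eq_tau tau_lt_1 by simp
  then have "golden * y < 2" using assms golden_gt_1 by (smt (verit) atLeastLessThan_iff mult_left_le)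
  moreover have "0 \<le> golden * y" using assms golden_gt_1 by simp
  ultimately show ?thesis by linarith
qed

lemma beta_eq: "beta y = golden * y - of_int \<lfloor>golden * y\<rfloor>"
  by (simp add: beta_def frac_def)

text \<open>The orbit of x stays outside the ring. If the digits vanish from \<open>K\<close> on,
  each step multiplies by \<open>golden\<close>, and boundedness forces the iterate to be 0, which
  lies in the ring.\<close>

lemma canonical_infinite:
  assumes "x \<in> {0..<1}" "x \<notin> Ztau"
  shows "infinite_canonical x"
  unfolding infinite_canonical_def
proof
  assume "finite {k. canonical_digit x k = 1}"
  then obtain K where K: "\<And>k. canonical_digit x k = 1 \<Longrightarrow> k < K" using finite_nat_bounded by blast
  define y where "y k = (beta ^^ k) x" for k
  have yb: "y k \<in> {0..<1}" for k unfolding y_def by (rule beta_iter_bounds[OF assms(1)])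
  have y: "y k \<notin> Ztau" for k
  proof (induction k)
    case (Suc k)
    show ?case
    proof
      assume *: "y (Suc k) \<in> Ztau"
      have "golden * y k = y (Suc k) + of_int \<lfloor>golden * y k\<rfloor>"
        using beta_eq[of "y k"] by (simp add: y_def)
      then have "golden * y k \<in> Ztau"
        using Ztau_add[OF * Ztau_int[of "\<lfloor>golden * y k\<rfloor>"]] by (simp only:)
      then show False using Suc golden_mult_Ztau by blast
    qed
  qed (use assms in \<open>simp add: y_def\<close>)
  have grow: "y (Suc k) = golden * y k" if "k \<ge> K" for k
  proof -
    have "\<lfloor>golden * y k\<rfloor> \<noteq> 1" using K[of k] that by (auto simp: canonical_digit_beta y_def)
    then show ?thesis using floor_golden[OF yb[of k]] beta_eq[of "y k"] by (simp add: y_def)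
  qed
  have "y K \<le> tp i" for i
  proof -
    have "y K = tp i * y (K + i)"
    proof (induction i)
      case (Suc i)
      then show ?case using grow[of "K + i"] golden_tau by (simp add: tp_Suc algebra_simps)
    qed simp
    also have "\<dots> \<le> tp i" using yb[of "K + i"] tp_pos[of i] by (simp add: mult_left_le)
    finally show ?thesis .
  qed
  \<comment> \<open>Any point of (0, 1) gives access to this lemma about fibres; 1/2 is one.\<close>
  then have "y K \<le> 0" using fibre.not_constant_positive[of "1/2" "y K" "\<lambda>i. i"] by (simp add: fibre_def)
  then have "y K = of_int 0" using yb[of K] by simp
  then show False using y[of K] Ztau_int by metis
qed

text \<open>If the orbit never reached 0, its multiple by tau would satisfy the recursion of
  \<open>conjugate_trap\<close>. The value tau would mean an iterate 1, so the iterate is tau, and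
  the next one is 0.\<close>

lemma canonical_finite:
  assumes "x \<in> {0..<1}" "x \<in> Ztau"
  shows "\<not> infinite_canonical x"
proof -
  define y where "y k = (beta ^^ k) x" for k
  have yb: "y k \<in> {0..<1}" for k unfolding y_def by (rule beta_iter_bounds[OF assms(1)])
  have "\<exists>n. y n = 0"
  proof (rule ccontr)
    assume "\<not> (\<exists>n. y n = 0)"
    then have yp: "0 < y n" for n using yb[of n] by (metis atLeastLessThan_iff order_le_less)
    have "\<exists>n. \<forall>m\<ge>n. tau * y m = tau \<or> tau * y m = 1 - tau"
    proof (rule conjugate_trap[where d = "\<lambda>n. of_int \<lfloor>golden * y n\<rfloor>"])
      show "tau * y 0 \<in> Ztau" using assms by (simp add: y_def Ztau_mult_tau)
      show "0 < tau * y n" for n using yp tau_pos by simp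
      show "tau * y n < 1" for n
        using yb[of n] yp[of n] tau_pos tau_lt_1 mult_strict_mono[of tau 1 "y n" 1] by simp
      show "tau * y (Suc n) = golden * (tau * y n) - of_int \<lfloor>golden * y n\<rfloor> * tau" for n
      proof -
        have "y (Suc n) = golden * y n - of_int \<lfloor>golden * y n\<rfloor>" using beta_eq[of "y n"] by (simp add: y_def)
        then show ?thesis by (simp only: right_diff_distrib golden_tau mult.commute)
      qed
      show "real_of_int \<lfloor>golden * y n\<rfloor> = 0 \<or> real_of_int \<lfloor>golden * y n\<rfloor> = 1" for n
        using floor_golden[OF yb[of n]] by auto
    qed
    then obtain n where "tau * y n = tau \<or> tau * y n = 1 - tau" by blast
    moreover have "tau * y n \<noteq> tau" using yb[of n] tau_pos by auto
    moreover have "1 - tau = tau * tau" using tau_sq by (simp add: power2_eq_square)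
    ultimately have "y n = tau" using tau_pos by simp
    then have "y (Suc n) = 0" using golden_tau by (simp add: y_def beta_def)
    then show False using yp[of "Suc n"] by simp
  qed
  then obtain n where n: "y n = 0" by blast
  have "y m = 0" if "m \<ge> n" for m
    using that by (induction m rule: dec_induct) (use n in \<open>auto simp: y_def beta_def\<close>)
  then have "{k. canonical_digit x k = 1} \<subseteq> {..<n}"
    by (auto simp: canonical_digit_beta y_def[symmetric] not_le[symmetric])
  then show ?thesis unfolding infinite_canonical_def using finite_subset by blast
qed

text \<open>The end point 1 is treated apart: its first iterate is tau, a point of the ring below
  1.\<close>

lemma infinite_canonical_iff:
  assumes "x \<in> {0..1}"
  shows "infinite_canonical x \<longleftrightarrow> x \<notin> Ztau"
proof (cases "x = 1")
  case True
  have b1: "beta 1 = tau"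
    unfolding beta_def golden_eq_tau using tau_pos tau_lt_1 by (auto simp: frac_unique_iff)
  have "tau \<in> Ztau" using Ztau_tp[of 1] by simp
  then have "finite {k. canonical_digit tau k = 1}"
    using canonical_finite[of tau] tau_pos tau_lt_1 by (auto simp: infinite_canonical_def)
  moreover have "{k. canonical_digit x k = 1} \<subseteq> insert 0 (Suc ` {k. canonical_digit tau k = 1})"
  proof
    fix k assume k: "k \<in> {k. canonical_digit x k = 1}"
    show "k \<in> insert 0 (Suc ` {k. canonical_digit tau k = 1})"
    proof (cases k)
      case (Suc j)
      then have "(beta ^^ k) x = (beta ^^ j) tau" using True b1 by (simp add: funpow_swap1)
      then show ?thesis using k Suc by (auto simp: canonical_digit_beta)
    qed simp
  qed
  ultimately show ?thesis
    using True Ztau_int[of 1] finite_subset by (auto simp: infinite_canonical_def)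
next
  case False
  then show ?thesis using assms canonical_finite canonical_infinite by auto
qed

subsection \<open>Invariance of the measures under the adic transformation\<close>

lemma splice_eqI: "(\<And>k. k < n \<Longrightarrow> q k = \<delta> k) \<Longrightarrow> (\<And>k. n \<le> k \<Longrightarrow> \<epsilon> k = \<delta> k) \<Longrightarrow> splice n q \<epsilon> = \<delta>"
  by (auto simp: splice_def fun_eq_iff)

text \<open>The first n digits fix the end vertex and the rank of the image at level n, and these
  two fix its first n digits.\<close>

lemma (in fibre) adic_splice:
  assumes "alive n \<epsilon>" "Suc (rk n \<epsilon>) < dim n \<epsilon>" "\<delta> \<in> cylinder n \<epsilon>"
  shows "\<delta> \<in> adic_dom" "adic \<delta> = splice n (adic \<epsilon>) \<delta>"
proof -
  have v: "vertex n \<delta> = vertex n \<epsilon>" using vertex_cylinder[OF assms(3)] by simp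
  have r: "rk n \<delta> = rk n \<epsilon>" using assms(3) by (intro rk_cong) (auto simp: cylinder_def)
  have al: "alive n \<delta>" "Suc (rk n \<delta>) < dim n \<delta>"
    using assms(1,2) alive_cong[OF v] dim_cong[OF v] r by auto
  note d = adic_rk[OF al] and e = adic_rk[OF assms(1,2)]
  show "\<delta> \<in> adic_dom" by (rule d(1))
  have "adic \<epsilon> k = adic \<delta> k" if "k < n" for k
  proof (rule rk_inj[OF _ _ _ that])
    show "alive n (adic \<epsilon>)" using same_alive[OF e(2)] assms(1) by simp
    show "vertex n (adic \<epsilon>) = vertex n (adic \<delta>)" using d(2) e(2) v by (simp add: same_def)
    show "rk n (adic \<epsilon>) = rk n (adic \<delta>)" using d(3) e(3) r by simp
  qed
  then show "adic \<delta> = splice n (adic \<epsilon>) \<delta>"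
    using d(2) by (intro splice_eqI[symmetric]) (auto simp: same_def)
qed

lemma adic_locally_splice:
  assumes "\<epsilon> \<in> adic_dom"
  shows "\<exists>n. \<forall>\<delta>\<in>cylinder n \<epsilon>. \<delta> \<in> adic_dom \<and> adic \<delta> = splice n (adic \<epsilon>) \<delta>"
proof -
  obtain n where n: "same n \<epsilon> (adic \<epsilon>)" using prec_same[OF adic_prec[OF assms]] by blast
  obtain x where "fibre x" and al: "fibre.alive x n \<epsilon>" by (rule ex_fibre)
  interpret fibre x by fact
  have "rk n \<epsilon> < rk n (adic \<epsilon>)" using prec_iff_rk[OF al n] adic_prec[OF assms] by simp
  moreover have "rk n (adic \<epsilon>) < dim n \<epsilon>"
    using rk_less_dim[of n "adic \<epsilon>"] same_alive[OF n] same_dim[OF n] al by simp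
  ultimately have "Suc (rk n \<epsilon>) < dim n \<epsilon>" by simp
  then show ?thesis using adic_splice[OF al] by blast
qed

text \<open>The domain is a countable union of cylinders on each of which the transformation is one
  splice.\<close>

lemma adic_preimage_borel:
  assumes A: "A \<in> sets borel"
  shows "{\<epsilon>\<in>adic_dom. adic \<epsilon> \<in> A} \<in> sets borel"
proof -
  define I where "I = {(n, p). p \<in> words n \<and> (\<forall>\<delta>\<in>cylinder n p. \<delta> \<in> adic_dom) \<and>
    (\<exists>q. \<forall>\<delta>\<in>cylinder n p. adic \<delta> = splice n q \<delta>)}"
  define q where "q n p = (SOME q. \<forall>\<delta>\<in>cylinder n p. adic \<delta> = splice n q \<delta>)" for n p
  have q: "adic \<delta> = splice n (q n p) \<delta>" if "(n, p) \<in> I" "\<delta> \<in> cylinder n p" for n p \<delta>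
  proof -
    have "\<exists>q. \<forall>\<delta>\<in>cylinder n p. adic \<delta> = splice n q \<delta>" using that(1) unfolding I_def by blast
    then have "\<forall>\<delta>\<in>cylinder n p. adic \<delta> = splice n (q n p) \<delta>" unfolding q_def by (rule someI_ex)
    then show ?thesis using that by blast
  qed
  have "I \<subseteq> Sigma UNIV words" by (auto simp: I_def)
  then have cI: "countable I"
    by (rule countable_subset) (intro countable_SIGMA, simp, rule countable_finite, rule finite_words)
  have "{\<epsilon>\<in>adic_dom. adic \<epsilon> \<in> A} = (\<Union>(n, p)\<in>I. cylinder n p \<inter> {\<epsilon>. splice n (q n p) \<epsilon> \<in> A})"
  proof (intro set_eqI iffI)
    fix \<epsilon> assume e: "\<epsilon> \<in> {\<epsilon>\<in>adic_dom. adic \<epsilon> \<in> A}"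
    then obtain n where n: "\<forall>\<delta>\<in>cylinder n \<epsilon>. \<delta> \<in> adic_dom \<and> adic \<delta> = splice n (adic \<epsilon>) \<delta>"
      using adic_locally_splice by blast
    have c: "cylinder n (trunc n \<epsilon>) = cylinder n \<epsilon>" by (rule cylinder_eqI) (simp add: trunc_def)
    have "\<forall>\<delta>\<in>cylinder n (trunc n \<epsilon>). \<delta> \<in> adic_dom"
      "\<exists>q. \<forall>\<delta>\<in>cylinder n (trunc n \<epsilon>). adic \<delta> = splice n q \<delta>"
      unfolding c using n by blast+
    then have i: "(n, trunc n \<epsilon>) \<in> I" unfolding I_def by simp
    have m: "\<epsilon> \<in> cylinder n (trunc n \<epsilon>)" using c by simp
    have "splice n (q n (trunc n \<epsilon>)) \<epsilon> \<in> A" using q[OF i m] e by simp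
    then show "\<epsilon> \<in> (\<Union>(n, p)\<in>I. cylinder n p \<inter> {\<epsilon>. splice n (q n p) \<epsilon> \<in> A})"
      using m by (intro UN_I[OF i]) simp
  next
    fix \<epsilon> assume "\<epsilon> \<in> (\<Union>(n, p)\<in>I. cylinder n p \<inter> {\<epsilon>. splice n (q n p) \<epsilon> \<in> A})"
    then obtain n p where np: "(n, p) \<in> I" "\<epsilon> \<in> cylinder n p" "splice n (q n p) \<epsilon> \<in> A" by auto
    have "\<epsilon> \<in> adic_dom" using np(1,2) unfolding I_def by blast
    moreover have "adic \<epsilon> \<in> A" using q[OF np(1,2)] np(3) by simp
    ultimately show "\<epsilon> \<in> {\<epsilon>\<in>adic_dom. adic \<epsilon> \<in> A}" by simp
  qed
  moreover have "cylinder n p \<inter> {\<epsilon>. splice n q \<epsilon> \<in> A} \<in> sets borel" for n p q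
    using measurable_sets[OF splice_measurable A, of n q] by (simp add: vimage_def)
  then have "(\<Union>(n, p)\<in>I. cylinder n p \<inter> {\<epsilon>. splice n (q n p) \<epsilon> \<in> A}) \<in> sets borel"
    using cI by (intro sets.countable_UN') auto
  ultimately show ?thesis by simp
qed

section \<open>Invariance and strict ergodicity over a point outside the ring\<close>

locale irr_fibre = fibre +
  assumes irr: "x \<notin> Ztau"
begin

sublocale cm: prob_space cmeas
  using cmeas_prob by (simp add: path_prob_def)

lemma sets_cmeas [simp, measurable_cong]: "sets cmeas = sets borel"
  using cmeas_prob by (simp add: path_prob_def)

lemma phi_alive: "phi x = {\<epsilon>. \<forall>n. alive n \<epsilon>}"
  using phi_eq[OF irr] proj_iff_alive[OF irr] by simp

lemma phi_borel [measurable]: "phi x \<in> sets borel"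
  using phi_eq[OF irr] closed_proj by simp

lemma AE_phi: "AE \<epsilon> in cmeas. \<epsilon> \<in> phi x"
  using cmeas_central(2) phi_eq[OF irr] by (simp add: lives_over_def)

definition nonmax :: "nat \<Rightarrow> path set" where
  "nonmax n = {\<epsilon>. alive n \<epsilon> \<and> Suc (rk n \<epsilon>) < dim n \<epsilon>}"

definition nonmin :: "nat \<Rightarrow> path set" where
  "nonmin n = {\<epsilon>. alive n \<epsilon> \<and> 0 < rk n \<epsilon>}"

lemma fin_dep_alive_rk: "fin_dep n {\<epsilon>. alive n \<epsilon> \<and> P (rk n \<epsilon>) (dim n \<epsilon>)}"
proof (rule fin_depI)
  fix \<epsilon> \<delta> assume e: "\<epsilon> \<in> {\<epsilon>. alive n \<epsilon> \<and> P (rk n \<epsilon>) (dim n \<epsilon>)}" and k: "\<And>k. k < n \<Longrightarrow> \<delta> k = \<epsilon> k"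
  have v: "vertex n \<delta> = vertex n \<epsilon>" by (rule vertex_cong) (rule k)
  have "rk n \<delta> = rk n \<epsilon>" by (rule rk_cong) (rule k)
  then show "\<delta> \<in> {\<epsilon>. alive n \<epsilon> \<and> P (rk n \<epsilon>) (dim n \<epsilon>)}"
    using e alive_cong[OF v] dim_cong[OF v] by simp
qed

lemma fin_dep_nonmax: "fin_dep n (nonmax n)"
  unfolding nonmax_def by (rule fin_dep_alive_rk)

lemma fin_dep_nonmin: "fin_dep n (nonmin n)"
  unfolding nonmin_def by (rule fin_dep_alive_rk[where P = "\<lambda>r _. 0 < r"])

text \<open>Each of the at most two alive vertices has only one path of a prescribed rank, so the
  set is covered by two cylinders.\<close>

lemma measure_rank_eq_le:
  "measure cmeas {\<epsilon>. alive n \<epsilon> \<and> rk n \<epsilon> = h (dim n \<epsilon>)} \<le> fst (wt n) + snd (wt n)"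
proof -
  have b: "{\<epsilon>. alive n \<epsilon> \<and> rk n \<epsilon> = h (dim n \<epsilon>)} \<in> sets borel"
    using fin_dep_alive_rk[of n "\<lambda>r d. r = h d"] by blast
  let ?U = "{\<epsilon>. upper n \<epsilon> \<and> rk n \<epsilon> = h (dhi n)}" and ?L = "{\<epsilon>. lower n \<epsilon> \<and> rk n \<epsilon> = h (dlo n)}"
  have cyl: "A \<subseteq> cylinder n \<epsilon>"
    if "\<epsilon> \<in> A" "\<And>\<delta>. \<delta> \<in> A \<Longrightarrow> alive n \<delta> \<and> vertex n \<delta> = vertex n \<epsilon> \<and> rk n \<delta> = rk n \<epsilon>" for A \<epsilon>
  proof
    fix \<delta> assume "\<delta> \<in> A"
    then show "\<delta> \<in> cylinder n \<epsilon>" using rk_inj[of n \<delta> \<epsilon>] that(2) by (auto simp: cylinder_def)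
  qed
  have U: "\<exists>S\<in>sets borel. ?U \<subseteq> S \<and> measure cmeas S \<le> fst (wt n)"
  proof (cases "?U = {}")
    case True
    then show ?thesis using wt_fst_pos[OF irr, of n] by (intro bexI[of _ "{}"]) auto
  next
    case False
    then obtain \<epsilon> where e: "\<epsilon> \<in> ?U" by blast
    then have "?U \<subseteq> cylinder n \<epsilon>" by (intro cyl) (auto simp: alive_iff intro: upper_vertex)
    then show ?thesis using e by (intro bexI[of _ "cylinder n \<epsilon>"]) (auto simp: cmeas_cylinder mass_upper)
  qed
  have L: "\<exists>S\<in>sets borel. ?L \<subseteq> S \<and> measure cmeas S \<le> snd (wt n)"
  proof (cases "?L = {}")
    case True
    then show ?thesis using wsys_wt by (intro bexI[of _ "{}"]) (auto simp: wsys_def)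
  next
    case False
    then obtain \<epsilon> where e: "\<epsilon> \<in> ?L" by blast
    then have "?L \<subseteq> cylinder n \<epsilon>" by (intro cyl) (auto simp: alive_iff intro: lower_vertex)
    then show ?thesis using e by (intro bexI[of _ "cylinder n \<epsilon>"]) (auto simp: cmeas_cylinder mass_lower)
  qed
  obtain S T where ST: "S \<in> sets borel" "T \<in> sets borel" "?U \<subseteq> S" "?L \<subseteq> T"
    "measure cmeas S \<le> fst (wt n)" "measure cmeas T \<le> snd (wt n)"
    using U L by blast
  have "{\<epsilon>. alive n \<epsilon> \<and> rk n \<epsilon> = h (dim n \<epsilon>)} \<subseteq> ?U \<union> ?L"
    using upper_lower_excl by (auto simp: alive_iff dim_def split: if_splits)
  then have "measure cmeas {\<epsilon>. alive n \<epsilon> \<and> rk n \<epsilon> = h (dim n \<epsilon>)} \<le> measure cmeas (S \<union> T)"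
    using ST b by (intro cm.finite_measure_mono) auto
  also have "\<dots> \<le> measure cmeas S + measure cmeas T"
    using ST by (intro measure_Un_le) auto
  finally show ?thesis using ST by linarith
qed

text \<open>Applied with \<open>d - 1\<close> and with 0: almost no path has the largest, or the
  smallest, rank at every level. Hence almost every path has a successor and a predecessor.\<close>

lemma AE_rank_ne: "AE \<epsilon> in cmeas. \<exists>n. rk n \<epsilon> \<noteq> h (dim n \<epsilon>)"
proof -
  let ?S = "\<lambda>n. {\<epsilon>. alive n \<epsilon> \<and> rk n \<epsilon> = h (dim n \<epsilon>)}"
  have S: "?S n \<in> sets borel" for n
    using fin_dep_alive_rk[of n "\<lambda>r d. r = h d"] by blast
  then have b: "(\<Inter>n. ?S n) \<in> sets borel" by blast
  have "measure cmeas (\<Inter>n. ?S n) \<le> fst (wt n) + snd (wt n)" for n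
  proof -
    have "measure cmeas (\<Inter>n. ?S n) \<le> measure cmeas (?S n)"
      using S by (intro cm.finite_measure_mono) auto
    then show ?thesis using measure_rank_eq_le[of n h] by linarith
  qed
  then have "measure cmeas (\<Inter>n. ?S n) \<le> 0"
    by (intro LIMSEQ_le_const[OF wt_tendsto[OF irr]]) blast
  then have "measure cmeas (\<Inter>n. ?S n) = 0" using measure_nonneg[of cmeas "\<Inter>n. ?S n"] by linarith
  then have "(\<Inter>n. ?S n) \<in> null_sets cmeas" using b by (simp add: null_sets_def cm.emeasure_eq_measure)
  then have "AE \<epsilon> in cmeas. \<epsilon> \<notin> (\<Inter>n. ?S n)" by (rule AE_not_in)
  then show ?thesis using AE_phi by eventually_elim (auto simp: phi_alive)
qed

lemma AE_nonmax: "AE \<epsilon> in cmeas. \<exists>n. \<epsilon> \<in> nonmax n"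
  using AE_rank_ne[of "\<lambda>d. d - 1"] AE_phi
proof eventually_elim
  case (elim \<epsilon>)
  then obtain n where "rk n \<epsilon> \<noteq> dim n \<epsilon> - 1" "alive n \<epsilon>" by (auto simp: phi_alive)
  then have "\<epsilon> \<in> nonmax n" using rk_less_dim[of n \<epsilon>] by (auto simp: nonmax_def)
  then show ?case by blast
qed

lemma AE_nonmin: "AE \<epsilon> in cmeas. \<exists>n. \<epsilon> \<in> nonmin n"
  using AE_rank_ne[of "\<lambda>_. 0"] AE_phi
proof eventually_elim
  case (elim \<epsilon>)
  then obtain n where "rk n \<epsilon> \<noteq> 0" "alive n \<epsilon>" by (auto simp: phi_alive)
  then have "\<epsilon> \<in> nonmin n" by (auto simp: nonmin_def)
  then show ?case by blast
qed

lemma AE_adic_dom: "AE \<epsilon> in cmeas. \<epsilon> \<in> adic_dom"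
  using AE_nonmax by eventually_elim (auto simp: nonmax_def intro: adic_rk(1))

lemma bij_betw_adic_words: "bij_betw adic (words n \<inter> nonmax n) (words n \<inter> nonmin n)"
  unfolding bij_betw_def
proof
  show "inj_on adic (words n \<inter> nonmax n)"
    by (rule inj_on_subset[OF adic_inj]) (auto simp: nonmax_def intro: adic_rk(1))
  show "adic ` (words n \<inter> nonmax n) = words n \<inter> nonmin n"
  proof (intro equalityI subsetI)
    fix \<delta> assume "\<delta> \<in> adic ` (words n \<inter> nonmax n)"
    then obtain \<epsilon> where e: "\<delta> = adic \<epsilon>" "\<epsilon> \<in> words n" "alive n \<epsilon>" "Suc (rk n \<epsilon>) < dim n \<epsilon>"
      by (auto simp: nonmax_def)
    note a = adic_rk[OF e(3,4)]
    show "\<delta> \<in> words n \<inter> nonmin n"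
      using a e same_alive[OF a(2)] by (auto simp: nonmin_def words_def same_def)
  next
    fix \<delta> assume d: "\<delta> \<in> words n \<inter> nonmin n"
    then obtain \<epsilon> where e: "\<epsilon> \<in> adic_dom" "adic \<epsilon> = \<delta>" "same n \<epsilon> \<delta>" "rk n \<delta> = Suc (rk n \<epsilon>)"
      using adic_pred[of n \<delta>] by (auto simp: nonmin_def)
    have "\<epsilon> \<in> words n \<inter> nonmax n"
      using d e same_alive[OF e(3)] same_dim[OF e(3)] rk_less_dim[of n \<delta>]
      by (auto simp: nonmin_def nonmax_def words_def same_def)
    then show "\<delta> \<in> adic ` (words n \<inter> nonmax n)" using e(2) by blast
  qed
qed

lemma emeasure_words_split:
  assumes "fin_dep n E" "A \<in> sets borel"
  shows "emeasure cmeas (E \<inter> A) = (\<Sum>p\<in>words n \<inter> E. emeasure cmeas (cylinder n p \<inter> A))"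
proof -
  have "E \<inter> A = (\<Union>p\<in>words n \<inter> E. cylinder n p \<inter> A)"
    using fin_dep_words[OF assms(1)] by blast
  moreover have "disjoint_family_on (\<lambda>p. cylinder n p \<inter> A) (words n \<inter> E)"
    using disjoint_cylinders[of n] by (auto simp: disjoint_family_on_def)
  moreover have "(\<lambda>p. cylinder n p \<inter> A) ` (words n \<inter> E) \<subseteq> sets cmeas"
    using assms(2) by auto
  moreover have "finite (words n \<inter> E)" using finite_words[of n] by simp
  ultimately show ?thesis using sum_emeasure[of "\<lambda>p. cylinder n p \<inter> A" "words n \<inter> E" cmeas] by (simp only:)
qed

text \<open>The transformation maps the words of level n below the largest rank bijectively onto
  those of positive rank, and each of their cylinders is moved by a splice.\<close>

lemma emeasure_adic_piece:
  assumes A: "A \<in> sets borel"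
  shows "emeasure cmeas (nonmax n \<inter> {\<epsilon>\<in>adic_dom. adic \<epsilon> \<in> A}) = emeasure cmeas (nonmin n \<inter> A)"
proof -
  have "emeasure cmeas (nonmax n \<inter> {\<epsilon>\<in>adic_dom. adic \<epsilon> \<in> A}) =
      (\<Sum>p\<in>words n \<inter> nonmax n. emeasure cmeas (cylinder n p \<inter> {\<epsilon>\<in>adic_dom. adic \<epsilon> \<in> A}))"
    by (rule emeasure_words_split[OF fin_dep_nonmax adic_preimage_borel[OF A]])
  also have "\<dots> = (\<Sum>p\<in>words n \<inter> nonmax n. emeasure cmeas (cylinder n (adic p) \<inter> A))"
  proof (rule sum.cong)
    fix p assume "p \<in> words n \<inter> nonmax n"
    then have p: "alive n p" "Suc (rk n p) < dim n p" by (auto simp: nonmax_def)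
    have "cylinder n p \<inter> {\<epsilon>\<in>adic_dom. adic \<epsilon> \<in> A} = cylinder n p \<inter> {\<epsilon>. splice n (adic p) \<epsilon> \<in> A}"
    proof (rule set_eqI)
      fix \<epsilon>
      show "\<epsilon> \<in> cylinder n p \<inter> {\<epsilon>\<in>adic_dom. adic \<epsilon> \<in> A} \<longleftrightarrow> \<epsilon> \<in> cylinder n p \<inter> {\<epsilon>. splice n (adic p) \<epsilon> \<in> A}"
      proof (cases "\<epsilon> \<in> cylinder n p")
        case True
        then show ?thesis using adic_splice[OF p True] by simp
      qed simp
    qed
    moreover have "vertex n p = vertex n (adic p)" using adic_rk(2)[OF p] by (simp add: same_def)
    ultimately show "emeasure cmeas (cylinder n p \<inter> {\<epsilon>\<in>adic_dom. adic \<epsilon> \<in> A}) = emeasure cmeas (cylinder n (adic p) \<inter> A)"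
      using exch_splice[OF cmeas_prob exch_cmeas _ A] by simp
  qed simp
  also have "\<dots> = (\<Sum>q\<in>words n \<inter> nonmin n. emeasure cmeas (cylinder n q \<inter> A))"
    by (rule sum.reindex_bij_betw[OF bij_betw_adic_words])
  also have "\<dots> = emeasure cmeas (nonmin n \<inter> A)"
    by (rule emeasure_words_split[OF fin_dep_nonmin A, symmetric])
  finally show ?thesis .
qed

text \<open>Growth of the sets is asked only inside \<open>phi x\<close>, because a path outside can
  cease to be alive at the next level.\<close>

lemma emeasure_exhaust:
  assumes E: "\<And>n. fin_dep n (E n)" "\<And>n. E n \<inter> phi x \<subseteq> E (Suc n)" "AE \<epsilon> in cmeas. \<exists>n. \<epsilon> \<in> E n"
    and B: "B \<in> sets borel"
  shows "(\<lambda>n. emeasure cmeas (E n \<inter> B)) \<longlonglongrightarrow> emeasure cmeas B"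
proof -
  have m: "E n \<inter> B \<in> sets borel" "E n \<inter> B \<inter> phi x \<in> sets borel" for n
    using E(1) B fin_dep_borel by (auto intro!: sets.Int)
  have "(\<lambda>n. emeasure cmeas (E n \<inter> B \<inter> phi x)) \<longlonglongrightarrow> emeasure cmeas (\<Union>n. E n \<inter> B \<inter> phi x)"
    using m(2) E(2) by (intro Lim_emeasure_incseq incseq_SucI) auto
  moreover have "emeasure cmeas (E n \<inter> B \<inter> phi x) = emeasure cmeas (E n \<inter> B)" for n
    using AE_phi m by (intro emeasure_eq_AE) (auto elim!: eventually_mono)
  moreover have "emeasure cmeas (\<Union>n. E n \<inter> B \<inter> phi x) = emeasure cmeas B"
  proof (rule emeasure_eq_AE)
    show "AE \<epsilon> in cmeas. (\<epsilon> \<in> (\<Union>n. E n \<inter> B \<inter> phi x)) = (\<epsilon> \<in> B)"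
      using AE_phi E(3) by eventually_elim auto
    have "range (\<lambda>n. E n \<inter> B \<inter> phi x) \<subseteq> sets borel" using m(2) by blast
    then have "(\<Union>n. E n \<inter> B \<inter> phi x) \<in> sets borel" by (rule sets.countable_UN)
    then show "(\<Union>n. E n \<inter> B \<inter> phi x) \<in> sets cmeas" by (simp only: sets_cmeas)
  qed (use B in simp)
  ultimately show ?thesis by simp
qed

lemma emeasure_adic_preimage:
  assumes A: "A \<in> sets borel"
  shows "emeasure cmeas {\<epsilon>\<in>adic_dom. adic \<epsilon> \<in> A} = emeasure cmeas A"
proof -
  have "(\<lambda>n. emeasure cmeas (nonmax n \<inter> {\<epsilon>\<in>adic_dom. adic \<epsilon> \<in> A})) \<longlonglongrightarrow> emeasure cmeas {\<epsilon>\<in>adic_dom. adic \<epsilon> \<in> A}"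
  proof (rule emeasure_exhaust[OF fin_dep_nonmax _ AE_nonmax adic_preimage_borel[OF A]])
    show "nonmax n \<inter> phi x \<subseteq> nonmax (Suc n)" for n
    proof
      fix \<epsilon> assume "\<epsilon> \<in> nonmax n \<inter> phi x"
      then show "\<epsilon> \<in> nonmax (Suc n)"
        using Suc_rk_dim_mono[of "Suc n" \<epsilon> n] by (simp add: nonmax_def phi_alive del: rk.simps)
    qed
  qed
  moreover have "(\<lambda>n. emeasure cmeas (nonmin n \<inter> A)) \<longlonglongrightarrow> emeasure cmeas A"
    by (rule emeasure_exhaust[OF fin_dep_nonmin _ AE_nonmin A]) (auto simp: nonmin_def phi_alive)
  ultimately show ?thesis
    unfolding emeasure_adic_piece[OF A] using LIMSEQ_unique by blast
qed

lemma adic_invariant_cmeas: "adic_invariant_measure cmeas"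
  unfolding adic_invariant_measure_def
proof (intro ballI impI)
  fix A :: "path set" assume A: "A \<in> sets borel"
  have "adic -` A \<inter> adic_dom = {\<epsilon>\<in>adic_dom. adic \<epsilon> \<in> A}" by auto
  then show "emeasure cmeas (adic -` A \<inter> adic_dom) = emeasure cmeas A"
    using emeasure_adic_preimage[OF A] by simp
qed

text \<open>The cylinder of the next rank is the exact image of the cylinder of \<epsilon>, so an
  invariant measure gives all initial segments to an alive vertex the same mass. Cylinders that are
  not alive miss \<open>phi x\<close>.\<close>

lemma adic_invariant_exch:
  assumes M: "path_prob M" "emeasure M (phi x) = 1" "adic_invariant_measure M"
  shows "exch M"
  unfolding exch_def
proof (intro allI impI)
  interpret prob_space M using M by (simp add: path_prob_def)
  have [simp]: "sets M = sets borel" using M by (simp add: path_prob_def)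
  have step: "measure M (cylinder n \<epsilon>) = measure M (cylinder n (adic \<epsilon>))"
    if e: "alive n \<epsilon>" "Suc (rk n \<epsilon>) < dim n \<epsilon>" for n \<epsilon>
  proof -
    note a = adic_rk[OF e]
    \<comment> \<open>This also shows that the cylinder lies in the range of the transformation,
      where invariance can be tested.\<close>
    have pred: "\<exists>\<eta>\<in>cylinder n \<epsilon>. \<eta> \<in> adic_dom \<and> adic \<eta> = \<delta>" if d: "\<delta> \<in> cylinder n (adic \<epsilon>)" for \<delta>
    proof -
      have v: "vertex n \<delta> = vertex n \<epsilon>" using vertex_cylinder[OF d, of n] a(2) by (simp add: same_def)
      have r: "rk n \<delta> = Suc (rk n \<epsilon>)" using rk_cong[of n \<delta> "adic \<epsilon>"] d a(3) by (simp add: cylinder_def)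
      have al: "alive n \<delta>" "rk n \<delta> > 0" using alive_cong[OF v] e r by auto
      obtain \<eta> where \<eta>: "\<eta> \<in> adic_dom" "adic \<eta> = \<delta>" "same n \<eta> \<delta>" "rk n \<delta> = Suc (rk n \<eta>)"
        using adic_pred[OF al] by blast
      have "\<eta> k = \<epsilon> k" if "k < n" for k
        using \<eta> v r same_alive[OF \<eta>(3)] al by (intro rk_inj[OF _ _ _ that]) (auto simp: same_def)
      then show ?thesis using \<eta> by (auto simp: cylinder_def)
    qed
    have "adic -` cylinder n (adic \<epsilon>) \<inter> adic_dom = cylinder n \<epsilon>"
    proof (intro equalityI subsetI)
      fix \<eta> assume *: "\<eta> \<in> adic -` cylinder n (adic \<epsilon>) \<inter> adic_dom"
      then obtain \<eta>' where "\<eta>' \<in> cylinder n \<epsilon>" "\<eta>' \<in> adic_dom" "adic \<eta>' = adic \<eta>" using pred by blast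
      then show "\<eta> \<in> cylinder n \<epsilon>" using * inj_onD[OF adic_inj, of \<eta>' \<eta>] by auto
    next
      fix \<eta> assume "\<eta> \<in> cylinder n \<epsilon>"
      from adic_splice[OF e this] show "\<eta> \<in> adic -` cylinder n (adic \<epsilon>) \<inter> adic_dom"
        by (simp add: cylinder_def splice_def)
    qed
    moreover have "cylinder n (adic \<epsilon>) \<subseteq> adic ` adic_dom" using pred by blast
    ultimately have "emeasure M (cylinder n \<epsilon>) = emeasure M (cylinder n (adic \<epsilon>))"
      using M(3) unfolding adic_invariant_measure_def by (metis cylinder_borel)
    then show ?thesis by (simp add: measure_def)
  qed
  have le: "measure M (cylinder n \<epsilon>) = measure M (cylinder n \<delta>)"
    if "alive n \<epsilon>" "same n \<epsilon> \<delta>" "rk n \<epsilon> \<le> rk n \<delta>" for n \<epsilon> \<delta>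
    using that
  proof (induction "rk n \<delta> - rk n \<epsilon>" arbitrary: \<epsilon>)
    case 0
    then show ?case using same_rk_eq[of n \<epsilon> \<delta>] by auto
  next
    case (Suc j)
    have d: "Suc (rk n \<epsilon>) < dim n \<epsilon>"
      using Suc.hyps(2) Suc.prems rk_less_dim[of n \<delta>] same_alive[of n \<epsilon> \<delta>] same_dim[of n \<epsilon> \<delta>] by auto
    note a = adic_rk[OF Suc.prems(1) d]
    have "measure M (cylinder n (adic \<epsilon>)) = measure M (cylinder n \<delta>)"
      using Suc a same_alive[OF a(2)] by (intro Suc.hyps(1)) (auto intro: same_trans same_sym)
    then show ?case using step[OF Suc.prems(1) d] by simp
  qed
  fix n \<epsilon> \<delta> assume v: "vertex n \<epsilon> = vertex n \<delta>"
  show "measure M (cylinder n \<epsilon>) = measure M (cylinder n \<delta>)"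
  proof (cases "alive n \<epsilon>")
    case True
    define \<eta> where "\<eta> = splice n \<delta> \<epsilon>"
    have s: "same n \<epsilon> \<eta>" unfolding \<eta>_def by (rule same_splice[OF cylinder_self v])
    have "cylinder n \<eta> = cylinder n \<delta>" by (rule cylinder_eqI) (simp add: \<eta>_def splice_def)
    moreover have "measure M (cylinder n \<epsilon>) = measure M (cylinder n \<eta>)"
      using le[of n \<epsilon> \<eta>] le[of n \<eta> \<epsilon>] True s same_sym[OF s] same_alive[OF s]
      by (cases "rk n \<epsilon> \<le> rk n \<eta>") auto
    ultimately show ?thesis by simp
  next
    case False
    have "measure M (cylinder n \<eta>) = 0" if "\<not> alive n \<eta>" for \<eta>
    proof -
      have "cylinder n \<eta> \<subseteq> - phi x"
      proof
        fix \<delta> assume "\<delta> \<in> cylinder n \<eta>"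
        then have "vertex n \<delta> = vertex n \<eta>" by (rule vertex_cylinder) simp
        from alive_cong[OF this] that have "\<not> alive n \<delta>" by simp
        then show "\<delta> \<in> - phi x" unfolding phi_alive by blast
      qed
      then have "measure M (cylinder n \<eta>) \<le> measure M (- phi x)"
        by (intro finite_measure_mono) auto
      also have "\<dots> = 0"
      proof -
        have "measure M (phi x) = 1" using M(2) by (simp add: measure_def)
        moreover have "- phi x = space M - phi x" using path_prob_space[OF M(1)] by auto
        ultimately show ?thesis using prob_compl[of "phi x"] by simp
      qed
      finally show ?thesis using measure_nonneg[of M "cylinder n \<eta>"] by linarith
    qed
    then show ?thesis using False v alive_cong[OF v] by simp
  qed
qed

lemma strictly_ergodic_phi: "strictly_ergodic_on (phi x)"
  unfolding strictly_ergodic_on_def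
proof (rule ex1I)
  have "emeasure cmeas (phi x) = 1"
    using AE_phi cm.prob_eq_1[of "phi x"] by (simp add: cm.emeasure_eq_measure)
  then show "path_prob cmeas \<and> emeasure cmeas (phi x) = 1 \<and> adic_invariant_measure cmeas"
    using cmeas_prob adic_invariant_cmeas by blast
  fix M assume M: "path_prob M \<and> emeasure M (phi x) = 1 \<and> adic_invariant_measure M"
  then interpret prob_space M by (simp add: path_prob_def)
  have [simp]: "sets M = sets borel" using M by (simp add: path_prob_def)
  have "exch M" using M adic_invariant_exch by blast
  moreover have "measure M (phi x) = 1" using M by (simp add: measure_def)
  then have "AE \<epsilon> in M. \<epsilon> \<in> phi x" by (intro AE_prob_1)
  then have "lives_over M x" unfolding lives_over_def phi_eq[OF irr] by simp
  ultimately show "M = cmeas" using central_unique M by (simp add: central_iff_exch)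
qed

lemma adic_invariant_phi: "adic_invariant_set (phi x)"
  unfolding phi_eq[OF irr] by (rule adic_invariant_proj)

end

subsection \<open>Even pieces and single vertices\<close>

context irr_fibre
begin

text \<open>Two vertices of level m become one at level \<open>Suc m\<close>. This is the
  counterpart of the end of an even piece.\<close>

definition collapse :: "nat \<Rightarrow> bool" where
  "collapse m \<longleftrightarrow> shape m = Near \<and> \<not> split_up m \<and> \<not> split_low m"

text \<open>The two greedy algorithms differ only in case of equality, which is excluded outside the
  ring.\<close>

lemma gen_remainder_urem: "gen_remainder x n = urem n"
proof (induction n)
  case (Suc n)
  have "weight n \<noteq> urem n" using urem_ne_tp[OF irr, of n "Suc (Suc n)"] by (simp add: weight_tp)
  then show ?case using Suc by (simp add: urem.simps(2) le_less)
qed simp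

lemma gen_canonical_split_up: "gen_canonical x = split_up"
proof
  fix n
  have "weight n \<noteq> urem n" using urem_ne_tp[OF irr, of n "Suc (Suc n)"] by (simp add: weight_tp)
  then show "gen_canonical x n = split_up n"
    unfolding gen_canonical_def gen_remainder_urem split_up_def by (simp add: weight_tp le_less)
qed

text \<open>Without lower splitting the remainder is at least tau^(m+3). Equality is excluded, so
  the next greedy digit is 1.\<close>

lemma collapse_next: "collapse m \<Longrightarrow> split_up (Suc m)"
  using urem_ne_tp[OF irr, of m "Suc (Suc (Suc m))"]
  by (auto simp: collapse_def split_low_def split_up_def[of "Suc m"] urem_Suc)

text \<open>After a digit 1 that leaves two vertices, the shapes run \<open>Far\<close>,
  \<open>Near\<close>, \<open>Far\<close>, ... while zeros follow, so the shape records the parity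
  of the distance to the last 1.\<close>

lemma last_one_before:
  "(shape n = Far \<longrightarrow> (\<exists>i<n. split_up i \<and> (\<forall>j. i < j \<and> j < n \<longrightarrow> \<not> split_up j) \<and> odd (n - i))) \<and>
   (shape n = Near \<longrightarrow> (\<exists>i<n. split_up i \<and> (\<forall>j. i < j \<and> j < n \<longrightarrow> \<not> split_up j) \<and> even (n - i)))"
proof (induction n)
  case (Suc n)
  show ?case
  proof (cases "shape n")
    case Single
    then show ?thesis by (auto intro!: exI[of _ n])
  next
    case Far
    then obtain i where i: "i < n" "split_up i" "\<forall>j. i < j \<and> j < n \<longrightarrow> \<not> split_up j" "odd (n - i)"
      using Suc by auto
    have "\<forall>j. i < j \<and> j < Suc n \<longrightarrow> \<not> split_up j" using i(3) Far_not_split_up[OF Far] by (auto simp: less_Suc_eq)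
    then show ?thesis using Far i by (auto intro!: exI[of _ i] simp: Suc_diff_le)
  next
    case Near
    show ?thesis
    proof (cases "split_up n")
      case True
      then show ?thesis using Near by (auto intro!: exI[of _ n])
    next
      case False
      obtain i where i: "i < n" "split_up i" "\<forall>j. i < j \<and> j < n \<longrightarrow> \<not> split_up j" "even (n - i)"
        using Suc Near by auto
      have "\<forall>j. i < j \<and> j < Suc n \<longrightarrow> \<not> split_up j" using i(3) False by (auto simp: less_Suc_eq)
      then show ?thesis using Near False i by (auto intro!: exI[of _ i] simp: Suc_diff_le)
    qed
  qed
qed simp

text \<open>The shape \<open>Near\<close> makes the number of zeros since the last 1 even, and the
  digit after a collapse is 1.\<close>

lemma collapse_even_piece:
  assumes "collapse m"
  shows "\<exists>i\<in>even_pieces (gen_canonical x). i < m \<and> (\<forall>j. i < j \<and> j \<le> m \<longrightarrow> \<not> split_up j)"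
proof -
  obtain i where i: "i < m" "split_up i" "\<forall>j. i < j \<and> j < m \<longrightarrow> \<not> split_up j" "even (m - i)"
    using last_one_before[of m] assms by (auto simp: collapse_def)
  have z: "\<forall>j. i < j \<and> j \<le> m \<longrightarrow> \<not> split_up j" using i(3) assms by (auto simp: collapse_def le_less)
  obtain l where l: "m = i + 2 * l" using i(1,4) by (metis dvd_def le_add_diff_inverse less_imp_le)
  then have "1 \<le> l" using i(1) by simp
  moreover have "\<forall>j\<in>{1..2 * l}. \<not> split_up (i + j)" using z l by auto
  moreover have "split_up (i + 2 * l + 1)" using collapse_next[OF assms] l by simp
  ultimately have "i \<in> even_pieces (gen_canonical x)"
    using i(2) unfolding gen_canonical_split_up even_pieces_def by blast
  then show ?thesis using i(1) z by blast
qed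

text \<open>The leading 1 leaves shape \<open>Far\<close>. Inside the run of zeros each
  \<open>Near\<close> level has a lower splitting, since a collapse would be followed by a 1. At the
  last zero the shape is \<open>Near\<close>, and the 1 after it excludes a passage to
  \<open>Far\<close>, so there is no splitting at all.\<close>

lemma even_piece_collapse:
  assumes "i \<in> even_pieces (gen_canonical x)"
  shows "\<exists>m>i. collapse m"
proof -
  obtain l where l: "l \<ge> 1" "split_up i" "\<forall>j\<in>{1..2 * l}. \<not> split_up (i + j)" "split_up (i + 2 * l + 1)"
    using assms unfolding gen_canonical_split_up even_pieces_def by blast
  have far: "shape (Suc i) = Far"
  proof (cases "shape i")
    case Single
    show ?thesis
    proof (cases "urem i < tp (Suc i)")
      case False
      \<comment> \<open>If digit 0 at i were impossible, the remainder after the digit 1 would still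
        be above tau^(i+3), and the next digit would be 1 as well.\<close>
      have "\<not> split_up (i + 1)" using l(3)[rule_format, of 1] l(1) by simp
      moreover have "urem (Suc i) \<noteq> tp (Suc (Suc (Suc i)))" by (rule urem_ne_tp[OF irr])
      ultimately show ?thesis using False l(2) by (simp add: split_up_def[of "Suc i"] urem_Suc)
    qed (use Single l in simp)
  next
    case Far
    then show ?thesis using Far_not_split_up l by blast
  qed (use l in simp)
  have near: "j < l \<Longrightarrow> shape (i + 2 + 2 * j) = Near" for j
  proof (induction j)
    case 0
    then show ?case using far by simp
  next
    case (Suc j)
    let ?k = "i + 2 + 2 * j"
    have k: "shape ?k = Near" using Suc by simp
    have "\<not> split_up (i + (2 + 2 * j))" "\<not> split_up (i + (3 + 2 * j))"
      using l(3)[rule_format, of "2 + 2 * j"] l(3)[rule_format, of "3 + 2 * j"] Suc.prems by simp_all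
    then have "\<not> split_up ?k" "\<not> split_up (Suc ?k)" by (simp_all add: numeral_eq_Suc)
    then have "split_low ?k" using collapse_next[of ?k] k by (auto simp: collapse_def)
    then have "shape (Suc (Suc ?k)) = Near" using k by simp
    then show ?case by simp
  qed
  let ?m = "i + 2 * l"
  have m: "?m = i + 2 + 2 * (l - 1)" using l(1) by simp
  have "shape ?m = Near" using near[of "l - 1"] l(1) unfolding m by simp
  moreover have "\<not> split_up ?m" using l(1,3) by auto
  moreover have "\<not> split_low ?m"
  proof
    assume "split_low ?m"
    then have "shape (Suc ?m) = Far" using \<open>shape ?m = Near\<close> by simp
    then show False using Far_not_split_up l(4) by simp
  qed
  ultimately have "collapse ?m" by (simp add: collapse_def)
  then show ?thesis using l(1) by (intro exI[of _ ?m]) simp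
qed

lemma infinite_collapse:
  assumes "infinite (even_pieces (gen_canonical x))"
  shows "\<exists>m\<ge>n. collapse m"
proof -
  obtain i where "i \<ge> n" "i \<in> even_pieces (gen_canonical x)"
    using assms by (auto simp: infinite_nat_iff_unbounded_le)
  then show ?thesis using even_piece_collapse[of i] by (meson le_trans less_imp_le)
qed

text \<open>The digit 1 behind one collapse separates it from the even piece of any later collapse.
  So a collapse after the one at m would have its piece start beyond all even pieces.\<close>

lemma finite_collapse:
  assumes "finite (even_pieces (gen_canonical x))"
  shows "\<exists>n. \<forall>m\<ge>n. \<not> collapse m"
proof -
  obtain N where N: "\<And>i. i \<in> even_pieces (gen_canonical x) \<Longrightarrow> i < N"
    using finite_nat_bounded[OF assms] by auto
  show ?thesis
  proof (cases "\<exists>m\<ge>N. collapse m")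
    case True
    then obtain m where m: "m \<ge> N" "collapse m" by blast
    have "\<not> collapse k" if "k \<ge> Suc m" for k
    proof
      assume k: "collapse k"
      have "k \<noteq> Suc m" using collapse_next[OF m(2)] k by (auto simp: collapse_def)
      obtain i where i: "i \<in> even_pieces (gen_canonical x)" "i < k" "\<forall>j. i < j \<and> j \<le> k \<longrightarrow> \<not> split_up j"
        using collapse_even_piece[OF k] by blast
      have "\<not> (i < Suc m \<and> Suc m \<le> k)" using i(3) collapse_next[OF m(2)] by blast
      then have "Suc m \<le> i" using that by simp
      then show False using N[OF i(1)] m(1) by simp
    qed
    then show ?thesis by blast
  qed blast
qed

lemma no_collapse: "even_pieces (gen_canonical x) = {} \<Longrightarrow> \<not> collapse m"
  using collapse_even_piece by blast

lemma collapse_Single: "collapse m \<Longrightarrow> shape (Suc m) = Single"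
  by (simp add: collapse_def)

lemma dim_Single: "shape n = Single \<Longrightarrow> alive n \<epsilon> \<Longrightarrow> dim n \<epsilon> = dhi n \<and> upper n \<epsilon>"
  by (auto simp: dim_def alive_iff lower_def)

text \<open>At a single vertex only the largest rank needs an argument. If its image had positive
  rank, the image would have a predecessor at the preceding rank; by injectivity this is the path
  itself, whose rank is too large for that.\<close>

lemma rk_adic_Single:
  assumes "\<epsilon> \<in> phi x" "\<epsilon> \<in> adic_dom" "shape n = Single"
  shows "rk n (adic \<epsilon>) = Suc (rk n \<epsilon>) mod dhi n"
proof -
  have al: "alive n \<epsilon>" using assms(1) by (simp add: phi_alive)
  have "adic \<epsilon> \<in> phi x" using assms adic_proj phi_eq[OF irr] by auto
  then have al': "alive n (adic \<epsilon>)" by (simp add: phi_alive)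
  have d: "dim n \<epsilon> = dhi n" "dim n (adic \<epsilon>) = dhi n" using dim_Single[OF assms(3)] al al' by auto
  show ?thesis
  proof (cases "Suc (rk n \<epsilon>) < dhi n")
    case True
    then show ?thesis using adic_rk(3)[OF al] d by simp
  next
    case False
    then have r: "Suc (rk n \<epsilon>) = dhi n" using rk_less_dim[OF al] d by simp
    have "rk n (adic \<epsilon>) = 0"
    proof (rule ccontr)
      assume "rk n (adic \<epsilon>) \<noteq> 0"
      then obtain \<eta> where \<eta>: "\<eta> \<in> adic_dom" "adic \<eta> = adic \<epsilon>" "rk n (adic \<epsilon>) = Suc (rk n \<eta>)"
        using adic_pred[OF al'] by auto
      then have "\<eta> = \<epsilon>" using inj_onD[OF adic_inj] assms(2) by blast
      then show False using \<eta>(3) r rk_less_dim[OF al'] d by simp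
    qed
    then show ?thesis using r by simp
  qed
qed

text \<open>At a single vertex both counts equal \<open>dhi m\<close>, and later steps only add one
  count to the other.\<close>

lemma dims_dvd:
  assumes "shape m = Single" "m \<le> n"
  shows "dhi m dvd dlo n \<and> dhi m dvd dhi n"
  using assms(2)
proof (induction n rule: dec_induct)
  case base
  then show ?case using Single_dims[OF assms(1)] by simp
qed (auto simp: dlo_Suc dhi_Suc)

text \<open>Beyond level m the rank grows by values of \<open>dlo\<close>, which are multiples of
  \<open>dhi m\<close>.\<close>

lemma rk_mod:
  assumes "shape m = Single" "m \<le> n" "alive m \<epsilon>"
  shows "rk n \<epsilon> mod dhi m = rk m \<epsilon>"
  using assms(2)
proof (induction n rule: dec_induct)
  case base
  then show ?case using rk_less_dim[OF assms(3)] dim_Single[OF assms(1,3)] by simp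
next
  case (step n)
  obtain c where "dlo n = dhi m * c" using dims_dvd[OF assms(1) step.hyps(1)] by (auto simp: dvd_def)
  then show ?case using step.IH by simp
qed

lemma mass_Single: "shape n = Single \<Longrightarrow> alive n \<epsilon> \<Longrightarrow> mass wt n \<epsilon> = 1 / dhi n"
  using dim_Single[of n \<epsilon>] wsys_Single(2)[OF wsys_wt, of n] by (simp add: mass_upper)

subsection \<open>Measurability on a fibre\<close>

lemma fibre_measure_eq: "fibre_measure x = restrict_space cmeas (phi x)"
  by (simp add: fibre_measure_def mu_eq_cmeas)

lemma space_fibre [simp]: "space (fibre_measure x) = phi x"
  by (simp add: fibre_measure_eq space_restrict_space)

lemma sets_fibre: "A \<in> sets (fibre_measure x) \<longleftrightarrow> A \<subseteq> phi x \<and> A \<in> sets borel"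
  unfolding fibre_measure_eq by (subst sets_restrict_space_iff) auto

lemma emeasure_fibre: "A \<in> sets (fibre_measure x) \<Longrightarrow> emeasure (fibre_measure x) A = emeasure cmeas A"
  unfolding sets_fibre unfolding fibre_measure_eq by (subst emeasure_restrict_space) auto

lemma prob_space_fibre: "prob_space (fibre_measure x)"
proof
  have "measure cmeas (phi x) = 1" using cm.prob_eq_1[of "phi x"] AE_phi by simp
  then show "emeasure (fibre_measure x) (space (fibre_measure x)) = 1"
    using emeasure_fibre[of "phi x"] by (simp add: sets_fibre cm.emeasure_eq_measure)
qed

lemma AE_fibre: "(AE \<epsilon> in cmeas. P \<epsilon>) \<Longrightarrow> AE \<epsilon> in fibre_measure x. P \<epsilon>"
  unfolding fibre_measure_eq by (subst AE_restrict_space_iff) (auto elim: eventually_mono)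

lemma measurable_from_fibre: "f \<in> borel \<rightarrow>\<^sub>M N \<Longrightarrow> f \<in> fibre_measure x \<rightarrow>\<^sub>M N"
  unfolding fibre_measure_eq by (intro measurable_restrict_space1) (simp cong: measurable_cong_sets)

lemma measurable_to_fibre:
  assumes "f \<in> N \<rightarrow>\<^sub>M borel" "\<And>y. y \<in> space N \<Longrightarrow> f y \<in> phi x"
  shows "f \<in> N \<rightarrow>\<^sub>M fibre_measure x"
  unfolding fibre_measure_eq using assms
  by (intro measurable_restrict_space2) (auto cong: measurable_cong_sets)

lemma distr_fibreI:
  assumes g: "g \<in> N \<rightarrow>\<^sub>M borel" "\<And>y. y \<in> space N \<Longrightarrow> g y \<in> phi x" and d: "distr N borel g = cmeas"
  shows "distr N (fibre_measure x) g = fibre_measure x"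
proof (rule measure_eqI)
  have gf: "g \<in> N \<rightarrow>\<^sub>M fibre_measure x" by (rule measurable_to_fibre[OF g])
  fix A assume "A \<in> sets (distr N (fibre_measure x) g)"
  then have A: "A \<in> sets (fibre_measure x)" "A \<in> sets borel" by (simp_all add: sets_fibre)
  have "emeasure (distr N (fibre_measure x) g) A = emeasure (distr N borel g) A"
    using A by (simp add: emeasure_distr[OF gf] emeasure_distr[OF g(1)])
  then show "emeasure (distr N (fibre_measure x) g) A = emeasure (fibre_measure x) A"
    using emeasure_fibre[OF A(1)] d by simp
qed simp

lemma measurable_to_paths:
  assumes "\<And>k. {y\<in>space N. g y k} \<in> sets N"
  shows "g \<in> N \<rightarrow>\<^sub>M (borel :: path measure)"
proof (rule measurable_sigma_sets[OF sets_borel_cylinders[of 0]])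
  show "g -` A \<inter> space N \<in> sets N" if A: "A \<in> insert {} {cylinder n \<epsilon> |n \<epsilon>. 0 \<le> n}" for A
  proof -
    consider "A = {}" | n \<epsilon> where "A = cylinder n \<epsilon>" using A by blast
    then show ?thesis
    proof cases
      case (2 n \<epsilon>)
      have "{y\<in>space N. g y k = \<epsilon> k} \<in> sets N" for k
      proof (cases "\<epsilon> k")
        case False
        have "{y\<in>space N. \<not> g y k} = space N - {y\<in>space N. g y k}" by auto
        then show ?thesis using assms[of k] False by simp
      qed (use assms[of k] in simp)
      then have "{y\<in>space N. \<forall>k\<in>{..<n}. g y k = \<epsilon> k} \<in> sets N"
        by (intro sets.sets_Collect_finite_All) auto
      moreover have "g -` A \<inter> space N = {y\<in>space N. \<forall>k\<in>{..<n}. g y k = \<epsilon> k}"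
        using 2 by (auto simp: cylinder_def)
      ultimately show ?thesis by simp
    qed simp
  qed
qed auto

lemma fixed_points_borel:
  assumes "h \<in> N \<rightarrow>\<^sub>M (borel :: path measure)" "(\<lambda>y. y) \<in> N \<rightarrow>\<^sub>M (borel :: path measure)"
  shows "{y\<in>space N. h y = y} \<in> sets N"
proof -
  have D: "{\<epsilon> :: path. \<epsilon> k} \<in> sets borel" for k
    by (rule fin_dep_borel[where n = "Suc k"], rule fin_depI) simp
  have A: "{y\<in>space N. h y k} \<in> sets N" "{y\<in>space N. y k} \<in> sets N" for k
    using measurable_sets[OF assms(1) D[of k]] measurable_sets[OF assms(2) D[of k]]
    by (simp_all add: vimage_def Int_def conj_commute)
  have "{y\<in>space N. h y k = y k} =
      ({y\<in>space N. h y k} \<inter> {y\<in>space N. y k}) \<union> ((space N - {y\<in>space N. h y k}) \<inter> (space N - {y\<in>space N. y k}))" for k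
    by auto
  then have B: "{y\<in>space N. h y k = y k} \<in> sets N" for k using A[of k] by simp
  have "{y\<in>space N. h y = y} = {y\<in>space N. \<forall>k. h y k = y k}" by (auto simp: fun_eq_iff)
  also have "\<dots> \<in> sets N" using B by (intro sets.sets_Collect_countable_All) auto
  finally show ?thesis .
qed

text \<open>Only one composite has to be the identity everywhere. The other one is the identity on
  the range of \<open>g\<close>, which has full measure because \<open>g\<close> transports the
  measure of \<open>N\<close> to the fibre.\<close>

lemma adic_isomorphicI:
  assumes g: "g \<in> N \<rightarrow>\<^sub>M borel" "\<And>y. y \<in> space N \<Longrightarrow> g y \<in> phi x" and d: "distr N borel g = cmeas"
    and f: "f \<in> fibre_measure x \<rightarrow>\<^sub>M N" and fg: "\<And>y. y \<in> space N \<Longrightarrow> f (g y) = y"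
    and T: "\<And>\<epsilon>. \<epsilon> \<in> phi x \<Longrightarrow> \<epsilon> \<in> adic_dom \<Longrightarrow> g (f \<epsilon>) = \<epsilon> \<Longrightarrow> f (adic \<epsilon>) = S (f \<epsilon>)"
  shows "adic_isomorphic x N S"
proof -
  let ?F = "fibre_measure x"
  have gf: "g \<in> N \<rightarrow>\<^sub>M ?F" by (rule measurable_to_fibre[OF g])
  have dF: "distr N ?F g = ?F" by (rule distr_fibreI[OF g d])
  have "distr ?F N f = distr (distr N ?F g) N f" using dF by simp
  also have "\<dots> = distr N N (f \<circ> g)" by (rule distr_distr[OF f gf])
  also have "\<dots> = distr N N (\<lambda>y. y)" using fg by (intro distr_cong) auto
  also have "\<dots> = N" by (rule distr_id)
  finally have dN: "distr ?F N f = N" .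
  have fp: "AE \<epsilon> in ?F. g (f \<epsilon>) = \<epsilon>"
  proof -
    have "(\<lambda>\<epsilon>. g (f \<epsilon>)) \<in> ?F \<rightarrow>\<^sub>M borel" using measurable_comp[OF f g(1)] by (simp add: comp_def)
    then have "{\<epsilon>\<in>space ?F. g (f \<epsilon>) = \<epsilon>} \<in> sets ?F"
      by (rule fixed_points_borel[OF _ measurable_from_fibre[OF measurable_ident_sets[OF refl]]])
    then have "(AE \<epsilon> in distr N ?F g. g (f \<epsilon>) = \<epsilon>) \<longleftrightarrow> (AE y in N. g (f (g y)) = g y)"
      by (intro AE_distr_iff[OF gf]) simp
    moreover have "AE y in N. g (f (g y)) = g y" using fg by (intro AE_I2) simp
    ultimately have "AE \<epsilon> in distr N ?F g. g (f \<epsilon>) = \<epsilon>" by blast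
    then show ?thesis unfolding dF .
  qed
  have "AE \<epsilon> in ?F. \<epsilon> \<in> phi x \<inter> adic_dom \<and> f (adic \<epsilon>) = S (f \<epsilon>)"
    using fp AE_fibre[OF AE_adic_dom] AE_space by eventually_elim (auto intro: T)
  then show ?thesis
    unfolding adic_isomorphic_def metrically_isomorphic_def
    using f gf dN dF fp fg by (intro exI[of _ f] exI[of _ g]) auto
qed

text \<open>Cylinders of level n are finite unions of cylinders of a higher level, so it suffices to
  know the masses on a cofinal set of levels.\<close>

lemma cmeas_eqI:
  assumes "path_prob M" and cof: "\<And>n. \<exists>m\<ge>n. L m"
    and eq: "\<And>n \<epsilon>. L n \<Longrightarrow> measure M (cylinder n \<epsilon>) = mass wt n \<epsilon>"
  shows "M = cmeas"
proof (rule central_eqI[OF assms(1) cmeas_prob, where s = 0])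
  fix n \<epsilon>
  obtain m where m: "m \<ge> n" "L m" using cof by blast
  have "fin_dep m (cylinder n \<epsilon>)" using m(1) by (intro fin_depI) (auto simp: cylinder_def)
  then show "measure M (cylinder n \<epsilon>) = measure cmeas (cylinder n \<epsilon>)"
    unfolding measure_fin_dep[OF assms(1) \<open>fin_dep m (cylinder n \<epsilon>)\<close>] measure_fin_dep[OF cmeas_prob \<open>fin_dep m (cylinder n \<epsilon>)\<close>]
    by (simp add: eq[OF m(2)] cmeas_cylinder)
qed

end

subsection \<open>The odometer\<close>

locale odometer_fibre = irr_fibre +
  assumes inf_collapse: "\<And>n. \<exists>m\<ge>n. collapse m"
begin

text \<open>Level 0 and then levels right behind a collapse. All of them have a single vertex, and
  each collapse adds paths, so the quotients \<open>base i\<close> of successive counts are at least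
  2.\<close>

primrec lev :: "nat \<Rightarrow> nat" where
  "lev 0 = 0"
| "lev (Suc i) = Suc (SOME m. m \<ge> lev i \<and> collapse m)"

definition dd :: "nat \<Rightarrow> nat" where "dd i = dhi (lev i)"

definition base :: "nat \<Rightarrow> nat" where "base i = dd (Suc i) div dd i"

lemma lev_Suc: "\<exists>m. lev (Suc i) = Suc m \<and> m \<ge> lev i \<and> collapse m"
  using someI_ex[of "\<lambda>m. m \<ge> lev i \<and> collapse m"] inf_collapse[of "lev i"] by auto

lemma lev_Single: "shape (lev i) = Single"
  using collapse_Single lev_Suc[of "i - 1"] by (cases i) auto

lemma lev_less: "lev i < lev (Suc i)"
  using lev_Suc[of i] by (auto simp del: lev.simps)

lemma lev_mono: "i \<le> j \<Longrightarrow> lev i \<le> lev j"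
  by (rule lift_Suc_mono_le) (simp_all add: less_imp_le lev_less del: lev.simps)

lemma lev_ge: "i \<le> lev i"
proof (induction i)
  case (Suc i)
  then show ?case using lev_less[of i] by linarith
qed simp

lemma dd_pos: "dd i > 0"
  by (simp add: dd_def dims_pos)

lemma dd_0 [simp]: "dd 0 = 1"
  by (simp add: dd_def)

lemma dd_Suc: "dd (Suc i) = dd i * base i"
  using dims_dvd[OF lev_Single lev_mono, of i "Suc i"] by (simp add: dd_def base_def)

lemma base_ge_2: "base i \<ge> 2"
proof -
  obtain m where m: "lev (Suc i) = Suc m" "m \<ge> lev i" "collapse m" using lev_Suc by blast
  have "dhi (Suc m) = dhi m + dlo m" using m(3) by (simp add: dhi_Suc collapse_def)
  then have "dd (Suc i) > dd i"
    unfolding dd_def m(1) using dims_mono(2)[OF m(2)] dims_pos[of m] by linarith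
  then show ?thesis
    unfolding dd_Suc by (cases "base i = 0 \<or> base i = 1") auto
qed

lemma prod_base: "(\<Prod>j<i. base j) = dd i"
  by (induction i) (simp_all add: dd_Suc)

lemma phi_alive_lev: "\<epsilon> \<in> phi x \<longleftrightarrow> (\<forall>i. alive (lev i) \<epsilon>)"
proof
  assume *: "\<forall>i. alive (lev i) \<epsilon>"
  have "alive n \<epsilon>" for n using alive_le[of "lev n" \<epsilon> n] * lev_ge by blast
  then show "\<epsilon> \<in> phi x" by (simp add: phi_alive)
qed (simp add: phi_alive)

lemma rk_lev_less: "alive (lev i) \<epsilon> \<Longrightarrow> rk (lev i) \<epsilon> < dd i"
  using rk_less_dim[of "lev i" \<epsilon>] dim_Single[OF lev_Single] by (simp add: dd_def)

lemma rk_lev_mod: "i \<le> j \<Longrightarrow> alive (lev i) \<epsilon> \<Longrightarrow> rk (lev j) \<epsilon> mod dd i = rk (lev i) \<epsilon>"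
  unfolding dd_def by (rule rk_mod[OF lev_Single lev_mono])

text \<open>Digits of the rank in the mixed radix system with place values
  \<open>dd i\<close>.\<close>

definition odigit :: "path \<Rightarrow> nat \<Rightarrow> nat" where
  "odigit \<epsilon> i = rk (lev (Suc i)) \<epsilon> div dd i"

definition osum :: "(nat \<Rightarrow> nat) \<Rightarrow> nat \<Rightarrow> nat" where
  "osum z i = (\<Sum>j<i. z j * dd j)"

lemma osum_less: "(\<And>j. j < i \<Longrightarrow> z j < base j) \<Longrightarrow> osum z i < dd i"
proof (induction i)
  case (Suc i)
  then have "osum z i < dd i" "Suc (z i) \<le> base i" by (auto simp: Suc_le_eq)
  then have "osum z i + z i * dd i < Suc (z i) * dd i" "Suc (z i) * dd i \<le> base i * dd i"
    by (simp, intro mult_le_mono1)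
  then show ?case by (simp add: osum_def dd_Suc mult.commute)
qed (simp add: osum_def)

lemma osum_mod:
  assumes "i \<le> j" "\<And>k. z k < base k"
  shows "osum z j mod dd i = osum z i"
  using assms(1)
proof (induction j rule: dec_induct)
  case base
  then show ?case using osum_less[of i z] assms(2) by simp
next
  case (step j)
  have "dd i dvd dd j" unfolding dd_def using dims_dvd[OF lev_Single lev_mono[OF step.hyps(1)]] by simp
  then obtain c where "dd j = dd i * c" by (auto simp: dvd_def)
  then have "osum z (Suc j) = osum z j + dd i * (c * z j)" by (simp add: osum_def)
  then show ?case using step.IH by simp
qed

lemma osum_odigit:
  assumes "\<epsilon> \<in> phi x"
  shows "osum (odigit \<epsilon>) i = rk (lev i) \<epsilon>"
proof (induction i)
  case (Suc i)
  have "alive (lev i) \<epsilon>" using assms phi_alive by blast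
  then have "rk (lev (Suc i)) \<epsilon> mod dd i = rk (lev i) \<epsilon>" by (intro rk_lev_mod) simp_all
  then have "rk (lev (Suc i)) \<epsilon> = rk (lev i) \<epsilon> + odigit \<epsilon> i * dd i"
    unfolding odigit_def by (metis add.commute div_mult_mod_eq)
  then show ?case using Suc by (simp add: osum_def)
qed (simp add: osum_def)

lemma odigit_less:
  assumes "\<epsilon> \<in> phi x"
  shows "odigit \<epsilon> i < base i"
proof -
  have "rk (lev (Suc i)) \<epsilon> < dd i * base i"
    using rk_lev_less[of "Suc i" \<epsilon>] assms phi_alive by (auto simp: dd_Suc simp del: lev.simps)
  then show ?thesis unfolding odigit_def using dd_pos[of i] by (simp add: div_less_iff_less_mult mult.commute)
qed

definition oword :: "nat \<Rightarrow> nat \<Rightarrow> path" where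
  "oword i r = (SOME \<epsilon>. alive (lev i) \<epsilon> \<and> rk (lev i) \<epsilon> = r)"

text \<open>Inverse of \<open>odigit\<close>. Digit k is read off at \<open>lev (Suc k)\<close>,
  which exceeds k; any other level above k gives the same digit.\<close>

definition opath :: "(nat \<Rightarrow> nat) \<Rightarrow> path" where
  "opath z k = oword (Suc k) (osum z (Suc k)) k"

lemma oword:
  assumes "r < dd i"
  shows "alive (lev i) (oword i r)" "rk (lev i) (oword i r) = r"
proof -
  obtain \<epsilon> where "upper (lev i) \<epsilon>" using ex_upper by blast
  then have e: "alive (lev i) \<epsilon>" by (simp add: alive_iff)
  then have "r < dim (lev i) \<epsilon>" using dim_Single[OF lev_Single e] assms by (simp add: dd_def)
  then obtain \<delta> where "same (lev i) \<epsilon> \<delta>" "rk (lev i) \<delta> = r" using rk_surj_same[OF e] by blast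
  then have "\<exists>\<delta>. alive (lev i) \<delta> \<and> rk (lev i) \<delta> = r" using e same_alive by blast
  then have "alive (lev i) (oword i r) \<and> rk (lev i) (oword i r) = r"
    unfolding oword_def by (rule someI_ex)
  then show "alive (lev i) (oword i r)" "rk (lev i) (oword i r) = r" by auto
qed

lemma Single_vertex:
  "shape n = Single \<Longrightarrow> alive n \<epsilon> \<Longrightarrow> alive n \<delta> \<Longrightarrow> vertex n \<epsilon> = vertex n \<delta>"
  using dim_Single[of n \<epsilon>] dim_Single[of n \<delta>] upper_vertex by blast

text \<open>Passing to a lower level reduces the rank modulo \<open>dd i\<close>, which is what
  truncation does to the digit sequence.\<close>

lemma opath_oword:
  assumes z: "\<And>j. z j < base j" and k: "k < lev i"
  shows "opath z k = oword i (osum z i) k"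
proof -
  have agree: "oword j (osum z j) k = oword i (osum z i) k" if "i \<le> j" "k < lev i" for i j
  proof (rule rk_inj[OF _ _ _ that(2)])
    have wi: "osum z i < dd i" and wj: "osum z j < dd j" using osum_less z by blast+
    show al: "alive (lev i) (oword j (osum z j))"
      using alive_le[OF oword(1)[OF wj] lev_mono[OF that(1)]] .
    show "vertex (lev i) (oword j (osum z j)) = vertex (lev i) (oword i (osum z i))"
      by (rule Single_vertex[OF lev_Single al oword(1)[OF wi]])
    have "rk (lev i) (oword j (osum z j)) = osum z j mod dd i"
      using rk_lev_mod[OF that(1) al] oword(2)[OF wj] by simp
    also have "\<dots> = osum z i" by (rule osum_mod[OF that(1)]) (rule z)
    finally show "rk (lev i) (oword j (osum z j)) = rk (lev i) (oword i (osum z i))"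
      using oword(2)[OF wi] by simp
  qed
  have k': "k < lev (Suc k)" using lev_ge[of "Suc k"] by simp
  show ?thesis
  proof (cases "i \<le> Suc k")
    case True
    then show ?thesis unfolding opath_def using agree[OF True k] by simp
  next
    case False
    then show ?thesis unfolding opath_def using agree[of "Suc k" i] k' by simp
  qed
qed

lemma opath_phi:
  assumes z: "\<And>j. z j < base j"
  shows "opath z \<in> phi x" "rk (lev i) (opath z) = osum z i"
proof -
  have w: "osum z i < dd i" for i using osum_less z by blast
  have "vertex (lev i) (opath z) = vertex (lev i) (oword i (osum z i))" for i
    by (rule vertex_cong) (rule opath_oword[OF z])
  then have "alive (lev i) (opath z)" for i using oword(1)[OF w] alive_cong by blast
  then show "opath z \<in> phi x" by (simp add: phi_alive_lev)
  have "rk (lev i) (opath z) = rk (lev i) (oword i (osum z i))"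
    by (rule rk_cong) (rule opath_oword[OF z])
  then show "rk (lev i) (opath z) = osum z i" using oword(2)[OF w] by simp
qed

lemma odigit_opath:
  assumes z: "\<And>j. z j < base j"
  shows "odigit (opath z) = z"
proof
  fix i
  have w: "osum z i < dd i" using osum_less z by blast
  show "odigit (opath z) i = z i"
    unfolding odigit_def opath_phi(2)[OF z] using w by (simp add: osum_def)
qed

lemma space_haar: "space (aint_haar base) = {z. \<forall>i. z i < base i}"
  by (auto simp: aint_haar_def space_PiM space_uniform_count_measure PiE_iff)

lemma product_prob_space_base: "product_prob_space (\<lambda>i. uniform_count_measure {..<base i})"
proof -
  have "prob_space (uniform_count_measure {..<base i})" for i
  proof (rule prob_space_uniform_count_measure)
    have "0 \<in> {..<base i}" using base_ge_2[of i] by simp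
    then show "{..<base i} \<noteq> {}" by blast
  qed simp
  then show ?thesis
    unfolding product_prob_space_def product_prob_space_axioms_def product_sigma_finite_def
    by (auto intro: prob_space_imp_sigma_finite)
qed

lemma coordinate_haar:
  "(\<lambda>z. z i) \<in> aint_haar base \<rightarrow>\<^sub>M count_space UNIV"
proof -
  have "(\<lambda>z. z i) \<in> aint_haar base \<rightarrow>\<^sub>M uniform_count_measure {..<base i}"
    unfolding aint_haar_def by (rule measurable_component_singleton) simp
  then have "(\<lambda>z. z i) \<in> aint_haar base \<rightarrow>\<^sub>M count_space {..<base i}"
    by (simp add: measurable_cong_sets[OF refl sets_uniform_count_measure_count_space])
  from measurable_compose[OF this, of "\<lambda>n. n" "count_space UNIV"] show ?thesis by simp
qed

lemma osum_haar: "(\<lambda>z. osum z i) \<in> aint_haar base \<rightarrow>\<^sub>M count_space UNIV"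
proof (induction i)
  case (Suc i)
  have "(\<lambda>z. r + z i * dd i) \<in> aint_haar base \<rightarrow>\<^sub>M count_space UNIV" for r
    using measurable_compose[OF coordinate_haar[of i], of "\<lambda>n. r + n * dd i" "count_space UNIV"] by simp
  from measurable_compose_countable[of "\<lambda>r z. r + z i * dd i", OF this Suc]
  have "(\<lambda>z. osum z i + z i * dd i) \<in> aint_haar base \<rightarrow>\<^sub>M count_space UNIV" .
  then show ?case by (simp add: osum_def)
qed (simp add: osum_def)

lemma opath_measurable: "opath \<in> aint_haar base \<rightarrow>\<^sub>M borel"
proof (rule measurable_to_paths)
  fix k
  have "{z\<in>space (aint_haar base). opath z k} =
      (\<lambda>z. osum z (Suc k)) -` {r. oword (Suc k) r k} \<inter> space (aint_haar base)"
    by (auto simp: opath_def)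
  moreover have "(\<lambda>z. osum z (Suc k)) -` {r. oword (Suc k) r k} \<inter> space (aint_haar base) \<in> sets (aint_haar base)"
    by (rule measurable_sets[OF osum_haar]) simp
  ultimately show "{z\<in>space (aint_haar base). opath z k} \<in> sets (aint_haar base)"
    by (simp only:)
qed

lemma prob_space_haar: "prob_space (aint_haar base)"
proof -
  interpret product_prob_space "\<lambda>i. uniform_count_measure {..<base i}" UNIV
    by (rule product_prob_space_base)
  show ?thesis unfolding aint_haar_def by (rule P.prob_space_axioms)
qed

text \<open>An alive cylinder of level \<open>lev i\<close> amounts to a rank at this level, that is
  to the first i digits. These have probability \<open>1 / dd i\<close>, the mass of the
  cylinder.\<close>

lemma opath_cylinder:
  "emeasure (aint_haar base) (opath -` cylinder (lev i) \<epsilon> \<inter> space (aint_haar base)) = ennreal (mass wt (lev i) \<epsilon>)"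
proof (cases "alive (lev i) \<epsilon>")
  case False
  have "opath -` cylinder (lev i) \<epsilon> \<inter> space (aint_haar base) = {}"
  proof (rule ccontr)
    assume "opath -` cylinder (lev i) \<epsilon> \<inter> space (aint_haar base) \<noteq> {}"
    then obtain z where z: "opath z \<in> cylinder (lev i) \<epsilon>" "\<And>j. z j < base j" by (auto simp: space_haar)
    have "alive (lev i) (opath z)" using opath_phi(1)[OF z(2)] phi_alive by blast
    then show False using False alive_cong[OF vertex_cylinder[OF z(1) order_refl]] by simp
  qed
  then show ?thesis using mass_not_alive[OF False] by simp
next
  case True
  interpret product_prob_space "\<lambda>i. uniform_count_measure {..<base i}" UNIV
    by (rule product_prob_space_base)
  \<comment> \<open>The mixed radix digits of the rank; reduction modulo \<open>base j\<close> keeps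
    them admissible at every index.\<close>
  define d where "d j = (rk (lev i) \<epsilon> div dd j) mod base j" for j
  have b0: "base j > 0" for j using base_ge_2[of j] by simp
  have od: "osum d j = rk (lev i) \<epsilon> mod dd j" for j
  proof (induction j)
    case (Suc j)
    have "rk (lev i) \<epsilon> mod (dd j * base j) = dd j * d j + rk (lev i) \<epsilon> mod dd j"
      unfolding d_def by (rule mod_mult2_eq)
    then show ?case using Suc by (simp add: osum_def dd_Suc mult.commute)
  qed (simp add: osum_def)
  have odi: "osum d i = rk (lev i) \<epsilon>" using od[of i] rk_lev_less[OF True] by simp
  have eq: "opath z \<in> cylinder (lev i) \<epsilon> \<longleftrightarrow> (\<forall>j<i. z j = d j)" if z: "\<And>j. z j < base j" for z
  proof -
    have op: "alive (lev i) (opath z)" "rk (lev i) (opath z) = osum z i"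
      using opath_phi[OF z] phi_alive by auto
    have "opath z \<in> cylinder (lev i) \<epsilon> \<longleftrightarrow> osum z i = osum d i"
    proof
      assume "opath z \<in> cylinder (lev i) \<epsilon>"
      then have "rk (lev i) (opath z) = rk (lev i) \<epsilon>" by (intro rk_cong) (auto simp: cylinder_def)
      then show "osum z i = osum d i" using op odi by simp
    next
      assume "osum z i = osum d i"
      then have "opath z k = \<epsilon> k" if "k < lev i" for k
        using op odi by (intro rk_inj[OF op(1) Single_vertex[OF lev_Single op(1) True] _ that]) simp
      then show "opath z \<in> cylinder (lev i) \<epsilon>" by (simp add: cylinder_def)
    qed
    also have "\<dots> \<longleftrightarrow> (\<forall>j<i. z j = d j)"
    proof
      assume s: "osum z i = osum d i"
      have d: "d j < base j" for j unfolding d_def using b0 by simp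
      show "\<forall>j<i. z j = d j"
      proof (intro allI impI)
        fix j assume "j < i"
        then have j: "j \<le> i" "Suc j \<le> i" by auto
        have "osum z j = osum d j" "osum z (Suc j) = osum d (Suc j)"
          using osum_mod[OF j(1), of z] osum_mod[OF j(1), of d] osum_mod[OF j(2), of z] osum_mod[OF j(2), of d] s z d
          by auto
        then show "z j = d j" using dd_pos[of j] by (simp add: osum_def)
      qed
    next
      assume "\<forall>j<i. z j = d j"
      then show "osum z i = osum d i" unfolding osum_def by (intro sum.cong) auto
    qed
    finally show ?thesis .
  qed
  have "opath -` cylinder (lev i) \<epsilon> \<inter> space (aint_haar base) =
      prod_emb UNIV (\<lambda>i. uniform_count_measure {..<base i}) {..<i} (\<Pi>\<^sub>E j\<in>{..<i}. {d j})"
  proof (intro set_eqI iffI)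
    fix z assume "z \<in> opath -` cylinder (lev i) \<epsilon> \<inter> space (aint_haar base)"
    then have z: "\<And>j. z j < base j" "opath z \<in> cylinder (lev i) \<epsilon>" by (auto simp: space_haar)
    then have "\<forall>j<i. z j = d j" using eq by blast
    then show "z \<in> prod_emb UNIV (\<lambda>i. uniform_count_measure {..<base i}) {..<i} (\<Pi>\<^sub>E j\<in>{..<i}. {d j})"
      using z by (auto simp: prod_emb_def space_uniform_count_measure PiE_iff)
  next
    fix z assume "z \<in> prod_emb UNIV (\<lambda>i. uniform_count_measure {..<base i}) {..<i} (\<Pi>\<^sub>E j\<in>{..<i}. {d j})"
    then have z: "\<And>j. z j < base j" "\<forall>j<i. z j = d j"
      by (auto simp: prod_emb_def space_uniform_count_measure PiE_iff)
    then show "z \<in> opath -` cylinder (lev i) \<epsilon> \<inter> space (aint_haar base)"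
      using eq by (auto simp: space_haar)
  qed
  then have "emeasure (aint_haar base) (opath -` cylinder (lev i) \<epsilon> \<inter> space (aint_haar base)) =
      (\<Prod>j<i. emeasure (uniform_count_measure {..<base j}) {d j})"
    unfolding aint_haar_def using b0
    by (simp only:) (intro emeasure_PiM_emb; auto simp: sets_uniform_count_measure d_def)
  also have "\<dots> = (\<Prod>j<i. ennreal (1 / base j))"
    using b0 by (intro prod.cong) (auto simp: emeasure_uniform_count_measure d_def ennreal_of_nat_eq_real_of_nat divide_ennreal)
  also have "\<dots> = ennreal (1 / dd i)"
    by (simp add: prod_ennreal prod_dividef prod_base[symmetric])
  finally show ?thesis using mass_Single[OF lev_Single True] by (simp add: dd_def)
qed

lemma distr_opath: "distr (aint_haar base) borel opath = cmeas"
proof (rule cmeas_eqI[where L = "\<lambda>n. \<exists>i. n = lev i"])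
  show "path_prob (distr (aint_haar base) borel opath)"
    using prob_space.prob_space_distr[OF prob_space_haar opath_measurable] by (simp add: path_prob_def)
  show "\<exists>m\<ge>n. \<exists>i. m = lev i" for n using lev_ge by blast
  fix n \<epsilon> assume "\<exists>i. n = lev i"
  then obtain i where i: "n = lev i" by blast
  have "emeasure (distr (aint_haar base) borel opath) (cylinder n \<epsilon>) = ennreal (mass wt n \<epsilon>)"
    using opath_cylinder[of i \<epsilon>] by (simp add: emeasure_distr[OF opath_measurable] i)
  then show "measure (distr (aint_haar base) borel opath) (cylinder n \<epsilon>) = mass wt n \<epsilon>"
    using mass_nonneg by (simp add: measure_def)
qed

lemma odigit_measurable: "odigit \<in> fibre_measure x \<rightarrow>\<^sub>M aint_haar base"
  unfolding aint_haar_def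
proof (rule measurable_PiM_single')
  fix i :: nat
  show "(\<lambda>\<epsilon>. odigit \<epsilon> i) \<in> fibre_measure x \<rightarrow>\<^sub>M uniform_count_measure {..<base i}"
  proof (rule measurableI)
    show "odigit \<epsilon> i \<in> space (uniform_count_measure {..<base i})" if "\<epsilon> \<in> space (fibre_measure x)" for \<epsilon>
      using odigit_less that by (simp add: space_uniform_count_measure)
    fix A
    have "fin_dep (lev (Suc i)) {\<epsilon>. rk (lev (Suc i)) \<epsilon> div dd i \<in> A}"
      by (rule fin_dep_fun[where P = "\<lambda>r. r div dd i \<in> A"]) (rule rk_cong)
    then have "{\<epsilon>. odigit \<epsilon> i \<in> A} \<in> sets borel" unfolding odigit_def by blast
    then have "{\<epsilon>. odigit \<epsilon> i \<in> A} \<inter> phi x \<in> sets borel" by (intro sets.Int phi_borel)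
    then show "(\<lambda>\<epsilon>. odigit \<epsilon> i) -` A \<inter> space (fibre_measure x) \<in> sets (fibre_measure x)"
      by (simp add: sets_fibre vimage_def)
  qed
next
  show "odigit \<in> space (fibre_measure x) \<rightarrow> (\<Pi>\<^sub>E i\<in>UNIV. space (uniform_count_measure {..<base i}))"
    using odigit_less by (auto simp: space_uniform_count_measure)
qed

lemma odigit_adic:
  assumes e: "\<epsilon> \<in> phi x" "\<epsilon> \<in> adic_dom"
  shows "odigit (adic \<epsilon>) = aint_shift base (odigit \<epsilon>)"
proof
  fix i
  define v where "v i = rk (lev i) \<epsilon>" for i
  let ?z = "odigit \<epsilon>" and ?one = "aint_of_nat base 1"
  have zl: "?z j < base j" for j by (rule odigit_less[OF e(1)])
  have v: "v (Suc i) = v i + ?z i * dd i" for i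
    using osum_odigit[OF e(1), of "Suc i"] osum_odigit[OF e(1), of i] by (simp add: v_def osum_def)
  have vl: "v i < dd i" for i unfolding v_def using rk_lev_less[of i \<epsilon>] e(1) phi_alive by auto
  have dd_ge: "dd i \<ge> 2" if i: "i > 0" for i
  proof -
    obtain j where j: "i = Suc j" using i gr0_conv_Suc by blast
    have "1 * 2 \<le> dd j * base j" using dd_pos[of j] base_ge_2[of j] by (intro mult_le_mono) auto
    then show ?thesis using j by (simp add: dd_Suc)
  qed
  have dv: "?z i + (v i + 1) div dd i = (v (Suc i) + 1) div dd i" for i
  proof -
    have "v (Suc i) + 1 = v i + 1 + ?z i * dd i" by (simp add: v)
    then show ?thesis using dd_pos[of i] by (simp only: div_mult_self1)
  qed
  \<comment> \<open>The summand 1 enters at index 0 and the carry at later indices. Their sum has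
    the same form at every index, namely whether adding 1 overflows the digits before i.\<close>
  have carry: "?one i + aint_carry base ?z ?one i = (v i + 1) div dd i" for i
  proof (induction i)
    case 0
    have "?one 0 = 1" using base_ge_2[of 0] by (simp add: aint_of_nat_def)
    moreover have "v 0 = 0" using vl[of 0] by simp
    ultimately show ?case by simp
  next
    case (Suc i)
    have "1 div dd (Suc i) = 0" using dd_ge[of "Suc i"] by simp
    then have o: "?one (Suc i) = 0" unfolding aint_of_nat_def prod_base by (simp only: mod_0)
    have "aint_carry base ?z ?one (Suc i) = (?z i + (v i + 1) div dd i) div base i"
      using Suc by (simp add: add.assoc)
    also have "?z i + (v i + 1) div dd i = (v (Suc i) + 1) div dd i"
      by (rule dv)
    also have "\<dots> div base i = (v (Suc i) + 1) div dd (Suc i)"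
      by (simp only: dd_Suc div_mult2_eq)
    finally show ?case using o by simp
  qed
  have "aint_shift base ?z i = (?z i + (v i + 1) div dd i) mod base i"
    unfolding aint_shift_def aint_add_def using carry[of i] by (simp add: add.assoc)
  also have "?z i + (v i + 1) div dd i = (v (Suc i) + 1) div dd i"
    by (rule dv)
  also have "(v (Suc i) + 1) div dd i mod base i = (v (Suc i) + 1) mod dd (Suc i) div dd i"
  proof -
    have "(v (Suc i) + 1) mod (dd i * base i) = dd i * ((v (Suc i) + 1) div dd i mod base i) + (v (Suc i) + 1) mod dd i"
      by (rule mod_mult2_eq)
    then show ?thesis using dd_pos[of i] by (simp add: dd_Suc)
  qed
  also have "(v (Suc i) + 1) mod dd (Suc i) = rk (lev (Suc i)) (adic \<epsilon>)"
    using rk_adic_Single[OF e lev_Single, of "Suc i"] by (simp add: v_def dd_def del: lev.simps)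
  finally have "aint_shift base ?z i = odigit (adic \<epsilon>) i" unfolding odigit_def[of "adic \<epsilon>" i] .
  then show "odigit (adic \<epsilon>) i = aint_shift base ?z i" by (rule sym)
qed

lemma adic_isomorphic_odometer: "adic_isomorphic x (aint_haar base) (aint_shift base)"
proof (rule adic_isomorphicI[OF opath_measurable _ distr_opath odigit_measurable])
  show "opath z \<in> phi x" "odigit (opath z) = z" if "z \<in> space (aint_haar base)" for z
    using that opath_phi(1)[of z] odigit_opath[of z] by (auto simp: space_haar)
qed (rule odigit_adic)

end

subsection \<open>Dense subspaces of square integrable functions\<close>

lemma cmod_add_sq_le: "(cmod (a + b))\<^sup>2 \<le> 2 * (cmod a)\<^sup>2 + 2 * (cmod b)\<^sup>2"
proof -
  have "(cmod (a + b))\<^sup>2 \<le> (cmod a + cmod b)\<^sup>2"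
    by (intro power_mono norm_triangle_ineq) simp
  also have "\<dots> \<le> 2 * (cmod a)\<^sup>2 + 2 * (cmod b)\<^sup>2"
    using zero_le_power2[of "cmod a - cmod b"] by (simp add: power2_eq_square algebra_simps)
  finally show ?thesis .
qed

lemma cnj_measurable [measurable]:
  "g \<in> borel_measurable M \<Longrightarrow> (\<lambda>x. cnj (g x)) \<in> borel_measurable M"
  by (rule measurable_compose[OF _ borel_measurable_continuous_onI[of cnj]])
    (auto intro: continuous_on_cnj continuous_on_id)

text \<open>Density criterion for a linear space \<open>H\<close> of square integrable functions.
  The sets with approximable indicators form a Dynkin class, so a generator closed under
  intersection is enough.\<close>

locale l2_dense = prob_space M for M :: "'a measure" +
  fixes H :: "('a \<Rightarrow> complex) set" and G :: "'a set set"
  assumes H_meas: "h \<in> H \<Longrightarrow> h \<in> borel_measurable M"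
    and H_int: "h \<in> H \<Longrightarrow> integrable M (\<lambda>x. (cmod (h x))\<^sup>2)"
    and H_add: "h \<in> H \<Longrightarrow> k \<in> H \<Longrightarrow> (\<lambda>x. h x + k x) \<in> H"
    and H_scale: "h \<in> H \<Longrightarrow> (\<lambda>x. b * h x) \<in> H"
    and H_one: "(\<lambda>_. 1) \<in> H"
    and G_int: "Int_stable G" and G_sub: "G \<subseteq> Pow (space M)" and G_sets: "sets M = sigma_sets (space M) G"
    and G_ind: "A \<in> G \<Longrightarrow> \<exists>h\<in>H. \<forall>x\<in>space M. h x = indicator A x"
begin

definition L2 :: "('a \<Rightarrow> complex) \<Rightarrow> bool" where
  "L2 f \<longleftrightarrow> f \<in> borel_measurable M \<and> integrable M (\<lambda>x. (cmod (f x))\<^sup>2)"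

text \<open>Membership in the closure of \<open>H\<close> for the norm of mean square.\<close>

definition near :: "('a \<Rightarrow> complex) \<Rightarrow> bool" where
  "near f \<longleftrightarrow> L2 f \<and> (\<forall>e>0. \<exists>h\<in>H. (LINT x|M. (cmod (f x - h x))\<^sup>2) < e)"

lemma L2_add: "L2 f \<Longrightarrow> L2 g \<Longrightarrow> L2 (\<lambda>x. f x + g x)"
proof -
  assume f: "L2 f" and g: "L2 g"
  have [measurable]: "f \<in> borel_measurable M" "g \<in> borel_measurable M" using f g by (simp_all add: L2_def)
  have m: "(\<lambda>x. f x + g x) \<in> borel_measurable M" by measurable
  have "integrable M (\<lambda>x. (cmod (f x + g x))\<^sup>2)"
  proof (rule Bochner_Integration.integrable_bound)
    show "integrable M (\<lambda>x. 2 * (cmod (f x))\<^sup>2 + 2 * (cmod (g x))\<^sup>2)"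
      using f g by (simp add: L2_def)
    show "(\<lambda>x. (cmod (f x + g x))\<^sup>2) \<in> borel_measurable M" using m by measurable
  qed (simp add: cmod_add_sq_le)
  then show ?thesis using m by (simp add: L2_def)
qed

lemma L2_scale: "L2 f \<Longrightarrow> L2 (\<lambda>x. b * f x)"
  by (auto simp: L2_def norm_mult power_mult_distrib)

lemma L2_diff: "L2 f \<Longrightarrow> L2 g \<Longrightarrow> L2 (\<lambda>x. f x - g x)"
  using L2_add[of f "\<lambda>x. -1 * g x"] L2_scale[of g "-1"] by simp

lemma L2_H: "h \<in> H \<Longrightarrow> L2 h"
  using H_meas H_int by (simp add: L2_def)

lemma L2_dist_triangle:
  assumes "L2 f" "L2 g" "L2 h"
  shows "(LINT x|M. (cmod (f x - h x))\<^sup>2) \<le> 2 * (LINT x|M. (cmod (f x - g x))\<^sup>2) + 2 * (LINT x|M. (cmod (g x - h x))\<^sup>2)"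
proof -
  note i = L2_diff[OF assms(1,3)] L2_diff[OF assms(1,2)] L2_diff[OF assms(2,3)]
  have "(LINT x|M. (cmod (f x - h x))\<^sup>2) \<le> (LINT x|M. 2 * (cmod (f x - g x))\<^sup>2 + 2 * (cmod (g x - h x))\<^sup>2)"
  proof (rule integral_mono)
    show "(cmod (f x - h x))\<^sup>2 \<le> 2 * (cmod (f x - g x))\<^sup>2 + 2 * (cmod (g x - h x))\<^sup>2" for x
      using cmod_add_sq_le[of "f x - g x" "g x - h x"] by simp
  qed (use i in \<open>simp_all add: L2_def\<close>)
  also have "\<dots> = 2 * (LINT x|M. (cmod (f x - g x))\<^sup>2) + 2 * (LINT x|M. (cmod (g x - h x))\<^sup>2)"
    using i by (simp add: L2_def)
  finally show ?thesis .
qed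

lemma near_limit:
  assumes "L2 f" "\<And>e. e > 0 \<Longrightarrow> \<exists>g. near g \<and> (LINT x|M. (cmod (f x - g x))\<^sup>2) < e"
  shows "near f"
  unfolding near_def
proof (intro conjI allI impI assms(1))
  fix e :: real assume e: "e > 0"
  obtain g where g: "near g" "(LINT x|M. (cmod (f x - g x))\<^sup>2) < e / 4" using assms(2)[of "e / 4"] e by auto
  obtain h where h: "h \<in> H" "(LINT x|M. (cmod (g x - h x))\<^sup>2) < e / 4"
    using g(1) e unfolding near_def by (meson divide_pos_pos zero_less_numeral)
  have "L2 g" using g by (simp add: near_def)
  from L2_dist_triangle[OF assms(1) this L2_H[OF h(1)]]
  have "(LINT x|M. (cmod (f x - h x))\<^sup>2) < e" using g(2) h(2) e by linarith
  then show "\<exists>h\<in>H. (LINT x|M. (cmod (f x - h x))\<^sup>2) < e" using h(1) by blast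
qed

lemma near_cong:
  assumes "near f" "\<And>x. x \<in> space M \<Longrightarrow> f x = g x"
  shows "near g"
proof -
  have "L2 g"
    using assms unfolding near_def L2_def
    by (metis (mono_tags, lifting) Bochner_Integration.integrable_cong measurable_cong)
  moreover have "(LINT x|M. (cmod (g x - h x))\<^sup>2) = (LINT x|M. (cmod (f x - h x))\<^sup>2)" for h
    using assms(2) by (intro Bochner_Integration.integral_cong) auto
  ultimately show ?thesis using assms(1) by (simp add: near_def)
qed

lemma near_H: "h \<in> H \<Longrightarrow> near h"
  using L2_H by (auto simp: near_def intro!: bexI[of _ h])

lemma near_add:
  assumes "near f" "near g"
  shows "near (\<lambda>x. f x + g x)"
  unfolding near_def
proof (intro conjI allI impI)
  show L: "L2 (\<lambda>x. f x + g x)" using assms L2_add by (simp add: near_def)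
  fix e :: real assume "e > 0"
  then have e: "e / 4 > 0" by simp
  obtain h k where h: "h \<in> H" "(LINT x|M. (cmod (f x - h x))\<^sup>2) < e / 4"
    and k: "k \<in> H" "(LINT x|M. (cmod (g x - k x))\<^sup>2) < e / 4"
    using assms e unfolding near_def by meson
  have Ls: "L2 f" "L2 g" using assms by (simp_all add: near_def)
  have "(LINT x|M. (cmod (f x + g x - (h x + k x)))\<^sup>2) \<le>
      2 * (LINT x|M. (cmod (f x + g x - (h x + g x)))\<^sup>2) + 2 * (LINT x|M. (cmod (h x + g x - (h x + k x)))\<^sup>2)"
    using L L2_add[OF L2_H[OF h(1)] Ls(2)] L2_H[OF H_add[OF h(1) k(1)]] by (rule L2_dist_triangle)
  then have "(LINT x|M. (cmod (f x + g x - (h x + k x)))\<^sup>2) < e" using h k \<open>e > 0\<close> by simp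
  then show "\<exists>h\<in>H. (LINT x|M. (cmod (f x + g x - h x))\<^sup>2) < e"
    by (rule bexI[where x = "\<lambda>x. h x + k x"]) (rule H_add[OF h(1) k(1)])
qed

lemma near_scale:
  assumes "near f"
  shows "near (\<lambda>x. b * f x)"
  unfolding near_def
proof (intro conjI allI impI)
  show "L2 (\<lambda>x. b * f x)" using assms L2_scale by (simp add: near_def)
  fix e :: real assume e: "e > 0"
  define d where "d = (cmod b)\<^sup>2 + 1"
  have d: "d > 0" unfolding d_def by (simp add: add_nonneg_pos)
  then obtain h where h: "h \<in> H" "(LINT x|M. (cmod (f x - h x))\<^sup>2) < e / d"
    using assms e unfolding near_def by (meson divide_pos_pos)
  have "(LINT x|M. (cmod (b * f x - b * h x))\<^sup>2) = (cmod b)\<^sup>2 * (LINT x|M. (cmod (f x - h x))\<^sup>2)"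
    by (simp flip: right_diff_distrib add: norm_mult power_mult_distrib)
  also have "\<dots> \<le> d * (LINT x|M. (cmod (f x - h x))\<^sup>2)"
    by (intro mult_right_mono) (simp_all add: d_def)
  also have "\<dots> < e" using h(2) d by (simp add: pos_less_divide_eq mult.commute)
  finally show "\<exists>h\<in>H. (LINT x|M. (cmod (b * f x - h x))\<^sup>2) < e"
    by (rule bexI[where x = "\<lambda>x. b * h x"]) (rule H_scale[OF h(1)])
qed

lemma near_zero: "near (\<lambda>_. 0)"
  using near_H[OF H_scale[OF H_one, of 0]] by simp

lemma near_sum: "finite I \<Longrightarrow> (\<And>i. i \<in> I \<Longrightarrow> near (f i)) \<Longrightarrow> near (\<lambda>x. \<Sum>i\<in>I. f i x)"
  by (induction I rule: finite_induct) (auto intro: near_add near_zero)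

lemma L2_indicator: "A \<in> sets M \<Longrightarrow> L2 (indicator A)"
proof -
  assume A: "A \<in> sets M"
  have "(\<lambda>x. (cmod (indicator A x))\<^sup>2) = (indicator A :: 'a \<Rightarrow> real)" by (auto simp: indicator_def)
  then show ?thesis using A by (simp add: L2_def less_top[symmetric])
qed

lemma near_indicator:
  assumes "A \<in> sets M"
  shows "near (indicator A)"
proof -
  have AG: "A \<in> sigma_sets (space M) G" using assms G_sets by simp
  show ?thesis
    using G_int G_sub AG
  proof (induction rule: sigma_sets_induct_disjoint)
    case (basic A)
    then obtain h where "h \<in> H" "\<forall>x\<in>space M. h x = indicator A x" using G_ind by blast
    then show ?case using near_cong[OF near_H] by blast
  next
    case empty
    show ?case using near_zero by (simp add: indicator_def)
  next
    case (compl A)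
    have "near (\<lambda>x. 1 + -1 * indicator A x)" by (intro near_add near_scale compl near_H H_one)
    then show ?case by (rule near_cong) (simp add: indicator_def)
  next
    case (union A)
    have A: "A i \<in> sets M" for i using union(2) G_sets by auto
    then have U: "(\<Union>i. A i) \<in> sets M" by auto
    show ?case
    proof (rule near_limit[OF L2_indicator[OF U]])
      fix e :: real assume e: "e > 0"
      define B where "B n = (\<Union>i<n. A i)" for n
      have B: "B n \<in> sets M" for n unfolding B_def using A by auto
      have "(\<lambda>n. measure M (B n)) \<longlonglongrightarrow> measure M (\<Union>n. B n)"
        using B by (intro finite_Lim_measure_incseq incseq_SucI) (auto simp: B_def lessThan_Suc)
      moreover have UB: "(\<Union>n. B n) = (\<Union>i. A i)" by (auto simp: B_def)
      ultimately have "(\<lambda>n. measure M (B n)) \<longlonglongrightarrow> measure M (\<Union>i. A i)" by simp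
      then obtain n where n: "\<bar>measure M (B n) - measure M (\<Union>i. A i)\<bar> < e"
        using e unfolding LIMSEQ_iff by force
      have sub: "B n \<subseteq> (\<Union>i. A i)" by (auto simp: B_def)
      have "near (\<lambda>x. \<Sum>i\<in>{..<n}. indicator (A i) x)" using union.IH by (intro near_sum) auto
      moreover have "(\<Sum>i\<in>{..<n}. indicator (A i) x) = (indicator (B n) x :: complex)" for x
        unfolding B_def using union(1)
        by (intro indicator_UN_disjoint[symmetric]) (auto simp: disjoint_family_on_def)
      ultimately have nB: "near (indicator (B n))" by simp
      have "(\<lambda>x. (cmod (indicator (\<Union>i. A i) x - indicator (B n) x))\<^sup>2) = (indicator ((\<Union>i. A i) - B n) :: 'a \<Rightarrow> real)"
        using sub by (auto simp: indicator_def fun_eq_iff)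
      then have "(LINT x|M. (cmod (indicator (\<Union>i. A i) x - indicator (B n) x))\<^sup>2) = measure M ((\<Union>i. A i) - B n)"
        using U B by (simp add: Int_absorb2 sets.sets_into_space Int_absorb1)
      also have "\<dots> = measure M (\<Union>i. A i) - measure M (B n)"
        using U B sub by (intro finite_measure_Diff) auto
      also have "\<dots> < e" using n by linarith
      finally show "\<exists>g. near g \<and> (LINT x|M. (cmod (indicator (\<Union>i. A i) x - g x))\<^sup>2) < e" using nB by blast
    qed
  qed
qed

lemma near_simple:
  assumes "simple_function M s"
  shows "near s"
proof -
  let ?I = "s ` space M"
  have fin: "finite ?I" using assms by (rule simple_functionD)
  have "near (\<lambda>x. \<Sum>y\<in>?I. y * indicator (s -` {y} \<inter> space M) x)"
    using assms by (intro near_sum fin near_scale near_indicator simple_functionD(2))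
  then show ?thesis
  proof (rule near_cong)
    fix x assume x: "x \<in> space M"
    have "(\<Sum>y\<in>?I. y * indicator (s -` {y} \<inter> space M) x) = (\<Sum>y\<in>?I. if y = s x then y else 0)"
      using x by (intro sum.cong) (auto simp: indicator_def)
    also have "\<dots> = s x" using fin x by simp
    finally show "(\<Sum>y\<in>?I. y * indicator (s -` {y} \<inter> space M) x) = s x" .
  qed
qed

text \<open>Simple functions bounded by 2|f| converge to f pointwise, and 9|f|^2 dominates the
  squared differences.\<close>

lemma near_L2:
  assumes f: "L2 f"
  shows "near f"
proof (rule near_limit[OF f])
  fix e :: real assume e: "e > 0"
  have fm: "f \<in> borel_measurable M" using f by (simp add: L2_def)
  obtain s where s: "\<And>i. simple_function M (s i)" "\<And>x. x \<in> space M \<Longrightarrow> (\<lambda>i. s i x) \<longlonglongrightarrow> f x"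
    "\<And>i x. x \<in> space M \<Longrightarrow> dist (s i x) 0 \<le> 2 * dist (f x) 0"
    using borel_measurable_implies_sequence_metric[OF fm, of 0] by metis
  have sm: "s i \<in> borel_measurable M" for i using s(1) by (rule borel_measurable_simple_function)
  have "(\<lambda>i. LINT x|M. (cmod (f x - s i x))\<^sup>2) \<longlonglongrightarrow> (LINT x|M. 0)"
  proof (rule integral_dominated_convergence)
    show "integrable M (\<lambda>x. 9 * (cmod (f x))\<^sup>2)" using f by (simp add: L2_def)
    show "(\<lambda>x. (cmod (f x - s i x))\<^sup>2) \<in> borel_measurable M" for i using fm sm by measurable
    have "(\<lambda>i. (cmod (f x - s i x))\<^sup>2) \<longlonglongrightarrow> 0" if "x \<in> space M" for x
      using tendsto_power[OF tendsto_norm[OF tendsto_diff[OF tendsto_const s(2)[OF that]]], of "f x" 2] by simp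
    then show "AE x in M. (\<lambda>i. (cmod (f x - s i x))\<^sup>2) \<longlonglongrightarrow> 0" by (intro AE_I2)
    show "AE x in M. norm ((cmod (f x - s i x))\<^sup>2) \<le> 9 * (cmod (f x))\<^sup>2" for i
    proof (intro AE_I2)
      fix x assume "x \<in> space M"
      then have "cmod (f x - s i x) \<le> 3 * cmod (f x)"
        using s(3)[of x i] norm_triangle_ineq4[of "f x" "s i x"] by simp
      then have "(cmod (f x - s i x))\<^sup>2 \<le> (3 * cmod (f x))\<^sup>2" by (intro power_mono) simp_all
      then show "norm ((cmod (f x - s i x))\<^sup>2) \<le> 9 * (cmod (f x))\<^sup>2" by (simp add: power_mult_distrib)
    qed
  qed simp
  then have lim: "(\<lambda>i. LINT x|M. (cmod (f x - s i x))\<^sup>2) \<longlonglongrightarrow> 0" by simp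
  obtain i where "(LINT x|M. (cmod (f x - s i x))\<^sup>2) < e"
    using order_tendstoD(2)[OF lim e] unfolding eventually_sequentially by blast
  then show "\<exists>g. near g \<and> (LINT x|M. (cmod (f x - g x))\<^sup>2) < e" using near_simple[OF s(1)] by blast
qed

end

subsection \<open>The spectrum of the odometer\<close>

text \<open>A geometric sum; |k - j| < N keeps its ratio away from 1 unless k = j.\<close>

lemma sum_roots_of_unity:
  assumes "k < N" "j < N"
  shows "(\<Sum>r<N. cis (2 * pi * real r * (real k - real j) / real N)) = (if k = j then of_nat N else 0)"
proof (cases "k = j")
  case False
  define \<omega> where "\<omega> = cis (2 * pi * (real k - real j) / real N)"
  have pw: "\<omega> ^ r = cis (2 * pi * real r * (real k - real j) / real N)" for r
  proof -
    have "\<omega> ^ r = cis (real r * (2 * pi * (real k - real j) / real N))" unfolding \<omega>_def by (rule Complex.DeMoivre)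
    then show ?thesis by (simp add: mult.assoc mult.left_commute)
  qed
  have "\<omega> ^ N = cis (2 * pi * real N * (real k - real j) / real N)" by (rule pw)
  also have "\<dots> = cis (2 * pi * (real k - real j))"
    by (rule arg_cong[of _ _ cis]) (use assms in simp)
  also have "\<dots> = 1" by (rule cis_multiple_2pi) simp
  finally have N: "\<omega> ^ N = 1" .
  have "\<omega> \<noteq> 1"
  proof
    assume "\<omega> = 1"
    then have "cos (2 * pi * (real k - real j) / real N) = 1" by (simp add: \<omega>_def complex_eq_iff)
    then obtain n :: int where "2 * pi * (real k - real j) / real N = of_int n * 2 * pi"
      unfolding cos_one_2pi_int by blast
    then have "(2 * pi) * (real k - real j) = (2 * pi) * (of_int n * real N)"
      using assms by (simp add: divide_simps)
    then have "real k - real j = of_int n * real N" by (subst (asm) mult_cancel_left) simp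
    then have n: "int k - int j = n * int N" by (metis of_int_diff of_int_eq_iff of_int_mult of_int_of_nat_eq)
    have "n = 0"
    proof (rule ccontr)
      assume "n \<noteq> 0"
      then have "1 * int N \<le> \<bar>n\<bar> * int N" by (intro mult_right_mono) auto
      then have "int N \<le> \<bar>int k - int j\<bar>" using n by (simp add: abs_mult)
      then show False using assms by linarith
    qed
    then show False using n False by simp
  qed
  then have "(\<Sum>r<N. \<omega> ^ r) = 0" using geometric_sum[of \<omega> N] N by simp
  then show ?thesis using False by (simp add: pw)
qed simp

context irr_fibre
begin

text \<open>The transformation completed by the identity off its domain. It preserves the measure of
  the fibre as a total map, so integrals can be transformed along it.\<close>

definition radic :: "path \<Rightarrow> path" where
  "radic \<epsilon> = (if \<epsilon> \<in> adic_dom then adic \<epsilon> else \<epsilon>)"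

lemma adic_dom_borel: "adic_dom \<in> sets borel"
  using adic_preimage_borel[of UNIV] by simp

lemma radic_phi: "\<epsilon> \<in> phi x \<Longrightarrow> radic \<epsilon> \<in> phi x"
  using adic_proj phi_eq[OF irr] by (auto simp: radic_def)

lemma radic_preimage: "radic -` A = {\<epsilon>\<in>adic_dom. adic \<epsilon> \<in> A} \<union> (A - adic_dom)"
  by (auto simp: radic_def split: if_splits)

lemma radic_borel: "A \<in> sets borel \<Longrightarrow> radic -` A \<in> sets borel"
  unfolding radic_preimage using adic_preimage_borel adic_dom_borel by auto

lemma radic_measurable: "radic \<in> fibre_measure x \<rightarrow>\<^sub>M fibre_measure x"
proof (rule measurableI)
  fix A assume "A \<in> sets (fibre_measure x)"
  then show "radic -` A \<inter> space (fibre_measure x) \<in> sets (fibre_measure x)"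
    using radic_borel[of A] phi_borel by (auto simp: sets_fibre)
qed (use radic_phi in simp)

lemma distr_radic: "distr (fibre_measure x) (fibre_measure x) radic = fibre_measure x"
proof (rule measure_eqI)
  fix A assume "A \<in> sets (distr (fibre_measure x) (fibre_measure x) radic)"
  then have A: "A \<in> sets (fibre_measure x)" "A \<in> sets borel" by (simp_all add: sets_fibre)
  have r: "radic -` A \<inter> phi x \<in> sets (fibre_measure x)"
    using measurable_sets[OF radic_measurable A(1)] by simp
  have "emeasure (distr (fibre_measure x) (fibre_measure x) radic) A = emeasure cmeas (radic -` A \<inter> phi x)"
    using A r by (simp add: emeasure_distr[OF radic_measurable] emeasure_fibre)
  also have "\<dots> = emeasure cmeas {\<epsilon>\<in>adic_dom. adic \<epsilon> \<in> A}"
  proof (rule emeasure_eq_AE)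
    show "AE \<epsilon> in cmeas. (\<epsilon> \<in> radic -` A \<inter> phi x) = (\<epsilon> \<in> {\<epsilon>\<in>adic_dom. adic \<epsilon> \<in> A})"
      using AE_phi AE_adic_dom by eventually_elim (simp add: radic_def)
  qed (use r adic_preimage_borel[OF A(2)] in \<open>simp_all add: sets_fibre\<close>)
  also have "\<dots> = emeasure (fibre_measure x) A"
    using emeasure_adic_preimage[OF A(2)] emeasure_fibre[OF A(1)] by simp
  finally show "emeasure (distr (fibre_measure x) (fibre_measure x) radic) A = emeasure (fibre_measure x) A" .
qed simp

lemma integral_radic:
  fixes f :: "path \<Rightarrow> complex"
  assumes "f \<in> borel_measurable (fibre_measure x)"
  shows "(LINT \<epsilon>|fibre_measure x. f (radic \<epsilon>)) = (LINT \<epsilon>|fibre_measure x. f \<epsilon>)"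
  using integral_distr[OF radic_measurable assms] distr_radic by simp

end

context odometer_fibre
begin

abbreviation F where "F \<equiv> fibre_measure x"

sublocale F: prob_space F
  by (rule prob_space_fibre)

text \<open>Modulus 1 is demanded at every path so that products with square integrable functions
  are integrable.\<close>

definition eig :: "complex \<Rightarrow> (path \<Rightarrow> complex) \<Rightarrow> bool" where
  "eig c g \<longleftrightarrow> eigenfunction F (phi x \<inter> adic_dom) adic c g \<and> (\<exists>q\<in>\<rat>. c = cis (2 * pi * q)) \<and>
     (\<forall>\<epsilon>. cmod (g \<epsilon>) = 1)"

text \<open>The linear span of these eigenfunctions, generated one summand at a time to allow
  induction.\<close>

inductive_set trig :: "(path \<Rightarrow> complex) set" where
  zero: "(\<lambda>_. 0) \<in> trig"
| step: "h \<in> trig \<Longrightarrow> eig c g \<Longrightarrow> (\<lambda>\<epsilon>. h \<epsilon> + b * g \<epsilon>) \<in> trig"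

text \<open>The characters of the cyclic group of order \<open>dd i\<close>, evaluated at the
  rank.\<close>

definition chi :: "nat \<Rightarrow> nat \<Rightarrow> path \<Rightarrow> complex" where
  "chi i r \<epsilon> = cis (2 * pi * real r * real (rk (lev i) \<epsilon>) / real (dd i))"

lemma chi_measurable: "chi i r \<in> borel_measurable F"
proof (rule measurable_from_fibre, rule measurableI)
  fix A :: "complex set"
  have "fin_dep (lev i) {\<epsilon>. cis (2 * pi * real r * real (rk (lev i) \<epsilon>) / real (dd i)) \<in> A}"
    by (rule fin_dep_fun[where P = "\<lambda>k. cis (2 * pi * real r * real k / real (dd i)) \<in> A"]) (rule rk_cong)
  then have "{\<epsilon>. chi i r \<epsilon> \<in> A} \<in> sets borel" unfolding chi_def by blast
  then show "chi i r -` A \<inter> space borel \<in> sets borel" by (simp add: vimage_def)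
qed simp

lemma chi_adic:
  assumes "\<epsilon> \<in> phi x" "\<epsilon> \<in> adic_dom"
  shows "chi i r (adic \<epsilon>) = cis (2 * pi * (real r / real (dd i))) * chi i r \<epsilon>"
proof -
  let ?N = "dd i" and ?k = "rk (lev i) \<epsilon>"
  have N: "real ?N \<noteq> 0" using dd_pos[of i] by simp
  have "real (Suc ?k) = real ?N * real (Suc ?k div ?N) + real (Suc ?k mod ?N)"
    by (metis of_nat_add of_nat_mult mult_div_mod_eq)
  then have "2 * pi * real r * real (Suc ?k) / real ?N =
      2 * pi * (real r * real (Suc ?k div ?N)) + 2 * pi * real r * real (Suc ?k mod ?N) / real ?N"
    using N by (simp add: field_simps)
  then have "cis (2 * pi * real r * real (Suc ?k) / real ?N) =
      cis (2 * pi * (real r * real (Suc ?k div ?N))) * cis (2 * pi * real r * real (Suc ?k mod ?N) / real ?N)"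
    by (simp only: cis_mult)
  moreover have "cis (2 * pi * (real r * real (Suc ?k div ?N))) = 1"
    by (rule cis_multiple_2pi) (simp add: Ints_mult)
  moreover have "rk (lev i) (adic \<epsilon>) = Suc ?k mod ?N"
    using rk_adic_Single[OF assms lev_Single] by (simp add: dd_def)
  ultimately have "chi i r (adic \<epsilon>) = cis (2 * pi * real r * real (Suc ?k) / real ?N)"
    by (simp add: chi_def)
  also have "2 * pi * real r * real (Suc ?k) / real ?N = 2 * pi * (real r / real ?N) + 2 * pi * real r * real ?k / real ?N"
    using N by (simp add: field_simps)
  finally show ?thesis unfolding chi_def by (simp only: cis_mult)
qed

lemma eig_chi: "eig (cis (2 * pi * (real r / real (dd i)))) (chi i r)"
proof -
  have n1: "cmod (chi i r \<epsilon>) = 1" for \<epsilon> by (simp add: chi_def)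
  have "chi i r \<epsilon> \<noteq> 0" for \<epsilon> by (simp add: chi_def)
  then have "\<not> (AE \<epsilon> in F. chi i r \<epsilon> = 0)" by simp
  moreover have "AE \<epsilon> in F. \<epsilon> \<in> phi x \<inter> adic_dom \<and> chi i r (adic \<epsilon>) = cis (2 * pi * (real r / real (dd i))) * chi i r \<epsilon>"
    using AE_fibre[OF AE_adic_dom] AE_space
  proof eventually_elim
    case (elim \<epsilon>)
    then show ?case using chi_adic[of \<epsilon> i r] by simp
  qed
  moreover have "\<exists>q\<in>\<rat>. cis (2 * pi * (real r / real (dd i))) = cis (2 * pi * q)"
    by (rule bexI[of _ "real r / real (dd i)"]) simp_all
  moreover have "integrable F (\<lambda>\<epsilon>. (cmod (chi i r \<epsilon>))\<^sup>2)" by (simp add: n1)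
  ultimately show ?thesis
    unfolding eig_def eigenfunction_def by (intro conjI allI n1 chi_measurable)
qed

lemma trig_add: "k \<in> trig \<Longrightarrow> h \<in> trig \<Longrightarrow> (\<lambda>\<epsilon>. h \<epsilon> + k \<epsilon>) \<in> trig"
proof (induction rule: trig.induct)
  case (step k c g b)
  have "(\<lambda>\<epsilon>. (h \<epsilon> + k \<epsilon>) + b * g \<epsilon>) \<in> trig" using step by (intro trig.step) auto
  then show ?case by (simp add: add.assoc)
qed simp

lemma trig_scale: "h \<in> trig \<Longrightarrow> (\<lambda>\<epsilon>. a * h \<epsilon>) \<in> trig"
proof (induction rule: trig.induct)
  case (step h c g b)
  have "(\<lambda>\<epsilon>. a * h \<epsilon> + (a * b) * g \<epsilon>) \<in> trig" using step by (intro trig.step)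
  then show ?case by (simp add: algebra_simps)
qed (simp add: trig.zero)

lemma trig_eig: "eig c g \<Longrightarrow> (\<lambda>\<epsilon>. b * g \<epsilon>) \<in> trig"
  using trig.step[OF trig.zero, of c g b] by simp

lemma trig_sum: "finite I \<Longrightarrow> (\<And>i. i \<in> I \<Longrightarrow> f i \<in> trig) \<Longrightarrow> (\<lambda>\<epsilon>. \<Sum>i\<in>I. f i \<epsilon>) \<in> trig"
  by (induction I rule: finite_induct) (auto intro: trig_add trig.zero)

lemma trig_bounded: "h \<in> trig \<Longrightarrow> h \<in> borel_measurable F \<and> (\<exists>B. \<forall>\<epsilon>. cmod (h \<epsilon>) \<le> B)"
proof (induction rule: trig.induct)
  case (step h c g b)
  then obtain B where B: "\<And>\<epsilon>. cmod (h \<epsilon>) \<le> B" by blast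
  have "cmod (h \<epsilon> + b * g \<epsilon>) \<le> B + cmod b" for \<epsilon>
    using norm_triangle_ineq[of "h \<epsilon>" "b * g \<epsilon>"] B[of \<epsilon>] step.hyps(2) by (simp add: eig_def norm_mult)
  moreover have [measurable]: "h \<in> borel_measurable F" "g \<in> borel_measurable F"
    using step by (simp_all add: eig_def eigenfunction_def)
  moreover have "(\<lambda>\<epsilon>. h \<epsilon> + b * g \<epsilon>) \<in> borel_measurable F" by measurable
  ultimately show ?case by blast
qed auto

text \<open>Fourier inversion on the cyclic group of order \<open>dd i\<close>.\<close>

lemma trig_indicator_rank:
  assumes "j < dd i"
  shows "\<exists>h\<in>trig. \<forall>\<epsilon>\<in>phi x. h \<epsilon> = of_bool (rk (lev i) \<epsilon> = j)"
proof -
  let ?N = "dd i"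
  let ?h = "\<lambda>\<epsilon>. \<Sum>r<?N. (cis (- (2 * pi * real r * real j / real ?N)) / of_nat ?N) * chi i r \<epsilon>"
  have 1: "?h \<in> trig" by (intro trig_sum trig_eig[OF eig_chi]) simp
  have 2: "?h \<epsilon> = of_bool (rk (lev i) \<epsilon> = j)" if "\<epsilon> \<in> phi x" for \<epsilon>
  proof -
    let ?k = "rk (lev i) \<epsilon>"
    have k: "?k < ?N" using rk_lev_less that phi_alive by blast
    have "?h \<epsilon> = (\<Sum>r<?N. cis (2 * pi * real r * (real ?k - real j) / real ?N) / of_nat ?N)"
      unfolding chi_def by (intro sum.cong refl) (simp add: cis_mult diff_divide_distrib right_diff_distrib)
    also have "\<dots> = (\<Sum>r<?N. cis (2 * pi * real r * (real ?k - real j) / real ?N)) / of_nat ?N"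
      by (rule sum_divide_distrib[symmetric])
    also have "\<dots> = of_bool (?k = j)"
      unfolding sum_roots_of_unity[OF k assms] using dd_pos[of i] by simp
    finally show ?thesis .
  qed
  show ?thesis
  proof (rule bexI[OF _ 1], rule ballI)
    fix \<epsilon> assume "\<epsilon> \<in> phi x"
    then show "?h \<epsilon> = of_bool (rk (lev i) \<epsilon> = j)" by (rule 2)
  qed
qed

text \<open>Since n is at most \<open>lev n\<close>, the rank at \<open>lev n\<close> determines the
  first n digits, so the cylinder is a finite union of sets of constant rank.\<close>

lemma trig_indicator_cylinder: "\<exists>h\<in>trig. \<forall>\<epsilon>\<in>phi x. h \<epsilon> = indicator (phi x \<inter> cylinder n \<delta>) \<epsilon>"
proof -
  let ?J = "rk (lev n) ` (phi x \<inter> cylinder n \<delta>)"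
  have J: "j < dd n" if "j \<in> ?J" for j using that rk_lev_less phi_alive by auto
  then have fin: "finite ?J" using finite_subset[of ?J "{..<dd n}"] by auto
  have "\<forall>j\<in>?J. \<exists>h\<in>trig. \<forall>\<epsilon>\<in>phi x. h \<epsilon> = of_bool (rk (lev n) \<epsilon> = j)"
    using trig_indicator_rank J by blast
  then obtain h where h: "\<And>j. j \<in> ?J \<Longrightarrow> h j \<in> trig"
    "\<And>j \<epsilon>. j \<in> ?J \<Longrightarrow> \<epsilon> \<in> phi x \<Longrightarrow> h j \<epsilon> = of_bool (rk (lev n) \<epsilon> = j)" by metis
  have 1: "(\<lambda>\<epsilon>. \<Sum>j\<in>?J. h j \<epsilon>) \<in> trig" using h(1) by (intro trig_sum fin)
  have 2: "(\<Sum>j\<in>?J. h j \<epsilon>) = indicator (phi x \<inter> cylinder n \<delta>) \<epsilon>" if e: "\<epsilon> \<in> phi x" for \<epsilon>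
  proof -
    have "(\<Sum>j\<in>?J. h j \<epsilon>) = (\<Sum>j\<in>?J. if j = rk (lev n) \<epsilon> then 1 else 0)"
      using h(2) e by (intro sum.cong) auto
    also have "\<dots> = of_bool (rk (lev n) \<epsilon> \<in> ?J)" using fin by simp
    also have "rk (lev n) \<epsilon> \<in> ?J \<longleftrightarrow> \<epsilon> \<in> cylinder n \<delta>"
    proof
      assume "rk (lev n) \<epsilon> \<in> ?J"
      then obtain \<eta> where \<eta>: "\<eta> \<in> phi x" "\<eta> \<in> cylinder n \<delta>" "rk (lev n) \<epsilon> = rk (lev n) \<eta>" by auto
      have al: "alive (lev n) \<epsilon>" "alive (lev n) \<eta>" using e \<eta>(1) phi_alive by auto
      have "\<epsilon> k = \<eta> k" if "k < n" for k
        using that lev_ge[of n] by (intro rk_inj[OF al(1) Single_vertex[OF lev_Single al] \<eta>(3)]) simp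
      then show "\<epsilon> \<in> cylinder n \<delta>" using \<eta>(2) by (simp add: cylinder_def)
    qed (use e in auto)
    finally show ?thesis using e by (simp add: indicator_def)
  qed
  show ?thesis
  proof (rule bexI[OF _ 1], rule ballI)
    fix \<epsilon> assume "\<epsilon> \<in> phi x"
    then show "(\<Sum>j\<in>?J. h j \<epsilon>) = indicator (phi x \<inter> cylinder n \<delta>) \<epsilon>" by (rule 2)
  qed
qed

lemma sets_fibre_cylinders:
  "sets F = sigma_sets (phi x) ((\<inter>) (phi x) ` insert {} {cylinder n \<epsilon> | n \<epsilon>. 0 \<le> n})"
proof -
  have "sets F = (\<inter>) (phi x) ` sets borel"
    unfolding fibre_measure_eq sets_restrict_space by simp
  also have "\<dots> = (\<inter>) (phi x) ` sigma_sets UNIV (insert {} {cylinder n \<epsilon> | n \<epsilon>. 0 \<le> n})"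
    using sets_borel_cylinders[of 0] by simp
  also have "\<dots> = sigma_sets (phi x) ((\<inter>) (phi x) ` insert {} {cylinder n \<epsilon> | n \<epsilon>. 0 \<le> n})"
    using phi_borel sets_borel_cylinders[of 0] by (intro sigma_sets_Int) simp_all
  finally show ?thesis .
qed

sublocale l2_dense F trig "(\<inter>) (phi x) ` insert {} {cylinder n \<epsilon> | n \<epsilon>. 0 \<le> n}"
proof
  show "h \<in> borel_measurable F" if "h \<in> trig" for h using trig_bounded[OF that] by blast
  show "integrable F (\<lambda>\<epsilon>. (cmod (h \<epsilon>))\<^sup>2)" if ht: "h \<in> trig" for h
  proof -
    obtain B where B: "\<And>\<epsilon>. cmod (h \<epsilon>) \<le> B" using trig_bounded[OF ht] by blast
    have "h \<in> borel_measurable F" using trig_bounded[OF ht] by blast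
    then show ?thesis
      using B by (intro F.integrable_const_bound[of _ "B\<^sup>2"]) (auto intro!: AE_I2 power_mono)
  qed
  show "(\<lambda>\<epsilon>. h \<epsilon> + k \<epsilon>) \<in> trig" if "h \<in> trig" "k \<in> trig" for h k using trig_add that by blast
  show "(\<lambda>\<epsilon>. b * h \<epsilon>) \<in> trig" if "h \<in> trig" for b h using trig_scale that by blast
  show "(\<lambda>_. 1) \<in> trig" using trig_eig[OF eig_chi[of 0 0], of 1] by (simp add: chi_def)
  show "Int_stable ((\<inter>) (phi x) ` insert {} {cylinder n \<epsilon> | n \<epsilon>. 0 \<le> n})"
  proof (rule Int_stableI)
    fix A B assume "A \<in> (\<inter>) (phi x) ` insert {} {cylinder n \<epsilon> | n \<epsilon>. 0 \<le> n}"
      "B \<in> (\<inter>) (phi x) ` insert {} {cylinder n \<epsilon> | n \<epsilon>. 0 \<le> n}"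
    then obtain C D where C: "C \<in> insert {} {cylinder n \<epsilon> | n \<epsilon>. 0 \<le> n}" "A = phi x \<inter> C"
      and D: "D \<in> insert {} {cylinder n \<epsilon> | n \<epsilon>. 0 \<le> n}" "B = phi x \<inter> D" by blast
    have "C \<inter> D \<in> insert {} {cylinder n \<epsilon> | n \<epsilon>. 0 \<le> n}"
      using Int_stableD[OF Int_stable_cylinders C(1) D(1)] .
    moreover have "A \<inter> B = phi x \<inter> (C \<inter> D)" using C D by auto
    ultimately show "A \<inter> B \<in> (\<inter>) (phi x) ` insert {} {cylinder n \<epsilon> | n \<epsilon>. 0 \<le> n}" by blast
  qed
  show "(\<inter>) (phi x) ` insert {} {cylinder n \<epsilon> | n \<epsilon>. 0 \<le> n} \<subseteq> Pow (space F)" by auto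
  show "sets F = sigma_sets (space F) ((\<inter>) (phi x) ` insert {} {cylinder n \<epsilon> | n \<epsilon>. 0 \<le> n})"
    using sets_fibre_cylinders by simp
  fix A assume "A \<in> (\<inter>) (phi x) ` insert {} {cylinder n \<epsilon> | n \<epsilon>. 0 \<le> n}"
  then consider "A = {}" | n \<delta> where "A = phi x \<inter> cylinder n \<delta>" by blast
  then show "\<exists>h\<in>trig. \<forall>\<epsilon>\<in>space F. h \<epsilon> = indicator A \<epsilon>"
  proof cases
    case 1
    then show ?thesis using trig.zero by (intro bexI[of _ "\<lambda>_. 0"]) auto
  next
    case 2
    then show ?thesis using trig_indicator_cylinder by simp
  qed
qed

lemma trig_combination:
  "h \<in> trig \<Longrightarrow> \<exists>(n::nat) c g b. (\<forall>i<n. eigenfunction F (phi x \<inter> adic_dom) adic (c i) (g i)) \<and>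
     h = (\<lambda>\<epsilon>. \<Sum>i<n. b i * g i \<epsilon>)"
proof (induction rule: trig.induct)
  case zero
  then show ?case by (intro exI[of _ 0]) auto
next
  case (step h c' g' b')
  then obtain n :: nat and c g b where IH: "\<forall>i<n. eigenfunction F (phi x \<inter> adic_dom) adic (c i) (g i)"
    "h = (\<lambda>\<epsilon>. \<Sum>i<n. b i * g i \<epsilon>)" by blast
  have "\<forall>i<Suc n. eigenfunction F (phi x \<inter> adic_dom) adic ((c(n := c')) i) ((g(n := g')) i)"
    using IH(1) step.hyps(2) by (auto simp: less_Suc_eq eig_def)
  moreover have "(\<lambda>\<epsilon>. h \<epsilon> + b' * g' \<epsilon>) = (\<lambda>\<epsilon>. \<Sum>i<Suc n. (b(n := b')) i * (g(n := g')) i \<epsilon>)"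
    unfolding IH(2) by simp
  ultimately show ?case by blast
qed

lemma purely_discrete: "purely_discrete_spectrum F (phi x \<inter> adic_dom) adic"
  unfolding purely_discrete_spectrum_def
proof (intro allI impI)
  fix f :: "path \<Rightarrow> complex" and e :: real
  assume "f \<in> borel_measurable F \<and> integrable F (\<lambda>x. (cmod (f x))\<^sup>2)" "e > 0"
  then obtain h where h: "h \<in> trig" "(LINT \<epsilon>|F. (cmod (f \<epsilon> - h \<epsilon>))\<^sup>2) < e"
    using near_L2[of f] by (auto simp: L2_def near_def)
  obtain n :: nat and c g b where "\<forall>i<n. eigenfunction F (phi x \<inter> adic_dom) adic (c i) (g i)"
    "h = (\<lambda>\<epsilon>. \<Sum>i<n. b i * g i \<epsilon>)" using trig_combination[OF h(1)] by blast
  then show "\<exists>(n::nat) c g b. (\<forall>i<n. eigenfunction F (phi x \<inter> adic_dom) adic (c i) (g i)) \<and>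
      (LINT \<epsilon>|F. (cmod (f \<epsilon> - (\<Sum>i<n. b i * g i \<epsilon>)))\<^sup>2) < e"
    using h(2) by blast
qed

lemma L2_times_bounded:
  assumes "L2 f" "g \<in> borel_measurable F" "\<And>\<epsilon>. cmod (g \<epsilon>) \<le> B"
  shows "integrable F (\<lambda>\<epsilon>. f \<epsilon> * cnj (g \<epsilon>))"
proof (rule Bochner_Integration.integrable_bound)
  show "integrable F (\<lambda>\<epsilon>. (1 + (cmod (f \<epsilon>))\<^sup>2) * B)" using assms(1) by (simp add: L2_def)
  have [measurable]: "f \<in> borel_measurable F" "g \<in> borel_measurable F" using assms by (simp_all add: L2_def)
  show "(\<lambda>\<epsilon>. f \<epsilon> * cnj (g \<epsilon>)) \<in> borel_measurable F" by measurable
  have "cmod (f \<epsilon>) \<le> 1 + (cmod (f \<epsilon>))\<^sup>2" for \<epsilon>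
    using zero_le_power2[of "cmod (f \<epsilon>) - 1 / 2"] by (simp add: power2_eq_square algebra_simps)
  then have "cmod (f \<epsilon>) * cmod (g \<epsilon>) \<le> (1 + (cmod (f \<epsilon>))\<^sup>2) * B" for \<epsilon>
    using assms(3)[of \<epsilon>] by (intro mult_mono) (auto simp: add_nonneg_nonneg)
  then show "AE \<epsilon> in F. norm (f \<epsilon> * cnj (g \<epsilon>)) \<le> norm ((1 + (cmod (f \<epsilon>))\<^sup>2) * B)"
    by (intro AE_I2) (auto simp: norm_mult intro: order_trans[OF _ abs_ge_self])
qed

text \<open>Invariance of the measure multiplies the inner product by \<open>c * cnj c'\<close>. As
  c' has modulus 1 and differs from c, this factor is not 1.\<close>

lemma eig_orthogonal:
  assumes f: "eigenfunction F (phi x \<inter> adic_dom) adic c f" and g: "eig c' g" and ne: "c \<noteq> c'"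
  shows "(LINT \<epsilon>|F. f \<epsilon> * cnj (g \<epsilon>)) = 0"
proof -
  let ?I = "LINT \<epsilon>|F. f \<epsilon> * cnj (g \<epsilon>)"
  have [measurable]: "f \<in> borel_measurable F" "g \<in> borel_measurable F" using f g by (auto simp: eig_def eigenfunction_def)
  have m': "(\<lambda>\<epsilon>. f \<epsilon> * cnj (g \<epsilon>)) \<in> borel_measurable F" by measurable
  have "AE \<epsilon> in F. \<epsilon> \<in> phi x \<inter> adic_dom \<and> f (adic \<epsilon>) = c * f \<epsilon>"
    "AE \<epsilon> in F. \<epsilon> \<in> phi x \<inter> adic_dom \<and> g (adic \<epsilon>) = c' * g \<epsilon>"
    using f g by (auto simp: eig_def eigenfunction_def)
  then have ae: "AE \<epsilon> in F. f (radic \<epsilon>) * cnj (g (radic \<epsilon>)) = c * cnj c' * (f \<epsilon> * cnj (g \<epsilon>))"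
    by eventually_elim (auto simp: radic_def)
  have "?I = (LINT \<epsilon>|F. f (radic \<epsilon>) * cnj (g (radic \<epsilon>)))" using integral_radic[OF m'] by simp
  also have "\<dots> = (LINT \<epsilon>|F. c * cnj c' * (f \<epsilon> * cnj (g \<epsilon>)))"
  proof (rule integral_cong_AE[OF _ _ ae])
    show "(\<lambda>\<epsilon>. f (radic \<epsilon>) * cnj (g (radic \<epsilon>))) \<in> borel_measurable F"
      using measurable_compose[OF radic_measurable m'] .
  qed (use m' in simp)
  also have "\<dots> = c * cnj c' * ?I" by simp
  finally have "(c * cnj c' - 1) * ?I = 0" by (simp add: algebra_simps)
  moreover have "c * cnj c' \<noteq> 1"
  proof
    assume *: "c * cnj c' = 1"
    have "cnj c' * c' = 1" using g by (auto simp: eig_def cis_cnj cis_mult)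
    then have "c = c * (cnj c' * c')" by simp
    also have "\<dots> = c'" using * by (simp add: mult.assoc[symmetric])
    finally show False using ne by simp
  qed
  ultimately show ?thesis by simp
qed

text \<open>An eigenfunction with any other eigenvalue is orthogonal to \<open>trig\<close>, so its
  distance to \<open>trig\<close> is at least its own norm, against density.\<close>

lemma rational: "rational_spectrum F (phi x \<inter> adic_dom) adic"
  unfolding rational_spectrum_def
proof (intro allI impI, rule ccontr)
  fix c f assume f: "eigenfunction F (phi x \<inter> adic_dom) adic c f" and no: "\<not> (\<exists>r\<in>\<rat>. c = cis (2 * pi * r))"
  have Lf: "L2 f" using f by (simp add: eigenfunction_def L2_def)
  have orth: "(LINT \<epsilon>|F. f \<epsilon> * cnj (h \<epsilon>)) = 0" if "h \<in> trig" for h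
    using that
  proof (induction rule: trig.induct)
    case (step h c' g b)
    have ne: "c \<noteq> c'" using step.hyps(2) no by (auto simp: eig_def)
    obtain B where B: "\<And>\<epsilon>. cmod (h \<epsilon>) \<le> B" "h \<in> borel_measurable F" using trig_bounded[OF step.hyps(1)] by blast
    have i: "integrable F (\<lambda>\<epsilon>. f \<epsilon> * cnj (h \<epsilon>))" by (rule L2_times_bounded[OF Lf B(2,1)])
    have "g \<in> borel_measurable F" "\<And>\<epsilon>. cmod (g \<epsilon>) \<le> 1" using step.hyps(2) by (auto simp: eig_def eigenfunction_def)
    then have j: "integrable F (\<lambda>\<epsilon>. f \<epsilon> * cnj (g \<epsilon>))" by (rule L2_times_bounded[OF Lf])
    have "(LINT \<epsilon>|F. f \<epsilon> * cnj (h \<epsilon> + b * g \<epsilon>)) = (LINT \<epsilon>|F. f \<epsilon> * cnj (h \<epsilon>) + cnj b * (f \<epsilon> * cnj (g \<epsilon>)))"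
      by (simp add: algebra_simps)
    also have "\<dots> = 0" using i j step.IH eig_orthogonal[OF f step.hyps(2) ne] by simp
    finally show ?case .
  qed simp
  have int: "integrable F (\<lambda>\<epsilon>. (cmod (f \<epsilon>))\<^sup>2)" using Lf by (simp add: L2_def)
  have pos: "(LINT \<epsilon>|F. (cmod (f \<epsilon>))\<^sup>2) > 0"
  proof -
    have "(LINT \<epsilon>|F. (cmod (f \<epsilon>))\<^sup>2) \<noteq> 0"
    proof
      assume "(LINT \<epsilon>|F. (cmod (f \<epsilon>))\<^sup>2) = 0"
      then have "AE \<epsilon> in F. (cmod (f \<epsilon>))\<^sup>2 = 0" using integral_nonneg_eq_0_iff_AE[OF int] by simp
      then have "AE \<epsilon> in F. f \<epsilon> = 0" by (rule eventually_mono) simp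
      then show False using f by (simp add: eigenfunction_def)
    qed
    moreover have "(LINT \<epsilon>|F. (cmod (f \<epsilon>))\<^sup>2) \<ge> 0" by simp
    ultimately show ?thesis by linarith
  qed
  then obtain h where h: "h \<in> trig" "(LINT \<epsilon>|F. (cmod (f \<epsilon> - h \<epsilon>))\<^sup>2) < (LINT \<epsilon>|F. (cmod (f \<epsilon>))\<^sup>2)"
    using near_L2[OF Lf] unfolding near_def by blast
  obtain B where B: "\<And>\<epsilon>. cmod (h \<epsilon>) \<le> B" "h \<in> borel_measurable F" using trig_bounded[OF h(1)] by blast
  have i: "integrable F (\<lambda>\<epsilon>. f \<epsilon> * cnj (h \<epsilon>))" by (rule L2_times_bounded[OF Lf B(2,1)])
  have ih: "integrable F (\<lambda>\<epsilon>. (cmod (h \<epsilon>))\<^sup>2)" by (rule H_int[OF h(1)])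
  have "(cmod (a - b))\<^sup>2 = (cmod a)\<^sup>2 + (cmod b)\<^sup>2 - 2 * Re (a * cnj b)" for a b
    unfolding cmod_power2 by (simp add: power2_eq_square algebra_simps)
  then have "(LINT \<epsilon>|F. (cmod (f \<epsilon> - h \<epsilon>))\<^sup>2) =
      (LINT \<epsilon>|F. (cmod (f \<epsilon>))\<^sup>2 + (cmod (h \<epsilon>))\<^sup>2 - 2 * Re (f \<epsilon> * cnj (h \<epsilon>)))" by simp
  also have "\<dots> = (LINT \<epsilon>|F. (cmod (f \<epsilon>))\<^sup>2) + (LINT \<epsilon>|F. (cmod (h \<epsilon>))\<^sup>2) - 2 * Re (LINT \<epsilon>|F. f \<epsilon> * cnj (h \<epsilon>))"
    using int ih i by (simp del: complex_cnj_mult times_complex.sel)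
  also have "\<dots> \<ge> (LINT \<epsilon>|F. (cmod (f \<epsilon>))\<^sup>2)" using orth[OF h(1)] by simp
  finally show False using h(2) by simp
qed

end

subsection \<open>Rotations\<close>

definition cong1 :: "real \<Rightarrow> real \<Rightarrow> bool" where
  "cong1 a b \<longleftrightarrow> a - b \<in> \<int>"

lemma cong1_refl [simp]: "cong1 a a"
  by (simp add: cong1_def)

lemma cong1_sym: "cong1 a b \<Longrightarrow> cong1 b a"
  unfolding cong1_def by (metis Ints_minus minus_diff_eq)

lemma cong1_trans: "cong1 a b \<Longrightarrow> cong1 b c \<Longrightarrow> cong1 a c"
  unfolding cong1_def using Ints_add[of "a - b" "b - c"] by simp

lemma cong1_add: "cong1 a b \<Longrightarrow> cong1 (a + c) (b + c)"
  by (simp add: cong1_def)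

lemma cong1_frac: "cong1 (frac a) a"
  by (simp add: cong1_def frac_def)

lemma cong1_frac_eq: "cong1 a b \<Longrightarrow> frac a = frac b"
proof -
  assume "cong1 a b"
  then have "cong1 a (frac b)" using cong1_trans cong1_sym cong1_frac by blast
  then show ?thesis by (auto simp: frac_unique_iff cong1_def frac_lt_1)
qed

section \<open>The interval coordinate on a fibre\<close>

context irr_fibre
begin

lemma gpath_phi: "0 \<le> y \<Longrightarrow> y < 1 \<Longrightarrow> gpath y \<in> phi x"
proof -
  assume y: "0 \<le> y" "y < 1"
  have "alive n (gpath y)" for n
  proof (rule ccontr)
    assume "\<not> alive n (gpath y)"
    then show False using gpath_interval[OF y, of n] mass_not_alive[of n "gpath y" wt] by auto
  qed
  then show ?thesis by (simp add: phi_alive)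
qed

lemma fpos_gpath_id: "0 \<le> y \<Longrightarrow> y < 1 \<Longrightarrow> fpos (gpath y) = y"
  by (rule fpos_gpath[OF _ _ mass_tendsto[OF irr]])

text \<open>The subdivision depends only on the vertex, because the masses do, so equal tails below
  a common vertex move by equal amounts.\<close>

lemma lft_diff_agree:
  assumes "vertex m \<epsilon> = vertex m \<delta>" "\<And>k. m \<le> k \<Longrightarrow> \<epsilon> k = \<delta> k" "m \<le> n"
  shows "lft n \<epsilon> - lft m \<epsilon> = lft n \<delta> - lft m \<delta>"
  using assms(3)
proof (induction n rule: dec_induct)
  case (step n)
  have "vertex n \<epsilon> = vertex n \<delta>"
    by (rule vertex_agree[OF assms(1) step.hyps(1)]) (use assms(2) in auto)
  then have "vertex (Suc n) (\<epsilon>(n := ld n)) = vertex (Suc n) (\<delta>(n := ld n))"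
    by (simp add: vertex_Suc)
  then have "mass wt (Suc n) (\<epsilon>(n := ld n)) = mass wt (Suc n) (\<delta>(n := ld n))"
    by (rule mass_cong)
  moreover have "\<epsilon> n = \<delta> n" using assms(2) step.hyps(1) by blast
  ultimately show ?case using step.IH by simp
qed simp

lemma fpos_diff_agree:
  assumes "vertex m \<epsilon> = vertex m \<delta>" "\<And>k. m \<le> k \<Longrightarrow> \<epsilon> k = \<delta> k"
  shows "fpos \<epsilon> - lft m \<epsilon> = fpos \<delta> - lft m \<delta>"
proof -
  have 1: "(\<lambda>n. lft n \<epsilon> - lft m \<epsilon>) \<longlonglongrightarrow> fpos \<epsilon> - lft m \<epsilon>"
    by (rule tendsto_diff[OF lft_tendsto tendsto_const])
  have 2: "(\<lambda>n. lft n \<delta> - lft m \<delta>) \<longlonglongrightarrow> fpos \<delta> - lft m \<delta>"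
    by (rule tendsto_diff[OF lft_tendsto tendsto_const])
  have "\<forall>\<^sub>F n in sequentially. lft n \<delta> - lft m \<delta> = lft n \<epsilon> - lft m \<epsilon>"
    by (rule eventually_sequentiallyI[of m]) (rule lft_diff_agree[OF assms, symmetric])
  from Lim_transform_eventually[OF 2 this] 1 show ?thesis using LIMSEQ_unique by blast
qed

end

section \<open>Cutting and stacking after the last single vertex\<close>

locale rotation_fibre = irr_fibre +
  fixes s :: nat
  assumes shape_s: "shape s = Single" and after_s: "\<And>n. s < n \<Longrightarrow> shape n \<noteq> Single"
begin

definition kk :: nat where "kk = dhi s"

text \<open>The width of the lower tower at level s + 1, in the scale where the two widths add up to
  1.\<close>

definition alpha :: real where "alpha = kk * snd (wt (Suc s))"

text \<open>Left end of the interval of level n relative to the block of the first s digits. This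
  block has length \<open>1 / kk\<close> and is rescaled to length 1.\<close>

definition hh :: "nat \<Rightarrow> path \<Rightarrow> real" where
  "hh n \<epsilon> = kk * (lft n \<epsilon> - lft s \<epsilon>)"

lemma kk_pos: "kk > 0"
  by (simp add: kk_def dims_pos)

lemma shape_Suc_s: "shape (Suc s) = Far"
  using after_s[of "Suc s"] shape_s by (auto split: if_splits)

lemma split_up_s: "split_up s"
  using shape_Suc_s shape_s by (auto split: if_splits)

lemma wrec_wt: "wrec wt n"
  using wsys_wt by (simp add: wsys_def)

lemma weights_Suc_s: "kk * fst (wt (Suc s)) + kk * snd (wt (Suc s)) = 1"
proof -
  have "fst (wt s) = fst (wt (Suc s)) + snd (wt (Suc s))"
    using wrec_wt[of s] shape_s by (simp add: wrec_def)
  moreover have "fst (wt s) = 1 / kk" using wsys_Single(2)[OF wsys_wt shape_s] by (simp add: kk_def)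
  ultimately have "kk * (fst (wt (Suc s)) + snd (wt (Suc s))) = 1" using kk_pos by (simp add: field_simps)
  then show ?thesis by (simp add: distrib_left)
qed

text \<open>The words to each vertex, ordered by rank, are the floors of a tower; the floors have
  width u = \<open>kk * fst (wt n)\<close> above and l = \<open>kk * snd (wt n)\<close> below. By
  the third clause the two bases adjoin, the upper one on the left. By the first two clauses
  translation by \<open>alpha\<close> carries the top floors onto the same interval in exchanged
  order, the lower one first. All positions are modulo 1. Passing to level n + 1 is a step of Rauzy
  induction.\<close>

definition towers :: "nat \<Rightarrow> bool" where
  "towers n \<longleftrightarrow>
     (\<forall>\<epsilon> \<delta>. lower n \<epsilon> \<and> Suc (rk n \<epsilon>) = dlo n \<and> upper n \<delta> \<and> rk n \<delta> = 0 \<longrightarrow>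
        cong1 (hh n \<epsilon> + alpha) (hh n \<delta>)) \<and>
     (\<forall>\<epsilon> \<delta>. upper n \<epsilon> \<and> Suc (rk n \<epsilon>) = dhi n \<and> upper n \<delta> \<and> rk n \<delta> = 0 \<longrightarrow>
        cong1 (hh n \<epsilon> + alpha) (hh n \<delta> + kk * snd (wt n))) \<and>
     (\<forall>\<epsilon> \<delta>. lower n \<epsilon> \<and> rk n \<epsilon> = 0 \<and> upper n \<delta> \<and> rk n \<delta> = 0 \<longrightarrow>
        cong1 (hh n \<epsilon>) (hh n \<delta> + kk * fst (wt n)))"

lemma hh_Suc: "s \<le> n \<Longrightarrow> hh (Suc n) \<epsilon> = hh n \<epsilon> + (if \<epsilon> n = ld n then 0 else kk * mass wt (Suc n) (\<epsilon>(n := ld n)))"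
  by (simp add: hh_def algebra_simps)

lemma hh_s: "hh s \<epsilon> = 0"
  by (simp add: hh_def)

text \<open>At level s + 1 the upper floors start at 0 and the lower ones at u, with u + l = 1: the
  exchange of these two intervals is the rotation by l.\<close>

lemma towers_base: "towers (Suc s)"
proof -
  have lds: "ld s" using shape_s by (simp add: ld_def)
  have up: "hh (Suc s) \<delta> = 0" if "upper (Suc s) \<delta>" for \<delta>
    using that shape_s split_up_s lds by (simp add: hh_Suc hh_s upper_Suc)
  have lo: "hh (Suc s) \<epsilon> = kk * fst (wt (Suc s))" if l: "lower (Suc s) \<epsilon>" for \<epsilon>
  proof -
    have e: "upper s \<epsilon>" "\<not> \<epsilon> s" using l shape_s shape_Suc_s by (simp_all add: lower_Suc)
    then have "upper (Suc s) (\<epsilon>(s := True))" using shape_s split_up_s by (simp add: upper_Suc)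
    then show ?thesis using e lds by (simp add: hh_Suc hh_s mass_upper)
  qed
  have c: "cong1 (kk * fst (wt (Suc s)) + alpha) 0"
    using weights_Suc_s by (simp add: cong1_def alpha_def)
  show ?thesis
    unfolding towers_def using up lo c by (auto simp: alpha_def)
qed

lemma dead_child:
  "shape n = Far \<Longrightarrow> upper n \<epsilon> \<Longrightarrow> mass wt (Suc n) (\<epsilon>(n := True)) = 0"
  "shape n = Near \<Longrightarrow> split_up n \<Longrightarrow> lower n \<epsilon> \<Longrightarrow> mass wt (Suc n) (\<epsilon>(n := False)) = 0"
  "shape n = Near \<Longrightarrow> \<not> split_up n \<Longrightarrow> upper n \<epsilon> \<Longrightarrow> mass wt (Suc n) (\<epsilon>(n := True)) = 0"
  using upper_lower_excl[of n \<epsilon>] by (auto simp: mass_def upper_Suc lower_Suc)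

lemma ex_min_upper: "\<exists>\<delta>. upper n \<delta> \<and> rk n \<delta> = 0"
proof -
  obtain \<epsilon> where "upper n \<epsilon>" using ex_upper by blast
  then have e: "alive n \<epsilon>" "0 < dim n \<epsilon>" by (auto simp: alive_iff dim_def dims_pos)
  then obtain \<delta> where "same n \<epsilon> \<delta>" "rk n \<delta> = 0" using rk_surj_same by blast
  then show ?thesis using \<open>upper n \<epsilon>\<close> same_upper by blast
qed

lemma rk_less_lower: "lower n \<epsilon> \<Longrightarrow> rk n \<epsilon> < dlo n"
  using rk_less_dim[of n \<epsilon>] upper_lower_excl[of n \<epsilon>]
  by (cases "upper n \<epsilon>") (simp_all add: alive_iff dim_def)

text \<open>At \<open>Far\<close> nothing is cut. At an upper splitting the left part, of width l,
  of the upper tower is stacked on top of the lower tower. At a lower splitting the left part, of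
  width u, of the lower tower is put under the upper tower.\<close>

lemma towers_Suc:
  assumes t: "towers n" and n: "s < n"
  shows "towers (Suc n)"
proof -
  have sn: "s \<le> n" using n by simp
  have t1: "\<And>\<epsilon> \<delta>. lower n \<epsilon> \<Longrightarrow> Suc (rk n \<epsilon>) = dlo n \<Longrightarrow> upper n \<delta> \<Longrightarrow> rk n \<delta> = 0 \<Longrightarrow>
      cong1 (hh n \<epsilon> + alpha) (hh n \<delta>)"
    and t2: "\<And>\<epsilon> \<delta>. upper n \<epsilon> \<Longrightarrow> Suc (rk n \<epsilon>) = dhi n \<Longrightarrow> upper n \<delta> \<Longrightarrow> rk n \<delta> = 0 \<Longrightarrow>
      cong1 (hh n \<epsilon> + alpha) (hh n \<delta> + kk * snd (wt n))"
    and t3: "\<And>\<epsilon> \<delta>. lower n \<epsilon> \<Longrightarrow> rk n \<epsilon> = 0 \<Longrightarrow> upper n \<delta> \<Longrightarrow> rk n \<delta> = 0 \<Longrightarrow>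
      cong1 (hh n \<epsilon>) (hh n \<delta> + kk * fst (wt n))"
    using t unfolding towers_def by blast+
  show ?thesis
  proof (cases "shape n")
    case Single
    then show ?thesis using after_s n by blast
  next
    case Far
    have up: "upper n \<epsilon> \<and> hh (Suc n) \<epsilon> = hh n \<epsilon>" if "upper (Suc n) \<epsilon>" for \<epsilon>
      using that Far dead_child(1)[OF Far, of \<epsilon>] by (simp add: upper_Suc hh_Suc[OF sn])
    have lo: "lower n \<epsilon> \<and> hh (Suc n) \<epsilon> = hh n \<epsilon>" if "lower (Suc n) \<epsilon>" for \<epsilon>
      using that Far by (simp add: lower_Suc hh_Suc[OF sn] ld_def)
    have w: "fst (wt (Suc n)) = fst (wt n)" "snd (wt (Suc n)) = snd (wt n)"
      using wrec_wt[of n] Far by (simp_all add: wrec_def)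
    have d: "dlo (Suc n) = dlo n" "dhi (Suc n) = dhi n" "\<And>\<epsilon>. rk (Suc n) \<epsilon> = rk n \<epsilon>"
      using Far by (simp_all add: dlo_Suc dhi_Suc)
    show ?thesis
      unfolding towers_def w d
    proof (intro conjI allI impI)
      fix \<epsilon> \<delta> assume a: "lower (Suc n) \<epsilon> \<and> Suc (rk n \<epsilon>) = dlo n \<and> upper (Suc n) \<delta> \<and> rk n \<delta> = 0"
      then show "cong1 (hh (Suc n) \<epsilon> + alpha) (hh (Suc n) \<delta>)" using lo[of \<epsilon>] up[of \<delta>] t1[of \<epsilon> \<delta>] by simp
    next
      fix \<epsilon> \<delta> assume a: "upper (Suc n) \<epsilon> \<and> Suc (rk n \<epsilon>) = dhi n \<and> upper (Suc n) \<delta> \<and> rk n \<delta> = 0"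
      then show "cong1 (hh (Suc n) \<epsilon> + alpha) (hh (Suc n) \<delta> + kk * snd (wt n))" using up[of \<epsilon>] up[of \<delta>] t2[of \<epsilon> \<delta>] by simp
    next
      fix \<epsilon> \<delta> assume a: "lower (Suc n) \<epsilon> \<and> rk n \<epsilon> = 0 \<and> upper (Suc n) \<delta> \<and> rk n \<delta> = 0"
      then show "cong1 (hh (Suc n) \<epsilon>) (hh (Suc n) \<delta> + kk * fst (wt n))" using lo[of \<epsilon>] up[of \<delta>] t3[of \<epsilon> \<delta>] by simp
    qed
  next
    case Near
    show ?thesis
    proof (cases "split_up n")
      case True
      let ?l = "kk * snd (wt n)" and ?u = "kk * fst (wt (Suc n))"
      have nl: "\<not> ld n" using Near True by (simp add: ld_def)
      have w: "snd (wt (Suc n)) = snd (wt n)" "kk * fst (wt n) = ?u + ?l"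
        using wrec_wt[of n] Near True by (simp_all add: wrec_def distrib_left)
      have d: "dlo (Suc n) = dlo n + dhi n" "dhi (Suc n) = dhi n"
        using Near True split_excl[OF True] by (simp_all add: dlo_Suc dhi_Suc)
      have up: "upper n \<epsilon> \<and> rk (Suc n) \<epsilon> = rk n \<epsilon> \<and> hh (Suc n) \<epsilon> = hh n \<epsilon> + ?l" if u: "upper (Suc n) \<epsilon>" for \<epsilon>
      proof -
        have e: "upper n \<epsilon>" "\<epsilon> n" using u Near True by (simp_all add: upper_Suc)
        then have "lower (Suc n) (\<epsilon>(n := False))" using Near True by (simp add: lower_Suc)
        then show ?thesis using e nl w by (simp add: hh_Suc[OF sn] mass_lower)
      qed
      have lo: "hh (Suc n) \<epsilon> = hh n \<epsilon> \<and> (lower n \<epsilon> \<and> rk (Suc n) \<epsilon> = rk n \<epsilon> \<or> upper n \<epsilon> \<and> rk (Suc n) \<epsilon> = rk n \<epsilon> + dlo n)"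
        if l: "lower (Suc n) \<epsilon>" for \<epsilon>
      proof -
        consider "upper n \<epsilon>" "\<not> \<epsilon> n" | "lower n \<epsilon>" "\<epsilon> n" using l Near True by (auto simp: lower_Suc)
        then show ?thesis
        proof cases
          case 1
          then show ?thesis using Near nl by (simp add: hh_Suc[OF sn])
        next
          case 2
          then show ?thesis using nl dead_child(2)[OF Near True 2(1)] by (simp add: hh_Suc[OF sn])
        qed
      qed
      show ?thesis
        unfolding towers_def w d
      proof (intro conjI allI impI)
        fix \<epsilon> \<delta> assume a: "lower (Suc n) \<epsilon> \<and> Suc (rk (Suc n) \<epsilon>) = dlo n + dhi n \<and> upper (Suc n) \<delta> \<and> rk (Suc n) \<delta> = 0"
        \<comment> \<open>The top of the new lower tower is the top of the piece cut off the upper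
          tower.\<close>
        have e: "upper n \<epsilon>" "rk (Suc n) \<epsilon> = rk n \<epsilon> + dlo n"
          using lo[of \<epsilon>] a rk_less_lower[of n \<epsilon>] dims_pos[of n] by (auto simp del: rk.simps)
        then have "cong1 (hh n \<epsilon> + alpha) (hh n \<delta> + ?l)" using up[of \<delta>] a by (intro t2) auto
        then show "cong1 (hh (Suc n) \<epsilon> + alpha) (hh (Suc n) \<delta>)" using lo[of \<epsilon>] up[of \<delta>] a by simp
      next
        fix \<epsilon> \<delta> assume a: "upper (Suc n) \<epsilon> \<and> Suc (rk (Suc n) \<epsilon>) = dhi n \<and> upper (Suc n) \<delta> \<and> rk (Suc n) \<delta> = 0"
        then have "cong1 (hh n \<epsilon> + alpha) (hh n \<delta> + ?l)" using up[of \<epsilon>] up[of \<delta>] by (intro t2) auto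
        from cong1_add[OF this, of ?l]
        show "cong1 (hh (Suc n) \<epsilon> + alpha) (hh (Suc n) \<delta> + ?l)" using up[of \<epsilon>] up[of \<delta>] a by (simp add: algebra_simps)
      next
        fix \<epsilon> \<delta> assume a: "lower (Suc n) \<epsilon> \<and> rk (Suc n) \<epsilon> = 0 \<and> upper (Suc n) \<delta> \<and> rk (Suc n) \<delta> = 0"
        have e: "lower n \<epsilon>" "rk n \<epsilon> = 0" using lo[of \<epsilon>] a dims_pos[of n] by auto
        then have "cong1 (hh n \<epsilon>) (hh n \<delta> + kk * fst (wt n))" using up[of \<delta>] a by (intro t3) auto
        then show "cong1 (hh (Suc n) \<epsilon>) (hh (Suc n) \<delta> + ?u)" using lo[of \<epsilon>] up[of \<delta>] a w by (simp add: algebra_simps)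
      qed
    next
      case False
      \<comment> \<open>A level with neither splitting would lead to a single vertex beyond
        s.\<close>
      have low: "split_low n" using after_s[of "Suc n"] n Near False by (auto split: if_splits)
      let ?l = "kk * snd (wt (Suc n))" and ?u = "kk * fst (wt n)"
      have nl: "ld n" using False by (simp add: ld_def)
      have w: "fst (wt (Suc n)) = fst (wt n)" "kk * snd (wt n) = ?l + ?u"
        using wrec_wt[of n] Near False by (simp_all add: wrec_def distrib_left)
      have d: "dlo (Suc n) = dlo n" "dhi (Suc n) = dhi n + dlo n"
        using Near False low by (simp_all add: dlo_Suc dhi_Suc)
      have lo: "lower n \<epsilon> \<and> rk (Suc n) \<epsilon> = rk n \<epsilon> \<and> hh (Suc n) \<epsilon> = hh n \<epsilon> + ?u" if l: "lower (Suc n) \<epsilon>" for \<epsilon>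
      proof -
        have e: "lower n \<epsilon>" "\<not> \<epsilon> n" using l Near False by (simp_all add: lower_Suc)
        then have "upper (Suc n) (\<epsilon>(n := True))" using Near False by (simp add: upper_Suc)
        then show ?thesis using e nl w upper_lower_excl[of n \<epsilon>] by (auto simp: hh_Suc[OF sn] mass_upper)
      qed
      have up: "hh (Suc n) \<epsilon> = hh n \<epsilon> \<and> (lower n \<epsilon> \<and> rk (Suc n) \<epsilon> = rk n \<epsilon> \<or> upper n \<epsilon> \<and> rk (Suc n) \<epsilon> = rk n \<epsilon> + dlo n)"
        if u: "upper (Suc n) \<epsilon>" for \<epsilon>
      proof -
        consider "upper n \<epsilon>" "\<not> \<epsilon> n" | "lower n \<epsilon>" "\<epsilon> n" using u Near False by (auto simp: upper_Suc)
        then show ?thesis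
        proof cases
          case 1
          then show ?thesis using Near nl dead_child(3)[OF Near False 1(1)] by (simp add: hh_Suc[OF sn])
        next
          case 2
          then show ?thesis using nl by (simp add: hh_Suc[OF sn])
        qed
      qed
      \<comment> \<open>The bottom of the new upper tower is the left part of the old lower
        base.\<close>
      have minup: "lower n \<delta> \<and> rk n \<delta> = 0 \<and> hh (Suc n) \<delta> = hh n \<delta>" if "upper (Suc n) \<delta>" "rk (Suc n) \<delta> = 0" for \<delta>
        using up[OF that(1)] that(2) dims_pos[of n] by auto
      \<comment> \<open>A word at the base of the old upper tower, used as a common reference for
        positions; no word through the new vertices need end there with rank 0.\<close>
      obtain \<delta>0 where d0: "upper n \<delta>0" "rk n \<delta>0 = 0" using ex_min_upper by blast
      have m: "cong1 (hh n \<delta>) (hh n \<delta>0 + ?u)" if "lower n \<delta>" "rk n \<delta> = 0" for \<delta>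
        using t3[OF that d0] .
      show ?thesis
        unfolding towers_def w d
      proof (intro conjI allI impI)
        fix \<epsilon> \<delta> assume a: "lower (Suc n) \<epsilon> \<and> Suc (rk (Suc n) \<epsilon>) = dlo n \<and> upper (Suc n) \<delta> \<and> rk (Suc n) \<delta> = 0"
        have "cong1 (hh n \<epsilon> + alpha) (hh n \<delta>0)" using lo[of \<epsilon>] a d0 by (intro t1) auto
        from cong1_add[OF this, of ?u] have "cong1 (hh n \<epsilon> + ?u + alpha) (hh n \<delta>0 + ?u)" by (simp add: algebra_simps)
        moreover have "cong1 (hh n \<delta>) (hh n \<delta>0 + ?u)" using minup[of \<delta>] a by (intro m) (auto simp del: rk.simps)
        ultimately have "cong1 (hh n \<epsilon> + ?u + alpha) (hh n \<delta>)" by (rule cong1_trans[OF _ cong1_sym])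
        then show "cong1 (hh (Suc n) \<epsilon> + alpha) (hh (Suc n) \<delta>)" using lo[of \<epsilon>] minup[of \<delta>] a by simp
      next
        fix \<epsilon> \<delta> assume a: "upper (Suc n) \<epsilon> \<and> Suc (rk (Suc n) \<epsilon>) = dhi n + dlo n \<and> upper (Suc n) \<delta> \<and> rk (Suc n) \<delta> = 0"
        have e: "upper n \<epsilon>" "Suc (rk n \<epsilon>) = dhi n"
          using up[of \<epsilon>] a rk_less_lower[of n \<epsilon>] dims_pos[of n] by (auto simp del: rk.simps)
        have 1: "cong1 (hh n \<epsilon> + alpha) (hh n \<delta>0 + ?u + ?l)" using t2[OF e d0] w(2) by (simp add: algebra_simps)
        have 2: "cong1 (hh n \<delta> + ?l) (hh n \<delta>0 + ?u + ?l)" by (rule cong1_add, rule m) (use minup[of \<delta>] a in auto)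
        have "cong1 (hh n \<epsilon> + alpha) (hh n \<delta> + ?l)" using cong1_trans[OF 1 cong1_sym[OF 2]] .
        then show "cong1 (hh (Suc n) \<epsilon> + alpha) (hh (Suc n) \<delta> + ?l)" using up[of \<epsilon>] minup[of \<delta>] a by simp
      next
        fix \<epsilon> \<delta> assume a: "lower (Suc n) \<epsilon> \<and> rk (Suc n) \<epsilon> = 0 \<and> upper (Suc n) \<delta> \<and> rk (Suc n) \<delta> = 0"
        have 1: "cong1 (hh n \<epsilon>) (hh n \<delta>0 + ?u)" using lo[of \<epsilon>] a by (intro m) (auto simp del: rk.simps)
        have 2: "cong1 (hh n \<delta>) (hh n \<delta>0 + ?u)" using minup[of \<delta>] a by (intro m) (auto simp del: rk.simps)
        have "cong1 (hh n \<epsilon> + ?u) (hh n \<delta> + ?u)" using cong1_add[OF cong1_trans[OF 1 cong1_sym[OF 2]]] .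
        then show "cong1 (hh (Suc n) \<epsilon>) (hh (Suc n) \<delta> + ?u)" using lo[of \<epsilon>] minup[of \<delta>] a by simp
      qed
    qed
  qed
qed

lemma towers_all: "s < n \<Longrightarrow> towers n"
proof (induction n)
  case (Suc n)
  then show ?case using towers_base towers_Suc by (cases "s = n") auto
qed simp

definition fang :: "path \<Rightarrow> real" where
  "fang \<epsilon> = kk * (fpos \<epsilon> - lft s \<epsilon>)"

lemma fang_adic_same:
  assumes "same s \<epsilon> (adic \<epsilon>)"
  shows "fang (adic \<epsilon>) = fang \<epsilon>"
proof -
  have "fpos \<epsilon> - lft s \<epsilon> = fpos (adic \<epsilon>) - lft s (adic \<epsilon>)"
    by (rule fpos_diff_agree) (use assms in \<open>auto simp: same_def\<close>)
  then show ?thesis by (simp add: fang_def)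
qed

text \<open>At the last changed digit n the path is on the top floor of the lower tower and its
  image on the bottom floor of the upper one, so the first clause of \<open>towers\<close> gives the
  shift. From level n + 1 on both positions move in parallel.\<close>

lemma fang_adic_carry:
  assumes e: "\<epsilon> \<in> phi x" "\<epsilon> \<in> adic_dom" and max: "Suc (rk s \<epsilon>) = kk"
  shows "cong1 (fang (adic \<epsilon>)) (fang \<epsilon> + alpha)"
proof -
  let ?d = "adic \<epsilon>"
  obtain n where n: "vertex (Suc n) \<epsilon> = vertex (Suc n) ?d" "\<epsilon> n" "\<not> ?d n" "\<forall>k>n. \<epsilon> k = ?d k"
    using adic_prec[OF e(2)] by (auto simp: prec_def)
  have al: "alive m \<epsilon>" for m using e(1) by (simp add: phi_alive)
  have "?d \<in> phi x" using e adic_proj phi_eq[OF irr] by auto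
  then have ald: "alive m ?d" for m by (simp add: phi_alive)
  note tw = merge_twins[OF al n(1-3)]
  \<comment> \<open>A last change before s would raise the rank at level s, which is already the
    largest.\<close>
  have sn: "s < n"
  proof (rule ccontr)
    assume "\<not> s < n"
    moreover have "n \<noteq> s" using tw(1) shape_s by auto
    ultimately have "n < s" by simp
    then have "same s \<epsilon> ?d"
      using n same_mono[of "Suc n" \<epsilon> ?d s] by (auto simp: same_def)
    then have "rk s \<epsilon> < rk s ?d" using prec_iff_rk[OF al] adic_prec[OF e(2)] by blast
    moreover have "rk s ?d < kk" using rk_less_dim[OF ald[of s]] dim_Single[OF shape_s ald[of s]] by (simp add: kk_def)
    ultimately show False using max by simp
  qed
  have mx: "Suc (rk n \<epsilon>) = dlo n"
  proof (rule ccontr)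
    assume "Suc (rk n \<epsilon>) \<noteq> dlo n"
    then have "Suc (rk n \<epsilon>) < dim n \<epsilon>"
      using rk_less_lower[OF tw(2)] upper_lower_excl[of n \<epsilon>] tw(2) by (auto simp: dim_def)
    from adic_rk(2)[OF al this] show False using n(2,3) by (auto simp: same_def)
  qed
  have mn: "rk n ?d = 0"
  proof (rule ccontr)
    assume "rk n ?d \<noteq> 0"
    then obtain \<eta> where \<eta>: "\<eta> \<in> adic_dom" "adic \<eta> = ?d" "same n \<eta> ?d"
      using adic_pred[OF ald, of n] by auto
    then have "\<eta> = \<epsilon>" using inj_onD[OF adic_inj] e(2) by blast
    then show False using \<eta>(3) n(2,3) by (auto simp: same_def)
  qed
  have c: "cong1 (hh n \<epsilon> + alpha) (hh n ?d)"
    using towers_all[OF sn] tw(2,3) mx mn unfolding towers_def by blast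
  \<comment> \<open>Each of the two meeting edges is either the left one or stands behind a dead
    edge of mass 0.\<close>
  have "hh (Suc n) \<epsilon> = hh n \<epsilon> \<and> hh (Suc n) ?d = hh n ?d"
  proof (cases "split_up n")
    case True
    then have "\<not> ld n" using tw(1) by (simp add: ld_def)
    then show ?thesis using dead_child(2)[OF tw(1) True tw(2)] n(2,3) sn by (simp add: hh_Suc)
  next
    case False
    then have "ld n" by (simp add: ld_def)
    then show ?thesis using dead_child(3)[OF tw(1) False tw(3)] n(2,3) sn by (simp add: hh_Suc)
  qed
  moreover have "fpos \<epsilon> - lft (Suc n) \<epsilon> = fpos ?d - lft (Suc n) ?d"
    by (rule fpos_diff_agree[OF n(1)]) (use n(4) in auto)
  then have "fang ?d - fang \<epsilon> = hh (Suc n) ?d - hh (Suc n) \<epsilon>"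
    unfolding fang_def hh_def by (simp flip: right_diff_distrib)
  ultimately have "fang ?d = fang \<epsilon> + hh n ?d - hh n \<epsilon>" by simp
  then have "fang ?d - (fang \<epsilon> + alpha) = hh n ?d - (hh n \<epsilon> + alpha)" by simp
  then show ?thesis using cong1_sym[OF c] by (simp only: cong1_def)
qed

section \<open>The isomorphism with the skew product\<close>

definition pword :: "nat \<Rightarrow> path" where
  "pword i = (SOME \<epsilon>. alive s \<epsilon> \<and> rk s \<epsilon> = i)"

lemma pword:
  assumes "i < kk"
  shows "alive s (pword i)" "rk s (pword i) = i"
proof -
  obtain \<epsilon> where "upper s \<epsilon>" using ex_upper by blast
  then have e: "alive s \<epsilon>" by (simp add: alive_iff)
  then have "i < dim s \<epsilon>" using dim_Single[OF shape_s e] assms by (simp add: kk_def)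
  then obtain \<delta> where "same s \<epsilon> \<delta>" "rk s \<delta> = i" using rk_surj_same[OF e] by blast
  then have "\<exists>\<delta>. alive s \<delta> \<and> rk s \<delta> = i" using e same_alive by blast
  then have "alive s (pword i) \<and> rk s (pword i) = i" unfolding pword_def by (rule someI_ex)
  then show "alive s (pword i)" "rk s (pword i) = i" by auto
qed

lemma pword_agree:
  assumes "alive s \<epsilon>" "k < s"
  shows "pword (rk s \<epsilon>) k = \<epsilon> k"
proof -
  have "rk s \<epsilon> < kk" using rk_less_dim[OF assms(1)] dim_Single[OF shape_s assms(1)] by (simp add: kk_def)
  note p = pword[OF this]
  have "upper s (pword (rk s \<epsilon>))" "upper s \<epsilon>" using dim_Single[OF shape_s] p(1) assms(1) by auto
  then show ?thesis using rk_inj[OF p(1) upper_vertex p(2) assms(2)] by blast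
qed

text \<open>The point at relative position y in the block of the word of level s with rank
  i.\<close>

definition gpos :: "real \<times> nat \<Rightarrow> real" where
  "gpos = (\<lambda>(y, i). lft s (pword i) + y / kk)"

definition gskew :: "real \<times> nat \<Rightarrow> path" where
  "gskew z = gpath (gpos z)"

definition fskew :: "path \<Rightarrow> real \<times> nat" where
  "fskew \<epsilon> = (frac (fang \<epsilon>), rk s \<epsilon>)"

lemma space_skew: "space (skew_space kk) = {0..<1} \<times> {..<kk}"
  by (simp add: skew_space_def space_pair_measure space_uniform_count_measure)

lemma gpos_interval:
  assumes "0 \<le> y" "y < 1" "i < kk"
  shows "lft s (pword i) \<le> gpos (y, i)" "gpos (y, i) < lft s (pword i) + mass wt s (pword i)"
    "0 \<le> gpos (y, i)" "gpos (y, i) < 1"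
proof -
  have m: "mass wt s (pword i) = 1 / kk"
    using mass_Single[OF shape_s pword(1)[OF assms(3)]] by (simp add: kk_def)
  show 1: "lft s (pword i) \<le> gpos (y, i)" using assms by (simp add: gpos_def)
  show 2: "gpos (y, i) < lft s (pword i) + mass wt s (pword i)"
    unfolding m using assms kk_pos by (simp add: gpos_def divide_strict_right_mono)
  show "0 \<le> gpos (y, i)" using 1 lft_mono[of 0 s "pword i"] by simp
  show "gpos (y, i) < 1" using 2 rgt_mono[of 0 s "pword i"] by (simp add: C_0)
qed

lemma gskew_prefix:
  assumes "0 \<le> y" "y < 1" "i < kk" "k < s"
  shows "gskew (y, i) k = pword i k"
  unfolding gskew_def using gpath_unique[OF gpos_interval(1,2)[OF assms(1-3)] assms(4)] .

lemma gskew_phi: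
  assumes "0 \<le> y" "y < 1" "i < kk"
  shows "gskew (y, i) \<in> phi x"
  unfolding gskew_def using gpath_phi gpos_interval(3,4)[OF assms] by blast

lemma fskew_gskew:
  assumes "0 \<le> y" "y < 1" "i < kk"
  shows "fskew (gskew (y, i)) = (y, i)"
proof -
  have "rk s (gskew (y, i)) = rk s (pword i)" by (rule rk_cong) (rule gskew_prefix[OF assms])
  then have r: "rk s (gskew (y, i)) = i" using pword(2)[OF assms(3)] by simp
  have "lft s (gskew (y, i)) = lft s (pword i)" by (rule lft_cong) (rule gskew_prefix[OF assms])
  moreover have "fpos (gskew (y, i)) = gpos (y, i)"
    unfolding gskew_def using fpos_gpath_id gpos_interval(3,4)[OF assms] by blast
  ultimately have "fang (gskew (y, i)) = y" using kk_pos by (simp add: fang_def gpos_def)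
  then show ?thesis using r assms by (simp add: fskew_def frac_eq)
qed

lemma fang_measurable [measurable]: "fang \<in> borel_measurable borel"
proof -
  note [measurable] = fpos_measurable
  show ?thesis unfolding fang_def[abs_def] by measurable
qed

lemma frac_measurable:
  assumes [measurable]: "f \<in> borel_measurable M"
  shows "(\<lambda>y. frac (f y) :: real) \<in> borel_measurable M"
  unfolding frac_def by measurable

lemma frac_circle: "f \<in> borel_measurable M \<Longrightarrow> (\<lambda>y. frac (f y)) \<in> M \<rightarrow>\<^sub>M circle"
  unfolding circle_def
  by (intro measurable_restrict_space2) (auto simp: frac_lt_1 measurable_lborel1 intro: frac_measurable)

lemma fskew_measurable: "fskew \<in> fibre_measure x \<rightarrow>\<^sub>M skew_space kk"
  unfolding skew_space_def fskew_def[abs_def]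
proof (rule measurable_Pair)
  show "(\<lambda>\<epsilon>. frac (fang \<epsilon>)) \<in> fibre_measure x \<rightarrow>\<^sub>M circle"
    by (intro frac_circle measurable_from_fibre fang_measurable)
  show "rk s \<in> fibre_measure x \<rightarrow>\<^sub>M uniform_count_measure {..<kk}"
  proof (rule measurableI)
    show "rk s \<epsilon> \<in> space (uniform_count_measure {..<kk})" if "\<epsilon> \<in> space (fibre_measure x)" for \<epsilon>
    proof -
      have "alive s \<epsilon>" using that by (simp add: phi_alive)
      then show ?thesis
        using rk_less_dim[of s \<epsilon>] dim_Single[OF shape_s] by (simp add: space_uniform_count_measure kk_def)
    qed
    fix A
    have "fin_dep s {\<epsilon>. rk s \<epsilon> \<in> A}" by (rule fin_dep_fun) (rule rk_cong)
    then have "{\<epsilon>. rk s \<epsilon> \<in> A} \<inter> phi x \<in> sets borel" by (intro sets.Int phi_borel) blast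
    then show "rk s -` A \<inter> space (fibre_measure x) \<in> sets (fibre_measure x)" by (simp add: sets_fibre vimage_def)
  qed
qed

lemma sigma_finite_count: "sigma_finite_measure (uniform_count_measure {..<kk})"
  using kk_pos by (intro prob_space_imp_sigma_finite prob_space_uniform_count_measure) auto

text \<open>A cylinder of level at least s lies in one block, so its preimage is a rectangle: one
  rank at level s and one interval of relative positions.\<close>

lemma gskew_cylinder:
  assumes n: "s \<le> n"
  shows "gskew -` cylinder n \<epsilon> \<inter> space (skew_space kk) =
    (if alive n \<epsilon> then {kk * (lft n \<epsilon> - lft s \<epsilon>) ..< kk * (lft n \<epsilon> - lft s \<epsilon>) + kk * mass wt n \<epsilon>} \<times> {rk s \<epsilon>} else {})"
proof (cases "alive n \<epsilon>")
  case False
  have "gskew (y, i) \<notin> cylinder n \<epsilon>" if yi: "0 \<le> y" "y < 1" "i < kk" for y i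
  proof
    assume "gskew (y, i) \<in> cylinder n \<epsilon>"
    then have "vertex n (gskew (y, i)) = vertex n \<epsilon>" by (rule vertex_cylinder) simp
    from alive_cong[OF this] False have "\<not> alive n (gskew (y, i))" by simp
    then show False using gskew_phi[OF yi] unfolding phi_alive by blast
  qed
  then show ?thesis using False by (auto simp: space_skew)
next
  case True
  have al: "alive s \<epsilon>" using alive_le[OF True n] .
  have kr: "rk s \<epsilon> < kk" using rk_less_dim[OF al] dim_Single[OF shape_s al] by (simp add: kk_def)
  have lp: "lft s (pword (rk s \<epsilon>)) = lft s \<epsilon>" by (rule lft_cong) (rule pword_agree[OF al])
  have ms: "mass wt s \<epsilon> = 1 / kk" using mass_Single[OF shape_s al] by (simp add: kk_def)
  have gp: "gpos (y, rk s \<epsilon>) = lft s \<epsilon> + y / kk" for y by (simp add: gpos_def lp)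
  have arith: "(lft n \<epsilon> \<le> lft s \<epsilon> + y / kk \<and> lft s \<epsilon> + y / kk < lft n \<epsilon> + mass wt n \<epsilon>) \<longleftrightarrow>
      (kk * (lft n \<epsilon> - lft s \<epsilon>) \<le> y \<and> y < kk * (lft n \<epsilon> - lft s \<epsilon>) + kk * mass wt n \<epsilon>)" for y
    using kk_pos by (simp add: field_simps)
  have sub: "0 \<le> y \<and> y < 1"
    if "kk * (lft n \<epsilon> - lft s \<epsilon>) \<le> y" "y < kk * (lft n \<epsilon> - lft s \<epsilon>) + kk * mass wt n \<epsilon>" for y
  proof -
    have "0 \<le> kk * (lft n \<epsilon> - lft s \<epsilon>)" using lft_mono[OF n, of \<epsilon>] by simp
    moreover have "kk * (lft n \<epsilon> + mass wt n \<epsilon>) \<le> kk * (lft s \<epsilon> + 1 / kk)"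
      using rgt_mono[OF n, of \<epsilon>] unfolding ms by (intro mult_left_mono) auto
    then have "kk * (lft n \<epsilon> - lft s \<epsilon>) + kk * mass wt n \<epsilon> \<le> 1" using kk_pos by (simp add: algebra_simps)
    ultimately show ?thesis using that by linarith
  qed
  have iff: "gskew (y, i) \<in> cylinder n \<epsilon> \<longleftrightarrow>
      i = rk s \<epsilon> \<and> kk * (lft n \<epsilon> - lft s \<epsilon>) \<le> y \<and> y < kk * (lft n \<epsilon> - lft s \<epsilon>) + kk * mass wt n \<epsilon>"
    if yi: "0 \<le> y" "y < 1" "i < kk" for y i
  proof
    assume g: "gskew (y, i) \<in> cylinder n \<epsilon>"
    have "rk s (gskew (y, i)) = rk s \<epsilon>" by (rule rk_cong) (use g n in \<open>auto simp: cylinder_def\<close>)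
    moreover have "rk s (gskew (y, i)) = rk s (pword i)" by (rule rk_cong) (rule gskew_prefix[OF yi])
    ultimately have i: "i = rk s \<epsilon>" using pword(2)[OF yi(3)] by simp
    have "gpos (y, i) \<in> gpath -` cylinder n \<epsilon> \<inter> {0..<1}" using g gpos_interval(3,4)[OF yi] by (simp add: gskew_def)
    then have "lft n \<epsilon> \<le> gpos (y, i) \<and> gpos (y, i) < lft n \<epsilon> + mass wt n \<epsilon>" unfolding gpath_cylinder by simp
    then show "i = rk s \<epsilon> \<and> kk * (lft n \<epsilon> - lft s \<epsilon>) \<le> y \<and> y < kk * (lft n \<epsilon> - lft s \<epsilon>) + kk * mass wt n \<epsilon>"
      using i gp[of y] arith[of y] by simp
  next
    assume a: "i = rk s \<epsilon> \<and> kk * (lft n \<epsilon> - lft s \<epsilon>) \<le> y \<and> y < kk * (lft n \<epsilon> - lft s \<epsilon>) + kk * mass wt n \<epsilon>"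
    then have "gpos (y, i) \<in> {lft n \<epsilon> ..< lft n \<epsilon> + mass wt n \<epsilon>}" using gp[of y] arith[of y] by simp
    then show "gskew (y, i) \<in> cylinder n \<epsilon>" unfolding gpath_cylinder[symmetric] by (simp add: gskew_def)
  qed
  show ?thesis
  proof (rule set_eqI)
    fix z :: "real \<times> nat"
    obtain y i where z: "z = (y, i)" by (cases z)
    show "z \<in> gskew -` cylinder n \<epsilon> \<inter> space (skew_space kk) \<longleftrightarrow>
        z \<in> (if alive n \<epsilon> then {kk * (lft n \<epsilon> - lft s \<epsilon>) ..< kk * (lft n \<epsilon> - lft s \<epsilon>) + kk * mass wt n \<epsilon>} \<times> {rk s \<epsilon>} else {})"
      using iff[of y i] sub[of y] kr True unfolding z space_skew by auto
  qed
qed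

lemma gskew_cylinder_emeasure:
  assumes n: "s \<le> n"
  shows "gskew -` cylinder n \<epsilon> \<inter> space (skew_space kk) \<in> sets (skew_space kk)"
    "emeasure (skew_space kk) (gskew -` cylinder n \<epsilon> \<inter> space (skew_space kk)) = ennreal (mass wt n \<epsilon>)"
proof -
  let ?P = "gskew -` cylinder n \<epsilon> \<inter> space (skew_space kk)"
  have "?P \<in> sets (skew_space kk) \<and> emeasure (skew_space kk) ?P = ennreal (mass wt n \<epsilon>)"
  proof (cases "alive n \<epsilon>")
    case False
    then show ?thesis unfolding gskew_cylinder[OF n] by (simp add: mass_not_alive)
  next
    case True
    let ?a = "kk * (lft n \<epsilon> - lft s \<epsilon>)"
    let ?I = "{?a ..< ?a + kk * mass wt n \<epsilon>}"
    have P: "?P = ?I \<times> {rk s \<epsilon>}" unfolding gskew_cylinder[OF n] using True by simp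
    have sub: "?P \<subseteq> {0..<1} \<times> {..<kk}" using space_skew by auto
    have kr: "rk s \<epsilon> < kk"
      using rk_less_dim[OF alive_le[OF True n]] dim_Single[OF shape_s alive_le[OF True n]] by (simp add: kk_def)
    have "?I \<subseteq> {0..<1}"
    proof
      fix y assume "y \<in> ?I"
      then have "(y, rk s \<epsilon>) \<in> ?P" unfolding P by simp
      then show "y \<in> {0..<1}" using sub by blast
    qed
    then have I: "?I \<in> sets circle" by (simp add: sets_circle)
    have J: "{rk s \<epsilon>} \<in> sets (uniform_count_measure {..<kk})" using kr by (simp add: sets_uniform_count_measure)
    have "emeasure (skew_space kk) ?P = emeasure circle ?I * emeasure (uniform_count_measure {..<kk}) {rk s \<epsilon>}"
      unfolding skew_space_def P[unfolded skew_space_def]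
      by (rule sigma_finite_measure.emeasure_pair_measure_Times[OF sigma_finite_count I J])
    also have "emeasure circle ?I = ennreal (kk * mass wt n \<epsilon>)"
      using emeasure_circle[OF I] mass_nonneg by simp
    also have "emeasure (uniform_count_measure {..<kk}) {rk s \<epsilon>} = ennreal (1 / kk)"
      using kr by (simp add: emeasure_uniform_count_measure ennreal_of_nat_eq_real_of_nat divide_ennreal)
    also have "ennreal (kk * mass wt n \<epsilon>) * ennreal (1 / kk) = ennreal (mass wt n \<epsilon>)"
      using kk_pos mass_nonneg by (simp add: ennreal_mult[symmetric])
    finally have "emeasure (skew_space kk) ?P = ennreal (mass wt n \<epsilon>)" .
    moreover have "?P \<in> sets (skew_space kk)"
      unfolding skew_space_def P[unfolded skew_space_def] using I J by (rule pair_measureI)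
    ultimately show ?thesis by blast
  qed
  then show "?P \<in> sets (skew_space kk)" "emeasure (skew_space kk) ?P = ennreal (mass wt n \<epsilon>)" by auto
qed

lemma gskew_measurable: "gskew \<in> skew_space kk \<rightarrow>\<^sub>M borel"
proof (rule measurable_sigma_sets[OF sets_borel_cylinders[of s]])
  show "gskew -` A \<inter> space (skew_space kk) \<in> sets (skew_space kk)"
    if A: "A \<in> insert {} {cylinder n \<epsilon> |n \<epsilon>. s \<le> n}" for A
  proof -
    consider "A = {}" | n \<epsilon> where "A = cylinder n \<epsilon>" "s \<le> n" using A by blast
    then show ?thesis using gskew_cylinder_emeasure(1) by cases auto
  qed
qed auto

lemma prob_space_skew: "prob_space (skew_space kk)"
proof -
  interpret c: prob_space circle by (rule prob_space_circle)
  interpret u: prob_space "uniform_count_measure {..<kk}"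
    using kk_pos by (intro prob_space_uniform_count_measure) auto
  interpret pair_prob_space circle "uniform_count_measure {..<kk}" ..
  show ?thesis unfolding skew_space_def by (rule prob_space_axioms)
qed

lemma distr_gskew: "distr (skew_space kk) borel gskew = cmeas"
proof (rule cmeas_eqI[where L = "\<lambda>n. s \<le> n"])
  show "path_prob (distr (skew_space kk) borel gskew)"
    using prob_space.prob_space_distr[OF prob_space_skew gskew_measurable] by (simp add: path_prob_def)
  show "\<exists>m\<ge>n. s \<le> m" for n by (rule exI[of _ "max n s"]) simp
  fix n \<epsilon> assume n: "s \<le> n"
  have "emeasure (distr (skew_space kk) borel gskew) (cylinder n \<epsilon>) = ennreal (mass wt n \<epsilon>)"
    using gskew_cylinder_emeasure(2)[OF n, of \<epsilon>] by (simp add: emeasure_distr[OF gskew_measurable])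
  then show "measure (distr (skew_space kk) borel gskew) (cylinder n \<epsilon>) = mass wt n \<epsilon>"
    using mass_nonneg by (simp add: measure_def)
qed

text \<open>Below the largest rank at level s the tail is kept and only the rank moves; at the
  largest rank it returns to 0 and the angle turns by \<open>alpha\<close>.\<close>

lemma fskew_adic:
  assumes e: "\<epsilon> \<in> phi x" "\<epsilon> \<in> adic_dom"
  shows "fskew (adic \<epsilon>) = skew_shift alpha kk (fskew \<epsilon>)"
proof -
  have al: "alive s \<epsilon>" using e(1) by (simp add: phi_alive)
  have d: "dim s \<epsilon> = kk" using dim_Single[OF shape_s al] by (simp add: kk_def)
  have r: "rk s (adic \<epsilon>) = Suc (rk s \<epsilon>) mod kk" using rk_adic_Single[OF e shape_s] by (simp add: kk_def)
  show ?thesis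
  proof (cases "Suc (rk s \<epsilon>) < kk")
    case True
    then have "same s \<epsilon> (adic \<epsilon>)" using adic_rk(2)[OF al] d by simp
    then show ?thesis using fang_adic_same r True by (simp add: fskew_def skew_shift_def)
  next
    case False
    then have mx: "Suc (rk s \<epsilon>) = kk" using rk_less_dim[OF al] d by simp
    have "cong1 (frac (fang \<epsilon>) + alpha) (fang \<epsilon> + alpha)" by (intro cong1_add cong1_frac)
    then have "cong1 (fang (adic \<epsilon>)) (frac (fang \<epsilon>) + alpha)"
      using fang_adic_carry[OF e mx] cong1_sym cong1_trans by blast
    then have "frac (fang (adic \<epsilon>)) = frac (frac (fang \<epsilon>) + alpha)" by (rule cong1_frac_eq)
    then show ?thesis using r mx by (simp add: fskew_def skew_shift_def rotation_def)
  qed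
qed

lemma adic_isomorphic_skew: "adic_isomorphic x (skew_space kk) (skew_shift alpha kk)"
proof (rule adic_isomorphicI[OF gskew_measurable _ distr_gskew fskew_measurable])
  show "gskew z \<in> phi x" "fskew (gskew z) = z" if "z \<in> space (skew_space kk)" for z
    using that gskew_phi fskew_gskew by (auto simp: space_skew)
qed (rule fskew_adic)

text \<open>After level s the recursion is inverted by subtracting one mass from the other, so
  integer combinations of 1 and \<open>alpha\<close> are preserved.\<close>

lemma weights_lattice:
  "s < n \<Longrightarrow> (\<exists>a b :: int. kk * fst (wt n) = of_int a + of_int b * alpha) \<and>
     (\<exists>a b :: int. kk * snd (wt n) = of_int a + of_int b * alpha)"
proof (induction n)
  case (Suc n)
  show ?case
  proof (cases "s = n")
    case True
    have "kk * snd (wt (Suc n)) = of_int 0 + of_int 1 * alpha" unfolding True[symmetric] alpha_def by simp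
    moreover have "kk * fst (wt (Suc n)) = of_int 1 + of_int (-1) * alpha"
      using weights_Suc_s unfolding True[symmetric] alpha_def by simp
    ultimately show ?thesis by blast
  next
    case False
    then have n: "s < n" using Suc.prems by simp
    obtain a b c d :: int where ab: "kk * fst (wt n) = of_int a + of_int b * alpha"
      and cd: "kk * snd (wt n) = of_int c + of_int d * alpha" using Suc.IH[OF n] by blast
    have w: "fst (wt n) = fst (wt (Suc n)) + (if shape n = Single \<or> shape n = Near \<and> split_up n then snd (wt (Suc n)) else 0)"
      "snd (wt n) = (case shape n of Single \<Rightarrow> 0 | Far \<Rightarrow> snd (wt (Suc n))
       | Near \<Rightarrow> snd (wt (Suc n)) + (if split_up n then 0 else fst (wt (Suc n))))"
      using wrec_wt[of n] unfolding wrec_def by blast+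
    show ?thesis
    proof (cases "shape n")
      case Single
      then show ?thesis using after_s[OF n] by blast
    next
      case Far
      then have "fst (wt (Suc n)) = fst (wt n)" "snd (wt (Suc n)) = snd (wt n)" using w by simp_all
      then show ?thesis using ab cd by metis
    next
      case Near
      show ?thesis
      proof (cases "split_up n")
        case True
        then have "snd (wt (Suc n)) = snd (wt n)" "fst (wt (Suc n)) = fst (wt n) - snd (wt n)" using w Near by simp_all
        then have "kk * snd (wt (Suc n)) = of_int c + of_int d * alpha"
          "kk * fst (wt (Suc n)) = of_int (a - c) + of_int (b - d) * alpha"
          using ab cd by (simp_all only: right_diff_distrib of_int_diff left_diff_distrib)
        then show ?thesis by blast
      next
        case False
        then have "fst (wt (Suc n)) = fst (wt n)" "snd (wt (Suc n)) = snd (wt n) - fst (wt n)" using w Near by simp_all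
        then have "kk * fst (wt (Suc n)) = of_int a + of_int b * alpha"
          "kk * snd (wt (Suc n)) = of_int (c - a) + of_int (d - b) * alpha"
          using ab cd by (simp_all only: right_diff_distrib of_int_diff left_diff_distrib)
        then show ?thesis by blast
      qed
    qed
  qed
qed simp

text \<open>For alpha = p/q every positive integer combination of 1 and \<open>alpha\<close> would
  be at least 1/q. The rescaled lower masses are such combinations, positive, and tend to 0.\<close>

lemma alpha_irrational: "alpha \<notin> \<rat>"
proof
  assume "alpha \<in> \<rat>"
  then obtain p :: int and q :: nat where pq: "q > 0" "alpha = of_int p / of_nat q"
    unfolding Rats_eq_int_div_nat by blast
  have low: "1 \<le> q * (kk * snd (wt n))" if n: "s < n" for n
  proof -
    obtain a b :: int where ab: "kk * snd (wt n) = of_int a + of_int b * alpha" using weights_lattice[OF n] by blast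
    have "q * (kk * snd (wt n)) = of_int (int q * a + b * p)"
      unfolding ab using pq by (simp add: field_simps)
    moreover have "0 < q * (kk * snd (wt n))" using pq kk_pos wt_snd_pos[OF irr after_s[OF n]] by simp
    ultimately show ?thesis by (metis int_one_le_iff_zero_less of_int_0_less_iff of_int_1_le_iff)
  qed
  have "(\<lambda>n. snd (wt n)) \<longlonglongrightarrow> 0"
  proof (rule real_tendsto_sandwich[OF _ _ tendsto_const wt_tendsto[OF irr]])
    show "\<forall>\<^sub>F n in sequentially. 0 \<le> snd (wt n)" using wsys_wt by (simp add: wsys_def)
    show "\<forall>\<^sub>F n in sequentially. snd (wt n) \<le> fst (wt n) + snd (wt n)" using wsys_wt by (simp add: wsys_def)
  qed
  then have "(\<lambda>n. q * (kk * snd (wt n))) \<longlonglongrightarrow> real q * (real kk * 0)" by (intro tendsto_mult tendsto_const)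
  then have "1 \<le> real q * (real kk * 0)"
    by (rule LIMSEQ_le_const) (use low in \<open>auto intro!: exI[of _ "Suc s"]\<close>)
  then show False by simp
qed

text \<open>With one word at level s the block is the whole interval and the rank is constantly 0,
  so the angle alone is a coordinate.\<close>

lemma adic_isomorphic_rotation:
  assumes k1: "kk = 1"
  shows "adic_isomorphic x circle (rotation alpha)"
proof (rule adic_isomorphicI[OF gpath_measurable])
  show "distr circle borel gpath = cmeas" by (simp add: cmeas_def)
  show "(\<lambda>\<epsilon>. frac (fang \<epsilon>)) \<in> fibre_measure x \<rightarrow>\<^sub>M circle"
    by (intro frac_circle measurable_from_fibre fang_measurable)
  show "gpath y \<in> phi x" if "y \<in> space circle" for y using that gpath_phi by simp
  show "frac (fang (gpath y)) = y" if "y \<in> space circle" for y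
  proof -
    have y: "0 \<le> y" "y < 1" using that by auto
    have al: "alive s (gpath y)" using gpath_phi[OF y] by (simp add: phi_alive)
    have "mass wt s (gpath y) = 1" using mass_Single[OF shape_s al] k1 by (simp add: kk_def)
    then have "lft s (gpath y) = 0"
      using lft_mono[of 0 s "gpath y"] rgt_mono[of 0 s "gpath y"] by (simp add: C_0)
    then have "fang (gpath y) = y" using k1 fpos_gpath_id[OF y] by (simp add: fang_def)
    then show ?thesis using y by (simp add: frac_eq)
  qed
  fix \<epsilon> assume e: "\<epsilon> \<in> phi x" "\<epsilon> \<in> adic_dom"
  from fskew_adic[OF e] show "frac (fang (adic \<epsilon>)) = rotation alpha (frac (fang \<epsilon>))"
    using k1 by (simp add: fskew_def skew_shift_def)
qed

end

section \<open>Even pieces and the alternatives for the adic transformation\<close>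

context irr_fibre
begin

text \<open>Only a collapse leads from two vertices back to one. After the last collapse two
  vertices appear and remain, so there is a largest level with a single vertex.\<close>

lemma last_Single:
  assumes no: "\<forall>m\<ge>n. \<not> collapse m"
  shows "\<exists>s. rotation_fibre x s"
proof -
  obtain m where m: "m \<ge> n" "shape m \<noteq> Single" using not_eventually_Single[OF irr] by blast
  have ns: "shape k \<noteq> Single" if "m \<le> k" for k
    using that
  proof (induction k rule: dec_induct)
    case (step k)
    have "\<not> collapse k" using no step.hyps(1) m(1) by simp
    then show ?case using step.IH by (cases "shape k") (auto simp: collapse_def)
  qed (rule m(2))
  define s where "s = Max {k. shape k = Single}"
  have fin: "finite {k. shape k = Single}"
    by (rule finite_subset[of _ "{..<m}"]) (use ns in \<open>auto simp: not_le[symmetric]\<close>)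
  have "0 \<in> {k. shape k = Single}" by simp
  then have "s \<in> {k. shape k = Single}" unfolding s_def using Max_in[OF fin] by blast
  then have s: "shape s = Single" by simp
  have "shape k \<noteq> Single" if "s < k" for k using Max_ge[OF fin, of k] that unfolding s_def by auto
  then have "rotation_fibre x s" using s by unfold_locales auto
  then show ?thesis by blast
qed

text \<open>Without collapses the levels up to s are all single; no edges meet there, and the count
  stays 1.\<close>

lemma no_collapse_kk:
  assumes no: "\<And>m. \<not> collapse m" and s: "rotation_fibre x s"
  shows "rotation_fibre.kk x s = 1"
proof -
  interpret rotation_fibre x s by (rule s)
  have ns: "shape k \<noteq> Single" if "m \<le> k" "shape m \<noteq> Single" for k m
    using that
  proof (induction k rule: dec_induct)
    case (step k)
    then show ?case using no[of k] by (cases "shape k") (auto simp: collapse_def)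
  qed
  have S: "shape k = Single" if "k \<le> s" for k using ns[OF that] shape_s by blast
  have "k \<le> s \<Longrightarrow> dhi k = 1" for k
    by (induction k) (use S in \<open>auto simp: dhi_Suc\<close>)
  then show ?thesis by (simp add: kk_def)
qed

end

lemma irr_fibreI:
  assumes "x \<in> {0..<1}" "\<forall>N::int. x \<noteq> frac (of_int N * golden)"
  shows "irr_fibre x"
proof -
  have "x \<notin> Ztau" using Ztau_frac[OF assms(1)] assms(2) by blast
  moreover have "x \<noteq> 0" using calculation Ztau_int[of 0] by auto
  ultimately show ?thesis using assms(1) by unfold_locales auto
qed

lemma fibre_alternatives:
  assumes "x \<in> {0..<1}" "\<forall>N::int. x \<noteq> frac (of_int N * golden)"
  shows "adic_invariant_set (phi x) \<and>
        (infinite (even_pieces (gen_canonical x)) \<longrightarrow>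
           strictly_ergodic_on (phi x) \<and>
           (\<exists>a. (\<forall>i. a i > 0) \<and> adic_isomorphic x (aint_haar a) (aint_shift a)) \<and>
           purely_discrete_spectrum (fibre_measure x) (phi x \<inter> adic_dom) adic \<and>
           rational_spectrum (fibre_measure x) (phi x \<inter> adic_dom) adic) \<and>
        (even_pieces (gen_canonical x) = {} \<longrightarrow>
           strictly_ergodic_on (phi x) \<and>
           (\<exists>\<alpha>. \<alpha> \<notin> \<rat> \<and> adic_isomorphic x circle (rotation \<alpha>))) \<and>
        (finite (even_pieces (gen_canonical x)) \<longrightarrow>
           (\<exists>\<alpha> k. k > 0 \<and> adic_isomorphic x (skew_space k) (skew_shift \<alpha> k)))"
proof (intro conjI impI)
  interpret irr_fibre x by (rule irr_fibreI[OF assms])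
  show "adic_invariant_set (phi x)" by (rule adic_invariant_phi)
  show "strictly_ergodic_on (phi x)" "strictly_ergodic_on (phi x)" by (rule strictly_ergodic_phi)+
  show "\<exists>a. (\<forall>i. a i > 0) \<and> adic_isomorphic x (aint_haar a) (aint_shift a)"
    "purely_discrete_spectrum (fibre_measure x) (phi x \<inter> adic_dom) adic"
    "rational_spectrum (fibre_measure x) (phi x \<inter> adic_dom) adic"
    if inf: "infinite (even_pieces (gen_canonical x))"
  proof -
    interpret odometer_fibre x by unfold_locales (rule infinite_collapse[OF inf])
    have "base i > 0" for i using base_ge_2[of i] by simp
    then show "\<exists>a. (\<forall>i. a i > 0) \<and> adic_isomorphic x (aint_haar a) (aint_shift a)"
      using adic_isomorphic_odometer by blast
    show "purely_discrete_spectrum (fibre_measure x) (phi x \<inter> adic_dom) adic" by (rule purely_discrete)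
    show "rational_spectrum (fibre_measure x) (phi x \<inter> adic_dom) adic" by (rule rational)
  qed
  show "\<exists>\<alpha>. \<alpha> \<notin> \<rat> \<and> adic_isomorphic x circle (rotation \<alpha>)" if "even_pieces (gen_canonical x) = {}"
  proof -
    have no: "\<And>m. \<not> collapse m" using no_collapse[OF that] .
    then obtain s where s: "rotation_fibre x s" using last_Single[of 0] by blast
    show ?thesis
      using rotation_fibre.adic_isomorphic_rotation[OF s no_collapse_kk[OF no s]] rotation_fibre.alpha_irrational[OF s]
      by blast
  qed
  show "\<exists>\<alpha> k. k > 0 \<and> adic_isomorphic x (skew_space k) (skew_shift \<alpha> k)"
    if "finite (even_pieces (gen_canonical x))"
  proof -
    obtain n where "\<forall>m\<ge>n. \<not> collapse m" using finite_collapse[OF \<open>finite _\<close>] by blast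
    then obtain s where s: "rotation_fibre x s" using last_Single by blast
    show ?thesis using rotation_fibre.adic_isomorphic_skew[OF s] rotation_fibre.kk_pos[OF s] by blast
  qed
qed

theorem theoremA1:
  shows
    "bij_betw mu {0..1} {M. ergodic_central M} \<and> (\<forall>x\<in>{0..1}. lives_over (mu x) x) \<and>
     (\<forall>x\<in>{0..<1}. atomless (mu x) \<longleftrightarrow> (\<forall>N::int. x \<noteq> frac (of_int N * golden))) \<and>
     (\<forall>x\<in>{0..1}. atomless (mu x) \<longleftrightarrow> infinite_canonical x) \<and>
     (\<nexists>\<epsilon>. closure (adic_orbit \<epsilon>) = UNIV) \<and>
     (\<forall>x\<in>{0..<1}. (\<forall>N::int. x \<noteq> frac (of_int N * golden)) \<longrightarrow>
        adic_invariant_set (phi x) \<and>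
        (infinite (even_pieces (gen_canonical x)) \<longrightarrow>
           strictly_ergodic_on (phi x) \<and>
           (\<exists>a. (\<forall>i. a i > 0) \<and> adic_isomorphic x (aint_haar a) (aint_shift a)) \<and>
           purely_discrete_spectrum (fibre_measure x) (phi x \<inter> adic_dom) adic \<and>
           rational_spectrum (fibre_measure x) (phi x \<inter> adic_dom) adic) \<and>
        (even_pieces (gen_canonical x) = {} \<longrightarrow>
           strictly_ergodic_on (phi x) \<and>
           (\<exists>\<alpha>. \<alpha> \<notin> \<rat> \<and> adic_isomorphic x circle (rotation \<alpha>))) \<and>
        (finite (even_pieces (gen_canonical x)) \<longrightarrow>
           (\<exists>\<alpha> k. k > 0 \<and> adic_isomorphic x (skew_space k) (skew_shift \<alpha> k))))"
proof (intro conjI)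
  show "bij_betw mu {0..1} {M. ergodic_central M}" by (rule bij_betw_mu)
  show "\<forall>x\<in>{0..1}. lives_over (mu x) x" by (intro ballI mu_properties(2))
  show "\<forall>x\<in>{0..<1}. atomless (mu x) \<longleftrightarrow> (\<forall>N::int. x \<noteq> frac (of_int N * golden))"
  proof
    fix x :: real assume x: "x \<in> {0..<1}"
    then have "x \<in> {0..1}" by simp
    from atomless_mu[OF this] Ztau_frac[OF x]
    show "atomless (mu x) \<longleftrightarrow> (\<forall>N::int. x \<noteq> frac (of_int N * golden))" by blast
  qed
  show "\<forall>x\<in>{0..1}. atomless (mu x) \<longleftrightarrow> infinite_canonical x"
  proof
    fix x :: real assume x: "x \<in> {0..1}"
    show "atomless (mu x) \<longleftrightarrow> infinite_canonical x"
      unfolding atomless_mu[OF x] infinite_canonical_iff[OF x] by (rule refl)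
  qed
  show "\<nexists>\<epsilon>. closure (adic_orbit \<epsilon>) = UNIV" using adic_orbit_not_dense by blast
qed (intro ballI impI, rule fibre_alternatives)

end
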